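(* Let $\mathcal{M}$ be a special weak cofibration category, that is, a small simplicial weak cofibration category such that: (1) $\mathcal{M}$ has finite limits; (2) every object in $\mathcal{M}$ is fibrant and cofibrant; (3) every map in $\mathcal{M}$ that is a homotopy equivalence in the simplicial category $\mathcal{M}$ is also a weak equivalence. Then $\mathcal{M}$ is left proper and ind-admissible.
   Context: Weak cofibration category: a category $\mathcal{M}$ with two subcategories, the cofibrations $\mathcal{C}of$ and the weak equivalences $\mathcal{W}$, each containing all isomorphisms, such that: (i) $\mathcal{M}$ has all finite colimits; (ii) $\mathcal{W}$ has the two out of three property; (iii) $\mathcal{C}of$ and $\mathcal{C}of\cap\mathcal{W}$ are closed under cobase change; (iv) every map factors as a map in $\mathcal{C}of$ followed by a map in $\mathcal{W}$. Maps in $\mathcal{C}of\cap\mathcal{W}$ are called acyclic cofibrations. An object $D$ is cofibrant if the map from the initial object to $D$ is a cofibration; it is fibrant if for every acyclic cofibration $A\to B$ every map $A\to D$ extends along $A\to B$ to a map $B\to D$. $\mathcal{M}$ is left proper if the cobase change of a weak equivalence along a cofibration is a weak equivalence. Let $\mathcal{S}$ be the category of simplicial sets with its standard model structure and $\mathcal{S}_f$ the full subcategory of finite simplicial sets (finitely many non-degenerate simplices); a map in $\mathcal{S}_f$ is a cofibration or weak equivalence if it is so in $\mathcal{S}$. A simplicial weak cofibration category is a weak cofibration category $\mathcal{M}$ tensored over $\mathcal{S}_f$, i.e. equipped with an action $\otimes:\mathcal{S}_f\times\mathcal{M}\to\mathcal{M}$ of the monoidal category $(\mathcal{S}_f,\times,\Delta^0)$,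 such that: (a) $\otimes$ commutes with finite colimits in each variable separately; (b) for every cofibration $X\to Y$ in $\mathcal{S}_f$ and every cofibration $L\to K$ in $\mathcal{M}$ the induced map $X\otimes K\coprod_{X\otimes L}Y\otimes L\to Y\otimes K$ is a cofibration, which is acyclic if either given map is. Such an $\mathcal{M}$ is enriched in $\mathcal{S}$ by $\mathrm{Map}_{\mathcal{M}}(A,B)_n=\mathrm{Hom}_{\mathcal{M}}(\Delta^n\otimes A,B)$. A map $f:A\to B$ is a homotopy equivalence in the simplicial category $\mathcal{M}$ if there is $g:B\to A$ with $gf$ and $\mathrm{id}_A$ in the same connected component of $\mathrm{Map}_{\mathcal{M}}(A,A)$, and $fg$ and $\mathrm{id}_B$ in the same connected component of $\mathrm{Map}_{\mathcal{M}}(B,B)$. $\mathrm{Ind}(\mathcal{M})$ is the category whose objects are diagrams $I\to\mathcal{M}$ with $I$ small and filtered, and $\mathrm{Hom}(X,Y)=\lim_s\operatorname{colim}_t\mathrm{Hom}_{\mathcal{M}}(X_s,Y_t)$. A natural transformation between diagrams with the same small filtered index category induces a morphism in $\mathrm{Ind}(\mathcal{M})$. $\mathrm{Lw}^{\cong}(\mathcal{W})$ is the class of morphisms in $\mathrm{Ind}(\mathcal{M})$ isomorphic (as morphisms) to one induced by a natural transformation all of whose components lie in $\mathcal{W}$. $\mathcal{M}$ is ind-admissible if $\mathrm{Lw}^{\cong}(\mathcal{W})$ satisfies the two out of three property. *)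

theory Defs
  imports "HOL-Homology.Simplices" "HOL-Library.Nat_Bijection"
begin

section \<open>Categories\<close>

text \<open>As with the records of \<^theory>\<open>HOL-Algebra.Group\<close>, the operations are total and their values
  outside the carriers are irrelevant.\<close>

record ('o, 'a) cat =
  Obj :: "'o set"
  Arr :: "'a set"
  Dom :: "'a \<Rightarrow> 'o"
  Cod :: "'a \<Rightarrow> 'o"
  Idn :: "'o \<Rightarrow> 'a"
  Cmp :: "'a \<Rightarrow> 'a \<Rightarrow> 'a"  (infixr "\<cdot>\<index>" 70)

definition homset :: "('o, 'a, 'z) cat_scheme \<Rightarrow> 'o \<Rightarrow> 'o \<Rightarrow> 'a set" where
  "homset C A B = {f \<in> Arr C. Dom C f = A \<and> Cod C f = B}"

locale category =
  fixes C :: "('o, 'a, 'z) cat_scheme" (structure)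
  assumes Dom_in: "f \<in> Arr C \<Longrightarrow> Dom C f \<in> Obj C"
    and Cod_in: "f \<in> Arr C \<Longrightarrow> Cod C f \<in> Obj C"
    and Idn_in: "A \<in> Obj C \<Longrightarrow> Idn C A \<in> homset C A A"
    and Cmp_in: "\<lbrakk>f \<in> homset C A B; g \<in> homset C B D\<rbrakk> \<Longrightarrow> g \<cdot> f \<in> homset C A D"
    and Cmp_Idn: "f \<in> homset C A B \<Longrightarrow> f \<cdot> Idn C A = f"
    and Idn_Cmp: "f \<in> homset C A B \<Longrightarrow> Idn C B \<cdot> f = f"
    and Cmp_assoc: "\<lbrakk>f \<in> homset C A B; g \<in> homset C B D; h \<in> homset C D E\<rbrakk>
      \<Longrightarrow> (h \<cdot> g) \<cdot> f = h \<cdot> (g \<cdot> f)"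

definition is_iso :: "('o, 'a, 'z) cat_scheme \<Rightarrow> 'a \<Rightarrow> bool" where
  "is_iso C f \<longleftrightarrow> f \<in> Arr C \<and>
    (\<exists>g \<in> homset C (Cod C f) (Dom C f).
      g \<cdot>\<^bsub>C\<^esub> f = Idn C (Dom C f) \<and> f \<cdot>\<^bsub>C\<^esub> g = Idn C (Cod C f))"

definition prod_cat ::
  "('o, 'a, 'z) cat_scheme \<Rightarrow> ('p, 'b, 'y) cat_scheme \<Rightarrow> ('o \<times> 'p, 'a \<times> 'b) cat" where
  "prod_cat C D =
    \<lparr>Obj = Obj C \<times> Obj D, Arr = Arr C \<times> Arr D,
     Dom = map_prod (Dom C) (Dom D), Cod = map_prod (Cod C) (Cod D),
     Idn = map_prod (Idn C) (Idn D),
     Cmp = (\<lambda>(g, g') (f, f'). (g \<cdot>\<^bsub>C\<^esub> f, g' \<cdot>\<^bsub>D\<^esub> f'))\<rparr>"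

record ('o, 'a, 'p, 'b) func =
  FOb :: "'o \<Rightarrow> 'p"
  FAr :: "'a \<Rightarrow> 'b"

definition is_functor ::
  "('o, 'a, 'z) cat_scheme \<Rightarrow> ('p, 'b, 'y) cat_scheme \<Rightarrow> ('o, 'a, 'p, 'b) func \<Rightarrow> bool" where
  "is_functor C D F \<longleftrightarrow>
    (\<forall>A \<in> Obj C. FOb F A \<in> Obj D \<and> FAr F (Idn C A) = Idn D (FOb F A)) \<and>
    (\<forall>f \<in> Arr C. FAr F f \<in> homset D (FOb F (Dom C f)) (FOb F (Cod C f))) \<and>
    (\<forall>f \<in> Arr C. \<forall>g \<in> Arr C. Dom C g = Cod C f \<longrightarrow>
      FAr F (g \<cdot>\<^bsub>C\<^esub> f) = FAr F g \<cdot>\<^bsub>D\<^esub> FAr F f)"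

definition comp_func ::
  "('p, 'b, 'q, 'c) func \<Rightarrow> ('o, 'a, 'p, 'b) func \<Rightarrow> ('o, 'a, 'q, 'c) func" where
  "comp_func G F = \<lparr>FOb = FOb G \<circ> FOb F, FAr = FAr G \<circ> FAr F\<rparr>"

definition nat_trans ::
  "('o, 'a, 'z) cat_scheme \<Rightarrow> ('p, 'b, 'y) cat_scheme \<Rightarrow> ('o, 'a, 'p, 'b) func \<Rightarrow>
    ('o, 'a, 'p, 'b) func \<Rightarrow> ('o \<Rightarrow> 'b) \<Rightarrow> bool" where
  "nat_trans C D F G \<tau> \<longleftrightarrow>
    (\<forall>A \<in> Obj C. \<tau> A \<in> homset D (FOb F A) (FOb G A)) \<and>
    (\<forall>f \<in> Arr C. \<tau> (Cod C f) \<cdot>\<^bsub>D\<^esub> FAr F f = FAr G f \<cdot>\<^bsub>D\<^esub> \<tau> (Dom C f))"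


section \<open>Finite limits and colimits\<close>

definition is_cocone ::
  "('i, 'j, 'y) cat_scheme \<Rightarrow> ('o, 'a, 'z) cat_scheme \<Rightarrow> ('i, 'j, 'o, 'a) func \<Rightarrow>
    'o \<Rightarrow> ('i \<Rightarrow> 'a) \<Rightarrow> bool" where
  "is_cocone J C D K c \<longleftrightarrow> K \<in> Obj C \<and>
    (\<forall>j \<in> Obj J. c j \<in> homset C (FOb D j) K) \<and>
    (\<forall>u \<in> Arr J. c (Cod J u) \<cdot>\<^bsub>C\<^esub> FAr D u = c (Dom J u))"

definition is_colimit ::
  "('i, 'j, 'y) cat_scheme \<Rightarrow> ('o, 'a, 'z) cat_scheme \<Rightarrow> ('i, 'j, 'o, 'a) func \<Rightarrow>
    'o \<Rightarrow> ('i \<Rightarrow> 'a) \<Rightarrow> bool" where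
  "is_colimit J C D K c \<longleftrightarrow> is_cocone J C D K c \<and>
    (\<forall>K' c'. is_cocone J C D K' c' \<longrightarrow>
      (\<exists>!h. h \<in> homset C K K' \<and> (\<forall>j \<in> Obj J. h \<cdot>\<^bsub>C\<^esub> c j = c' j)))"

definition is_cone ::
  "('i, 'j, 'y) cat_scheme \<Rightarrow> ('o, 'a, 'z) cat_scheme \<Rightarrow> ('i, 'j, 'o, 'a) func \<Rightarrow>
    'o \<Rightarrow> ('i \<Rightarrow> 'a) \<Rightarrow> bool" where
  "is_cone J C D K c \<longleftrightarrow> K \<in> Obj C \<and>
    (\<forall>j \<in> Obj J. c j \<in> homset C K (FOb D j)) \<and>
    (\<forall>u \<in> Arr J. FAr D u \<cdot>\<^bsub>C\<^esub> c (Dom J u) = c (Cod J u))"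

definition is_limit ::
  "('i, 'j, 'y) cat_scheme \<Rightarrow> ('o, 'a, 'z) cat_scheme \<Rightarrow> ('i, 'j, 'o, 'a) func \<Rightarrow>
    'o \<Rightarrow> ('i \<Rightarrow> 'a) \<Rightarrow> bool" where
  "is_limit J C D K c \<longleftrightarrow> is_cone J C D K c \<and>
    (\<forall>K' c'. is_cone J C D K' c' \<longrightarrow>
      (\<exists>!h. h \<in> homset C K' K \<and> (\<forall>j \<in> Obj J. c j \<cdot>\<^bsub>C\<^esub> h = c' j)))"

definition finite_category :: "('o, 'a, 'z) cat_scheme \<Rightarrow> bool" where
  "finite_category J \<longleftrightarrow> category J \<and> finite (Obj J) \<and> finite (Arr J)"

text \<open>Every finite category is isomorphic to one whose objects and arrows are natural numbers.\<close>

definition has_finite_colimits :: "('o, 'a, 'z) cat_scheme \<Rightarrow> bool" where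
  "has_finite_colimits C \<longleftrightarrow>
    (\<forall>(J :: (nat, nat) cat) D. finite_category J \<longrightarrow> is_functor J C D \<longrightarrow>
      (\<exists>K c. is_colimit J C D K c))"

definition has_finite_limits :: "('o, 'a, 'z) cat_scheme \<Rightarrow> bool" where
  "has_finite_limits C \<longleftrightarrow>
    (\<forall>(J :: (nat, nat) cat) D. finite_category J \<longrightarrow> is_functor J C D \<longrightarrow>
      (\<exists>K c. is_limit J C D K c))"

definition preserves_finite_colimits ::
  "('o, 'a, 'z) cat_scheme \<Rightarrow> ('p, 'b, 'y) cat_scheme \<Rightarrow> ('o, 'a, 'p, 'b) func \<Rightarrow> bool" where
  "preserves_finite_colimits C C' F \<longleftrightarrow>
    (\<forall>(J :: (nat, nat) cat) D K c. finite_category J \<longrightarrow> is_functor J C D \<longrightarrow>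
      is_colimit J C D K c \<longrightarrow>
      is_colimit J C' (comp_func F D) (FOb F K) (\<lambda>j. FAr F (c j)))"

definition is_initial :: "('o, 'a, 'z) cat_scheme \<Rightarrow> 'o \<Rightarrow> bool" where
  "is_initial C I \<longleftrightarrow> I \<in> Obj C \<and> (\<forall>A \<in> Obj C. \<exists>!f. f \<in> homset C I A)"

text \<open>\<open>is_pushout C f g p q\<close>: with \<open>f : A \<rightarrow> B\<close> and \<open>g : A \<rightarrow> D\<close>, the maps
  \<open>p : B \<rightarrow> P\<close> and \<open>q : D \<rightarrow> P\<close> form a pushout; \<open>q\<close> is the cobase change of \<open>f\<close> along \<open>g\<close>
  and \<open>p\<close> is the cobase change of \<open>g\<close> along \<open>f\<close>.\<close>

definition is_pushout :: "('o, 'a, 'z) cat_scheme \<Rightarrow> 'a \<Rightarrow> 'a \<Rightarrow> 'a \<Rightarrow> 'a \<Rightarrow> bool" where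
  "is_pushout C f g p q \<longleftrightarrow>
    f \<in> Arr C \<and> g \<in> Arr C \<and> p \<in> Arr C \<and> q \<in> Arr C \<and>
    Dom C f = Dom C g \<and> Dom C p = Cod C f \<and> Dom C q = Cod C g \<and> Cod C p = Cod C q \<and>
    p \<cdot>\<^bsub>C\<^esub> f = q \<cdot>\<^bsub>C\<^esub> g \<and>
    (\<forall>p' q'. p' \<in> Arr C \<and> q' \<in> Arr C \<and> Dom C p' = Cod C f \<and> Dom C q' = Cod C g \<and>
        Cod C p' = Cod C q' \<and> p' \<cdot>\<^bsub>C\<^esub> f = q' \<cdot>\<^bsub>C\<^esub> g \<longrightarrow>
      (\<exists>!h. h \<in> homset C (Cod C p) (Cod C p') \<and>
        h \<cdot>\<^bsub>C\<^esub> p = p' \<and> h \<cdot>\<^bsub>C\<^esub> q = q'))"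


section \<open>Weak cofibration categories\<close>

definition two_out_of_three :: "('o, 'a, 'z) cat_scheme \<Rightarrow> 'a set \<Rightarrow> bool" where
  "two_out_of_three C S \<longleftrightarrow>
    (\<forall>f \<in> Arr C. \<forall>g \<in> Arr C. Dom C g = Cod C f \<longrightarrow>
      (f \<in> S \<and> g \<in> S \<longrightarrow> g \<cdot>\<^bsub>C\<^esub> f \<in> S) \<and>
      (f \<in> S \<and> g \<cdot>\<^bsub>C\<^esub> f \<in> S \<longrightarrow> g \<in> S) \<and>
      (g \<in> S \<and> g \<cdot>\<^bsub>C\<^esub> f \<in> S \<longrightarrow> f \<in> S))"

text \<open>A subcategory containing all isomorphisms is determined by its arrows: containing the
  identities, it contains all objects.\<close>

definition subcategory_with_isos :: "('o, 'a, 'z) cat_scheme \<Rightarrow> 'a set \<Rightarrow> bool" where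
  "subcategory_with_isos C S \<longleftrightarrow> S \<subseteq> Arr C \<and> (\<forall>f. is_iso C f \<longrightarrow> f \<in> S) \<and>
    (\<forall>f \<in> S. \<forall>g \<in> S. Dom C g = Cod C f \<longrightarrow> g \<cdot>\<^bsub>C\<^esub> f \<in> S)"

definition closed_under_cobase_change :: "('o, 'a, 'z) cat_scheme \<Rightarrow> 'a set \<Rightarrow> bool" where
  "closed_under_cobase_change C S \<longleftrightarrow>
    (\<forall>f g p q. f \<in> S \<longrightarrow> is_pushout C f g p q \<longrightarrow> q \<in> S)"

locale weak_cofibration_category = category M
  for M :: "('o, 'a) cat" (structure) and Cof W :: "'a set" +
  assumes Cof_sub: "subcategory_with_isos M Cof"
    and W_sub: "subcategory_with_isos M W"
    and fin_colims: "has_finite_colimits M"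
    and W_two_of_three: "two_out_of_three M W"
    and Cof_cobase: "closed_under_cobase_change M Cof"
    and acyclic_Cof_cobase: "closed_under_cobase_change M (Cof \<inter> W)"
    and factorization: "f \<in> Arr M \<Longrightarrow> \<exists>i \<in> Cof. \<exists>w \<in> W. Dom M w = Cod M i \<and> f = w \<cdot> i"

definition cofibrant :: "('o, 'a, 'z) cat_scheme \<Rightarrow> 'a set \<Rightarrow> 'o \<Rightarrow> bool" where
  "cofibrant M Cof D \<longleftrightarrow> D \<in> Obj M \<and> (\<forall>I f. is_initial M I \<and> f \<in> homset M I D \<longrightarrow> f \<in> Cof)"

definition fibrant :: "('o, 'a, 'z) cat_scheme \<Rightarrow> 'a set \<Rightarrow> 'a set \<Rightarrow> 'o \<Rightarrow> bool" where
  "fibrant M Cof W D \<longleftrightarrow> D \<in> Obj M \<and>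
    (\<forall>i \<in> Cof \<inter> W. \<forall>f \<in> homset M (Dom M i) D. \<exists>h \<in> homset M (Cod M i) D. h \<cdot>\<^bsub>M\<^esub> i = f)"

definition left_proper :: "('o, 'a, 'z) cat_scheme \<Rightarrow> 'a set \<Rightarrow> 'a set \<Rightarrow> bool" where
  "left_proper M Cof W \<longleftrightarrow>
    (\<forall>f g p q. f \<in> Cof \<longrightarrow> g \<in> W \<longrightarrow> is_pushout M f g p q \<longrightarrow> p \<in> W)"


section \<open>Simplicial sets\<close>

text \<open>A monotone map \<open>[m] \<rightarrow> [n]\<close> is the sorted list of its \<open>m + 1\<close> values.  For
  \<open>\<theta> : [m] \<rightarrow> [n]\<close> and \<open>x \<in> cells X n\<close>, the simplex \<open>act X n \<theta> x \<in> cells X m\<close> is \<open>\<theta>\<^sup>* x\<close>.\<close>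

definition ord_maps :: "nat \<Rightarrow> nat \<Rightarrow> nat list set" where
  "ord_maps m n = {\<theta>. length \<theta> = Suc m \<and> sorted \<theta> \<and> set \<theta> \<subseteq> {..n}}"

definition ord_comp :: "nat list \<Rightarrow> nat list \<Rightarrow> nat list" where
  "ord_comp \<theta> \<phi> = map (\<lambda>i. \<theta> ! i) \<phi>"

record 's sset =
  cells :: "nat \<Rightarrow> 's set"
  act :: "nat \<Rightarrow> nat list \<Rightarrow> 's \<Rightarrow> 's"

definition simplicial_set :: "'s sset \<Rightarrow> bool" where
  "simplicial_set X \<longleftrightarrow>
    (\<forall>m n. \<forall>\<theta> \<in> ord_maps m n. \<forall>x \<in> cells X n. act X n \<theta> x \<in> cells X m) \<and>
    (\<forall>n. \<forall>x \<in> cells X n. act X n [0..<Suc n] x = x) \<and>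
    (\<forall>k m n. \<forall>\<theta> \<in> ord_maps m n. \<forall>\<phi> \<in> ord_maps k m. \<forall>x \<in> cells X n.
      act X m \<phi> (act X n \<theta> x) = act X n (ord_comp \<theta> \<phi>) x)"

text \<open>Maps are extensional, so that equality of maps is equality on simplices.\<close>

definition simplicial_map :: "'s sset \<Rightarrow> 't sset \<Rightarrow> (nat \<Rightarrow> 's \<Rightarrow> 't) \<Rightarrow> bool" where
  "simplicial_map X Y f \<longleftrightarrow>
    (\<forall>n. f n \<in> cells X n \<rightarrow>\<^sub>E cells Y n) \<and>
    (\<forall>m n. \<forall>\<theta> \<in> ord_maps m n. \<forall>x \<in> cells X n. f m (act X n \<theta> x) = act Y n \<theta> (f n x))"

definition degenerate :: "'s sset \<Rightarrow> nat \<Rightarrow> 's \<Rightarrow> bool" where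
  "degenerate X n x \<longleftrightarrow>
    (\<exists>m<n. \<exists>\<theta> \<in> ord_maps n m. set \<theta> = {..m} \<and> (\<exists>y \<in> cells X m. x = act X m \<theta> y))"

definition finite_sset :: "'s sset \<Rightarrow> bool" where
  "finite_sset X \<longleftrightarrow> simplicial_set X \<and> finite {(n, x). x \<in> cells X n \<and> \<not> degenerate X n x}"

definition same_component :: "'s sset \<Rightarrow> 's \<Rightarrow> 's \<Rightarrow> bool" where
  "same_component X =
    equivclp (\<lambda>x y. \<exists>e \<in> cells X 1. x = act X 1 [0] e \<and> y = act X 1 [1] e)"


subsection \<open>Geometric realization and weak equivalences\<close>

definition quotient_topology :: "'a topology \<Rightarrow> ('a \<Rightarrow> 'b) \<Rightarrow> 'b topology" where
  "quotient_topology T q =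
    topology (\<lambda>U. U \<subseteq> q ` topspace T \<and> openin T {p \<in> topspace T. q p \<in> U})"

definition simplices_space :: "'s sset \<Rightarrow> ((nat \<times> 's) \<times> (nat \<Rightarrow> real)) topology" where
  "simplices_space X =
    sum_topology (\<lambda>(n, x). subtopology (powertop_real UNIV) (standard_simplex n))
      {(n, x). x \<in> cells X n}"

text \<open>The affine map of standard simplices induced by \<open>\<theta>\<close> on vertices.\<close>

definition push_simplex :: "nat list \<Rightarrow> (nat \<Rightarrow> real) \<Rightarrow> nat \<Rightarrow> real" where
  "push_simplex \<theta> t = (\<lambda>j. \<Sum>i | i < length \<theta> \<and> \<theta> ! i = j. t i)"

definition glued ::
  "'s sset \<Rightarrow> (nat \<times> 's) \<times> (nat \<Rightarrow> real) \<Rightarrow> (nat \<times> 's) \<times> (nat \<Rightarrow> real) \<Rightarrow> bool" where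
  "glued X p q \<longleftrightarrow>
    (\<exists>m n \<theta> x t. \<theta> \<in> ord_maps m n \<and> x \<in> cells X n \<and> t \<in> standard_simplex m \<and>
      p = ((m, act X n \<theta> x), t) \<and> q = ((n, x), push_simplex \<theta> t))"

definition realization_point ::
  "'s sset \<Rightarrow> (nat \<times> 's) \<times> (nat \<Rightarrow> real) \<Rightarrow> ((nat \<times> 's) \<times> (nat \<Rightarrow> real)) set" where
  "realization_point X p = {q. equivclp (glued X) p q}"

definition realization :: "'s sset \<Rightarrow> ((nat \<times> 's) \<times> (nat \<Rightarrow> real)) set topology" where
  "realization X = quotient_topology (simplices_space X) (realization_point X)"

definition realize_map ::
  "'t sset \<Rightarrow> (nat \<Rightarrow> 's \<Rightarrow> 't) \<Rightarrow> ((nat \<times> 's) \<times> (nat \<Rightarrow> real)) set \<Rightarrow>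
    ((nat \<times> 't) \<times> (nat \<Rightarrow> real)) set" where
  "realize_map Y f c = (\<Union>((n, x), t) \<in> c. realization_point Y ((n, f n x), t))"

definition cube :: "nat \<Rightarrow> (nat \<Rightarrow> real) set" where
  "cube n = {t. (\<forall>i<n. 0 \<le> t i \<and> t i \<le> 1) \<and> (\<forall>i\<ge>n. t i = 0)}"

definition cube_boundary :: "nat \<Rightarrow> (nat \<Rightarrow> real) set" where
  "cube_boundary n = {t \<in> cube n. \<exists>i<n. t i = 0 \<or> t i = 1}"

definition cube_space :: "nat \<Rightarrow> (nat \<Rightarrow> real) topology" where
  "cube_space n = subtopology (powertop_real UNIV) (cube n)"

definition spheroids :: "nat \<Rightarrow> 'a topology \<Rightarrow> 'a \<Rightarrow> ((nat \<Rightarrow> real) \<Rightarrow> 'a) set" where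
  "spheroids n X x = {a. continuous_map (cube_space n) X a \<and> a ` cube_boundary n \<subseteq> {x}}"

definition spheroid_homotopic ::
  "nat \<Rightarrow> 'a topology \<Rightarrow> 'a \<Rightarrow> ((nat \<Rightarrow> real) \<Rightarrow> 'a) \<Rightarrow> ((nat \<Rightarrow> real) \<Rightarrow> 'a) \<Rightarrow> bool" where
  "spheroid_homotopic n X x = homotopic_with (\<lambda>h. h ` cube_boundary n \<subseteq> {x}) (cube_space n) X"

text \<open>The underlying set of the homotopy group \<open>\<pi>\<^sub>n(X, x)\<close>, for \<open>n \<ge> 1\<close>.\<close>

definition homotopy_group :: "nat \<Rightarrow> 'a topology \<Rightarrow> 'a \<Rightarrow> ((nat \<Rightarrow> real) \<Rightarrow> 'a) set set" where
  "homotopy_group n X x =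
    spheroids n X x //
      {(a, b). a \<in> spheroids n X x \<and> b \<in> spheroids n X x \<and> spheroid_homotopic n X x a b}"

definition homotopy_group_map ::
  "nat \<Rightarrow> 'b topology \<Rightarrow> ('a \<Rightarrow> 'b) \<Rightarrow> 'a \<Rightarrow> ((nat \<Rightarrow> real) \<Rightarrow> 'a) set \<Rightarrow>
    ((nat \<Rightarrow> real) \<Rightarrow> 'b) set" where
  "homotopy_group_map n Y f x c =
    {b \<in> spheroids n Y (f x). \<exists>a \<in> c. spheroid_homotopic n Y (f x) (f \<circ> a) b}"

text \<open>Bijectivity suffices for an isomorphism of homotopy groups, as the induced maps are
  homomorphisms.\<close>

definition weak_homotopy_equivalence :: "'a topology \<Rightarrow> 'b topology \<Rightarrow> ('a \<Rightarrow> 'b) \<Rightarrow> bool" where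
  "weak_homotopy_equivalence X Y f \<longleftrightarrow> continuous_map X Y f \<and>
    bij_betw (\<lambda>c. {y. \<exists>x \<in> c. path_component_of Y (f x) y})
      (path_components_of X) (path_components_of Y) \<and>
    (\<forall>n\<ge>1. \<forall>x \<in> topspace X.
      bij_betw (homotopy_group_map n Y f x) (homotopy_group n X x) (homotopy_group n Y (f x)))"

text \<open>Cofibrations and weak equivalences of the standard (Kan--Quillen) model structure.\<close>

definition sset_cofibration :: "'s sset \<Rightarrow> 't sset \<Rightarrow> (nat \<Rightarrow> 's \<Rightarrow> 't) \<Rightarrow> bool" where
  "sset_cofibration X Y f \<longleftrightarrow> simplicial_map X Y f \<and> (\<forall>n. inj_on (f n) (cells X n))"

definition sset_weak_equivalence :: "'s sset \<Rightarrow> 't sset \<Rightarrow> (nat \<Rightarrow> 's \<Rightarrow> 't) \<Rightarrow> bool" where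
  "sset_weak_equivalence X Y f \<longleftrightarrow> simplicial_map X Y f \<and>
    weak_homotopy_equivalence (realization X) (realization Y) (realize_map Y f)"


subsection \<open>The monoidal category of finite simplicial sets\<close>

record ('o, 'a) moncat = "('o, 'a) cat" +
  Tens :: "('o \<times> 'o, 'a \<times> 'a, 'o, 'a) func"
  Unt :: "'o"
  Asc :: "'o \<Rightarrow> 'o \<Rightarrow> 'o \<Rightarrow> 'a"  \<comment> \<open>\<open>(X \<otimes> Y) \<otimes> Z \<rightarrow> X \<otimes> (Y \<otimes> Z)\<close>\<close>
  LUn :: "'o \<Rightarrow> 'a"  \<comment> \<open>\<open>Unt \<otimes> X \<rightarrow> X\<close>\<close>
  RUn :: "'o \<Rightarrow> 'a"  \<comment> \<open>\<open>X \<otimes> Unt \<rightarrow> X\<close>\<close>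

text \<open>A finite simplicial set has countably many simplices.  Hence the simplicial sets with
  simplices in \<^typ>\<open>nat\<close> represent all finite ones up to isomorphism; products and standard simplices
  are encoded by the bijections of \<^theory>\<open>HOL-Library.Nat_Bijection\<close>.\<close>

type_synonym sf_ob = "nat sset"
type_synonym sf_arr = "nat sset \<times> (nat \<Rightarrow> nat \<Rightarrow> nat) \<times> nat sset"

definition std_simplex :: "nat \<Rightarrow> sf_ob" where
  "std_simplex n =
    \<lparr>cells = (\<lambda>m. list_encode ` ord_maps m n),
     act = (\<lambda>m \<theta> x. list_encode (ord_comp (list_decode x) \<theta>))\<rparr>"

definition sset_prod :: "sf_ob \<Rightarrow> sf_ob \<Rightarrow> sf_ob" where
  "sset_prod X Y =
    \<lparr>cells = (\<lambda>n. prod_encode ` (cells X n \<times> cells Y n)),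
     act = (\<lambda>n \<theta> z. case prod_decode z of (x, y) \<Rightarrow> prod_encode (act X n \<theta> x, act Y n \<theta> y))\<rparr>"

definition sf_mk :: "sf_ob \<Rightarrow> sf_ob \<Rightarrow> (nat \<Rightarrow> nat \<Rightarrow> nat) \<Rightarrow> sf_arr" where
  "sf_mk X Y f = (X, \<lambda>n. restrict (f n) (cells X n), Y)"

definition std_simplex_map :: "nat \<Rightarrow> nat \<Rightarrow> nat list \<Rightarrow> sf_arr" where
  "std_simplex_map m n \<theta> =
    sf_mk (std_simplex m) (std_simplex n) (\<lambda>k x. list_encode (ord_comp \<theta> (list_decode x)))"

definition SF :: "(sf_ob, sf_arr) moncat" where
  "SF =
    \<lparr>Obj = {X. finite_sset X},
     Arr = {(X, f, Y). finite_sset X \<and> finite_sset Y \<and> simplicial_map X Y f},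
     Dom = (\<lambda>(X, f, Y). X),
     Cod = (\<lambda>(X, f, Y). Y),
     Idn = (\<lambda>X. sf_mk X X (\<lambda>n x. x)),
     Cmp = (\<lambda>(Y, g, Z) (X, f, Y'). sf_mk X Z (\<lambda>n x. g n (f n x))),
     Tens =
       \<lparr>FOb = (\<lambda>(X, Y). sset_prod X Y),
        FAr = (\<lambda>((X, f, X'), (Y, g, Y')). sf_mk (sset_prod X Y) (sset_prod X' Y')
          (\<lambda>n z. case prod_decode z of (x, y) \<Rightarrow> prod_encode (f n x, g n y)))\<rparr>,
     Unt = std_simplex 0,
     Asc = (\<lambda>X Y Z. sf_mk (sset_prod (sset_prod X Y) Z) (sset_prod X (sset_prod Y Z))
       (\<lambda>n w. case prod_decode w of (v, z) \<Rightarrow> case prod_decode v of (x, y) \<Rightarrow>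
         prod_encode (x, prod_encode (y, z)))),
     LUn = (\<lambda>X. sf_mk (sset_prod (std_simplex 0) X) X (\<lambda>n z. snd (prod_decode z))),
     RUn = (\<lambda>X. sf_mk (sset_prod X (std_simplex 0)) X (\<lambda>n z. fst (prod_decode z)))\<rparr>"

definition SF_Cof :: "sf_arr set" where
  "SF_Cof = {(X, f, Y) \<in> Arr SF. sset_cofibration X Y f}"

definition SF_W :: "sf_arr set" where
  "SF_W = {(X, f, Y) \<in> Arr SF. sset_weak_equivalence X Y f}"


section \<open>Simplicial weak cofibration categories\<close>

text \<open>An action of a monoidal category \<open>V\<close> on \<open>M\<close>: the functor \<open>T\<close>, with natural isomorphisms
  \<open>a X Y A : (X \<otimes> Y) \<otimes> A \<rightarrow> X \<otimes> (Y \<otimes> A)\<close> and \<open>l A : Unt \<otimes> A \<rightarrow> A\<close> subject to the usual pentagon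
  and unit coherence conditions.\<close>

locale monoidal_action = category M
  for V :: "('v, 'w) moncat"
    and M :: "('o, 'a) cat" (structure)
    and T :: "('v \<times> 'o, 'w \<times> 'a, 'o, 'a) func"
    and a :: "'v \<Rightarrow> 'v \<Rightarrow> 'o \<Rightarrow> 'a"
    and l :: "'o \<Rightarrow> 'a" +
  assumes T_functor: "is_functor (prod_cat V M) M T"
    and a_arr: "\<lbrakk>X \<in> Obj V; Y \<in> Obj V; A \<in> Obj M\<rbrakk> \<Longrightarrow>
      a X Y A \<in> homset M (FOb T (FOb (Tens V) (X, Y), A)) (FOb T (X, FOb T (Y, A)))"
    and a_iso: "\<lbrakk>X \<in> Obj V; Y \<in> Obj V; A \<in> Obj M\<rbrakk> \<Longrightarrow> is_iso M (a X Y A)"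
    and a_natural: "\<lbrakk>f \<in> homset V X X'; g \<in> homset V Y Y'; h \<in> homset M A A'\<rbrakk> \<Longrightarrow>
      a X' Y' A' \<cdot> FAr T (FAr (Tens V) (f, g), h) = FAr T (f, FAr T (g, h)) \<cdot> a X Y A"
    and l_arr: "A \<in> Obj M \<Longrightarrow> l A \<in> homset M (FOb T (Unt V, A)) A"
    and l_iso: "A \<in> Obj M \<Longrightarrow> is_iso M (l A)"
    and l_natural: "h \<in> homset M A A' \<Longrightarrow> l A' \<cdot> FAr T (Idn V (Unt V), h) = h \<cdot> l A"
    and pentagon: "\<lbrakk>X \<in> Obj V; Y \<in> Obj V; Z \<in> Obj V; A \<in> Obj M\<rbrakk> \<Longrightarrow>
      a X Y (FOb T (Z, A)) \<cdot> a (FOb (Tens V) (X, Y)) Z A =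
        FAr T (Idn V X, a Y Z A) \<cdot> a X (FOb (Tens V) (Y, Z)) A
          \<cdot> FAr T (Asc V X Y Z, Idn M A)"
    and unit_left: "\<lbrakk>X \<in> Obj V; A \<in> Obj M\<rbrakk> \<Longrightarrow>
      l (FOb T (X, A)) \<cdot> a (Unt V) X A = FAr T (LUn V X, Idn M A)"
    and unit_right: "\<lbrakk>X \<in> Obj V; A \<in> Obj M\<rbrakk> \<Longrightarrow>
      FAr T (Idn V X, l A) \<cdot> a X (Unt V) A = FAr T (RUn V X, Idn M A)"

locale simplicial_weak_cofibration_category =
  weak_cofibration_category M Cof W + monoidal_action SF M T a l
  for M :: "('o, 'a) cat" (structure) and Cof W :: "'a set"
    and T :: "(sf_ob \<times> 'o, sf_arr \<times> 'a, 'o, 'a) func"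
    and a :: "sf_ob \<Rightarrow> sf_ob \<Rightarrow> 'o \<Rightarrow> 'a"
    and l :: "'o \<Rightarrow> 'a" +
  assumes T_colim_left: "A \<in> Obj M \<Longrightarrow>
      preserves_finite_colimits SF M
        \<lparr>FOb = (\<lambda>X. FOb T (X, A)), FAr = (\<lambda>f. FAr T (f, Idn M A))\<rparr>"
    and T_colim_right: "X \<in> Obj SF \<Longrightarrow>
      preserves_finite_colimits M M
        \<lparr>FOb = (\<lambda>A. FOb T (X, A)), FAr = (\<lambda>h. FAr T (Idn SF X, h))\<rparr>"
    and pushout_product: "\<lbrakk>j \<in> SF_Cof; j \<in> homset SF X Y; i \<in> Cof; i \<in> homset M L K;
        is_pushout M (FAr T (Idn SF X, i)) (FAr T (j, Idn M L)) p q;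
        h \<in> homset M (Cod M p) (FOb T (Y, K));
        h \<cdot> p = FAr T (j, Idn M K); h \<cdot> q = FAr T (Idn SF Y, i)\<rbrakk> \<Longrightarrow>
      h \<in> Cof \<and> (j \<in> SF_W \<or> i \<in> W \<longrightarrow> h \<in> W)"

definition Map_space ::
  "('o, 'a) cat \<Rightarrow> (sf_ob \<times> 'o, sf_arr \<times> 'a, 'o, 'a) func \<Rightarrow> 'o \<Rightarrow> 'o \<Rightarrow> 'a sset" where
  "Map_space M T A B =
    \<lparr>cells = (\<lambda>n. homset M (FOb T (std_simplex n, A)) B),
     act = (\<lambda>n \<theta> h. h \<cdot>\<^bsub>M\<^esub> FAr T (std_simplex_map (length \<theta> - 1) n \<theta>, Idn M A))\<rparr>"

text \<open>A map \<open>f : A \<rightarrow> B\<close> is regarded as the vertex \<open>f \<cdot> l A\<close> of \<open>Map_space M T A B\<close>.\<close>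

definition simplicial_homotopy_equivalence ::
  "('o, 'a) cat \<Rightarrow> (sf_ob \<times> 'o, sf_arr \<times> 'a, 'o, 'a) func \<Rightarrow> ('o \<Rightarrow> 'a) \<Rightarrow> 'a \<Rightarrow> bool" where
  "simplicial_homotopy_equivalence M T l f \<longleftrightarrow> f \<in> Arr M \<and>
    (\<exists>g \<in> homset M (Cod M f) (Dom M f).
      same_component (Map_space M T (Dom M f) (Dom M f))
        ((g \<cdot>\<^bsub>M\<^esub> f) \<cdot>\<^bsub>M\<^esub> l (Dom M f)) (Idn M (Dom M f) \<cdot>\<^bsub>M\<^esub> l (Dom M f)) \<and>
      same_component (Map_space M T (Cod M f) (Cod M f))
        ((f \<cdot>\<^bsub>M\<^esub> g) \<cdot>\<^bsub>M\<^esub> l (Cod M f)) (Idn M (Cod M f) \<cdot>\<^bsub>M\<^esub> l (Cod M f)))"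

text \<open>Smallness is relative to a universe, here played by a type \<open>'u\<close>: a category is small if its
  arrows (hence, via identities, its objects) can be indexed by elements of \<open>'u\<close>.  The type is a
  parameter, so a statement about all infinite \<open>'u\<close> covers diagrams of every size.\<close>

definition small_category :: "'u itself \<Rightarrow> ('o, 'a, 'z) cat_scheme \<Rightarrow> bool" where
  "small_category U C \<longleftrightarrow> category C \<and> (\<exists>e :: 'a \<Rightarrow> 'u. inj_on e (Arr C))"

locale special_weak_cofibration_category =
  simplicial_weak_cofibration_category M Cof W T a l
  for U :: "'u itself"
    and M :: "('o, 'a) cat" (structure) and Cof W :: "'a set"
    and T :: "(sf_ob \<times> 'o, sf_arr \<times> 'a, 'o, 'a) func"
    and a :: "sf_ob \<Rightarrow> sf_ob \<Rightarrow> 'o \<Rightarrow> 'a"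
    and l :: "'o \<Rightarrow> 'a" +
  assumes small: "small_category U M"
    and fin_lims: "has_finite_limits M"
    and all_fibrant: "A \<in> Obj M \<Longrightarrow> fibrant M Cof W A"
    and all_cofibrant: "A \<in> Obj M \<Longrightarrow> cofibrant M Cof A"
    and homotopy_equivalence_W: "simplicial_homotopy_equivalence M T l f \<Longrightarrow> f \<in> W"


section \<open>Ind-categories\<close>

definition filtered :: "('i, 'j, 'z) cat_scheme \<Rightarrow> bool" where
  "filtered I \<longleftrightarrow> category I \<and> Obj I \<noteq> {} \<and>
    (\<forall>s \<in> Obj I. \<forall>t \<in> Obj I. \<exists>r. homset I s r \<noteq> {} \<and> homset I t r \<noteq> {}) \<and>
    (\<forall>u \<in> Arr I. \<forall>v \<in> Arr I. Dom I u = Dom I v \<and> Cod I u = Cod I v \<longrightarrow>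
      (\<exists>w \<in> Arr I. Dom I w = Cod I u \<and> w \<cdot>\<^bsub>I\<^esub> u = w \<cdot>\<^bsub>I\<^esub> v))"

text \<open>Index categories have their objects and arrows in the universe \<open>'u\<close>.\<close>

type_synonym ('u, 'o, 'a) ind_ob = "('u, 'u) cat \<times> ('u, 'u, 'o, 'a) func"

text \<open>An element of \<open>lim\<^sub>s colim\<^sub>t Hom(X\<^sub>s, Y\<^sub>t)\<close> assigns to \<open>s\<close> a class of pairs \<open>(t, h)\<close> with
  \<open>h : X\<^sub>s \<rightarrow> Y\<^sub>t\<close>.\<close>

type_synonym ('u, 'o, 'a) ind_arr =
  "('u, 'o, 'a) ind_ob \<times> ('u \<Rightarrow> ('u \<times> 'a) set) \<times> ('u, 'o, 'a) ind_ob"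

definition colim_class ::
  "('o, 'a) cat \<Rightarrow> 'o \<Rightarrow> ('u, 'o, 'a) ind_ob \<Rightarrow> 'u \<Rightarrow> 'a \<Rightarrow> ('u \<times> 'a) set" where
  "colim_class M A = (\<lambda>(J, Y) t h. {q. equivclp
    (\<lambda>p p'. \<exists>u \<in> Arr J. \<exists>k \<in> homset M A (FOb Y (Dom J u)).
      p = (Dom J u, k) \<and> p' = (Cod J u, FAr Y u \<cdot>\<^bsub>M\<^esub> k)) (t, h) q})"

definition colim_hom ::
  "('o, 'a) cat \<Rightarrow> 'o \<Rightarrow> ('u, 'o, 'a) ind_ob \<Rightarrow> ('u \<times> 'a) set set" where
  "colim_hom M A = (\<lambda>(J, Y).
    {colim_class M A (J, Y) t h | t h. t \<in> Obj J \<and> h \<in> homset M A (FOb Y t)})"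

definition ind_hom ::
  "('o, 'a) cat \<Rightarrow> ('u, 'o, 'a) ind_ob \<Rightarrow> ('u, 'o, 'a) ind_ob \<Rightarrow>
    ('u \<Rightarrow> ('u \<times> 'a) set) set" where
  "ind_hom M = (\<lambda>(I, X) Y.
    {\<phi> \<in> (\<Pi>\<^sub>E s \<in> Obj I. colim_hom M (FOb X s) Y).
      \<forall>v \<in> Arr I. \<forall>(t, h) \<in> \<phi> (Cod I v). (t, h \<cdot>\<^bsub>M\<^esub> FAr X v) \<in> \<phi> (Dom I v)})"

definition ind_obj :: "('o, 'a) cat \<Rightarrow> ('u, 'o, 'a) ind_ob \<Rightarrow> bool" where
  "ind_obj M = (\<lambda>(I, X). filtered I \<and> is_functor I M X)"

definition ind_level ::
  "('o, 'a) cat \<Rightarrow> ('u, 'u) cat \<Rightarrow> ('u, 'u, 'o, 'a) func \<Rightarrow> ('u, 'u, 'o, 'a) func \<Rightarrow>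
    ('u \<Rightarrow> 'a) \<Rightarrow> ('u, 'o, 'a) ind_arr" where
  "ind_level M I X Y \<tau> =
    ((I, X), \<lambda>s \<in> Obj I. colim_class M (FOb X s) (I, Y) s (\<tau> s), (I, Y))"

definition Ind :: "('o, 'a) cat \<Rightarrow> (('u, 'o, 'a) ind_ob, ('u, 'o, 'a) ind_arr) cat" where
  "Ind M =
    \<lparr>Obj = {X. ind_obj M X},
     Arr = {(X, \<phi>, Y). ind_obj M X \<and> ind_obj M Y \<and> \<phi> \<in> ind_hom M X Y},
     Dom = (\<lambda>(X, \<phi>, Y). X),
     Cod = (\<lambda>(X, \<phi>, Y). Y),
     Idn = (\<lambda>(I, X). ind_level M I X X (\<lambda>s. Idn M (FOb X s))),
     Cmp = (\<lambda>(Y, \<psi>, Z) ((I, X), \<phi>, Y').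
       ((I, X),
        \<lambda>s \<in> Obj I. \<Union>(t, h) \<in> \<phi> s. \<Union>(r, k) \<in> \<psi> t. colim_class M (FOb X s) Z r (k \<cdot>\<^bsub>M\<^esub> h),
        Z))\<rparr>"

definition arrows_isomorphic :: "('o, 'a, 'z) cat_scheme \<Rightarrow> 'a \<Rightarrow> 'a \<Rightarrow> bool" where
  "arrows_isomorphic C f g \<longleftrightarrow> f \<in> Arr C \<and> g \<in> Arr C \<and>
    (\<exists>x \<in> homset C (Dom C f) (Dom C g). \<exists>y \<in> homset C (Cod C f) (Cod C g).
      is_iso C x \<and> is_iso C y \<and> y \<cdot>\<^bsub>C\<^esub> f = g \<cdot>\<^bsub>C\<^esub> x)"

definition Lw_iso :: "('o, 'a) cat \<Rightarrow> 'a set \<Rightarrow> ('u, 'o, 'a) ind_arr set" where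
  "Lw_iso M W = {f. \<exists>I X Y \<tau>. filtered I \<and> is_functor I M X \<and> is_functor I M Y \<and>
    nat_trans I M X Y \<tau> \<and> (\<forall>s \<in> Obj I. \<tau> s \<in> W) \<and>
    arrows_isomorphic (Ind M) f (ind_level M I X Y \<tau>)}"

definition ind_admissible :: "'u itself \<Rightarrow> ('o, 'a) cat \<Rightarrow> 'a set \<Rightarrow> bool" where
  "ind_admissible U M W \<longleftrightarrow>
    two_out_of_three (Ind M) (Lw_iso M W :: ('u, 'o, 'a) ind_arr set)"

end

theory Submission
  imports Defs
begin

text \<open>An arrow \<open>f\<close> of \<open>Ind M\<close> is isomorphic to a levelwise weak equivalence iff every square from an
  arrow \<open>u\<close> of \<open>M\<close> to \<open>f\<close> factors through a weak equivalence of \<open>M\<close>: the squares from weak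
  equivalences to \<open>f\<close> then form a filtered category with colimit \<open>f\<close>.  Two out of three can thus be
  checked one square at a time, without functorial factorizations.

  The squares are corrected by means of left properness, which follows from the cofibrancy of all
  objects by Reedy's argument, and of mapping cylinders.  The mapping cylinder factors an arrow into
  a cofibration and a projection \<open>\<pi>\<close> that is a deformation retraction over its codomain.  The
  homotopy takes place in the fibres, so every base change of \<open>\<pi>\<close> is again a simplicial homotopy
  equivalence, hence a weak equivalence.  Fibrancy of all objects is used to retract an acyclic
  cofibration when \<open>g\<close> and \<open>g \<cdot> f\<close> are given and \<open>f\<close> is sought.\<close>

section \<open>Pushouts and pullbacks\<close>

text \<open>Levelwise models of two composable arrows live over different index categories, with
  unrelated presentations of the middle object. The criterion by squares speaks only of the functors
  sending \<open>A\<close> to \<open>colim Hom(A, X_s)\<close>, which see no presentation. As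
  filtered colimits of representables they turn finite colimits of \<open>M\<close> into limits, so
  partial data can be amalgamated by pushouts in \<open>M\<close>. When two factorizations are
  chained, the obstacle is variance: the second weak equivalence starts or ends at the wrong object,
  and the connecting map is not invertible. Weak equivalences cannot be pulled back in general,
  whereas a deformation retraction over the base, being given by equations, can. A mapping cylinder
  splits a connecting map into a cofibration, good for pushouts, and such a retraction, good for
  pullbacks. The homotopy comes from the maximum map
  \<open>\<Delta>1 \<times> \<Delta>1 \<rightarrow> \<Delta>1\<close>, which contracts the interval
  to the vertex 1 and keeps that vertex fixed throughout; the tensor carries it over to
  cylinders.\<close>

lemma is_isoI:
  assumes "f \<in> homset C A B" "g \<in> homset C B A"
    "g \<cdot>\<^bsub>C\<^esub> f = Idn C A" "f \<cdot>\<^bsub>C\<^esub> g = Idn C B"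
  shows "is_iso C f"
proof -
  have "Dom C f = A" "Cod C f = B" "f \<in> Arr C" using assms(1) by (simp_all add: homset_def)
  then show ?thesis using assms(2-4) unfolding is_iso_def by blast
qed

context category
begin

lemma Arr_Cmp [simp]:
  assumes "f \<in> Arr C" "g \<in> Arr C" "Dom C g = Cod C f"
  shows "g \<cdot> f \<in> Arr C" "Dom C (g \<cdot> f) = Dom C f" "Cod C (g \<cdot> f) = Cod C g"
  using Cmp_in[of f "Dom C f" "Cod C f" g "Cod C g"] assms by (auto simp: homset_def)

lemma Cmp_assoc_Arr [simp]:
  assumes "f \<in> Arr C" "g \<in> Arr C" "h \<in> Arr C" "Dom C g = Cod C f" "Dom C h = Cod C g"
  shows "(h \<cdot> g) \<cdot> f = h \<cdot> (g \<cdot> f)"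
  using Cmp_assoc[of f "Dom C f" "Cod C f" g "Cod C g" h "Cod C h"] assms
  by (auto simp: homset_def)

lemma Arr_Idn [simp]:
  assumes "A \<in> Obj C"
  shows "Idn C A \<in> Arr C" "Dom C (Idn C A) = A" "Cod C (Idn C A) = A"
  using Idn_in[OF assms] by (auto simp: homset_def)

lemma Cmp_Idn_Arr [simp]: "\<lbrakk>f \<in> Arr C; Dom C f = A\<rbrakk> \<Longrightarrow> f \<cdot> Idn C A = f"
  using Cmp_Idn[of f A "Cod C f"] by (auto simp: homset_def)

lemma Idn_Cmp_Arr [simp]: "\<lbrakk>f \<in> Arr C; Cod C f = B\<rbrakk> \<Longrightarrow> Idn C B \<cdot> f = f"
  using Idn_Cmp[of f "Dom C f" B] by (auto simp: homset_def)

lemma homset_Obj: "f \<in> homset C A B \<Longrightarrow> A \<in> Obj C \<and> B \<in> Obj C"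
  using Dom_in Cod_in by (auto simp: homset_def)

text \<open>Composites are normalised to the right by \<open>Cmp_assoc_Arr\<close>, where an
  equation for \<open>g \<cdot> f\<close> no longer matches inside
  \<open>g \<cdot> (f \<cdot> x)\<close>. This lemma applies it there.\<close>

lemma Cmp_left_cong:
  "\<lbrakk>g \<cdot> f = k; f \<in> Arr C; g \<in> Arr C; Dom C g = Cod C f; x \<in> Arr C; Cod C x = Dom C f\<rbrakk>
    \<Longrightarrow> g \<cdot> (f \<cdot> x) = k \<cdot> x"
  by (metis Cmp_assoc_Arr)

lemma is_iso_inverse:
  assumes "is_iso C f" "f \<in> homset C A B"
  obtains g where "g \<in> homset C B A" "g \<cdot> f = Idn C A" "f \<cdot> g = Idn C B" "is_iso C g"
proof -
  from assms obtain g where g: "g \<in> homset C B A" "g \<cdot> f = Idn C A" "f \<cdot> g = Idn C B"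
    unfolding is_iso_def by (auto simp: homset_def)
  show thesis by (rule that[OF g is_isoI[OF g(1) assms(2) g(3,2)]])
qed

text \<open>Existence and uniqueness of the comparison map are separate premises because they are
  proved by different means later on, and the test object is a variable instead of a
  codomain.\<close>

lemma is_pushoutI:
  assumes "f \<in> homset C A B" "g \<in> homset C A D" "p \<in> homset C B P" "q \<in> homset C D P"
    and "p \<cdot> f = q \<cdot> g"
    and "\<And>E p' q'. \<lbrakk>p' \<in> homset C B E; q' \<in> homset C D E; p' \<cdot> f = q' \<cdot> g\<rbrakk>
      \<Longrightarrow> \<exists>h \<in> homset C P E. h \<cdot> p = p' \<and> h \<cdot> q = q'"
    and "\<And>E h h'. \<lbrakk>h \<in> homset C P E; h' \<in> homset C P E; h \<cdot> p = h' \<cdot> p; h \<cdot> q = h' \<cdot> q\<rbrakk>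
      \<Longrightarrow> h = h'"
  shows "is_pushout C f g p q"
proof -
  have ex: "\<exists>!h. h \<in> homset C P E \<and> h \<cdot> p = p' \<and> h \<cdot> q = q'"
    if "p' \<in> homset C B E" "q' \<in> homset C D E" "p' \<cdot> f = q' \<cdot> g" for E p' q'
    using assms(6)[OF that] assms(7)[of _ E] by (metis (no_types, lifting))
  have eqs: "B = Cod C f" "D = Cod C g" "P = Cod C p"
    using assms(1-3) by (auto simp: homset_def)
  have "\<exists>!h. h \<in> homset C (Cod C p) (Cod C p') \<and> h \<cdot> p = p' \<and> h \<cdot> q = q'"
    if "p' \<in> Arr C" "q' \<in> Arr C" "Dom C p' = Cod C f" "Dom C q' = Cod C g"
      "Cod C p' = Cod C q'" "p' \<cdot> f = q' \<cdot> g" for p' q'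
  proof -
    have "p' \<in> homset C B (Cod C p')" "q' \<in> homset C D (Cod C p')"
      using that by (simp_all add: homset_def eqs)
    from ex[OF this that(6)] show ?thesis by (simp only: eqs)
  qed
  moreover have "f \<in> Arr C \<and> g \<in> Arr C \<and> p \<in> Arr C \<and> q \<in> Arr C \<and> Dom C f = Dom C g \<and>
      Dom C p = Cod C f \<and> Dom C q = Cod C g \<and> Cod C p = Cod C q"
    using assms(1-4) by (simp add: homset_def)
  ultimately show ?thesis
    using assms(5) unfolding is_pushout_def by blast
qed

lemma is_pushoutD:
  assumes "is_pushout C f g p q"
  shows "f \<in> Arr C" "g \<in> Arr C" "p \<in> Arr C" "q \<in> Arr C"
    "Dom C g = Dom C f" "Dom C p = Cod C f" "Dom C q = Cod C g" "Cod C q = Cod C p"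
    "p \<cdot> f = q \<cdot> g"
  using assms unfolding is_pushout_def by auto

lemma pushout_ex1:
  assumes "is_pushout C f g p q" "p' \<in> homset C (Cod C f) E" "q' \<in> homset C (Cod C g) E"
    "p' \<cdot> f = q' \<cdot> g"
  shows "\<exists>!h. h \<in> homset C (Cod C p) E \<and> h \<cdot> p = p' \<and> h \<cdot> q = q'"
proof -
  have *: "p' \<in> Arr C \<and> q' \<in> Arr C \<and> Dom C p' = Cod C f \<and> Dom C q' = Cod C g \<and>
      Cod C p' = Cod C q' \<and> p' \<cdot> f = q' \<cdot> g" and E: "Cod C p' = E"
    using assms by (simp_all add: homset_def)
  from assms(1) * show ?thesis
    unfolding is_pushout_def E[symmetric]
    by - (elim conjE, drule spec[of _ p'], drule spec[of _ q'], erule mp, intro conjI, assumption+)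
qed

lemma pushout_induced:
  assumes "is_pushout C f g p q" "p' \<in> homset C (Cod C f) E" "q' \<in> homset C (Cod C g) E"
    "p' \<cdot> f = q' \<cdot> g"
  obtains h where "h \<in> homset C (Cod C p) E" "h \<cdot> p = p'" "h \<cdot> q = q'"
  using pushout_ex1[OF assms] by (elim ex1E conjE)

lemma pushout_eqI:
  assumes P: "is_pushout C f g p q"
    and h: "h \<in> homset C (Cod C p) E" "h' \<in> homset C (Cod C p) E"
    and eq: "h \<cdot> p = h' \<cdot> p" "h \<cdot> q = h' \<cdot> q"
  shows "h = h'"
proof -
  note D = is_pushoutD[OF P]
  have "h \<cdot> p \<in> homset C (Cod C f) E" "h \<cdot> q \<in> homset C (Cod C g) E"
    using D h by (simp_all add: homset_def)
  moreover have "(h \<cdot> p) \<cdot> f = (h \<cdot> q) \<cdot> g"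
    using D h by (simp add: homset_def)
  ultimately show ?thesis
    using pushout_ex1[OF P] h eq by (metis (no_types, lifting))
qed

lemma is_pushout_sym:
  assumes P: "is_pushout C f g p q"
  shows "is_pushout C g f q p"
proof (rule is_pushoutI)
  note D = is_pushoutD[OF P]
  show "g \<in> homset C (Dom C f) (Cod C g)" "f \<in> homset C (Dom C f) (Cod C f)"
    "q \<in> homset C (Cod C g) (Cod C p)" "p \<in> homset C (Cod C f) (Cod C p)" "q \<cdot> g = p \<cdot> f"
    using D by (auto simp: homset_def)
  show "\<exists>h \<in> homset C (Cod C p) E. h \<cdot> q = p' \<and> h \<cdot> p = q'"
    if "p' \<in> homset C (Cod C g) E" "q' \<in> homset C (Cod C f) E" "p' \<cdot> g = q' \<cdot> f" for E p' q'
    using pushout_induced[OF P that(2,1)] that(3) by metis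
  show "h = h'"
    if "h \<in> homset C (Cod C p) E" "h' \<in> homset C (Cod C p) E" "h \<cdot> q = h' \<cdot> q" "h \<cdot> p = h' \<cdot> p"
    for E h h'
    by (rule pushout_eqI[OF P that(1,2,4,3)])
qed

lemma pushout_paste:
  assumes P: "is_pushout C f g p q" and Q: "is_pushout C k p r t"
  shows "is_pushout C (k \<cdot> f) g r (t \<cdot> q)"
proof (rule is_pushoutI)
  note D = is_pushoutD[OF P] is_pushoutD[OF Q]
  have kf: "Dom C k = Cod C f" using D(6) D(14) by metis
  note [simp] = D(1-8,10-13,15-17) kf
  show "k \<cdot> f \<in> homset C (Dom C f) (Cod C k)" "g \<in> homset C (Dom C f) (Cod C g)"
    "r \<in> homset C (Cod C k) (Cod C r)" "t \<cdot> q \<in> homset C (Cod C g) (Cod C r)"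
    by (auto simp: homset_def)
  show "r \<cdot> (k \<cdot> f) = (t \<cdot> q) \<cdot> g"
    using Cmp_left_cong[OF D(18), of f] D(9) by simp
  show "\<exists>h \<in> homset C (Cod C r) E. h \<cdot> r = p' \<and> h \<cdot> (t \<cdot> q) = q'"
    if p': "p' \<in> homset C (Cod C k) E" and q': "q' \<in> homset C (Cod C g) E"
      and eq: "p' \<cdot> (k \<cdot> f) = q' \<cdot> g" for E p' q'
  proof -
    have *: "p' \<cdot> k \<in> homset C (Cod C f) E" "(p' \<cdot> k) \<cdot> f = q' \<cdot> g"
      using p' eq by (auto simp: homset_def)
    obtain u where u: "u \<in> homset C (Cod C p) E" "u \<cdot> p = p' \<cdot> k" "u \<cdot> q = q'"
      by (rule pushout_induced[OF P *(1) q' *(2)])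
    obtain h where h: "h \<in> homset C (Cod C r) E" "h \<cdot> r = p'" "h \<cdot> t = u"
      by (rule pushout_induced[OF Q p' u(1) u(2)[symmetric]])
    have "h \<cdot> (t \<cdot> q) = q'"
      using Cmp_left_cong[OF h(3), of q] h u(3) by (auto simp: homset_def)
    then show ?thesis using h by blast
  qed
  show "h = h'"
    if h: "h \<in> homset C (Cod C r) E" "h' \<in> homset C (Cod C r) E"
      and r: "h \<cdot> r = h' \<cdot> r" and tq: "h \<cdot> (t \<cdot> q) = h' \<cdot> (t \<cdot> q)" for E h h'
  proof -
    have "(h \<cdot> t) \<cdot> p = h \<cdot> (r \<cdot> k)" "(h' \<cdot> t) \<cdot> p = h' \<cdot> (r \<cdot> k)"
      using h D(18) by (auto simp: homset_def)
    moreover have "h \<cdot> (r \<cdot> k) = h' \<cdot> (r \<cdot> k)"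
      using Cmp_left_cong[OF r, of k] h by (auto simp: homset_def)
    ultimately have "(h \<cdot> t) \<cdot> p = (h' \<cdot> t) \<cdot> p" by simp
    then have "h \<cdot> t = h' \<cdot> t"
      using h tq by - (rule pushout_eqI[OF P, of _ E], auto simp: homset_def)
    then show ?thesis by (rule pushout_eqI[OF Q h r])
  qed
qed

text \<open>A cocone on the second square restricts along \<open>q\<close> to one on the outer
  rectangle. The map induced by the latter has the right composite with \<open>t\<close> because
  both sides agree on the two legs \<open>p\<close> and \<open>q\<close> of the first
  pushout.\<close>

lemma pushout_cancel:
  assumes P: "is_pushout C f g p q" and R: "is_pushout C (k \<cdot> f) g r (t \<cdot> q)"
    and k: "k \<in> homset C (Cod C f) (Dom C r)" and t: "t \<in> homset C (Cod C p) (Cod C r)"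
    and eq: "r \<cdot> k = t \<cdot> p"
  shows "is_pushout C k p r t"
proof (rule is_pushoutI)
  note D = is_pushoutD[OF P]
  note [simp] = D(1-8)
  have kA: "k \<in> Arr C \<and> Dom C k = Cod C f \<and> Cod C k = Dom C r"
    using k by (simp add: homset_def)
  have tA: "t \<in> Arr C \<and> Dom C t = Cod C p \<and> Cod C t = Cod C r"
    using t by (simp add: homset_def)
  note [simp] = kA[THEN conjunct1] kA[THEN conjunct2, THEN conjunct1]
    kA[THEN conjunct2, THEN conjunct2, symmetric] tA is_pushoutD(3)[OF R]
  show "k \<in> homset C (Cod C f) (Cod C k)" "p \<in> homset C (Cod C f) (Cod C p)"
    "r \<in> homset C (Cod C k) (Cod C r)" "t \<in> homset C (Cod C p) (Cod C r)" "r \<cdot> k = t \<cdot> p"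
    using eq by (auto simp: homset_def)
  show "\<exists>h \<in> homset C (Cod C r) E. h \<cdot> r = p' \<and> h \<cdot> t = q'"
    if p': "p' \<in> homset C (Cod C k) E" and q': "q' \<in> homset C (Cod C p) E"
      and e: "p' \<cdot> k = q' \<cdot> p" for E p' q'
  proof -
    have [simp]: "p' \<in> Arr C" "Dom C p' = Cod C k" "Cod C p' = E"
      "q' \<in> Arr C" "Dom C q' = Cod C p" "Cod C q' = E"
      using p' q' by (auto simp: homset_def)
    have *: "p' \<cdot> (k \<cdot> f) = (q' \<cdot> q) \<cdot> g"
      using Cmp_left_cong[OF e, of f] D(9) by simp
    have **: "p' \<in> homset C (Cod C (k \<cdot> f)) E" "q' \<cdot> q \<in> homset C (Cod C g) E"
      by (auto simp: homset_def)
    obtain h where h: "h \<in> homset C (Cod C r) E" "h \<cdot> r = p'" "h \<cdot> (t \<cdot> q) = q' \<cdot> q"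
      by (rule pushout_induced[OF R ** *])
    then have [simp]: "h \<in> Arr C" "Dom C h = Cod C r" "Cod C h = E" by (auto simp: homset_def)
    have "(h \<cdot> t) \<cdot> p = q' \<cdot> p"
      using Cmp_left_cong[OF h(2), of k] eq e by simp
    then have "h \<cdot> t = q'"
      using h by - (rule pushout_eqI[OF P, of _ E], auto simp: homset_def)
    then show ?thesis using h by blast
  qed
  show "h = h'"
    if h: "h \<in> homset C (Cod C r) E" "h' \<in> homset C (Cod C r) E"
      and r: "h \<cdot> r = h' \<cdot> r" and tq: "h \<cdot> t = h' \<cdot> t" for E h h'
  proof (rule pushout_eqI[OF R h r])
    show "h \<cdot> (t \<cdot> q) = h' \<cdot> (t \<cdot> q)"
      using Cmp_left_cong[OF tq, of q] h by (auto simp: homset_def)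
  qed
qed

lemma pushout_of_iso:
  assumes "f \<in> homset C A B" "g \<in> homset C A D" "f' \<in> homset C B A"
    "f' \<cdot> f = Idn C A" "f \<cdot> f' = Idn C B"
  shows "is_pushout C f g (g \<cdot> f') (Idn C D)"
proof (rule is_pushoutI[OF assms(1,2)])
  have O: "A \<in> Obj C" "B \<in> Obj C" "D \<in> Obj C" using assms homset_Obj by blast+
  show "g \<cdot> f' \<in> homset C B D" "Idn C D \<in> homset C D D" "(g \<cdot> f') \<cdot> f = Idn C D \<cdot> g"
    using assms O by (auto simp: homset_def)
  show "\<exists>h \<in> homset C D E. h \<cdot> (g \<cdot> f') = p' \<and> h \<cdot> Idn C D = q'"
    if p': "p' \<in> homset C B E" and q': "q' \<in> homset C D E"
      and e: "p' \<cdot> f = q' \<cdot> g" for E p' q'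
    using that assms Cmp_left_cong[OF e, of f']
    by (intro bexI[of _ q']) (auto simp: homset_def)
  show "h = h'"
    if "h \<in> homset C D E" "h' \<in> homset C D E" "h \<cdot> Idn C D = h' \<cdot> Idn C D" for E h h'
    using that by (auto simp: homset_def)
qed

text \<open>Tensoring with an initial object gives initial objects that are isomorphic but not
  equal. The pushout corner of a pushout-product therefore degenerates only along the unique
  isomorphism \<open>g\<close>.\<close>

lemma initial_pushout:
  assumes I: "is_initial C I" and f: "f \<in> homset C I B" and J: "is_initial C J" and g:
    "g \<in> homset C I J"
    and h: "h \<in> homset C J B"
  shows "is_pushout C f g (Idn C B) h"
proof -
  from I J obtain g' where g': "g' \<in> homset C J I" unfolding is_initial_def by blast
  have "g' \<cdot> g = Idn C I" "g \<cdot> g' = Idn C J"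
    using I J g g' Cmp_in Idn_in unfolding is_initial_def by (metis (no_types, lifting))+
  then have "is_pushout C g f (f \<cdot> g') (Idn C B)"
    using pushout_of_iso[OF g f g'] by blast
  moreover have "f \<cdot> g' = h"
    using J h f g' Cmp_in homset_Obj unfolding is_initial_def by (metis (no_types, lifting))
  ultimately show ?thesis using is_pushout_sym by blast
qed

end

text \<open>The walking span \<open>1 \<leftarrow> 0 \<rightarrow> 2\<close>, with arrows \<open>3 : 0 \<rightarrow> 1\<close> and \<open>4 : 0 \<rightarrow> 2\<close>, and the
  walking cospan \<open>1 \<rightarrow> 0 \<leftarrow> 2\<close>.\<close>

definition span_cat :: "(nat, nat) cat" where
  "span_cat = \<lparr>Obj = {0, 1, 2}, Arr = {0, 1, 2, 3, 4},
     Dom = (\<lambda>u. if u < 3 then u else 0), Cod = (\<lambda>u. if u < 3 then u else u - 2),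
     Idn = (\<lambda>j. j), Cmp = (\<lambda>v u. if v < 3 then u else v)\<rparr>"

definition cospan_cat :: "(nat, nat) cat" where
  "cospan_cat = \<lparr>Obj = {0, 1, 2}, Arr = {0, 1, 2, 3, 4},
     Dom = (\<lambda>u. if u < 3 then u else u - 2), Cod = (\<lambda>u. if u < 3 then u else 0),
     Idn = (\<lambda>j. j), Cmp = (\<lambda>v u. if u < 3 then v else u)\<rparr>"

definition empty_cat :: "(nat, nat) cat" where
  "empty_cat = \<lparr>Obj = {}, Arr = {}, Dom = id, Cod = id, Idn = id, Cmp = (\<lambda>v u. u)\<rparr>"

section \<open>Pushouts, initial objects and pullbacks as finite colimits and limits\<close>

lemma finite_span_cat: "finite_category span_cat"
  unfolding finite_category_def category_def span_cat_def homset_def by auto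

lemma finite_cospan_cat: "finite_category cospan_cat"
  unfolding finite_category_def category_def cospan_cat_def homset_def by auto

lemma finite_empty_cat: "finite_category empty_cat"
  unfolding finite_category_def category_def empty_cat_def homset_def by auto

definition span_diag :: "('o, 'a, 'z) cat_scheme \<Rightarrow> 'a \<Rightarrow> 'a \<Rightarrow> (nat, nat, 'o, 'a) func" where
  "span_diag C f g =
    \<lparr>FOb = (\<lambda>j. if j = 0 then Dom C f else if j = 1 then Cod C f else Cod C g),
     FAr = (\<lambda>u. if u = 0 then Idn C (Dom C f) else if u = 1 then Idn C (Cod C f)
       else if u = 2 then Idn C (Cod C g) else if u = 3 then f else g)\<rparr>"

definition cospan_diag :: "('o, 'a, 'z) cat_scheme \<Rightarrow> 'a \<Rightarrow> 'a \<Rightarrow> (nat, nat, 'o, 'a) func" where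
  "cospan_diag C f g =
    \<lparr>FOb = (\<lambda>j. if j = 0 then Cod C f else if j = 1 then Dom C f else Dom C g),
     FAr = (\<lambda>u. if u = 0 then Idn C (Cod C f) else if u = 1 then Idn C (Dom C f)
       else if u = 2 then Idn C (Dom C g) else if u = 3 then f else g)\<rparr>"

lemma (in category) span_diag_functor:
  assumes f: "f \<in> homset C A B" and g: "g \<in> homset C A D"
  shows "is_functor span_cat C (span_diag C f g)"
proof -
  have O: "A \<in> Obj C" "B \<in> Obj C" "D \<in> Obj C" using f g homset_Obj by blast+
  have fg: "f \<in> Arr C" "g \<in> Arr C" "Dom C f = A" "Dom C g = A" "Cod C f = B" "Cod C g = D"
    using f g by (simp_all add: homset_def)
  show ?thesis
    unfolding is_functor_def span_diag_def span_cat_def homset_def fg(3-6)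
    by (simp add: O fg split del: if_split)
qed

lemma (in category) cospan_diag_functor:
  assumes f: "f \<in> homset C B A" and g: "g \<in> homset C D A"
  shows "is_functor cospan_cat C (cospan_diag C f g)"
proof -
  have O: "A \<in> Obj C" "B \<in> Obj C" "D \<in> Obj C" using f g homset_Obj by blast+
  have fg: "f \<in> Arr C" "g \<in> Arr C" "Dom C f = B" "Dom C g = D" "Cod C f = A" "Cod C g = A"
    using f g by (simp_all add: homset_def)
  show ?thesis
    unfolding is_functor_def cospan_diag_def cospan_cat_def homset_def fg(3-6)
    by (simp add: O fg split del: if_split)
qed

text \<open>The diagram is given by its values instead of as \<open>span_diag\<close>, so that the
  criterion also applies to the image of a span under a functor, as \<open>preserves_pushout\<close>
  requires.\<close>

lemma (in category) span_cocone_iff: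
  assumes fg: "f \<in> homset C A B" "g \<in> homset C A D"
    and D: "FOb F 0 = A" "FOb F 1 = B" "FOb F 2 = D" "FAr F 3 = f" "FAr F 4 = g"
      "FAr F 0 = Idn C A" "FAr F 1 = Idn C B" "FAr F 2 = Idn C D"
  shows "is_cocone span_cat C F P c \<longleftrightarrow>
    c 1 \<in> homset C B P \<and> c 2 \<in> homset C D P \<and> c 0 = c 1 \<cdot> f \<and> c 1 \<cdot> f = c 2 \<cdot> g"
  (is "?L \<longleftrightarrow> ?R")
proof
  assume ?L
  then show ?R using D unfolding is_cocone_def span_cat_def by simp
next
  assume R: ?R
  then have "P \<in> Obj C" using homset_Obj by blast
  moreover have "c 0 \<in> homset C A P" using R fg Cmp_in by simp
  ultimately show ?L
    using R D fg Cmp_Idn[of "c 0" A P] Cmp_Idn[of "c 1" B P] Cmp_Idn[of "c 2" D P]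
    unfolding is_cocone_def span_cat_def by auto
qed

lemma (in category) span_colimit_iff:
  assumes fg: "f \<in> homset C A B" "g \<in> homset C A D"
    and D: "FOb F 0 = A" "FOb F 1 = B" "FOb F 2 = D" "FAr F 3 = f" "FAr F 4 = g"
      "FAr F 0 = Idn C A" "FAr F 1 = Idn C B" "FAr F 2 = Idn C D"
  shows "is_colimit span_cat C F P c \<longleftrightarrow>
    P = Cod C (c 1) \<and> c 0 = c 1 \<cdot> f \<and> is_pushout C f g (c 1) (c 2)"
  (is "?L \<longleftrightarrow> ?R")
proof
  note cocone = span_cocone_iff[OF fg D]
  assume L: ?L
  then have c: "c 1 \<in> homset C B P" "c 2 \<in> homset C D P" "c 0 = c 1 \<cdot> f" "c 1 \<cdot> f = c 2 \<cdot> g"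
    unfolding is_colimit_def cocone by auto
  have univ: "\<exists>!h. h \<in> homset C P E \<and> h \<cdot> c 1 = p' \<and> h \<cdot> c 2 = q'"
    if p': "p' \<in> homset C B E" and q': "q' \<in> homset C D E" and eq: "p' \<cdot> f = q' \<cdot> g" for E p' q'
  proof -
    define c' where "c' j = (if j = 0 then p' \<cdot> f else if j = 1 then p' else q')" for j :: nat
    have "is_cocone span_cat C F E c'"
      unfolding cocone using p' q' eq by (simp add: c'_def)
    then have "\<exists>!h. h \<in> homset C P E \<and> (\<forall>j \<in> Obj span_cat. h \<cdot> c j = c' j)"
      using L unfolding is_colimit_def by blast
    \<comment> \<open>The leg at the apex \<open>0\<close> is forced by the leg at \<open>1\<close>,
      so a comparison map has to be tested on two legs only.\<close>
    moreover have "(\<forall>j \<in> Obj span_cat. h \<cdot> c j = c' j) \<longleftrightarrow> h \<cdot> c 1 = p' \<and> h \<cdot> c 2 = q'"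
      if "h \<in> homset C P E" for h
    proof -
      have "h \<cdot> c 0 = (h \<cdot> c 1) \<cdot> f"
        using c fg that by (simp add: homset_def)
      then show ?thesis by (auto simp: span_cat_def c'_def)
    qed
    ultimately show ?thesis by (metis (no_types, lifting))
  qed
  have "is_pushout C f g (c 1) (c 2)"
  proof (rule is_pushoutI[OF fg c(1,2,4)])
    show "\<exists>h \<in> homset C P E. h \<cdot> c 1 = p' \<and> h \<cdot> c 2 = q'"
      if "p' \<in> homset C B E" "q' \<in> homset C D E" "p' \<cdot> f = q' \<cdot> g" for E p' q'
      using univ[OF that] by blast
    show "h = h'"
      if h: "h \<in> homset C P E" "h' \<in> homset C P E" "h \<cdot> c 1 = h' \<cdot> c 1" "h \<cdot> c 2 = h' \<cdot> c 2"
      for E h h'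
    proof -
      have "(h \<cdot> c 1) \<cdot> f = (h \<cdot> c 2) \<cdot> g" using h(1) c fg by (simp add: homset_def)
      then show ?thesis
        using univ[OF Cmp_in[OF c(1) h(1)] Cmp_in[OF c(2) h(1)]] h by (metis (no_types, lifting))
    qed
  qed
  then show ?R using c by (simp add: homset_def)
next
  note cocone = span_cocone_iff[OF fg D]
  assume R: ?R
  then have P: "P = Cod C (c 1)" "c 0 = c 1 \<cdot> f" and po: "is_pushout C f g (c 1) (c 2)" by auto
  note po' = is_pushoutD[OF po]
  have c: "c 1 \<in> homset C B P" "c 2 \<in> homset C D P"
    using po' P fg by (simp_all add: homset_def)
  have "\<exists>!h. h \<in> homset C P E \<and> (\<forall>j \<in> Obj span_cat. h \<cdot> c j = c' j)"
    if "is_cocone span_cat C F E c'" for E c'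
  proof -
    from that have c': "c' 1 \<in> homset C B E" "c' 2 \<in> homset C D E" "c' 0 = c' 1 \<cdot> f"
      "c' 1 \<cdot> f = c' 2 \<cdot> g" unfolding cocone by auto
    have "\<exists>!h. h \<in> homset C P E \<and> h \<cdot> c 1 = c' 1 \<and> h \<cdot> c 2 = c' 2"
      using pushout_ex1[OF po, of "c' 1" E "c' 2"] c' fg P by (simp add: homset_def)
    moreover have "(\<forall>j \<in> Obj span_cat. h \<cdot> c j = c' j) \<longleftrightarrow> h \<cdot> c 1 = c' 1 \<and> h \<cdot> c 2 = c' 2"
      if "h \<in> homset C P E" for h
    proof -
      have "h \<cdot> c 0 = (h \<cdot> c 1) \<cdot> f"
        using c P(2) fg that by (simp add: homset_def)
      then show ?thesis by (auto simp: span_cat_def c'(3))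
    qed
    ultimately show ?thesis by (metis (no_types, lifting))
  qed
  moreover have "is_cocone span_cat C F P c"
    unfolding cocone using c P po' by simp
  ultimately show ?L unfolding is_colimit_def by blast
qed

lemma (in category) pushout_exists:
  assumes "has_finite_colimits C" "f \<in> homset C A B" "g \<in> homset C A D"
  obtains P p q where "is_pushout C f g p q" "p \<in> homset C B P" "q \<in> homset C D P"
proof -
  obtain P c where "is_colimit span_cat C (span_diag C f g) P c"
    using assms(1) finite_span_cat span_diag_functor[OF assms(2,3)] unfolding
      has_finite_colimits_def by blast
  then have *: "is_pushout C f g (c 1) (c 2)"
    using span_colimit_iff[OF assms(2,3), of "span_diag C f g" P c] assms(2,3)
    by (simp add: span_diag_def homset_def)
  show thesis
    using that[OF *, of "Cod C (c 1)"] is_pushoutD[OF *] assms(2,3) by (simp add: homset_def)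
qed

lemma preserves_pushout:
  assumes C: "category C" and C': "category C'" and F: "is_functor C C' F"
    and pres: "preserves_finite_colimits C C' F" and po: "is_pushout C f g p q"
  shows "is_pushout C' (FAr F f) (FAr F g) (FAr F p) (FAr F q)"
proof -
  interpret C: category C by fact
  interpret C': category C' by fact
  note D = C.is_pushoutD[OF po]
  define c where "c j = (if j = 0 then p \<cdot>\<^bsub>C\<^esub> f else if j = 1 then p else q)" for j :: nat
  have fg: "f \<in> homset C (Dom C f) (Cod C f)" "g \<in> homset C (Dom C f) (Cod C g)"
    using D by (simp_all add: homset_def)
  have fg': "FAr F f \<in> homset C' (FOb F (Dom C f)) (FOb F (Cod C f))"
    "FAr F g \<in> homset C' (FOb F (Dom C f)) (FOb F (Cod C g))"
    using F D unfolding is_functor_def by metis+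
  have "is_colimit span_cat C (span_diag C f g) (Cod C p) c"
    using C.span_colimit_iff[OF fg, of "span_diag C f g" "Cod C p" c] D po
    by (simp add: span_diag_def c_def)
  then have col: "is_colimit span_cat C' (comp_func F (span_diag C f g)) (FOb F (Cod C p))
      (\<lambda>j. FAr F (c j))"
    using pres finite_span_cat C.span_diag_functor[OF fg]
    unfolding preserves_finite_colimits_def by metis
  have ob: "Dom C f \<in> Obj C" "Cod C f \<in> Obj C" "Cod C g \<in> Obj C"
    using D C.Dom_in C.Cod_in by auto
  then have idn: "FAr F (Idn C (Dom C f)) = Idn C' (FOb F (Dom C f))"
    "FAr F (Idn C (Cod C f)) = Idn C' (FOb F (Cod C f))"
    "FAr F (Idn C (Cod C g)) = Idn C' (FOb F (Cod C g))"
    using F unfolding is_functor_def by blast+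
  show ?thesis
    using C'.span_colimit_iff[OF fg', of "comp_func F (span_diag C f g)"] col idn
    by (simp add: span_diag_def c_def comp_func_def)
qed

lemma is_colimit_empty_iff: "is_colimit empty_cat C F K c \<longleftrightarrow> is_initial C K"
  unfolding is_colimit_def is_cocone_def empty_cat_def is_initial_def by auto

lemma initial_exists:
  assumes "has_finite_colimits C"
  obtains I where "is_initial C I"
proof -
  have "is_functor empty_cat C F" for F :: "(nat, nat, 'a, 'b) func"
    unfolding is_functor_def empty_cat_def by simp
  then show thesis
    using that assms finite_empty_cat is_colimit_empty_iff unfolding has_finite_colimits_def by
      metis
qed

lemma preserves_initial:
  assumes "preserves_finite_colimits C C' F" "is_initial C I"
  shows "is_initial C' (FOb F I)"
proof -
  have "is_functor empty_cat C D" for D :: "(nat, nat, 'a, 'b) func"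
    unfolding is_functor_def empty_cat_def by simp
  then show ?thesis
    using assms finite_empty_cat is_colimit_empty_iff unfolding preserves_finite_colimits_def by
      metis
qed

lemma (in category) cospan_cone_iff:
  assumes fg: "f \<in> homset C B A" "g \<in> homset C D A"
  shows "is_cone cospan_cat C (cospan_diag C f g) P c \<longleftrightarrow>
    c 1 \<in> homset C P B \<and> c 2 \<in> homset C P D \<and> c 0 = f \<cdot> c 1 \<and> f \<cdot> c 1 = g \<cdot> c 2"
  (is "?L \<longleftrightarrow> ?R")
proof
  assume ?L
  then show ?R using fg unfolding is_cone_def cospan_cat_def cospan_diag_def by
    (simp add: homset_def)
next
  assume R: ?R
  then have "P \<in> Obj C" using homset_Obj by blast
  moreover have "c 0 \<in> homset C P A" using R fg Cmp_in by metis
  ultimately show ?L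
    using R fg unfolding is_cone_def cospan_cat_def cospan_diag_def by (auto simp: homset_def)
qed

lemma (in category) pullback_exists:
  assumes "has_finite_limits C" and fg: "f \<in> homset C B A" "g \<in> homset C D A"
  obtains P p q where "p \<in> homset C P B" "q \<in> homset C P D" "f \<cdot> p = g \<cdot> q"
    "\<And>E p' q'. \<lbrakk>p' \<in> homset C E B; q' \<in> homset C E D; f \<cdot> p' = g \<cdot> q'\<rbrakk>
      \<Longrightarrow> \<exists>h \<in> homset C E P. p \<cdot> h = p' \<and> q \<cdot> h = q'"
    "\<And>E h h'. \<lbrakk>h \<in> homset C E P; h' \<in> homset C E P; p \<cdot> h = p \<cdot> h'; q \<cdot> h = q \<cdot> h'\<rbrakk> \<Longrightarrow> h = h'"
proof -
  note cone = cospan_cone_iff[OF fg]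
  have "is_functor cospan_cat C (cospan_diag C f g)"
    using fg by (rule cospan_diag_functor)
  then obtain P c where L: "is_limit cospan_cat C (cospan_diag C f g) P c"
    using assms(1) finite_cospan_cat unfolding has_finite_limits_def by blast
  then have c: "c 1 \<in> homset C P B" "c 2 \<in> homset C P D" "c 0 = f \<cdot> c 1" "f \<cdot> c 1 = g \<cdot> c 2"
    unfolding is_limit_def cone by auto
  have univ: "\<exists>!h. h \<in> homset C E P \<and> c 1 \<cdot> h = p' \<and> c 2 \<cdot> h = q'"
    if p': "p' \<in> homset C E B" and q': "q' \<in> homset C E D" and eq: "f \<cdot> p' = g \<cdot> q'" for E p' q'
  proof -
    define c' where "c' j = (if j = 0 then f \<cdot> p' else if j = 1 then p' else q')" for j :: nat
    have "is_cone cospan_cat C (cospan_diag C f g) E c'"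
      unfolding cone using p' q' eq by (simp add: c'_def)
    then have "\<exists>!h. h \<in> homset C E P \<and> (\<forall>j \<in> Obj cospan_cat. c j \<cdot> h = c' j)"
      using L unfolding is_limit_def by blast
    moreover have "(\<forall>j \<in> Obj cospan_cat. c j \<cdot> h = c' j) \<longleftrightarrow> c 1 \<cdot> h = p' \<and> c 2 \<cdot> h = q'"
      if "h \<in> homset C E P" for h
    proof -
      have "c 0 \<cdot> h = f \<cdot> (c 1 \<cdot> h)"
        unfolding c(3) using c(1) fg(1) that by (simp add: homset_def)
      then show ?thesis by (auto simp: cospan_cat_def c'_def)
    qed
    ultimately show ?thesis by (metis (no_types, lifting))
  qed
  show thesis
  proof (rule that[OF c(1,2,4)])
    show "\<exists>h \<in> homset C E P. c 1 \<cdot> h = p' \<and> c 2 \<cdot> h = q'"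
      if "p' \<in> homset C E B" "q' \<in> homset C E D" "f \<cdot> p' = g \<cdot> q'" for E p' q'
      using univ[OF that] by blast
    show "h = h'"
      if h: "h \<in> homset C E P" "h' \<in> homset C E P" "c 1 \<cdot> h = c 1 \<cdot> h'" "c 2 \<cdot> h = c 2 \<cdot> h'"
      for E h h'
    proof -
      have "f \<cdot> (c 1 \<cdot> h) = g \<cdot> (c 2 \<cdot> h)"
        using Cmp_left_cong[OF c(4), of h] h(1) c fg by (simp add: homset_def)
      then show ?thesis
        using univ[OF Cmp_in[OF h(1) c(1)] Cmp_in[OF h(1) c(2)]] h by (metis (no_types, lifting))
    qed
  qed
qed

section \<open>Ind-objects as filtered colimits\<close>

lemma filtered_category: "filtered I \<Longrightarrow> category I"
  by (simp add: filtered_def)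

lemma filtered_upper_bound:
  assumes "filtered I" "s \<in> Obj I" "t \<in> Obj I"
  obtains r u v where "u \<in> homset I s r" "v \<in> homset I t r"
  using assms unfolding filtered_def by (metis ex_in_conv)

lemma filtered_equalize:
  assumes "filtered I" "u \<in> homset I s t" "v \<in> homset I s t"
  obtains r w where "w \<in> homset I t r" "w \<cdot>\<^bsub>I\<^esub> u = w \<cdot>\<^bsub>I\<^esub> v"
proof -
  have "u \<in> Arr I" "v \<in> Arr I" "Dom I u = Dom I v \<and> Cod I u = Cod I v" "Cod I u = t"
    using assms by (simp_all add: homset_def)
  then obtain w where "w \<in> Arr I" "Dom I w = t" "w \<cdot>\<^bsub>I\<^esub> u = w \<cdot>\<^bsub>I\<^esub> v"
    using assms(1) unfolding filtered_def by metis
  then show thesis using that[of w "Cod I w"] by (simp add: homset_def)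
qed

lemma filtered_span:
  assumes I: "filtered I" and u: "u \<in> homset I s t" and v: "v \<in> homset I s t'"
  obtains r p q where "p \<in> homset I t r" "q \<in> homset I t' r" "p \<cdot>\<^bsub>I\<^esub> u = q \<cdot>\<^bsub>I\<^esub> v"
proof -
  interpret category I using I by (rule filtered_category)
  obtain r0 a b where ab: "a \<in> homset I t r0" "b \<in> homset I t' r0"
    using filtered_upper_bound[OF I] homset_Obj[OF u] homset_Obj[OF v] by metis
  obtain r w where w: "w \<in> homset I r0 r" "w \<cdot>\<^bsub>I\<^esub> (a \<cdot>\<^bsub>I\<^esub> u) = w \<cdot>\<^bsub>I\<^esub> (b \<cdot>\<^bsub>I\<^esub> v)"
    using filtered_equalize[OF I Cmp_in[OF u ab(1)] Cmp_in[OF v ab(2)]] by metis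
  show thesis
    by (rule that[OF Cmp_in[OF ab(1) w(1)] Cmp_in[OF ab(2) w(1)]])
      (simp only: Cmp_assoc[OF u ab(1) w(1)] Cmp_assoc[OF v ab(2) w(1)] w(2))
qed

section \<open>Generalized elements of an ind-object\<close>

lemma equivclp_class: "equivclp R p q \<Longrightarrow> {x. equivclp R q x} = {x. equivclp R p x}"
  by (blast intro: equivclp_trans equivclp_sym)

text \<open>Precomposition of a generalized element with \<open>g\<close>. The union runs over all
  representatives of \<open>c\<close>; by \<open>el_res_class\<close> each contributes the same
  class, so no choice is made.\<close>

definition el_res :: "('o, 'a) cat \<Rightarrow> ('u, 'o, 'a) ind_ob \<Rightarrow> ('u \<times> 'a) set \<Rightarrow> 'a \<Rightarrow> ('u \<times> 'a) set" where
  "el_res M Y c g = (\<Union>(t, h) \<in> c. colim_class M (Dom M g) Y t (h \<cdot>\<^bsub>M\<^esub> g))"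

definition ind_app ::
  "('o, 'a) cat \<Rightarrow> ('u, 'o, 'a) ind_ob \<Rightarrow> ('u \<Rightarrow> ('u \<times> 'a) set) \<Rightarrow> ('u \<times> 'a) set \<Rightarrow> ('u \<times> 'a) set" where
  "ind_app M Y \<phi> c = (\<Union>(s, h) \<in> c. el_res M Y (\<phi> s) h)"

text \<open>An arrow \<open>X \<rightarrow> Y\<close> of \<open>Ind M\<close> acts on generalized elements, i.e. on
  \<open>colim\<^sub>s Hom(A, X\<^sub>s)\<close>.\<close>

definition ind_act :: "('o, 'a) cat \<Rightarrow> ('u, 'o, 'a) ind_arr \<Rightarrow> ('u \<times> 'a) set \<Rightarrow> ('u \<times> 'a) set" where
  "ind_act M f = (case f of (X, \<phi>, Y) \<Rightarrow> ind_app M Y \<phi>)"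

text \<open>\<open>Ind\<close> and the notions around it take plain category records, so the scheme
  parameter of \<open>category\<close> is fixed here.\<close>

locale base_category = category M for M :: "('o, 'a) cat" (structure)
begin

lemma functor_Obj: "\<lbrakk>is_functor I M X; s \<in> Obj I\<rbrakk> \<Longrightarrow> FOb X s \<in> Obj M"
  by (simp add: is_functor_def)

lemma functor_Arr: "\<lbrakk>is_functor I M X; u \<in> homset I s t\<rbrakk> \<Longrightarrow> FAr X u \<in> homset M (FOb X s) (FOb X t)"
  by (auto simp: is_functor_def homset_def)

lemma functor_Idn: "\<lbrakk>is_functor I M X; s \<in> Obj I\<rbrakk> \<Longrightarrow> FAr X (Idn I s) = Idn M (FOb X s)"
  by (simp add: is_functor_def)

lemma functor_Cmp:
  "\<lbrakk>is_functor I M X; u \<in> homset I s t; v \<in> homset I t r\<rbrakk>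
    \<Longrightarrow> FAr X (v \<cdot>\<^bsub>I\<^esub> u) = FAr X v \<cdot> FAr X u"
  by (simp add: is_functor_def homset_def)

lemma colim_class_refl: "(t, h) \<in> colim_class M A (J, Y) t h"
  by (simp add: colim_class_def)

text \<open>The generated equivalence is a zigzag through the index category, and filteredness
  shortens it to one cospan: a forward step leaves a span, which is completed to a square, and a
  backward step is absorbed by composition.\<close>

lemma colim_class_mem_iff:
  assumes J: "filtered J" and Y: "is_functor J M Y"
    and t: "t \<in> Obj J" and h: "h \<in> homset M A (FOb Y t)"
  shows "(t', h') \<in> colim_class M A (J, Y) t h \<longleftrightarrow>
    t' \<in> Obj J \<and> h' \<in> homset M A (FOb Y t') \<and>
    (\<exists>r. \<exists>u \<in> homset J t r. \<exists>v \<in> homset J t' r. FAr Y u \<cdot> h = FAr Y v \<cdot> h')"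
    (is "_ \<longleftrightarrow> ?J (t', h')")
proof
  interpret J: category J using J by (rule filtered_category)
  let ?R = "\<lambda>p p'. \<exists>u \<in> Arr J. \<exists>k \<in> homset M A (FOb Y (Dom J u)).
      p = (Dom J u, k) \<and> p' = (Cod J u, FAr Y u \<cdot> k)"
  {
    assume "(t', h') \<in> colim_class M A (J, Y) t h"
    then have "equivclp ?R (t, h) (t', h')" by (simp add: colim_class_def)
    then have "case (t', h') of (t', h') \<Rightarrow> t' \<in> Obj J \<and> h' \<in> homset M A (FOb Y t') \<and>
      (\<exists>r. \<exists>u \<in> homset J t r. \<exists>v \<in> homset J t' r. FAr Y u \<cdot> h = FAr Y v \<cdot> h')"
    proof (induction rule: equivclp_induct)
      case base
      then show ?case using t h J.Idn_in[OF t] by auto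
    next
      case (step y z)
      obtain t1 h1 t2 h2 where y: "y = (t1, h1)" and z: "z = (t2, h2)" by (cases y, cases z)
      from step.IH y obtain r u v where 1: "t1 \<in> Obj J" "h1 \<in> homset M A (FOb Y t1)"
        and u: "u \<in> homset J t r" and v: "v \<in> homset J t1 r" and eq: "FAr Y u \<cdot> h = FAr Y v \<cdot> h1"
        by auto
      from step.hyps(2) show ?case
      proof
        assume "?R y z"
        then obtain w where w: "w \<in> homset J t1 t2" and h2: "h2 = FAr Y w \<cdot> h1"
          using y z by (auto simp: homset_def)
        obtain r' p q where p: "p \<in> homset J r r'" and q: "q \<in> homset J t2 r'"
          and pq: "p \<cdot>\<^bsub>J\<^esub> v = q \<cdot>\<^bsub>J\<^esub> w"
          using filtered_span[OF J v w] by metis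
        have "FAr Y (p \<cdot>\<^bsub>J\<^esub> u) \<cdot> h = FAr Y p \<cdot> (FAr Y v \<cdot> h1)"
          using functor_Cmp[OF Y u p] Cmp_assoc[OF h functor_Arr[OF Y u] functor_Arr[OF Y p]] eq by
            simp
        also have "\<dots> = FAr Y (q \<cdot>\<^bsub>J\<^esub> w) \<cdot> h1"
          using functor_Cmp[OF Y v p] Cmp_assoc[OF 1(2) functor_Arr[OF Y v] functor_Arr[OF Y p]] pq
            by simp
        also have "\<dots> = FAr Y q \<cdot> h2"
          using functor_Cmp[OF Y w q] Cmp_assoc[OF 1(2) functor_Arr[OF Y w] functor_Arr[OF Y q]] h2
            by simp
        finally show ?case
          using z J.Cmp_in[OF u p] q Cmp_in[OF 1(2) functor_Arr[OF Y w]] h2 J.homset_Obj[OF w] by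
            auto
      next
        assume "?R z y"
        then obtain w where w: "w \<in> homset J t2 t1" and h2: "h2 \<in> homset M A (FOb Y t2)"
          "h1 = FAr Y w \<cdot> h2"
          using y z by (auto simp: homset_def)
        have "FAr Y u \<cdot> h = FAr Y (v \<cdot>\<^bsub>J\<^esub> w) \<cdot> h2"
          using functor_Cmp[OF Y w v] Cmp_assoc[OF h2(1) functor_Arr[OF Y w] functor_Arr[OF Y v]] eq
            h2 by simp
        then show ?case using z u J.Cmp_in[OF w v] h2 J.homset_Obj[OF w] by auto
      qed
    qed
    then show "?J (t', h')" by auto
  }
  assume "?J (t', h')"
  then obtain r u v where h': "t' \<in> Obj J" "h' \<in> homset M A (FOb Y t')"
    and u: "u \<in> homset J t r" and v: "v \<in> homset J t' r" and eq: "FAr Y u \<cdot> h = FAr Y v \<cdot> h'"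
    by auto
  have 1: "?R (t, h) (r, FAr Y u \<cdot> h)" and 2: "?R (t', h') (r, FAr Y u \<cdot> h)"
    using u v h h' eq by (auto simp: homset_def)
  have "equivclp ?R (t, h) (t', h')"
    by (rule equivclp_trans[OF r_into_equivclp[of ?R, OF 1]
      equivclp_sym[OF r_into_equivclp[of ?R, OF 2]]])
  then show "(t', h') \<in> colim_class M A (J, Y) t h" by (simp add: colim_class_def)
qed

lemma colim_class_cong:
  assumes "(t', h') \<in> colim_class M A (J, Y) t h"
  shows "colim_class M A (J, Y) t' h' = colim_class M A (J, Y) t h"
  using assms equivclp_class unfolding colim_class_def by fastforce

lemma colim_class_eq_iff:
  assumes "filtered J" "is_functor J M Y" "t \<in> Obj J" "h \<in> homset M A (FOb Y t)"
    "t' \<in> Obj J" "h' \<in> homset M A (FOb Y t')"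
  shows "colim_class M A (J, Y) t h = colim_class M A (J, Y) t' h' \<longleftrightarrow>
    (\<exists>r. \<exists>u \<in> homset J t r. \<exists>v \<in> homset J t' r. FAr Y u \<cdot> h = FAr Y v \<cdot> h')"
  using colim_class_mem_iff[OF assms(1-4), of t' h'] colim_class_refl[of t' h' A J Y]
    colim_class_cong[of t' h' A J Y t h] assms by auto

lemma colim_hom_cases:
  assumes "c \<in> colim_hom M A (J, Y)"
  obtains t h where "t \<in> Obj J" "h \<in> homset M A (FOb Y t)" "c = colim_class M A (J, Y) t h"
  using assms unfolding colim_hom_def by auto

lemma colim_hom_mem:
  assumes "filtered J" "is_functor J M Y" "c \<in> colim_hom M A (J, Y)" "(t, h) \<in> c"
  shows "t \<in> Obj J" "h \<in> homset M A (FOb Y t)" "c = colim_class M A (J, Y) t h"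
proof -
  obtain t0 h0 where c: "t0 \<in> Obj J" "h0 \<in> homset M A (FOb Y t0)" "c = colim_class M A (J, Y) t0 h0"
    using assms(3) by (rule colim_hom_cases)
  have m: "(t, h) \<in> colim_class M A (J, Y) t0 h0" using assms(4) c(3) by simp
  then show "t \<in> Obj J" "h \<in> homset M A (FOb Y t)"
    using colim_class_mem_iff[OF assms(1,2) c(1,2), of t h] by auto
  show "c = colim_class M A (J, Y) t h" using colim_class_cong[OF m] c(3) by simp
qed

lemma colim_class_in: "\<lbrakk>t \<in> Obj J; h \<in> homset M A (FOb Y t)\<rbrakk> \<Longrightarrow> colim_class M A (J, Y) t h \<in>
    colim_hom M A (J, Y)"
  unfolding colim_hom_def by auto

lemma el_res_class:
  assumes J: "filtered J" and Y: "is_functor J M Y" and t: "t \<in> Obj J" and h: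
    "h \<in> homset M A (FOb Y t)"
    and g: "g \<in> homset M B A"
  shows "el_res M (J, Y) (colim_class M A (J, Y) t h) g = colim_class M B (J, Y) t (h \<cdot> g)"
proof -
  have "colim_class M B (J, Y) t' (h' \<cdot> g) = colim_class M B (J, Y) t (h \<cdot> g)"
    if "(t', h') \<in> colim_class M A (J, Y) t h" for t' h'
  proof -
    from that obtain r u v where h': "t' \<in> Obj J" "h' \<in> homset M A (FOb Y t')"
      and u: "u \<in> homset J t r" and v: "v \<in> homset J t' r" and eq: "FAr Y u \<cdot> h = FAr Y v \<cdot> h'"
      using colim_class_mem_iff[OF J Y t h] by auto
    have "FAr Y v \<cdot> (h' \<cdot> g) = FAr Y u \<cdot> (h \<cdot> g)"
      using Cmp_assoc[OF g h functor_Arr[OF Y u]] Cmp_assoc[OF g h'(2) functor_Arr[OF Y v]] eq by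
        simp
    then show ?thesis
      using colim_class_eq_iff[OF J Y h'(1) Cmp_in[OF g h'(2)] t Cmp_in[OF g h]] u v by metis
  qed
  then have "(\<Union>(t', h') \<in> colim_class M A (J, Y) t h. colim_class M B (J, Y) t' (h' \<cdot> g)) =
      (\<Union>p \<in> colim_class M A (J, Y) t h. colim_class M B (J, Y) t (h \<cdot> g))"
    by (intro SUP_cong) auto
  also have "\<dots> = colim_class M B (J, Y) t (h \<cdot> g)"
    using colim_class_refl[of t h A J Y] by (simp add: SUP_constant) (metis empty_iff)
  moreover have "Dom M g = B" using g by (simp add: homset_def)
  ultimately show ?thesis unfolding el_res_def by simp
qed

lemma ind_objD: "ind_obj M (I, X) \<Longrightarrow> filtered I \<and> is_functor I M X"
  by (simp add: ind_obj_def)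

lemma el_res_in:
  assumes "ind_obj M X" "c \<in> colim_hom M A X" "g \<in> homset M B A"
  shows "el_res M X c g \<in> colim_hom M B X"
proof -
  obtain J Y where X: "X = (J, Y)" by (cases X)
  obtain t h where c: "t \<in> Obj J" "h \<in> homset M A (FOb Y t)" "c = colim_class M A X t h"
    using assms(2) colim_hom_cases unfolding X by metis
  show ?thesis
    using el_res_class[OF _ _ c(1,2) assms(3)] ind_objD assms(1) c(3)
      colim_class_in[OF c(1) Cmp_in[OF assms(3) c(2)]] unfolding X by metis
qed

lemma el_res_Cmp:
  assumes "ind_obj M X" "c \<in> colim_hom M A X" "g \<in> homset M B A" "g' \<in> homset M D B"
  shows "el_res M X (el_res M X c g) g' = el_res M X c (g \<cdot> g')"
proof -
  obtain J Y where X: "X = (J, Y)" by (cases X)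
  then have JY: "filtered J" "is_functor J M Y" using ind_objD assms(1) by blast+
  obtain t h where c: "t \<in> Obj J" "h \<in> homset M A (FOb Y t)" "c = colim_class M A X t h"
    using assms(2) colim_hom_cases unfolding X by metis
  show ?thesis
    unfolding c(3) X el_res_class[OF JY c(1,2) assms(3)]
      el_res_class[OF JY c(1) Cmp_in[OF assms(3) c(2)] assms(4)]
      el_res_class[OF JY c(1,2) Cmp_in[OF assms(4,3)]]
    using Cmp_assoc[OF assms(4,3) c(2)] by simp
qed

lemma el_res_Idn:
  assumes "ind_obj M X" "c \<in> colim_hom M A X" "A \<in> Obj M"
  shows "el_res M X c (Idn M A) = c"
proof -
  obtain J Y where X: "X = (J, Y)" by (cases X)
  then have JY: "filtered J" "is_functor J M Y" using ind_objD assms(1) by blast+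
  obtain t h where c: "t \<in> Obj J" "h \<in> homset M A (FOb Y t)" "c = colim_class M A X t h"
    using assms(2) colim_hom_cases unfolding X by metis
  show ?thesis
    unfolding c(3) X el_res_class[OF JY c(1,2) Idn_in[OF assms(3)]] Cmp_Idn[OF c(2)] ..
qed

text \<open>The colimit leg from \<open>X_s\<close>, as the class of the identity. By
  \<open>colim_hom_gen\<close> every element is a restriction of such a leg, so arrows of the
  ind-category are determined by their values on these.\<close>

abbreviation gen :: "('u, 'o, 'a) ind_ob \<Rightarrow> 'u \<Rightarrow> ('u \<times> 'a) set" where
  "gen X s \<equiv> colim_class M (FOb (snd X) s) X s (Idn M (FOb (snd X) s))"

lemma gen_in: "\<lbrakk>ind_obj M X; s \<in> Obj (fst X)\<rbrakk> \<Longrightarrow> gen X s \<in> colim_hom M (FOb (snd X) s) X"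
  using colim_class_in[of s "fst X" _ _ "snd X"] Idn_in functor_Obj ind_objD
  by (metis prod.collapse)

lemma colim_hom_gen:
  assumes "ind_obj M X" "c \<in> colim_hom M A X"
  obtains t h where "t \<in> Obj (fst X)" "h \<in> homset M A (FOb (snd X) t)" "c = el_res M X (gen X t) h"
proof -
  obtain J Y where X: "X = (J, Y)" by (cases X)
  then have JY: "filtered J" "is_functor J M Y" using ind_objD assms(1) by blast+
  obtain t h where c: "t \<in> Obj J" "h \<in> homset M A (FOb Y t)" "c = colim_class M A X t h"
    using assms(2) colim_hom_cases unfolding X by metis
  have "c = el_res M X (gen X t) h"
    using el_res_class[OF JY c(1) Idn_in[OF functor_Obj[OF JY(2) c(1)]] c(2)] Idn_Cmp[OF c(2)] c(3)
      X
    by simp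
  then show thesis using that c X by simp
qed

text \<open>Together with \<open>el_equalize\<close> this says that the category of elements of
  \<open>X\<close> is filtered. The gluing lemmas below rest on these two facts and no longer
  mention the index category.\<close>

lemma el_joint_factor:
  assumes X: "ind_obj M X" and c: "c \<in> colim_hom M A X" and c': "c' \<in> colim_hom M A' X"
  obtains B b p q where "b \<in> colim_hom M B X" "p \<in> homset M A B" "q \<in> homset M A' B"
    "c = el_res M X b p" "c' = el_res M X b q"
proof -
  obtain J Y where JY: "X = (J, Y)" by (cases X)
  then have J: "filtered J" and Y: "is_functor J M Y" using ind_objD X by blast+
  obtain t h where t: "t \<in> Obj J" "h \<in> homset M A (FOb Y t)" "c = colim_class M A X t h"
    using c colim_hom_cases unfolding JY by metis
  obtain t' h' where t': "t' \<in> Obj J" "h' \<in> homset M A' (FOb Y t')" "c' = colim_class M A' X t' h'"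
    using c' colim_hom_cases unfolding JY by metis
  obtain r u v where u: "u \<in> homset J t r" and v: "v \<in> homset J t' r"
    using filtered_upper_bound[OF J t(1) t'(1)] by metis
  interpret J: category J using J by (rule filtered_category)
  have r: "r \<in> Obj J" "FOb Y r \<in> Obj M" using J.homset_Obj[OF u] functor_Obj[OF Y] by auto
  have *: "colim_class M A0 X t0 h0 = el_res M X (gen X r) (FAr Y w \<cdot> h0)"
    if "t0 \<in> Obj J" "h0 \<in> homset M A0 (FOb Y t0)" "w \<in> homset J t0 r" for A0 t0 h0 w
  proof -
    note w = Cmp_in[OF that(2) functor_Arr[OF Y that(3)]]
    have "colim_class M A0 (J, Y) t0 h0 = colim_class M A0 (J, Y) r (FAr Y w \<cdot> h0)"
      using colim_class_eq_iff[OF J Y that(1,2) r(1) w] that(3) J.Idn_in[OF r(1)]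
        functor_Idn[OF Y r(1)]
        Idn_Cmp[OF w] by metis
    then show ?thesis
      using el_res_class[OF J Y r(1) Idn_in[OF r(2)] w] Idn_Cmp[OF w] JY by simp
  qed
  have g: "gen X r \<in> colim_hom M (FOb Y r) X" using gen_in[OF X, of r] r(1) JY by simp
  have "c = el_res M X (gen X r) (FAr Y u \<cdot> h)" using *[OF t(1,2) u] t(3) by simp
  moreover have "c' = el_res M X (gen X r) (FAr Y v \<cdot> h')" using *[OF t'(1,2) v] t'(3) by simp
  ultimately show thesis
    by (rule that[OF g Cmp_in[OF t(2) functor_Arr[OF Y u]] Cmp_in[OF t'(2) functor_Arr[OF Y v]]])
qed

lemma el_equalize:
  assumes X: "ind_obj M X" and c: "c \<in> colim_hom M A X" and p: "p \<in> homset M B A"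
    "p' \<in> homset M B A"
    and eq: "el_res M X c p = el_res M X c p'"
  obtains D d q where "d \<in> colim_hom M D X" "q \<in> homset M A D" "c = el_res M X d q" "q \<cdot> p = q \<cdot> p'"
proof -
  obtain J Y where JY: "X = (J, Y)" by (cases X)
  then have J: "filtered J" and Y: "is_functor J M Y" using ind_objD X by blast+
  obtain t h where t: "t \<in> Obj J" "h \<in> homset M A (FOb Y t)" "c = colim_class M A X t h"
    using c colim_hom_cases unfolding JY by metis
  have "colim_class M B (J, Y) t (h \<cdot> p) = colim_class M B (J, Y) t (h \<cdot> p')"
    using eq unfolding t(3) JY el_res_class[OF J Y t(1,2) p(1)] el_res_class[OF J Y t(1,2) p(2)] .
  then obtain r u v where u: "u \<in> homset J t r" and v: "v \<in> homset J t r"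
    and uv: "FAr Y u \<cdot> (h \<cdot> p) = FAr Y v \<cdot> (h \<cdot> p')"
    using colim_class_eq_iff[OF J Y t(1) Cmp_in[OF p(1) t(2)] t(1) Cmp_in[OF p(2) t(2)]] by auto
  \<comment> \<open>Equality in the colimit may use two different index maps \<open>u\<close> and
    \<open>v\<close>; after \<open>w\<close> they become one, so that the same arrow
    \<open>FAr Y ?k \<cdot> h\<close> serves both sides.\<close>
  obtain s w where w: "w \<in> homset J r s" "w \<cdot>\<^bsub>J\<^esub> u = w \<cdot>\<^bsub>J\<^esub> v"
    using filtered_equalize[OF J u v] by metis
  interpret J: category J using J by (rule filtered_category)
  have s: "s \<in> Obj J" "FOb Y s \<in> Obj M" using J.homset_Obj[OF w(1)] functor_Obj[OF Y] by auto
  let ?k = "w \<cdot>\<^bsub>J\<^esub> u"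
  note k = functor_Arr[OF Y J.Cmp_in[OF u w(1)]]
  note q = Cmp_in[OF t(2) k]
  have "c = el_res M X (gen X s) (FAr Y ?k \<cdot> h)"
  proof -
    have "colim_class M A (J, Y) t h = colim_class M A (J, Y) s (FAr Y ?k \<cdot> h)"
      using colim_class_eq_iff[OF J Y t(1,2) s(1) q] J.Cmp_in[OF u w(1)] J.Idn_in[OF s(1)]
        functor_Idn[OF Y s(1)] Idn_Cmp[OF q] by metis
    then show ?thesis
      using el_res_class[OF J Y s(1) Idn_in[OF s(2)] q] Idn_Cmp[OF q] JY t(3) by simp
  qed
  moreover have "(FAr Y ?k \<cdot> h) \<cdot> p = (FAr Y ?k \<cdot> h) \<cdot> p'"
  proof -
    note Yu = functor_Arr[OF Y u] and Yv = functor_Arr[OF Y v] and Yw = functor_Arr[OF Y w(1)]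
    have "(FAr Y ?k \<cdot> h) \<cdot> p = FAr Y ?k \<cdot> (h \<cdot> p)"
      by (rule Cmp_assoc[OF p(1) t(2) k])
    also have "\<dots> = FAr Y w \<cdot> (FAr Y u \<cdot> (h \<cdot> p))"
      using Cmp_assoc[OF Cmp_in[OF p(1) t(2)] Yu Yw] functor_Cmp[OF Y u w(1)] by simp
    also have "\<dots> = FAr Y w \<cdot> (FAr Y v \<cdot> (h \<cdot> p'))" using uv by simp
    also have "\<dots> = FAr Y ?k \<cdot> (h \<cdot> p')"
      using Cmp_assoc[OF Cmp_in[OF p(2) t(2)] Yv Yw] functor_Cmp[OF Y v w(1)] w(2) by simp
    also have "\<dots> = (FAr Y ?k \<cdot> h) \<cdot> p'"
      by (rule Cmp_assoc[OF p(2) t(2) k, symmetric])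
    finally show ?thesis .
  qed
  ultimately show thesis
    using that[of "gen X s" "FOb Y s"] q gen_in[OF X, of s] s JY by simp
qed

text \<open>Left exactness at the initial object: any stage provides an element, and two elements
  restrict from a common one along maps out of \<open>I\<close>, which coincide. It supplies a
  starting element whenever only one side of a square is given.\<close>

lemma el_nonempty:
  assumes X: "ind_obj M X" and I: "is_initial M I"
  shows "\<exists>c. colim_hom M I X = {c}"
proof -
  have J: "filtered (fst X)" and Y: "is_functor (fst X) M (snd X)"
    using X ind_objD by (metis prod.collapse)+
  from J have "Obj (fst X) \<noteq> {}" by (simp add: filtered_def)
  then obtain s where s: "s \<in> Obj (fst X)" by auto
  then obtain h where "h \<in> homset M I (FOb (snd X) s)"
    using I functor_Obj[OF Y s] unfolding is_initial_def by metis
  then have "el_res M X (gen X s) h \<in> colim_hom M I X"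
    using el_res_in[OF X gen_in[OF X s]] by blast
  moreover have "c = c'" if c: "c \<in> colim_hom M I X" "c' \<in> colim_hom M I X" for c c'
  proof -
    obtain B b p q where "b \<in> colim_hom M B X" "p \<in> homset M I B" "q \<in> homset M I B"
      "c = el_res M X b p" "c' = el_res M X b q"
      using el_joint_factor[OF X c] by metis
    moreover from this have "p = q" using I homset_Obj unfolding is_initial_def by metis
    ultimately show ?thesis by simp
  qed
  ultimately show ?thesis by blast
qed

text \<open>Existence half of left exactness at pushouts. Both elements are brought to one object,
  the two restrictions are equalized at a later one, and there the universal property in
  \<open>M\<close> applies.\<close>

lemma el_glue:
  assumes X: "ind_obj M X" and po: "is_pushout M f g p q"
    and b: "b \<in> colim_hom M (Cod M f) X" and d: "d \<in> colim_hom M (Cod M g) X"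
    and eq: "el_res M X b f = el_res M X d g"
  obtains e where "e \<in> colim_hom M (Cod M p) X" "el_res M X e p = b" "el_res M X e q = d"
proof -
  note D = is_pushoutD[OF po]
  have f: "f \<in> homset M (Dom M f) (Cod M f)" and g: "g \<in> homset M (Dom M f) (Cod M g)"
    and p: "p \<in> homset M (Cod M f) (Cod M p)" and q: "q \<in> homset M (Cod M g) (Cod M p)"
    using D by (simp_all add: homset_def)
  obtain E e \<beta> \<delta> where e: "e \<in> colim_hom M E X" and \<beta>: "\<beta> \<in> homset M (Cod M f) E"
    and \<delta>: "\<delta> \<in> homset M (Cod M g) E" and bd: "b = el_res M X e \<beta>" "d = el_res M X e \<delta>"
    using el_joint_factor[OF X b d] by metis
  have "el_res M X e (\<beta> \<cdot> f) = el_res M X e (\<delta> \<cdot> g)"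
    using el_res_Cmp[OF X e \<beta> f] el_res_Cmp[OF X e \<delta> g] eq bd by simp
  then obtain E' e' k where e': "e' \<in> colim_hom M E' X" and k: "k \<in> homset M E E'"
    and ek: "e = el_res M X e' k" and keq: "k \<cdot> (\<beta> \<cdot> f) = k \<cdot> (\<delta> \<cdot> g)"
    using el_equalize[OF X e Cmp_in[OF f \<beta>] Cmp_in[OF g \<delta>]] by metis
  have "(k \<cdot> \<beta>) \<cdot> f = (k \<cdot> \<delta>) \<cdot> g"
    using keq Cmp_assoc[OF f \<beta> k] Cmp_assoc[OF g \<delta> k] by simp
  then obtain h where h: "h \<in> homset M (Cod M p) E'" "h \<cdot> p = k \<cdot> \<beta>" "h \<cdot> q = k \<cdot> \<delta>"
    using pushout_induced[OF po Cmp_in[OF \<beta> k] Cmp_in[OF \<delta> k]] by metis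
  show thesis
  proof (rule that[OF el_res_in[OF X e' h(1)]])
    show "el_res M X (el_res M X e' h) p = b"
      using el_res_Cmp[OF X e' h(1) p] h(2) el_res_Cmp[OF X e' k \<beta>] ek bd by simp
    show "el_res M X (el_res M X e' h) q = d"
      using el_res_Cmp[OF X e' h(1) q] h(3) el_res_Cmp[OF X e' k \<delta>] ek bd by simp
  qed
qed

text \<open>Uniqueness half of left exactness at pushouts. The two legs are equalized one after the
  other, since each equalization moves on to a new object.\<close>

lemma el_pushout_eqI:
  assumes X: "ind_obj M X" and po: "is_pushout M f g p q"
    and z: "z \<in> colim_hom M (Cod M p) X" "z' \<in> colim_hom M (Cod M p) X"
    and eq: "el_res M X z p = el_res M X z' p" "el_res M X z q = el_res M X z' q"
  shows "z = z'"
proof -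
  note D = is_pushoutD[OF po]
  have p: "p \<in> homset M (Cod M f) (Cod M p)" and q: "q \<in> homset M (Cod M g) (Cod M p)"
    using D by (simp_all add: homset_def)
  obtain E e \<zeta> \<zeta>' where e: "e \<in> colim_hom M E X" and \<zeta>: "\<zeta> \<in> homset M (Cod M p) E"
    "\<zeta>' \<in> homset M (Cod M p) E" and zz: "z = el_res M X e \<zeta>" "z' = el_res M X e \<zeta>'"
    using el_joint_factor[OF X z] by metis
  have "el_res M X e (\<zeta> \<cdot> p) = el_res M X e (\<zeta>' \<cdot> p)"
    using el_res_Cmp[OF X e \<zeta>(1) p] el_res_Cmp[OF X e \<zeta>(2) p] eq zz by simp
  then obtain E1 e1 k1 where e1: "e1 \<in> colim_hom M E1 X" and k1: "k1 \<in> homset M E E1"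
    and ek1: "e = el_res M X e1 k1" and keq1: "k1 \<cdot> (\<zeta> \<cdot> p) = k1 \<cdot> (\<zeta>' \<cdot> p)"
    using el_equalize[OF X e Cmp_in[OF p \<zeta>(1)] Cmp_in[OF p \<zeta>(2)]] by metis
  note kz = Cmp_in[OF \<zeta>(1) k1] Cmp_in[OF \<zeta>(2) k1]
  have zz1: "z = el_res M X e1 (k1 \<cdot> \<zeta>)" "z' = el_res M X e1 (k1 \<cdot> \<zeta>')"
    using el_res_Cmp[OF X e1 k1 \<zeta>(1)] el_res_Cmp[OF X e1 k1 \<zeta>(2)] ek1 zz by simp_all
  have "el_res M X e1 ((k1 \<cdot> \<zeta>) \<cdot> q) = el_res M X e1 ((k1 \<cdot> \<zeta>') \<cdot> q)"
    using el_res_Cmp[OF X e1 kz(1) q] el_res_Cmp[OF X e1 kz(2) q] eq zz1 by simp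
  then obtain E2 e2 k2 where e2: "e2 \<in> colim_hom M E2 X" and k2: "k2 \<in> homset M E1 E2"
    and ek2: "e1 = el_res M X e2 k2" and keq2: "k2 \<cdot> ((k1 \<cdot> \<zeta>) \<cdot> q) = k2 \<cdot> ((k1 \<cdot> \<zeta>') \<cdot> q)"
    using el_equalize[OF X e1 Cmp_in[OF q kz(1)] Cmp_in[OF q kz(2)]] by metis
  have "k2 \<cdot> (k1 \<cdot> \<zeta>) = k2 \<cdot> (k1 \<cdot> \<zeta>')"
  proof (rule pushout_eqI[OF po Cmp_in[OF kz(1) k2] Cmp_in[OF kz(2) k2]])
    show "(k2 \<cdot> (k1 \<cdot> \<zeta>)) \<cdot> p = (k2 \<cdot> (k1 \<cdot> \<zeta>')) \<cdot> p"
      using keq1 Cmp_assoc[OF p kz(1) k2] Cmp_assoc[OF p kz(2) k2] Cmp_assoc[OF p \<zeta>(1) k1]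
        Cmp_assoc[OF p \<zeta>(2) k1] by simp
    show "(k2 \<cdot> (k1 \<cdot> \<zeta>)) \<cdot> q = (k2 \<cdot> (k1 \<cdot> \<zeta>')) \<cdot> q"
      using keq2 Cmp_assoc[OF q kz(1) k2] Cmp_assoc[OF q kz(2) k2] by simp
  qed
  then show ?thesis
    using zz1 ek2 el_res_Cmp[OF X e2 k2 kz(1)] el_res_Cmp[OF X e2 k2 kz(2)] by simp
qed

end

section \<open>Arrows of the ind-category as maps of generalized elements\<close>

context base_category
begin

text \<open>The definition tests compatibility on every representative. As all representatives of a
  class restrict to the same class, this amounts to one equation between elements for each index
  arrow.\<close>

lemma ind_hom_iff:
  assumes X: "ind_obj M (I, X)" and Y: "ind_obj M Y"
  shows "\<phi> \<in> ind_hom M (I, X) Y \<longleftrightarrow> \<phi> \<in> extensional (Obj I) \<and>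
    (\<forall>s \<in> Obj I. \<phi> s \<in> colim_hom M (FOb X s) Y) \<and>
    (\<forall>v \<in> Arr I. el_res M Y (\<phi> (Cod I v)) (FAr X v) = \<phi> (Dom I v))"
proof -
  obtain J Z where YZ: "Y = (J, Z)" by (cases Y)
  then have J: "filtered J" and Z: "is_functor J M Z" using ind_objD Y by blast+
  have I: "filtered I" and Xf: "is_functor I M X" using ind_objD X by blast+
  interpret I: category I using I by (rule filtered_category)
  have "(\<forall>(t, h) \<in> \<phi> (Cod I v). (t, h \<cdot> FAr X v) \<in> \<phi> (Dom I v)) \<longleftrightarrow>
      el_res M Y (\<phi> (Cod I v)) (FAr X v) = \<phi> (Dom I v)" (is "?L \<longleftrightarrow> ?R")
    if \<phi>: "\<forall>s \<in> Obj I. \<phi> s \<in> colim_hom M (FOb X s) Y" and v: "v \<in> Arr I" for v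
  proof -
    have v': "v \<in> homset I (Dom I v) (Cod I v)" using v by (simp add: homset_def)
    note Xv = functor_Arr[OF Xf v']
    have c: "\<phi> (Cod I v) \<in> colim_hom M (FOb X (Cod I v)) (J, Z)"
      and d: "\<phi> (Dom I v) \<in> colim_hom M (FOb X (Dom I v)) (J, Z)"
      using \<phi> v I.Dom_in I.Cod_in YZ by auto
    show ?thesis
    proof
      assume L: ?L
      obtain t h where t: "t \<in> Obj J" "h \<in> homset M (FOb X (Cod I v)) (FOb Z t)"
        "\<phi> (Cod I v) = colim_class M (FOb X (Cod I v)) (J, Z) t h"
        using c by (rule colim_hom_cases)
      have "(t, h) \<in> \<phi> (Cod I v)" unfolding t(3) by (rule colim_class_refl)
      then have "(t, h \<cdot> FAr X v) \<in> \<phi> (Dom I v)" using L by blast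
      then show ?R
        using colim_hom_mem(3)[OF J Z d] el_res_class[OF J Z t(1,2) Xv] YZ t(3) by simp
    next
      assume R: ?R
      show ?L
      proof clarify
        fix t h assume m: "(t, h) \<in> \<phi> (Cod I v)"
        note t = colim_hom_mem[OF J Z c m]
        show "(t, h \<cdot> FAr X v) \<in> \<phi> (Dom I v)"
          using R el_res_class[OF J Z t(1,2) Xv] YZ t(3) by (metis colim_class_refl)
      qed
    qed
  qed
  then show ?thesis unfolding ind_hom_def PiE_def Pi_def by (simp, blast)
qed

text \<open>The action is independent of the representative because compatibility of
  \<open>\<phi>\<close> allows passing to a later stage, and two representatives agree at some later
  stage.\<close>

lemma ind_app_class:
  assumes X: "ind_obj M (I, X)" and Y: "ind_obj M Y" and \<phi>: "\<phi> \<in> ind_hom M (I, X) Y"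
    and s: "s \<in> Obj I" and h: "h \<in> homset M A (FOb X s)"
  shows "ind_app M Y \<phi> (colim_class M A (I, X) s h) = el_res M Y (\<phi> s) h"
proof -
  have I: "filtered I" and Xf: "is_functor I M X" using ind_objD X by blast+
  interpret I: category I using I by (rule filtered_category)
  note hom = \<phi>[unfolded ind_hom_iff[OF X Y]]
  have step: "el_res M Y (\<phi> s0) h0 = el_res M Y (\<phi> r) (FAr X u \<cdot> h0)"
    if "u \<in> homset I s0 r" "h0 \<in> homset M A (FOb X s0)" for u s0 r h0
  proof -
    have u: "u \<in> Arr I" "Dom I u = s0" "Cod I u = r" using that(1) by (simp_all add: homset_def)
    then have "\<phi> r \<in> colim_hom M (FOb X r) Y" "el_res M Y (\<phi> r) (FAr X u) = \<phi> s0"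
      using hom I.Cod_in[OF u(1)] by auto
    then show ?thesis using el_res_Cmp[OF Y _ functor_Arr[OF Xf that(1)] that(2)] by metis
  qed
  have "el_res M Y (\<phi> s') h' = el_res M Y (\<phi> s) h" if m: "(s', h') \<in> colim_class M A (I, X) s h" for
    s' h'
  proof -
    from m obtain r u v where "s' \<in> Obj I" "h' \<in> homset M A (FOb X s')"
      "u \<in> homset I s r" "v \<in> homset I s' r" "FAr X u \<cdot> h = FAr X v \<cdot> h'"
      using colim_class_mem_iff[OF I Xf s h] by auto
    then show ?thesis using step h by metis
  qed
  then have "ind_app M Y \<phi> (colim_class M A (I, X) s h) =
      (\<Union>p \<in> colim_class M A (I, X) s h. el_res M Y (\<phi> s) h)"
    unfolding ind_app_def by (intro SUP_cong) auto
  also have "\<dots> = el_res M Y (\<phi> s) h"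
    using colim_class_refl[of s h A I X] by (simp add: SUP_constant) (metis empty_iff)
  finally show ?thesis .
qed

lemma Ind_simps:
  "Arr (Ind M) = {(X, \<phi>, Y). ind_obj M X \<and> ind_obj M Y \<and> \<phi> \<in> ind_hom M X Y}"
  "Dom (Ind M) (X, \<phi>, Y) = X" "Cod (Ind M) (X, \<phi>, Y) = Y"
  "Idn (Ind M) (I, Z) = ind_level M I Z Z (\<lambda>s. Idn M (FOb Z s))"
  by (simp_all add: Ind_def)

lemma Ind_homset_iff:
  "f \<in> homset (Ind M) X Y \<longleftrightarrow> (\<exists>\<phi>. f = (X, \<phi>, Y) \<and> ind_obj M X \<and> ind_obj M Y \<and> \<phi> \<in> ind_hom M X Y)"
  unfolding homset_def by (cases f) (auto simp: Ind_simps)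

lemma Ind_homsetD:
  "f \<in> homset (Ind M) X Y \<Longrightarrow> ind_obj M X"
  "f \<in> homset (Ind M) X Y \<Longrightarrow> ind_obj M Y"
  by (auto simp: Ind_homset_iff)

lemma ind_act_gen:
  assumes f: "(X, \<phi>, Y) \<in> homset (Ind M) X Y" and s: "s \<in> Obj (fst X)"
    and h: "h \<in> homset M A (FOb (snd X) s)"
  shows "ind_act M (X, \<phi>, Y) (el_res M X (gen X s) h) = el_res M Y (\<phi> s) h"
proof -
  obtain I Z where X: "X = (I, Z)" by (cases X)
  from f have *: "ind_obj M (I, Z)" "ind_obj M Y" "\<phi> \<in> ind_hom M (I, Z) Y"
    unfolding Ind_homset_iff X by auto
  then have I: "filtered I" "is_functor I M Z" using ind_objD by blast+
  have s': "s \<in> Obj I" "h \<in> homset M A (FOb Z s)" using s h X by auto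
  then have g: "Idn M (FOb Z s) \<in> homset M (FOb Z s) (FOb Z s)"
    using Idn_in functor_Obj[OF I(2)] by blast
  show ?thesis
    using ind_app_class[OF * s'] el_res_class[OF I s'(1) g s'(2)] Idn_Cmp[OF s'(2)] X
    by (simp add: ind_act_def)
qed

lemma ind_hom_in:
  assumes "(X, \<phi>, Y) \<in> homset (Ind M) X Y" "s \<in> Obj (fst X)"
  shows "\<phi> s \<in> colim_hom M (FOb (snd X) s) Y"
proof -
  obtain I Z where X: "X = (I, Z)" by (cases X)
  from assms have "ind_obj M (I, Z)" "ind_obj M Y" "\<phi> \<in> ind_hom M (I, Z) Y"
    unfolding Ind_homset_iff X by auto
  then show ?thesis using ind_hom_iff[of I Z Y \<phi>] assms(2) X by auto
qed

lemma ind_act_in: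
  assumes f: "f \<in> homset (Ind M) X Y" and c: "c \<in> colim_hom M A X"
  shows "ind_act M f c \<in> colim_hom M A Y"
proof -
  obtain \<phi> where \<phi>: "f = (X, \<phi>, Y)" using f Ind_homset_iff by blast
  obtain s h where s: "s \<in> Obj (fst X)" "h \<in> homset M A (FOb (snd X) s)"
    "c = el_res M X (gen X s) h"
    using colim_hom_gen[OF Ind_homsetD(1)[OF f] c] by metis
  show ?thesis
    unfolding s(3) \<phi> ind_act_gen[OF f[unfolded \<phi>] s(1,2)]
    by (rule el_res_in[OF Ind_homsetD(2)[OF f] ind_hom_in[OF f[unfolded \<phi>] s(1)] s(2)])
qed

lemma ind_act_res:
  assumes f: "f \<in> homset (Ind M) X Y" and c: "c \<in> colim_hom M A X" and g: "g \<in> homset M B A"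
  shows "ind_act M f (el_res M X c g) = el_res M Y (ind_act M f c) g"
proof -
  obtain \<phi> where \<phi>: "f = (X, \<phi>, Y)" using f Ind_homset_iff by blast
  note f' = f[unfolded \<phi>]
  note X = Ind_homsetD(1)[OF f] and Y = Ind_homsetD(2)[OF f]
  obtain s h where s: "s \<in> Obj (fst X)" "h \<in> homset M A (FOb (snd X) s)"
    "c = el_res M X (gen X s) h"
    using colim_hom_gen[OF X c] by metis
  show ?thesis
    unfolding s(3) \<phi> ind_act_gen[OF f' s(1,2)] el_res_Cmp[OF X gen_in[OF X s(1)] s(2) g]
      ind_act_gen[OF f' s(1) Cmp_in[OF g s(2)]] el_res_Cmp[OF Y ind_hom_in[OF f' s(1)] s(2) g] ..
qed

lemma gen_res:
  assumes X: "ind_obj M X" and v: "v \<in> homset (fst X) s t"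
  shows "el_res M X (gen X t) (FAr (snd X) v) = gen X s"
proof -
  obtain I Z where XZ: "X = (I, Z)" by (cases X)
  then have I: "filtered I" "is_functor I M Z" using ind_objD X by blast+
  interpret I: category I using I(1) by (rule filtered_category)
  have v': "v \<in> homset I s t" using v XZ by simp
  have st: "s \<in> Obj I" "t \<in> Obj I" using I.homset_Obj[OF v'] by auto
  note O = functor_Obj[OF I(2) st(1)] functor_Obj[OF I(2) st(2)]
  note Zv = functor_Arr[OF I(2) v']
  have "el_res M (I, Z) (gen (I, Z) t) (FAr Z v) = colim_class M (FOb Z s) (I, Z) t (FAr Z v)"
    using el_res_class[OF I st(2) Idn_in[OF O(2)] Zv] Idn_Cmp[OF Zv] by simp
  also have "\<dots> = gen (I, Z) s"
  proof -
    have "FAr Z (Idn I t) \<cdot> FAr Z v = FAr Z v \<cdot> Idn M (FOb Z s)"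
      using functor_Idn[OF I(2) st(2)] Idn_Cmp[OF Zv] Cmp_Idn[OF Zv] by simp
    then show ?thesis
      using colim_class_eq_iff[OF I st(2) Zv st(1) Idn_in[OF O(1)]] v' I.Idn_in[OF st(2)]
      unfolding snd_conv by blast
  qed
  finally show ?thesis using XZ by simp
qed

lemma ind_arrow_construct:
  assumes X: "ind_obj M X" and Y: "ind_obj M Y"
    and \<phi>: "\<And>s. s \<in> Obj (fst X) \<Longrightarrow> \<phi> s \<in> colim_hom M (FOb (snd X) s) Y"
    and nat: "\<And>s t v. v \<in> homset (fst X) s t \<Longrightarrow> el_res M Y (\<phi> t) (FAr (snd X) v) = \<phi> s"
  obtains f where "f \<in> homset (Ind M) X Y"
    "\<And>s. s \<in> Obj (fst X) \<Longrightarrow> ind_act M f (gen X s) = \<phi> s"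
proof -
  obtain I Z where XZ: "X = (I, Z)" by (cases X)
  then have I: "filtered I" "is_functor I M Z" using ind_objD X by blast+
  interpret I: category I using I(1) by (rule filtered_category)
  let ?\<phi> = "restrict \<phi> (Obj I)"
  have "?\<phi> \<in> ind_hom M (I, Z) Y"
    using \<phi> nat I.Dom_in I.Cod_in X Y unfolding XZ by (subst ind_hom_iff) (auto simp: homset_def)
  then have f: "(X, ?\<phi>, Y) \<in> homset (Ind M) X Y"
    using X Y unfolding Ind_homset_iff XZ by blast
  have "ind_act M (X, ?\<phi>, Y) (gen X s) = \<phi> s" if s: "s \<in> Obj (fst X)" for s
  proof -
    have O: "FOb (snd X) s \<in> Obj M" using functor_Obj[OF I(2), of s] s XZ by simp
    show ?thesis
      using ind_act_gen[OF f s Idn_in[OF O]] el_res_Idn[OF X gen_in[OF X s] O]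
        el_res_Idn[OF Y \<phi>[OF s] O] s XZ by simp
  qed
  then show thesis using that[OF f] by blast
qed

lemma ind_arrow_ext:
  assumes f: "f \<in> homset (Ind M) X Y" and g: "g \<in> homset (Ind M) X Y"
    and eq: "\<And>s. s \<in> Obj (fst X) \<Longrightarrow> ind_act M f (gen X s) = ind_act M g (gen X s)"
  shows "f = g"
proof -
  obtain \<phi> where \<phi>: "f = (X, \<phi>, Y)" using f Ind_homset_iff by blast
  obtain \<psi> where \<psi>: "g = (X, \<psi>, Y)" using g Ind_homset_iff by blast
  obtain I Z where XZ: "X = (I, Z)" by (cases X)
  note X = Ind_homsetD(1)[OF f] and Y = Ind_homsetD(2)[OF f]
  have I: "filtered I" "is_functor I M Z" using ind_objD X XZ by blast+
  have act: "ind_act M (X, \<phi>', Y) (gen X s) = \<phi>' s"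
    if "(X, \<phi>', Y) \<in> homset (Ind M) X Y" "s \<in> Obj (fst X)" for \<phi>' s
  proof -
    have O: "FOb (snd X) s \<in> Obj M" using functor_Obj[OF I(2), of s] that(2) XZ by simp
    show ?thesis
      using ind_act_gen[OF that Idn_in[OF O]] el_res_Idn[OF X gen_in[OF X that(2)] O]
        el_res_Idn[OF Y ind_hom_in[OF that] O] by simp
  qed
  have "\<phi> s = \<psi> s" if "s \<in> Obj I" for s
    using eq act f g that XZ \<phi> \<psi> by (metis fst_conv)
  moreover have "\<phi> \<in> extensional (Obj I)" "\<psi> \<in> extensional (Obj I)"
    using f g X Y ind_hom_iff[of I Z Y] unfolding Ind_homset_iff \<phi> \<psi> XZ by auto
  ultimately have "\<phi> = \<psi>" using extensionalityI by metis
  then show ?thesis using \<phi> \<psi> by simp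
qed

text \<open>The double union that defines composition is recognised as the action of
  \<open>g\<close> on the classes of \<open>f\<close>. From here on composites are handled only
  through their action.\<close>

lemma Ind_Cmp:
  assumes f: "f \<in> homset (Ind M) X Y" and g: "g \<in> homset (Ind M) Y Z"
  shows "g \<cdot>\<^bsub>Ind M\<^esub> f \<in> homset (Ind M) X Z"
    and "c \<in> colim_hom M A X \<Longrightarrow> ind_act M (g \<cdot>\<^bsub>Ind M\<^esub> f) c = ind_act M g (ind_act M f c)"
proof -
  obtain \<phi> where \<phi>: "f = (X, \<phi>, Y)" using f Ind_homset_iff by blast
  obtain \<psi> where \<psi>: "g = (Y, \<psi>, Z)" using g Ind_homset_iff by blast
  obtain I D where XD: "X = (I, D)" by (cases X)
  obtain J E where YE: "Y = (J, E)" by (cases Y)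
  note X = Ind_homsetD(1)[OF f] and Y = Ind_homsetD(2)[OF f] and Z = Ind_homsetD(2)[OF g]
  have J: "filtered J" "is_functor J M E" using ind_objD Y YE by blast+
  let ?\<chi> = "\<lambda>s \<in> Obj I. ind_act M g (\<phi> s)"
  have "(\<Union>(t, h) \<in> \<phi> s. \<Union>(r, k) \<in> \<psi> t. colim_class M (FOb D s) Z r (k \<cdot> h)) = ind_act M g (\<phi> s)"
    if "s \<in> Obj I" for s
  proof -
    have "\<phi> s \<in> colim_hom M (FOb D s) (J, E)"
      using ind_hom_in[OF f[unfolded \<phi>]] that XD YE by simp
    from colim_hom_mem(2)[OF J this] have "Dom M h = FOb D s" if "(t, h) \<in> \<phi> s" for t h
      using that by (auto simp: homset_def)
    then show ?thesis
      unfolding \<psi> ind_act_def ind_app_def el_res_def prod.case by (intro SUP_cong refl) auto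
  qed
  then have gf: "g \<cdot>\<^bsub>Ind M\<^esub> f = (X, ?\<chi>, Z)"
    unfolding \<phi> \<psi> XD by (auto simp: Ind_def restrict_def fun_eq_iff)
  have "?\<chi> \<in> ind_hom M (I, D) Z"
  proof (subst ind_hom_iff)
    show "ind_obj M (I, D)" "ind_obj M Z" using X XD Z by auto
    have \<phi>': "\<phi> \<in> ind_hom M (I, D) Y" using f unfolding Ind_homset_iff \<phi> XD by auto
    have I: "filtered I" "is_functor I M D" using ind_objD X XD by blast+
    interpret I: category I using I(1) by (rule filtered_category)
    have in1: "\<phi> s \<in> colim_hom M (FOb D s) Y" if "s \<in> Obj I" for s
      using ind_hom_in[OF f[unfolded \<phi>]] that XD by simp
    have "el_res M Z (?\<chi> (Cod I v)) (FAr D v) = ?\<chi> (Dom I v)" if v: "v \<in> Arr I" for v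
    proof -
      have "FAr D v \<in> homset M (FOb D (Dom I v)) (FOb D (Cod I v))"
        using functor_Arr[OF I(2)] v by (simp add: homset_def)
      then have "el_res M Z (ind_act M g (\<phi> (Cod I v))) (FAr D v)
          = ind_act M g (el_res M Y (\<phi> (Cod I v)) (FAr D v))"
        using ind_act_res[OF g in1[OF I.Cod_in[OF v]]] by simp
      also have "el_res M Y (\<phi> (Cod I v)) (FAr D v) = \<phi> (Dom I v)"
        using \<phi>' v ind_hom_iff[of I D Y \<phi>] X Y XD by simp
      finally show ?thesis using I.Cod_in[OF v] I.Dom_in[OF v] by simp
    qed
    then show "?\<chi> \<in> extensional (Obj I) \<and> (\<forall>s \<in> Obj I. ?\<chi> s \<in> colim_hom M (FOb D s) Z) \<and>
        (\<forall>v \<in> Arr I. el_res M Z (?\<chi> (Cod I v)) (FAr D v) = ?\<chi> (Dom I v))"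
      using ind_act_in[OF g in1] by simp
  qed
  then show gf': "g \<cdot>\<^bsub>Ind M\<^esub> f \<in> homset (Ind M) X Z"
    unfolding gf Ind_homset_iff using X Z XD by blast
  show "ind_act M (g \<cdot>\<^bsub>Ind M\<^esub> f) c = ind_act M g (ind_act M f c)" if c: "c \<in> colim_hom M A X"
  proof -
    obtain s h where s: "s \<in> Obj (fst X)" "h \<in> homset M A (FOb (snd X) s)"
      "c = el_res M X (gen X s) h"
      using colim_hom_gen[OF X c] by metis
    have "ind_act M (g \<cdot>\<^bsub>Ind M\<^esub> f) c = el_res M Z (ind_act M g (\<phi> s)) h"
      using ind_act_gen[OF gf'[unfolded gf] s(1,2)] s gf XD by simp
    also have "\<dots> = ind_act M g (ind_act M f c)"
      using ind_act_res[OF g ind_hom_in[OF f[unfolded \<phi>] s(1)] s(2)]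
        ind_act_gen[OF f[unfolded \<phi>] s(1,2)] s(3) \<phi> by simp
    finally show ?thesis .
  qed
qed

lemma ind_level_arrow:
  assumes I: "filtered I" and X: "is_functor I M X" and Y: "is_functor I M Y" and \<tau>:
    "nat_trans I M X Y \<tau>"
  shows "ind_level M I X Y \<tau> \<in> homset (Ind M) (I, X) (I, Y)"
    and "s \<in> Obj I \<Longrightarrow> ind_act M (ind_level M I X Y \<tau>) (gen (I, X) s) = el_res M (I,
        Y) (gen (I, Y) s) (\<tau> s)"
proof -
  interpret I: category I using I by (rule filtered_category)
  have ind: "ind_obj M (I, X)" "ind_obj M (I, Y)" using I X Y by (auto simp: ind_obj_def)
  let ?\<phi> = "\<lambda>s \<in> Obj I. colim_class M (FOb X s) (I, Y) s (\<tau> s)"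
  have \<tau>s: "\<tau> s \<in> homset M (FOb X s) (FOb Y s)" if "s \<in> Obj I" for s
    using \<tau> that by (simp add: nat_trans_def)
  have \<phi>: "?\<phi> s = el_res M (I, Y) (gen (I, Y) s) (\<tau> s)" if s: "s \<in> Obj I" for s
    using el_res_class[OF I Y s Idn_in[OF functor_Obj[OF Y s]] \<tau>s[OF s]] Idn_Cmp[OF \<tau>s[OF s]] s by
      simp
  have in1: "?\<phi> s \<in> colim_hom M (FOb X s) (I, Y)" if s: "s \<in> Obj I" for s
    using el_res_in[OF ind(2) _ \<tau>s[OF s]] gen_in[OF ind(2), of s] s \<phi>[OF s] by simp
  have "?\<phi> \<in> ind_hom M (I, X) (I, Y)"
  proof (subst ind_hom_iff[OF ind])
    have "el_res M (I, Y) (?\<phi> (Cod I v)) (FAr X v) = ?\<phi> (Dom I v)" if v: "v \<in> Arr I" for v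
    proof -
      let ?s = "Dom I v" and ?t = "Cod I v"
      have v': "v \<in> homset I ?s ?t" using v by (simp add: homset_def)
      have st: "?s \<in> Obj I" "?t \<in> Obj I" using I.Dom_in I.Cod_in v by auto
      have gt: "gen (I, Y) ?t \<in> colim_hom M (FOb Y ?t) (I, Y)" using gen_in[OF ind(2), of ?t] st by
        simp
      have "el_res M (I, Y) (?\<phi> ?t) (FAr X v) = el_res M (I, Y) (gen (I, Y) ?t) (\<tau> ?t \<cdot> FAr X v)"
        unfolding \<phi>[OF st(2)] by (rule el_res_Cmp[OF ind(2) gt \<tau>s[OF st(2)] functor_Arr[OF X v']])
      also have "\<tau> ?t \<cdot> FAr X v = FAr Y v \<cdot> \<tau> ?s"
        using \<tau> v by (simp add: nat_trans_def)
      also have "el_res M (I, Y) (gen (I, Y) ?t) (FAr Y v \<cdot> \<tau> ?s)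
          = el_res M (I, Y) (el_res M (I, Y) (gen (I, Y) ?t) (FAr Y v)) (\<tau> ?s)"
        by (rule el_res_Cmp[OF ind(2) gt functor_Arr[OF Y v'] \<tau>s[OF st(1)], symmetric])
      also have "el_res M (I, Y) (gen (I, Y) ?t) (FAr Y v) = gen (I, Y) ?s"
        using gen_res[OF ind(2), of v ?s ?t] v' by simp
      also have "el_res M (I, Y) (gen (I, Y) ?s) (\<tau> ?s) = ?\<phi> ?s"
        by (rule \<phi>[OF st(1), symmetric])
      finally show ?thesis .
    qed
    then show "?\<phi> \<in> extensional (Obj I) \<and> (\<forall>s \<in> Obj I. ?\<phi> s \<in> colim_hom M (FOb X s) (I, Y)) \<and>
        (\<forall>v \<in> Arr I. el_res M (I, Y) (?\<phi> (Cod I v)) (FAr X v) = ?\<phi> (Dom I v))"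
      using in1 by simp
  qed
  then show arr: "ind_level M I X Y \<tau> \<in> homset (Ind M) (I, X) (I, Y)"
    using ind unfolding ind_level_def Ind_homset_iff by blast
  show "ind_act M (ind_level M I X Y \<tau>) (gen (I, X) s) = el_res M (I, Y) (gen (I, Y) s) (\<tau> s)"
    if s: "s \<in> Obj I"
  proof -
    have arr': "((I, X), ?\<phi>, (I, Y)) \<in> homset (Ind M) (I, X) (I, Y)"
      using arr by (simp add: ind_level_def)
    have O: "FOb X s \<in> Obj M" by (rule functor_Obj[OF X s])
    show ?thesis
      using ind_act_gen[OF arr', of s "Idn M (FOb X s)" "FOb X s"] Idn_in[OF O]
        el_res_Idn[OF ind(1) _ O] gen_in[OF ind(1), of s] el_res_Idn[OF ind(2) in1[OF s] O] s
          \<phi>[OF s]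
      by (simp add: ind_level_def)
  qed
qed

lemma Ind_Idn:
  assumes X: "ind_obj M X"
  shows "Idn (Ind M) X \<in> homset (Ind M) X X"
    and "c \<in> colim_hom M A X \<Longrightarrow> ind_act M (Idn (Ind M) X) c = c"
proof -
  obtain I Z where XZ: "X = (I, Z)" by (cases X)
  then have I: "filtered I" "is_functor I M Z" using ind_objD X by blast+
  have "nat_trans I M Z Z (\<lambda>s. Idn M (FOb Z s))"
  proof -
    have "FAr Z u \<in> homset M (FOb Z (Dom I u)) (FOb Z (Cod I u))" if "u \<in> Arr I" for u
      using functor_Arr[OF I(2)] that by (simp add: homset_def)
    then show ?thesis
      unfolding nat_trans_def using Idn_in functor_Obj[OF I(2)] Cmp_Idn Idn_Cmp by metis
  qed
  note lev = ind_level_arrow[OF I I(2) this]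
  show arr: "Idn (Ind M) X \<in> homset (Ind M) X X"
    using lev(1) XZ by (simp add: Ind_simps)
  assume c: "c \<in> colim_hom M A X"
  obtain s h where s: "s \<in> Obj (fst X)" "h \<in> homset M A (FOb (snd X) s)"
    "c = el_res M X (gen X s) h"
    using colim_hom_gen[OF X c] by metis
  have "ind_act M (Idn (Ind M) X) (gen X s) = gen X s"
    using lev(2)[of s] s(1) XZ el_res_Idn[OF X gen_in[OF X s(1)]] functor_Obj[OF I(2), of s]
    by (simp add: Ind_simps)
  then show "ind_act M (Idn (Ind M) X) c = c"
    using ind_act_res[OF arr gen_in[OF X s(1)] s(2)] s(3) by simp
qed

text \<open>A form of the Yoneda lemma. The inverse is assembled from preimages of the colimit legs
  of \<open>Y\<close>; injectivity makes this family compatible and unique.\<close>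

lemma Ind_isoI:
  assumes f: "f \<in> homset (Ind M) X Y"
    and bij: "\<And>A. A \<in> Obj M \<Longrightarrow> bij_betw (ind_act M f) (colim_hom M A X) (colim_hom M A Y)"
  obtains g where "g \<in> homset (Ind M) Y X" "is_iso (Ind M) f" "is_iso (Ind M) g"
    "g \<cdot>\<^bsub>Ind M\<^esub> f = Idn (Ind M) X" "f \<cdot>\<^bsub>Ind M\<^esub> g = Idn (Ind M) Y"
proof -
  note X = Ind_homsetD(1)[OF f] and Y = Ind_homsetD(2)[OF f]
  have YO: "FOb (snd Y) t \<in> Obj M" if "t \<in> Obj (fst Y)" for t
    using functor_Obj ind_objD Y that by (metis prod.collapse)
  have XO: "FOb (snd X) t \<in> Obj M" if "t \<in> Obj (fst X)" for t
    using functor_Obj ind_objD X that by (metis prod.collapse)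
  have inj: "c = c'" if "c \<in> colim_hom M A X" "c' \<in> colim_hom M A X" "ind_act M f c =
      ind_act M f c'" "A \<in> Obj M"
    for c c' A
    using bij[OF that(4)] that(1-3) unfolding bij_betw_def inj_on_def by blast
  have "\<exists>c \<in> colim_hom M (FOb (snd Y) t) X. ind_act M f c = gen Y t" if "t \<in> Obj (fst Y)" for t
  proof -
    have "gen Y t \<in> ind_act M f ` colim_hom M (FOb (snd Y) t) X"
      unfolding bij_betw_imp_surj_on[OF bij[OF YO[OF that]]] by (rule gen_in[OF Y that])
    then show ?thesis by (elim imageE) (rule bexI, erule sym)
  qed
  then obtain \<psi> where \<psi>: "\<And>t. t \<in> Obj (fst Y) \<Longrightarrow> \<psi> t \<in> colim_hom M (FOb (snd Y) t) X"
    "\<And>t. t \<in> Obj (fst Y) \<Longrightarrow> ind_act M f (\<psi> t) = gen Y t" by metis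
  have "el_res M X (\<psi> t) (FAr (snd Y) v) = \<psi> s" if v: "v \<in> homset (fst Y) s t" for s t v
  proof -
    have fil: "filtered (fst Y)" "is_functor (fst Y) M (snd Y)" using ind_objD Y by
      (metis prod.collapse)+
    then interpret J: category "fst Y" by (simp add: filtered_category)
    have st: "s \<in> Obj (fst Y)" "t \<in> Obj (fst Y)" using J.homset_Obj[OF v] by auto
    note Yv = functor_Arr[OF fil(2) v]
    show ?thesis
      by (rule inj[OF el_res_in[OF X \<psi>(1)[OF st(2)] Yv] \<psi>(1)[OF st(1)] _ YO[OF st(1)]])
        (simp add: ind_act_res[OF f \<psi>(1)[OF st(2)] Yv] \<psi>(2)[OF st(1)] \<psi>(2)[OF st(2)] gen_res[OF Y
          v])
  qed
  then obtain g where g: "g \<in> homset (Ind M) Y X"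
    and gs: "\<And>t. t \<in> Obj (fst Y) \<Longrightarrow> ind_act M g (gen Y t) = \<psi> t"
    using ind_arrow_construct[OF Y X \<psi>(1)] by metis
  have fg: "f \<cdot>\<^bsub>Ind M\<^esub> g = Idn (Ind M) Y"
    by (rule ind_arrow_ext[OF Ind_Cmp(1)[OF g f] Ind_Idn(1)[OF Y]])
      (simp add: Ind_Cmp(2)[OF g f gen_in[OF Y]] Ind_Idn(2)[OF Y gen_in[OF Y]] gs \<psi>(2))
  have act_fg: "ind_act M f (ind_act M g c) = c" if "c \<in> colim_hom M A Y" for A c
    using Ind_Cmp(2)[OF g f that] Ind_Idn(2)[OF Y that] fg by simp
  have gf: "g \<cdot>\<^bsub>Ind M\<^esub> f = Idn (Ind M) X"
  proof (rule ind_arrow_ext[OF Ind_Cmp(1)[OF f g] Ind_Idn(1)[OF X]])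
    fix s assume s: "s \<in> Obj (fst X)"
    note gX = gen_in[OF X s]
    note fX = ind_act_in[OF f gX]
    have "ind_act M g (ind_act M f (gen X s)) = gen X s"
      by (rule inj[OF ind_act_in[OF g fX] gX act_fg[OF fX] XO[OF s]])
    then show "ind_act M (g \<cdot>\<^bsub>Ind M\<^esub> f) (gen X s) = ind_act M (Idn (Ind M) X) (gen X s)"
      using Ind_Cmp(2)[OF f g gX] Ind_Idn(2)[OF X gX] by simp
  qed
  have "is_iso (Ind M) f" "is_iso (Ind M) g"
    by (rule is_isoI[OF f g gf fg]) (rule is_isoI[OF g f fg gf])
  then show thesis using that g gf fg by blast
qed

text \<open>Two elements of \<open>Z\<close> have representatives at a common stage
  \<open>k\<close>, so injectivity may be tested on parallel arrows into one stage, where it means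
  that a later stage identifies them.\<close>

lemma ind_act_bijI:
  assumes f: "f \<in> homset (Ind M) Z X"
    and inj: "\<And>k A h h'. \<lbrakk>k \<in> Obj (fst Z); h \<in> homset M A (FOb (snd Z) k);
        h' \<in> homset M A (FOb (snd Z) k);
        el_res M X (ind_act M f (gen Z k)) h = el_res M X (ind_act M f (gen Z k)) h'\<rbrakk>
      \<Longrightarrow> \<exists>l. \<exists>u \<in> homset (fst Z) k l. FAr (snd Z) u \<cdot> h = FAr (snd Z) u \<cdot> h'"
    and surj: "\<And>x. x \<in> colim_hom M A X \<Longrightarrow> \<exists>k \<in> Obj (fst Z). \<exists>h \<in> homset M A (FOb (snd Z) k).
      x = el_res M X (ind_act M f (gen Z k)) h"
  shows "bij_betw (ind_act M f) (colim_hom M A Z) (colim_hom M A X)"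
proof (rule bij_betw_imageI)
  note Z = Ind_homsetD(1)[OF f]
  have fZ: "filtered (fst Z)" "is_functor (fst Z) M (snd Z)" using Z ind_objD by
    (metis prod.collapse)+
  show "inj_on (ind_act M f) (colim_hom M A Z)"
  proof (rule inj_onI)
    fix c c' assume c: "c \<in> colim_hom M A Z" "c' \<in> colim_hom M A Z"
      and eq: "ind_act M f c = ind_act M f c'"
    obtain B b p q where b: "b \<in> colim_hom M B Z" "p \<in> homset M A B" "q \<in> homset M A B"
      "c = el_res M Z b p" "c' = el_res M Z b q"
      using el_joint_factor[OF Z c] by metis
    obtain k h where k: "k \<in> Obj (fst Z)" "h \<in> homset M B (FOb (snd Z) k)"
      "b = el_res M Z (gen Z k) h"
      using colim_hom_gen[OF Z b(1)] by metis
    note g = gen_in[OF Z k(1)] and hp = Cmp_in[OF b(2) k(2)] and hq = Cmp_in[OF b(3) k(2)]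
    have cc: "c = el_res M Z (gen Z k) (h \<cdot> p)" "c' = el_res M Z (gen Z k) (h \<cdot> q)"
      using el_res_Cmp[OF Z g k(2) b(2)] el_res_Cmp[OF Z g k(2) b(3)] b(4,5) k(3) by simp_all
    have "el_res M X (ind_act M f (gen Z k)) (h \<cdot> p) = el_res M X (ind_act M f (gen Z k)) (h \<cdot> q)"
      using eq ind_act_res[OF f g hp] ind_act_res[OF f g hq] cc by simp
    then obtain l u where u: "u \<in> homset (fst Z) k l" "FAr (snd Z) u \<cdot> (h \<cdot> p) =
        FAr (snd Z) u \<cdot> (h \<cdot> q)"
      using inj[OF k(1) hp hq] by blast
    have l: "l \<in> Obj (fst Z)" using category.homset_Obj[OF filtered_category[OF fZ(1)] u(1)] by simp
    note Zu = functor_Arr[OF fZ(2) u(1)]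
    show "c = c'"
      unfolding cc gen_res[OF Z u(1), symmetric] el_res_Cmp[OF Z gen_in[OF Z l] Zu hp]
        el_res_Cmp[OF Z gen_in[OF Z l] Zu hq] u(2) ..
  qed
  have "x \<in> ind_act M f ` colim_hom M A Z" if x: "x \<in> colim_hom M A X" for x
  proof -
    obtain k h where k: "k \<in> Obj (fst Z)" "h \<in> homset M A (FOb (snd Z) k)"
      "x = el_res M X (ind_act M f (gen Z k)) h"
      using surj[OF x] by blast
    note g = gen_in[OF Z k(1)]
    have "x = ind_act M f (el_res M Z (gen Z k) h)" using ind_act_res[OF f g k(2)] k(3) by simp
    then show ?thesis using el_res_in[OF Z g k(2)] by blast
  qed
  then show "ind_act M f ` colim_hom M A Z = colim_hom M A X"
    using ind_act_in[OF f] by blast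
qed

lemma ind_act_inverse:
  assumes f: "f \<in> homset (Ind M) X Y" and g: "g \<in> homset (Ind M) Y X"
    and gf: "g \<cdot>\<^bsub>Ind M\<^esub> f = Idn (Ind M) X" and c: "c \<in> colim_hom M A X"
  shows "ind_act M g (ind_act M f c) = c"
  using Ind_Cmp(2)[OF f g c] gf Ind_Idn(2)[OF Ind_homsetD(1)[OF f] c] by simp

end

section \<open>Levelwise arrows of the ind-category\<close>

text \<open>Infiniteness of \<open>'u\<close> is used to code a tuple of elements as a single one,
  which turns squares into legitimate indices.\<close>

lemma infinite_pairing:
  assumes "infinite (UNIV :: 'u set)"
  obtains pr :: "'u \<times> 'u \<Rightarrow> 'u" where "inj pr"
proof -
  have "|(UNIV :: 'u set) \<times> (UNIV :: 'u set)| =o |UNIV :: 'u set|"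
    using card_of_Times_same_infinite[OF assms] .
  then obtain pr :: "'u \<times> 'u \<Rightarrow> 'u" where "bij_betw pr (UNIV \<times> UNIV) UNIV"
    using card_of_ordIso by blast
  then have "inj pr" by (simp add: bij_betw_def)
  then show thesis by (rule that)
qed

text \<open>Index categories of ind-objects must have their objects and arrows in \<open>'u\<close>; this lemma
  recodes a small filtered category accordingly.\<close>

lemma filtered_transport:
  fixes K :: "('k, 'l) cat" and en :: "'k \<Rightarrow> 'u" and ar :: "'l \<Rightarrow> 'u"
  assumes K: "filtered K" and en: "inj_on en (Obj K)" and ar: "inj_on ar (Arr K)"
  obtains K' :: "('u, 'u) cat" and D :: "('u, 'u, 'k, 'l) func"
  where "filtered K'" "is_functor K' K D"
    "\<And>k. k \<in> Obj K \<Longrightarrow> \<exists>k' \<in> Obj K'. FOb D k' = k"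
    "\<And>k' k'' m. \<lbrakk>k' \<in> Obj K'; k'' \<in> Obj K'; m \<in> homset K (FOb D k') (FOb D k'')\<rbrakk>
      \<Longrightarrow> \<exists>u \<in> homset K' k' k''. FAr D u = m"
proof -
  interpret K: category K using K by (rule filtered_category)
  let ?o = "inv_into (Obj K) en" and ?a = "inv_into (Arr K) ar"
  define K' :: "('u, 'u) cat" where
    "K' = \<lparr>Obj = en ` Obj K, Arr = ar ` Arr K, Dom = (\<lambda>f. en (Dom K (?a f))), Cod =
        (\<lambda>f. en (Cod K (?a f))),
      Idn = (\<lambda>k. ar (Idn K (?o k))), Cmp = (\<lambda>g f. ar (?a g \<cdot>\<^bsub>K\<^esub> ?a f))\<rparr>"
  have o: "?o (en k) = k" if "k \<in> Obj K" for k using en that by simp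
  have a: "?a (ar f) = f" if "f \<in> Arr K" for f using ar that by simp
  have Kobj: "Obj K' = en ` Obj K" by (simp add: K'_def)
  have hom: "f \<in> homset K' A B \<longleftrightarrow> (\<exists>f0 A0 B0. f0 \<in> homset K A0 B0 \<and> f = ar f0 \<and> A = en A0 \<and> B =
      en B0)"
    for f A B
    by (auto simp: K'_def homset_def a)
  have idn: "Idn K' (en k) = ar (Idn K k)" if "k \<in> Obj K" for k using that by (simp add: K'_def o)
  have cmp: "ar g \<cdot>\<^bsub>K'\<^esub> ar f = ar (g \<cdot>\<^bsub>K\<^esub> f)" if "f \<in> Arr K" "g \<in> Arr K" for f g
    using that by (simp add: K'_def a)
  have hArr: "f \<in> Arr K" if "f \<in> homset K A B" for f A B using that by (simp add: homset_def)
  have enD: "A = B" if "en A = en B" "A \<in> Obj K" "B \<in> Obj K" for A B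
    using en that by (auto dest: inj_onD)
  have homC: "\<exists>f0. f0 \<in> homset K A B \<and> f = ar f0" if "f \<in> homset K' (en A) (en B)" "A \<in> Obj K"
    "B \<in> Obj K" for f A B
    using that unfolding hom by (metis enD K.homset_Obj)
  have arr: "f \<in> Arr K' \<longleftrightarrow> f \<in> homset K' (Dom K' f) (Cod K' f)" for f by (simp add: homset_def)
  have homO: "\<exists>A0 \<in> Obj K. \<exists>B0 \<in> Obj K. A = en A0 \<and> B = en B0" if "f \<in> homset K' A B" for f A B
    using that unfolding hom by (metis K.homset_Obj)
  have K'cat: "category K'"
  proof
    show "Dom K' f \<in> Obj K'" "Cod K' f \<in> Obj K'" if "f \<in> Arr K'" for f
      using homO that unfolding arr Kobj by blast+
    show "Idn K' A \<in> homset K' A A" if "A \<in> Obj K'" for A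
      using that unfolding Kobj hom by (metis imageE idn K.Idn_in)
    fix A B f assume f: "f \<in> homset K' A B"
    then obtain A0 B0 f0 where f0: "A = en A0" "B = en B0" "f = ar f0" "f0 \<in> homset K A0 B0"
      unfolding hom by blast
    note O = K.homset_Obj[OF f0(4)]
    note I = K.Idn_in[OF conjunct1[OF O]] K.Idn_in[OF conjunct2[OF O]]
    show "f \<cdot>\<^bsub>K'\<^esub> Idn K' A = f" "Idn K' B \<cdot>\<^bsub>K'\<^esub> f = f"
      using f0 O idn cmp hArr[OF f0(4)] hArr[OF I(1)] hArr[OF I(2)] K.Cmp_Idn[OF f0(4)]
        K.Idn_Cmp[OF f0(4)]
      by simp_all
    fix D g assume g: "g \<in> homset K' B D"
    then obtain D0 where D0: "D = en D0" "D0 \<in> Obj K" using homO by blast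
    then obtain g0 where g0: "g = ar g0" "g0 \<in> homset K B0 D0"
      using homC[OF g[unfolded f0(2) D0(1)]] O by blast
    note gf = K.Cmp_in[OF f0(4) g0(2)]
    show "g \<cdot>\<^bsub>K'\<^esub> f \<in> homset K' A D"
      using cmp[OF hArr[OF f0(4)] hArr[OF g0(2)]] gf f0 g0 D0 unfolding hom by blast
    fix E h assume h: "h \<in> homset K' D E"
    then obtain E0 where E0: "E = en E0" "E0 \<in> Obj K" using homO by blast
    then obtain h0 where h0: "h = ar h0" "h0 \<in> homset K D0 E0"
      using homC[OF h[unfolded E0(1) D0(1)]] D0(2) by blast
    show "(h \<cdot>\<^bsub>K'\<^esub> g) \<cdot>\<^bsub>K'\<^esub> f = h \<cdot>\<^bsub>K'\<^esub> (g \<cdot>\<^bsub>K'\<^esub> f)"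
      unfolding f0(3) g0(1) h0(1) cmp[OF hArr[OF g0(2)] hArr[OF h0(2)]]
        cmp[OF hArr[OF f0(4)] hArr[OF g0(2)]]
        cmp[OF hArr[OF f0(4)] hArr[OF K.Cmp_in[OF g0(2) h0(2)]]] cmp[OF hArr[OF gf] hArr[OF h0(2)]]
        K.Cmp_assoc[OF f0(4) g0(2) h0(2)] ..
  qed
  have K'fil: "filtered K'"
    unfolding filtered_def
  proof (intro conjI ballI impI)
    show "category K'" by fact
    show "Obj K' \<noteq> {}" using K unfolding filtered_def Kobj by simp
  next
    fix s t assume "s \<in> Obj K'" "t \<in> Obj K'"
    then obtain s0 t0 where st: "s = en s0" "t = en t0" "s0 \<in> Obj K" "t0 \<in> Obj K" unfolding Kobj by
      blast
    obtain r u v where "u \<in> homset K s0 r" "v \<in> homset K t0 r"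
      using filtered_upper_bound[OF K st(3,4)] by metis
    then have "ar u \<in> homset K' s (en r)" "ar v \<in> homset K' t (en r)" unfolding hom st(1,2) by
      blast+
    then show "\<exists>r. homset K' s r \<noteq> {} \<and> homset K' t r \<noteq> {}" by blast
  next
    fix u v assume uv: "u \<in> Arr K'" "v \<in> Arr K'" and e: "Dom K' u = Dom K' v \<and> Cod K' u = Cod K' v"
    from uv(1) obtain u0 A B where u0: "u0 \<in> homset K A B" "u = ar u0" "Dom K' u = en A" "Cod K' u =
        en B"
      unfolding arr hom by blast
    note O = K.homset_Obj[OF u0(1)]
    have "v \<in> homset K' (en A) (en B)" using uv(2) e u0(3,4) by (simp add: homset_def)
    then obtain v0 where v0: "v0 \<in> homset K A B" "v = ar v0" using homC O by blast
    obtain r w where w: "w \<in> homset K B r" "w \<cdot>\<^bsub>K\<^esub> u0 = w \<cdot>\<^bsub>K\<^esub> v0"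
      using filtered_equalize[OF K u0(1) v0(1)] by metis
    have "ar w \<in> homset K' (en B) (en r)" using w(1) unfolding hom by blast
    moreover have "ar w \<cdot>\<^bsub>K'\<^esub> u = ar w \<cdot>\<^bsub>K'\<^esub> v"
      unfolding u0(2) v0(2) cmp[OF hArr[OF u0(1)] hArr[OF w(1)]]
        cmp[OF hArr[OF v0(1)] hArr[OF w(1)]] w(2) ..
    ultimately show "\<exists>w \<in> Arr K'. Dom K' w = Cod K' u \<and> w \<cdot>\<^bsub>K'\<^esub> u = w \<cdot>\<^bsub>K'\<^esub> v"
      using u0(4) by (auto simp: homset_def)
  qed
  let ?D = "\<lparr>FOb = ?o, FAr = ?a\<rparr>"
  have D: "is_functor K' K ?D"
    unfolding is_functor_def
  proof (intro conjI ballI impI)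
    fix A assume "A \<in> Obj K'"
    then obtain A0 where A0: "A = en A0" "A0 \<in> Obj K" unfolding Kobj by blast
    then show "FOb ?D A \<in> Obj K" "FAr ?D (Idn K' A) = Idn K (FOb ?D A)"
      using a[OF hArr[OF K.Idn_in]] by (simp_all add: o idn)
  next
    fix f assume "f \<in> Arr K'"
    then obtain f0 A B where f0: "f0 \<in> homset K A B" "f = ar f0" "Dom K' f = en A" "Cod K' f = en B"
      unfolding arr hom by blast
    then show "FAr ?D f \<in> homset K (FOb ?D (Dom K' f)) (FOb ?D (Cod K' f))"
      using a[OF hArr[OF f0(1)]] o K.homset_Obj[OF f0(1)] by simp
  next
    fix f g assume "f \<in> Arr K'" "g \<in> Arr K'" and e: "Dom K' g = Cod K' f"
    then obtain f0 g0 where fg: "f = ar f0" "g = ar g0" "f0 \<in> Arr K" "g0 \<in> Arr K"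
      unfolding K'_def by auto
    then have "Dom K g0 = Cod K f0"
      using e K.Dom_in K.Cod_in by (intro enD) (auto simp: K'_def a)
    then have "g0 \<cdot>\<^bsub>K\<^esub> f0 \<in> Arr K" using fg by simp
    then show "FAr ?D (g \<cdot>\<^bsub>K'\<^esub> f) = FAr ?D g \<cdot>\<^bsub>K\<^esub> FAr ?D f"
      using fg by (simp add: cmp a)
  qed
  show thesis
  proof (rule that[OF K'fil D])
    show "\<exists>k' \<in> Obj K'. FOb ?D k' = k" if "k \<in> Obj K" for k
      using that o[OF that] unfolding Kobj by auto
    show "\<exists>u \<in> homset K' k' k''. FAr ?D u = m"
      if "k' \<in> Obj K'" "k'' \<in> Obj K'" "m \<in> homset K (FOb ?D k') (FOb ?D k'')" for k' k'' m
    proof (intro bexI)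
      show "FAr ?D (ar m) = m" using a[OF hArr[OF that(3)]] by simp
      have "en (?o k') = k'" "en (?o k'') = k''" using that(1,2) unfolding Kobj by
        (simp_all add: f_inv_into_f)
      then show "ar m \<in> homset K' k' k''" using that(3) unfolding hom by
        (metis func.select_convs(1))
    qed
  qed
qed

lemma is_functor_comp:
  assumes F: "is_functor C D F" and G: "is_functor D E G"
  shows "is_functor C E (comp_func G F)"
proof -
  have F': "FAr F f \<in> Arr D" "Dom D (FAr F f) = FOb F (Dom C f)" "Cod D (FAr F f) = FOb F (Cod C f)"
    if "f \<in> Arr C" for f
    using F that unfolding is_functor_def homset_def by auto
  have G': "FAr G f \<in> homset E (FOb G (Dom D f)) (FOb G (Cod D f))" if "f \<in> Arr D" for f
    using G that unfolding is_functor_def by blast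
  have "FAr G (FAr F f) \<in> homset E (FOb G (FOb F (Dom C f))) (FOb G (FOb F (Cod C f)))"
    if "f \<in> Arr C" for f
    using G'[OF F'(1)[OF that]] F'(2,3)[OF that] by simp
  then show ?thesis
    using F G F' unfolding is_functor_def comp_func_def by simp
qed

section \<open>Density of weak equivalences among squares\<close>

definition W_factors :: "('o, 'a) cat \<Rightarrow> 'a set \<Rightarrow> ('u, 'o, 'a) ind_ob \<Rightarrow> ('u, 'o, 'a) ind_ob \<Rightarrow>
    ('u, 'o, 'a) ind_arr \<Rightarrow> 'o \<Rightarrow> 'o \<Rightarrow> 'a \<Rightarrow> ('u \<times> 'a) set \<Rightarrow> ('u \<times> 'a) set \<Rightarrow> bool" where
  "W_factors M W X Y f A B u x y \<longleftrightarrow>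
    (\<exists>P Q w p q x' y'. w \<in> W \<and> w \<in> homset M P Q \<and> p \<in> homset M A P \<and> q \<in> homset M B Q \<and>
      w \<cdot>\<^bsub>M\<^esub> p = q \<cdot>\<^bsub>M\<^esub> u \<and> x' \<in> colim_hom M P X \<and> y' \<in> colim_hom M Q Y \<and>
      ind_act M f x' = el_res M Y y' w \<and> x = el_res M X x' p \<and> y = el_res M Y y' q)"

text \<open>Elements \<open>x\<close> and \<open>y\<close> with this equation are a square from
  \<open>u\<close> to \<open>f\<close> in the arrow category of the ind-category, and
  \<open>W_factors\<close> splits it as a square of \<open>M\<close> from \<open>u\<close> to some
  \<open>w\<close> in \<open>W\<close> followed by one from \<open>w\<close> to \<open>f\<close>. So
  density is cofinality of the weak equivalences among the arrows of \<open>M\<close> over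
  \<open>f\<close>.\<close>

definition W_dense :: "('o, 'a) cat \<Rightarrow> 'a set \<Rightarrow> ('u, 'o, 'a) ind_ob \<Rightarrow> ('u, 'o, 'a) ind_ob \<Rightarrow>
    ('u, 'o, 'a) ind_arr \<Rightarrow> bool" where
  "W_dense M W X Y f \<longleftrightarrow> (\<forall>A B u x y. u \<in> homset M A B \<and> x \<in> colim_hom M A X \<and>
    y \<in> colim_hom M B Y \<and> ind_act M f x = el_res M Y y u \<longrightarrow> W_factors M W X Y f A B u x y)"

lemma W_denseE:
  assumes "W_dense M W X Y f" "u \<in> homset M A B" "x \<in> colim_hom M A X" "y \<in> colim_hom M B Y"
    "ind_act M f x = el_res M Y y u"
  obtains P Q w p q x' y' where "w \<in> W" "w \<in> homset M P Q" "p \<in> homset M A P" "q \<in> homset M B Q"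
    "w \<cdot>\<^bsub>M\<^esub> p = q \<cdot>\<^bsub>M\<^esub> u" "x' \<in> colim_hom M P X" "y' \<in> colim_hom M Q Y"
    "ind_act M f x' = el_res M Y y' w" "x = el_res M X x' p" "y = el_res M Y y' q"
  using assms unfolding W_dense_def W_factors_def by blast

lemma W_denseI:
  assumes "\<And>A B u x y. \<lbrakk>u \<in> homset M A B; x \<in> colim_hom M A X; y \<in> colim_hom M B Y;
    ind_act M f x = el_res M Y y u\<rbrakk> \<Longrightarrow> W_factors M W X Y f A B u x y"
  shows "W_dense M W X Y f"
  using assms unfolding W_dense_def by blast

context base_category
begin

text \<open>A version of \<open>el_equalize\<close> whose equalizing map comes from the index
  category. Such a map acts on all diagrams over that category at once, as needed for a levelwise
  arrow.\<close>

lemma el_gen_eq: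
  assumes X: "ind_obj M X" and r: "r \<in> Obj (fst X)"
    and k: "k \<in> homset M A (FOb (snd X) r)" "k' \<in> homset M A (FOb (snd X) r)"
    and eq: "el_res M X (gen X r) k = el_res M X (gen X r) k'"
  obtains r' m where "m \<in> homset (fst X) r r'" "FAr (snd X) m \<cdot> k = FAr (snd X) m \<cdot> k'"
proof -
  obtain J Y where JY: "X = (J, Y)" by (cases X)
  then have J: "filtered J" and Y: "is_functor J M Y" using ind_objD X by blast+
  interpret J: category J using J by (rule filtered_category)
  have r': "r \<in> Obj J" using r JY by simp
  have k': "k \<in> homset M A (FOb Y r)" "k' \<in> homset M A (FOb Y r)" using k JY by auto
  note O = Idn_in[OF functor_Obj[OF Y r']]
  have "colim_class M A (J, Y) r k = colim_class M A (J, Y) r k'"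
    using eq el_res_class[OF J Y r' O k'(1)] el_res_class[OF J Y r' O k'(2)]
      Idn_Cmp[OF k'(1)] Idn_Cmp[OF k'(2)] JY by simp
  then obtain t u v where u: "u \<in> homset J r t" and v: "v \<in> homset J r t" and uv: "FAr Y u \<cdot> k =
      FAr Y v \<cdot> k'"
    using colim_class_eq_iff[OF J Y r' k'(1) r' k'(2)] by auto
  obtain s w where w: "w \<in> homset J t s" "w \<cdot>\<^bsub>J\<^esub> u = w \<cdot>\<^bsub>J\<^esub> v"
    using filtered_equalize[OF J u v] by metis
  note Yu = functor_Arr[OF Y u] and Yv = functor_Arr[OF Y v] and Yw = functor_Arr[OF Y w(1)]
  have "FAr Y (w \<cdot>\<^bsub>J\<^esub> u) \<cdot> k = FAr Y w \<cdot> (FAr Y u \<cdot> k)"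
    unfolding functor_Cmp[OF Y u w(1)] by (rule Cmp_assoc[OF k'(1) Yu Yw])
  also have "\<dots> = FAr Y (w \<cdot>\<^bsub>J\<^esub> u) \<cdot> k'"
    unfolding uv w(2) functor_Cmp[OF Y v w(1)] by (rule Cmp_assoc[OF k'(2) Yv Yw, symmetric])
  finally show thesis using that[of "w \<cdot>\<^bsub>J\<^esub> u" s] J.Cmp_in[OF u w(1)] JY by simp
qed

text \<open>After transport along the isomorphisms to the levelwise model, \<open>x\<close> and
  \<open>y\<close> are represented at a common level. The component of \<open>\<tau>\<close> at a
  sufficiently late level is the weak equivalence through which the square factors.\<close>

lemma Lw_iso_W_dense:
  assumes f: "f \<in> homset (Ind M) X Y" and Lw: "f \<in> Lw_iso M W"
  shows "W_dense M W X Y f"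
proof (rule W_denseI)
  from Lw obtain I X' Y' \<tau> where I: "filtered I" and X': "is_functor I M X'" and Y':
    "is_functor I M Y'"
    and \<tau>: "nat_trans I M X' Y' \<tau>" and W: "\<And>s. s \<in> Obj I \<Longrightarrow> \<tau> s \<in> W"
    and iso: "arrows_isomorphic (Ind M) f (ind_level M I X' Y' \<tau>)"
    unfolding Lw_iso_def by blast
  interpret I: category I using I by (rule filtered_category)
  have ind: "ind_obj M (I, X')" "ind_obj M (I, Y')" using I X' Y' by (auto simp: ind_obj_def)
  let ?L = "ind_level M I X' Y' \<tau>"
  note L = ind_level_arrow[OF I X' Y' \<tau>]
  have dc: "Dom (Ind M) f = X" "Cod (Ind M) f = Y" "Dom (Ind M) ?L = (I, X')" "Cod (Ind M) ?L =
      (I, Y')"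
    using f L(1) by (simp_all add: homset_def)
  from iso obtain \<xi> \<eta> where \<xi>: "\<xi> \<in> homset (Ind M) X (I, X')" "is_iso (Ind M) \<xi>"
    and \<eta>: "\<eta> \<in> homset (Ind M) Y (I, Y')" "is_iso (Ind M) \<eta>"
    and sq: "\<eta> \<cdot>\<^bsub>Ind M\<^esub> f = ?L \<cdot>\<^bsub>Ind M\<^esub> \<xi>"
    unfolding arrows_isomorphic_def dc by blast
  have dc': "Dom (Ind M) \<xi> = X" "Cod (Ind M) \<xi> = (I, X')" "Dom (Ind M) \<eta> = Y" "Cod (Ind M) \<eta> =
      (I, Y')"
    using \<xi>(1) \<eta>(1) by (simp_all add: homset_def)
  obtain \<xi>' where \<xi>': "\<xi>' \<in> homset (Ind M) (I, X') X" "\<xi>' \<cdot>\<^bsub>Ind M\<^esub> \<xi> = Idn (Ind M) X"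
    "\<xi> \<cdot>\<^bsub>Ind M\<^esub> \<xi>' = Idn (Ind M) (I, X')"
    using \<xi>(2) unfolding is_iso_def dc' by blast
  obtain \<eta>' where \<eta>': "\<eta>' \<in> homset (Ind M) (I, Y') Y" "\<eta>' \<cdot>\<^bsub>Ind M\<^esub> \<eta> = Idn (Ind M) Y"
    "\<eta> \<cdot>\<^bsub>Ind M\<^esub> \<eta>' = Idn (Ind M) (I, Y')"
    using \<eta>(2) unfolding is_iso_def dc' by blast
  note X = Ind_homsetD(1)[OF f] and Y = Ind_homsetD(2)[OF f]
  have sq_act: "ind_act M \<eta> (ind_act M f c) = ind_act M ?L (ind_act M \<xi> c)" if "c \<in> colim_hom M A X"
    for A c
    using Ind_Cmp(2)[OF f \<eta>(1) that] Ind_Cmp(2)[OF \<xi>(1) L(1) that] sq by simp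
  fix A B u x y
  assume u: "u \<in> homset M A B" and x: "x \<in> colim_hom M A X" and y: "y \<in> colim_hom M B Y"
    and xy: "ind_act M f x = el_res M Y y u"
  define x0 where "x0 = ind_act M \<xi> x"
  define y0 where "y0 = ind_act M \<eta> y"
  have x0: "x0 \<in> colim_hom M A (I, X')" and y0: "y0 \<in> colim_hom M B (I, Y')"
    unfolding x0_def y0_def by (rule ind_act_in[OF \<xi>(1) x], rule ind_act_in[OF \<eta>(1) y])
  have xy0: "ind_act M ?L x0 = el_res M (I, Y') y0 u"
    using sq_act[OF x] xy ind_act_res[OF \<eta>(1) y u] unfolding x0_def y0_def by simp
  obtain s h where s: "s \<in> Obj I" "h \<in> homset M A (FOb X' s)" "x0 = el_res M (I, X') (gen (I,
      X') s) h"
    using colim_hom_gen[OF ind(1) x0] unfolding fst_conv snd_conv by metis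
  obtain t k where t: "t \<in> Obj I" "k \<in> homset M B (FOb Y' t)" "y0 = el_res M (I, Y') (gen (I,
      Y') t) k"
    using colim_hom_gen[OF ind(2) y0] unfolding fst_conv snd_conv by metis
  obtain r a b where a: "a \<in> homset I s r" and b: "b \<in> homset I t r"
    using filtered_upper_bound[OF I s(1) t(1)] by metis
  have r: "r \<in> Obj I" using I.homset_Obj[OF a] by simp
  note Xa = functor_Arr[OF X' a] and Yb = functor_Arr[OF Y' b]
  define h1 where "h1 = FAr X' a \<cdot> h"
  define k1 where "k1 = FAr Y' b \<cdot> k"
  have h1: "h1 \<in> homset M A (FOb X' r)" and k1: "k1 \<in> homset M B (FOb Y' r)"
    unfolding h1_def k1_def by (rule Cmp_in[OF s(2) Xa], rule Cmp_in[OF t(2) Yb])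
  have genX: "gen (I, X') v \<in> colim_hom M (FOb X' v) (I, X')" if "v \<in> Obj I" for v
    using gen_in[OF ind(1), of v] that by simp
  have genY: "gen (I, Y') v \<in> colim_hom M (FOb Y' v) (I, Y')" if "v \<in> Obj I" for v
    using gen_in[OF ind(2), of v] that by simp
  have resX: "el_res M (I, X') (gen (I, X') v') (FAr X' m) = gen (I, X') v" if "m \<in> homset I v v'"
    for v v' m
    using gen_res[OF ind(1), of m v v'] that by simp
  have resY: "el_res M (I, Y') (gen (I, Y') v') (FAr Y' m) = gen (I, Y') v" if "m \<in> homset I v v'"
    for v v' m
    using gen_res[OF ind(2), of m v v'] that by simp
  have x1: "x0 = el_res M (I, X') (gen (I, X') r) h1"
    using el_res_Cmp[OF ind(1) genX[OF r] Xa s(2)] resX[OF a] s(3) unfolding h1_def by simp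
  have y1: "y0 = el_res M (I, Y') (gen (I, Y') r) k1"
    using el_res_Cmp[OF ind(2) genY[OF r] Yb t(2)] resY[OF b] t(3) unfolding k1_def by simp
  have \<tau>s: "\<tau> v \<in> homset M (FOb X' v) (FOb Y' v)" if "v \<in> Obj I" for v
    using \<tau> that by (simp add: nat_trans_def)
  have eq: "el_res M (I, Y') (gen (I, Y') r) (\<tau> r \<cdot> h1) = el_res M (I, Y') (gen (I, Y') r) (k1 \<cdot> u)"
    using xy0 ind_act_res[OF L(1) genX[OF r] h1] L(2)[OF r] el_res_Cmp[OF ind(2) genY[OF r] \<tau>s[OF r]
      h1]
      el_res_Cmp[OF ind(2) genY[OF r] k1 u] unfolding x1 y1 by simp
  \<comment> \<open>At level \<open>r\<close> the square commutes only after passing to the colimit;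
    at \<open>r'\<close> it commutes in \<open>M\<close>.\<close>
  obtain r' m where m: "m \<in> homset I r r'" and mm: "FAr Y' m \<cdot> (\<tau> r \<cdot> h1) = FAr Y' m \<cdot> (k1 \<cdot> u)"
    by (rule el_gen_eq[OF ind(2), of r, unfolded fst_conv snd_conv,
          OF r Cmp_in[OF h1 \<tau>s[OF r]] Cmp_in[OF u k1] eq[unfolded snd_conv]])
  have r': "r' \<in> Obj I" using I.homset_Obj[OF m] by simp
  note Xm = functor_Arr[OF X' m] and Ym = functor_Arr[OF Y' m]
  define p where "p = FAr X' m \<cdot> h1"
  define q where "q = FAr Y' m \<cdot> k1"
  define x' where "x' = ind_act M \<xi>' (gen (I, X') r')"
  define y' where "y' = ind_act M \<eta>' (gen (I, Y') r')"
  have p: "p \<in> homset M A (FOb X' r')" and q: "q \<in> homset M B (FOb Y' r')"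
    unfolding p_def q_def by (rule Cmp_in[OF h1 Xm], rule Cmp_in[OF k1 Ym])
  have x': "x' \<in> colim_hom M (FOb X' r') X" and y': "y' \<in> colim_hom M (FOb Y' r') Y"
    unfolding x'_def y'_def by (rule ind_act_in[OF \<xi>'(1) genX[OF r']], rule ind_act_in[OF \<eta>'(1)
      genY[OF r']])
  have wpq: "\<tau> r' \<cdot> p = q \<cdot> u"
  proof -
    have nat: "\<tau> r' \<cdot> FAr X' m = FAr Y' m \<cdot> \<tau> r"
      using \<tau> m unfolding nat_trans_def homset_def by auto
    have "\<tau> r' \<cdot> p = (FAr Y' m \<cdot> \<tau> r) \<cdot> h1"
      unfolding p_def nat[symmetric] by (rule Cmp_assoc[OF h1 Xm \<tau>s[OF r'], symmetric])
    also have "\<dots> = FAr Y' m \<cdot> (\<tau> r \<cdot> h1)" by (rule Cmp_assoc[OF h1 \<tau>s[OF r] Ym])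
    also have "\<dots> = q \<cdot> u" unfolding mm q_def by (rule Cmp_assoc[OF u k1 Ym, symmetric])
    finally show ?thesis .
  qed
  have "ind_act M f x' = ind_act M \<eta>' (ind_act M \<eta> (ind_act M f x'))"
    using ind_act_inverse[OF \<eta>(1) \<eta>'(1,2) ind_act_in[OF f x']] by simp
  also have "\<dots> = ind_act M \<eta>' (ind_act M ?L (gen (I, X') r'))"
    using sq_act[OF x'] ind_act_inverse[OF \<xi>'(1) \<xi>(1) \<xi>'(3) genX[OF r']] unfolding x'_def by simp
  also have "\<dots> = el_res M Y y' (\<tau> r')"
    unfolding L(2)[OF r'] y'_def by (rule ind_act_res[OF \<eta>'(1) genY[OF r'] \<tau>s[OF r']])
  finally have fx': "ind_act M f x' = el_res M Y y' (\<tau> r')" .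
  have "x = ind_act M \<xi>' x0" unfolding x0_def by
    (rule ind_act_inverse[OF \<xi>(1) \<xi>'(1,2) x, symmetric])
  also have "x0 = el_res M (I, X') (gen (I, X') r') p"
    using el_res_Cmp[OF ind(1) genX[OF r'] Xm h1] resX[OF m] x1 unfolding p_def by simp
  also have "ind_act M \<xi>' \<dots> = el_res M X x' p"
    unfolding x'_def by (rule ind_act_res[OF \<xi>'(1) genX[OF r'] p])
  finally have xx: "x = el_res M X x' p" .
  have "y = ind_act M \<eta>' y0" unfolding y0_def by
    (rule ind_act_inverse[OF \<eta>(1) \<eta>'(1,2) y, symmetric])
  also have "y0 = el_res M (I, Y') (gen (I, Y') r') q"
    using el_res_Cmp[OF ind(2) genY[OF r'] Ym k1] resY[OF m] y1 unfolding q_def by simp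
  also have "ind_act M \<eta>' \<dots> = el_res M Y y' q"
    unfolding y'_def by (rule ind_act_res[OF \<eta>'(1) genY[OF r'] q])
  finally have yy: "y = el_res M Y y' q" .
  show "W_factors M W X Y f A B u x y"
    unfolding W_factors_def
    using W[OF r'] \<tau>s[OF r'] p q wpq x' y' fx' xx yy by blast
qed

end

section \<open>The filtered category of squares from weak equivalences to \<open>f\<close>\<close>

type_synonym ('u, 'a) square = "'a \<times> ('u \<times> 'a) \<times> ('u \<times> 'a)"

locale W_dense_arrow = base_category M for M :: "('o, 'a) cat" (structure) +
  fixes W :: "'a set" and X Y :: "('u, 'o, 'a) ind_ob" and f :: "('u, 'o, 'a) ind_arr"
  assumes f: "f \<in> homset (Ind M) X Y"
    and dense: "W_dense M W X Y f"
    and W_Arr: "W \<subseteq> Arr M"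
    and colims: "has_finite_colimits M"
begin

lemmas X = Ind_homsetD(1)[OF f] and Y = Ind_homsetD(2)[OF f]

text \<open>\<open>(w, (s, \<alpha>), (t, \<beta>))\<close> represents the square from \<open>w\<close> to \<open>f\<close> given by the classes of
  \<open>\<alpha> : Dom w \<rightarrow> X\<^sub>s\<close> and \<open>\<beta> : Cod w \<rightarrow> Y\<^sub>t\<close>.\<close>

definition top_el :: "('u, 'a) square \<Rightarrow> ('u \<times> 'a) set" where
  "top_el k = (case k of (w, (s, \<alpha>), _) \<Rightarrow> colim_class M (Dom M w) X s \<alpha>)"

definition bot_el :: "('u, 'a) square \<Rightarrow> ('u \<times> 'a) set" where
  "bot_el k = (case k of (w, _, (t, \<beta>)) \<Rightarrow> colim_class M (Cod M w) Y t \<beta>)"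

text \<open>Elements are stored by representatives so that a square consists of indices in
  \<open>'u\<close> and arrows of \<open>M\<close>, which can be coded in \<open>'u\<close>. That
  \<open>\<alpha>\<close> and \<open>\<beta>\<close> are arrows of \<open>M\<close> is recorded
  because the coding is injective only on those.\<close>

definition sq_ob :: "('u, 'a) square set" where
  "sq_ob = {k. fst k \<in> W \<and> snd (fst (snd k)) \<in> Arr M \<and> snd (snd (snd k)) \<in> Arr M \<and>
    top_el k \<in> colim_hom M (Dom M (fst k)) X \<and> bot_el k \<in> colim_hom M (Cod M (fst k)) Y \<and>
    ind_act M f (top_el k) = el_res M Y (bot_el k) (fst k)}"

definition sq_map :: "('u, 'a) square \<Rightarrow> ('u, 'a) square \<Rightarrow> 'a \<Rightarrow> 'a \<Rightarrow> bool" where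
  "sq_map k k' p q \<longleftrightarrow> k \<in> sq_ob \<and> k' \<in> sq_ob \<and>
    p \<in> homset M (Dom M (fst k)) (Dom M (fst k')) \<and> q \<in> homset M (Cod M (fst k)) (Cod M (fst k')) \<and>
    fst k' \<cdot> p = q \<cdot> fst k \<and> el_res M X (top_el k') p = top_el k \<and> el_res M Y (bot_el k') q = bot_el
      k"

text \<open>The full subcategory, on the members of \<open>W\<close>, of the category of arrows of
  \<open>M\<close> over \<open>f\<close>. Arrows carry both end objects because \<open>Dom\<close>
  and \<open>Cod\<close> must be functions of the arrow.\<close>

definition squares :: "(('u, 'a) square,
    ('u, 'a) square \<times> ('a \<times> 'a) \<times> ('u, 'a) square) cat" where
  "squares = \<lparr>Obj = sq_ob, Arr = {(k, (p, q), k'). sq_map k k' p q},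
    Dom = fst, Cod = (\<lambda>m. snd (snd m)),
    Idn = (\<lambda>k. (k, (Idn M (Dom M (fst k)), Idn M (Cod M (fst k))), k)),
    Cmp = (\<lambda>(_, (p', q'), k'') (k, (p, q), _). (k, (p' \<cdot> p, q' \<cdot> q), k''))\<rparr>"

lemma squares_homset: "m \<in> homset squares k k' \<longleftrightarrow> (\<exists>p q. m = (k, (p, q), k') \<and> sq_map k k' p q)"
  by (cases m) (auto simp: squares_def homset_def)

lemma squares_Cmp: "(k', (p', q'), k'') \<cdot>\<^bsub>squares\<^esub> (k, (p, q), k') = (k, (p' \<cdot> p, q' \<cdot> q), k'')"
  by (simp add: squares_def)

lemma squares_Obj: "Obj squares = sq_ob"
  by (simp add: squares_def)

lemma sq_obD:
  assumes "k \<in> sq_ob"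
  shows "fst k \<in> W" "fst k \<in> homset M (Dom M (fst k)) (Cod M (fst k))"
    "Dom M (fst k) \<in> Obj M" "Cod M (fst k) \<in> Obj M"
    "top_el k \<in> colim_hom M (Dom M (fst k)) X" "bot_el k \<in> colim_hom M (Cod M (fst k)) Y"
    "ind_act M f (top_el k) = el_res M Y (bot_el k) (fst k)"
proof -
  show w: "fst k \<in> W" "top_el k \<in> colim_hom M (Dom M (fst k)) X"
    "bot_el k \<in> colim_hom M (Cod M (fst k)) Y"
    "ind_act M f (top_el k) = el_res M Y (bot_el k) (fst k)"
    using assms unfolding sq_ob_def by auto
  then have "fst k \<in> Arr M" using W_Arr by blast
  then show "fst k \<in> homset M (Dom M (fst k)) (Cod M (fst k))"
    "Dom M (fst k) \<in> Obj M" "Cod M (fst k) \<in> Obj M"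
    using Dom_in Cod_in by (auto simp: homset_def)
qed

lemma sq_mapD:
  assumes "sq_map k k' p q"
  shows "k \<in> sq_ob" "k' \<in> sq_ob" "p \<in> homset M (Dom M (fst k)) (Dom M (fst k'))"
    "q \<in> homset M (Cod M (fst k)) (Cod M (fst k'))" "fst k' \<cdot> p = q \<cdot> fst k"
    "el_res M X (top_el k') p = top_el k" "el_res M Y (bot_el k') q = bot_el k"
  using assms unfolding sq_map_def by auto

lemma sq_map_Idn: "k \<in> sq_ob \<Longrightarrow> sq_map k k (Idn M (Dom M (fst k))) (Idn M (Cod M (fst k)))"
  using sq_obD[of k] Idn_in Cmp_Idn[OF sq_obD(2)] Idn_Cmp[OF sq_obD(2)]
    el_res_Idn[OF X sq_obD(5)] el_res_Idn[OF Y sq_obD(6)]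
  unfolding sq_map_def by simp

lemma sq_map_Cmp:
  assumes 1: "sq_map k k' p q" and 2: "sq_map k' k'' p' q'"
  shows "sq_map k k'' (p' \<cdot> p) (q' \<cdot> q)"
proof -
  note a = sq_mapD[OF 1] and b = sq_mapD[OF 2]
  note w = sq_obD(2)[OF a(1)] sq_obD(2)[OF a(2)] sq_obD(2)[OF b(2)]
  have "fst k'' \<cdot> (p' \<cdot> p) = (q' \<cdot> fst k') \<cdot> p"
    using Cmp_assoc[OF a(3) b(3) w(3)] b(5) by simp
  also have "\<dots> = (q' \<cdot> q) \<cdot> fst k"
    using Cmp_assoc[OF a(3) w(2) b(4)] Cmp_assoc[OF w(1) a(4) b(4)] a(5) by simp
  finally have sq: "fst k'' \<cdot> (p' \<cdot> p) = (q' \<cdot> q) \<cdot> fst k" .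
  have "el_res M X (top_el k'') (p' \<cdot> p) = top_el k" "el_res M Y (bot_el k'') (q' \<cdot> q) = bot_el k"
    using el_res_Cmp[OF X sq_obD(5)[OF b(2)] b(3) a(3)] el_res_Cmp[OF Y sq_obD(6)[OF b(2)] b(4)
      a(4)]
      a(6,7) b(6,7) by simp_all
  then show ?thesis
    unfolding sq_map_def using a(1) b(2) Cmp_in[OF a(3) b(3)] Cmp_in[OF a(4) b(4)] sq by simp
qed

lemma squares_category: "category squares"
proof
  show "Dom squares m \<in> Obj squares" "Cod squares m \<in> Obj squares" if "m \<in> Arr squares" for m
    using that sq_mapD(1,2) by (auto simp: squares_def)
  show "Idn squares k \<in> homset squares k k" if "k \<in> Obj squares" for k
    using sq_map_Idn[of k] that unfolding squares_homset by (simp add: squares_def)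
  fix k k' m assume "m \<in> homset squares k k'"
  then obtain p q where m: "m = (k, (p, q), k')" "sq_map k k' p q" unfolding squares_homset by blast
  show "m \<cdot>\<^bsub>squares\<^esub> Idn squares k = m" "Idn squares k' \<cdot>\<^bsub>squares\<^esub> m = m"
    using Cmp_Idn[OF sq_mapD(3)[OF m(2)]] Cmp_Idn[OF sq_mapD(4)[OF m(2)]]
      Idn_Cmp[OF sq_mapD(3)[OF m(2)]] Idn_Cmp[OF sq_mapD(4)[OF m(2)]]
    by (simp_all add: squares_def m(1))
  fix k'' n assume "n \<in> homset squares k' k''"
  then obtain p' q' where n: "n = (k', (p', q'), k'')" "sq_map k' k'' p' q'" unfolding
    squares_homset by blast
  show "n \<cdot>\<^bsub>squares\<^esub> m \<in> homset squares k k''"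
    using sq_map_Cmp[OF m(2) n(2)] unfolding m(1) n(1) squares_Cmp squares_homset by blast
  fix k3 l assume "l \<in> homset squares k'' k3"
  then obtain p3 q3 where l: "l = (k'', (p3, q3), k3)" "sq_map k'' k3 p3 q3" unfolding
    squares_homset by blast
  show "(l \<cdot>\<^bsub>squares\<^esub> n) \<cdot>\<^bsub>squares\<^esub> m = l \<cdot>\<^bsub>squares\<^esub> (n \<cdot>\<^bsub>squares\<^esub> m)"
    unfolding m(1) n(1) l(1) squares_Cmp
    using Cmp_assoc[OF sq_mapD(3)[OF m(2)] sq_mapD(3)[OF n(2)] sq_mapD(3)[OF l(2)]]
      Cmp_assoc[OF sq_mapD(4)[OF m(2)] sq_mapD(4)[OF n(2)] sq_mapD(4)[OF l(2)]] by simp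
qed

lemma square_factor:
  assumes "u \<in> homset M A B" "x \<in> colim_hom M A X" "y \<in> colim_hom M B Y" "ind_act M f x =
      el_res M Y y u"
  obtains k p q where "k \<in> sq_ob" "p \<in> homset M A (Dom M (fst k))" "q \<in> homset M B (Cod M (fst k))"
    "fst k \<cdot> p = q \<cdot> u" "x = el_res M X (top_el k) p" "y = el_res M Y (bot_el k) q"
proof -
  obtain P Q w p q x' y' where w: "w \<in> W" "w \<in> homset M P Q" "p \<in> homset M A P"
    "q \<in> homset M B Q" "w \<cdot> p = q \<cdot> u" and xy: "x' \<in> colim_hom M P X" "y' \<in> colim_hom M Q Y"
    "ind_act M f x' = el_res M Y y' w" "x = el_res M X x' p" "y = el_res M Y y' q"
    by (rule W_denseE[OF dense assms])
  obtain s \<alpha> where s': "\<alpha> \<in> homset M P (FOb (snd X) s)" and s: "x' = colim_class M P X s \<alpha>"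
    by (rule colim_hom_cases[of x' P "fst X" "snd X", unfolded prod.collapse, OF xy(1)])
  obtain t \<beta> where t': "\<beta> \<in> homset M Q (FOb (snd Y) t)" and t: "y' = colim_class M Q Y t \<beta>"
    by (rule colim_hom_cases[of y' Q "fst Y" "snd Y", unfolded prod.collapse, OF xy(2)])
  have arr: "\<alpha> \<in> Arr M" "\<beta> \<in> Arr M" using s' t' by (simp_all add: homset_def)
  let ?k = "(w, (s, \<alpha>), (t, \<beta>))"
  have PQ: "Dom M w = P" "Cod M w = Q" using w(2) by (simp_all add: homset_def)
  then have e: "top_el ?k = x'" "bot_el ?k = y'" using s t by (simp_all add: top_el_def bot_el_def)
  have "?k \<in> sq_ob" unfolding sq_ob_def using e w(1) arr xy PQ by simp
  then show thesis using that[of ?k p q] w PQ xy(4,5) e by simp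
qed

text \<open>Each requirement is met in two moves: a pushout in \<open>M\<close> yields some arrow
  with a square to \<open>f\<close>, and density replaces that arrow by a weak equivalence.\<close>

lemma squares_filtered: "filtered squares"
  unfolding filtered_def
proof (intro conjI ballI impI)
  show "category squares" by (rule squares_category)
  obtain I where I: "is_initial M I" using initial_exists[OF colims] .
  then have IO: "I \<in> Obj M" by (simp add: is_initial_def)
  obtain x where x: "x \<in> colim_hom M I X" using el_nonempty[OF X I] by blast
  note fx = ind_act_in[OF f x]
  \<comment> \<open>The square to be factored starts at the identity of the initial object, over its
    only element in \<open>X\<close>.\<close>
  obtain k where "k \<in> sq_ob"
    using square_factor[OF Idn_in[OF IO] x fx el_res_Idn[OF Y fx IO, symmetric]] by metis
  then show "Obj squares \<noteq> {}" unfolding squares_Obj by blast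
next
  fix k1 k2 assume "k1 \<in> Obj squares" "k2 \<in> Obj squares"
  then have k: "k1 \<in> sq_ob" "k2 \<in> sq_ob" unfolding squares_Obj by auto
  note k1 = sq_obD[OF k(1)] and k2 = sq_obD[OF k(2)]
  \<comment> \<open>The tops are joined in \<open>P\<close>. Pushing out the weak equivalences of
    \<open>k1\<close> and then \<open>k2\<close> along the maps from their tops gives an object
    \<open>S\<close> that receives both bottoms and \<open>P\<close>; the arrow to be factored is
    the resulting \<open>P \<rightarrow> S\<close>.\<close>
  obtain P x p1 p2 where x: "x \<in> colim_hom M P X" and p: "p1 \<in> homset M (Dom M (fst k1)) P"
    "p2 \<in> homset M (Dom M (fst k2)) P" and xp: "top_el k1 = el_res M X x p1" "top_el k2 =
        el_res M X x p2"
    using el_joint_factor[OF X k1(5) k2(5)] by metis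
  note fx = ind_act_in[OF f x]
  obtain R a b where po: "is_pushout M (fst k1) p1 a b" and ab: "a \<in> homset M (Cod M (fst k1)) R"
    "b \<in> homset M P R"
    using pushout_exists[OF colims k1(2) p(1)] by metis
  have dc: "Cod M p1 = P" "Cod M a = R" "Cod M (fst k1) = Cod M (fst k1)" using p ab by
    (simp_all add: homset_def)
  have "el_res M Y (bot_el k1) (fst k1) = el_res M Y (ind_act M f x) p1"
    using k1(7) ind_act_res[OF f x p(1)] xp(1) by simp
  then obtain z where z: "z \<in> colim_hom M R Y" "el_res M Y z a = bot_el k1" "el_res M Y z b =
      ind_act M f x"
    using el_glue[OF Y po k1(6), unfolded dc, OF fx] by metis
  obtain S a' b' where po': "is_pushout M (fst k2) (b \<cdot> p2) a' b'" and ab':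
    "a' \<in> homset M (Cod M (fst k2)) S" "b' \<in> homset M R S"
    using pushout_exists[OF colims k2(2) Cmp_in[OF p(2) ab(2)]] by metis
  have dc': "Cod M (b \<cdot> p2) = R" "Cod M a' = S" using Cmp_in[OF p(2) ab(2)] ab' by
    (simp_all add: homset_def)
  have "el_res M Y (bot_el k2) (fst k2) = el_res M Y z (b \<cdot> p2)"
    using k2(7) ind_act_res[OF f x p(2)] xp(2) el_res_Cmp[OF Y z(1) ab(2) p(2)] z(3) by simp
  then obtain v where v: "v \<in> colim_hom M S Y" "el_res M Y v a' = bot_el k2" "el_res M Y v b' = z"
    using el_glue[OF Y po' k2(6), unfolded dc', OF z(1)] by metis
  have "ind_act M f x = el_res M Y v (b' \<cdot> b)"
    using el_res_Cmp[OF Y v(1) ab'(2) ab(2)] v(3) z(3) by simp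
  then obtain k r q where k: "k \<in> sq_ob" "r \<in> homset M P (Dom M (fst k))"
    "q \<in> homset M S (Cod M (fst k))"
    "fst k \<cdot> r = q \<cdot> (b' \<cdot> b)" "x = el_res M X (top_el k) r" "v = el_res M Y (bot_el k) q"
    using square_factor[OF Cmp_in[OF ab(2) ab'(2)] x v(1)] by metis
  note kk = sq_obD[OF k(1)]
  have "sq_map k1 k (r \<cdot> p1) (q \<cdot> (b' \<cdot> a))"
    unfolding sq_map_def
  proof (intro conjI)
    show "r \<cdot> p1 \<in> homset M (Dom M (fst k1)) (Dom M (fst k))" by (rule Cmp_in[OF p(1) k(2)])
    show "q \<cdot> (b' \<cdot> a) \<in> homset M (Cod M (fst k1)) (Cod M (fst k))"
      by (rule Cmp_in[OF Cmp_in[OF ab(1) ab'(2)] k(3)])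
    have "fst k \<cdot> (r \<cdot> p1) = (q \<cdot> (b' \<cdot> b)) \<cdot> p1" using Cmp_assoc[OF p(1) k(2) kk(2)] k(4) by simp
    also have "\<dots> = q \<cdot> (b' \<cdot> (b \<cdot> p1))"
      using Cmp_assoc[OF p(1) Cmp_in[OF ab(2) ab'(2)] k(3)] Cmp_assoc[OF p(1) ab(2) ab'(2)] by simp
    also have "\<dots> = (q \<cdot> (b' \<cdot> a)) \<cdot> fst k1"
      using is_pushoutD(9)[OF po] Cmp_assoc[OF k1(2) Cmp_in[OF ab(1) ab'(2)] k(3)]
        Cmp_assoc[OF k1(2) ab(1) ab'(2)] by simp
    finally show "fst k \<cdot> (r \<cdot> p1) = (q \<cdot> (b' \<cdot> a)) \<cdot> fst k1" .
    show "el_res M X (top_el k) (r \<cdot> p1) = top_el k1"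
      using el_res_Cmp[OF X kk(5) k(2) p(1)] k(5) xp(1) by simp
    show "el_res M Y (bot_el k) (q \<cdot> (b' \<cdot> a)) = bot_el k1"
      using el_res_Cmp[OF Y kk(6) k(3) Cmp_in[OF ab(1) ab'(2)]] el_res_Cmp[OF Y v(1) ab'(2) ab(1)]
        k(6) v(3) z(2) by simp
  qed fact+
  moreover have "sq_map k2 k (r \<cdot> p2) (q \<cdot> a')"
    unfolding sq_map_def
  proof (intro conjI)
    show "r \<cdot> p2 \<in> homset M (Dom M (fst k2)) (Dom M (fst k))" by (rule Cmp_in[OF p(2) k(2)])
    show "q \<cdot> a' \<in> homset M (Cod M (fst k2)) (Cod M (fst k))" by (rule Cmp_in[OF ab'(1) k(3)])
    have "fst k \<cdot> (r \<cdot> p2) = (q \<cdot> (b' \<cdot> b)) \<cdot> p2" using Cmp_assoc[OF p(2) k(2) kk(2)] k(4) by simp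
    also have "\<dots> = q \<cdot> (b' \<cdot> (b \<cdot> p2))"
      using Cmp_assoc[OF p(2) Cmp_in[OF ab(2) ab'(2)] k(3)] Cmp_assoc[OF p(2) ab(2) ab'(2)] by simp
    also have "\<dots> = (q \<cdot> a') \<cdot> fst k2"
      using is_pushoutD(9)[OF po'] Cmp_assoc[OF k2(2) ab'(1) k(3)] by simp
    finally show "fst k \<cdot> (r \<cdot> p2) = (q \<cdot> a') \<cdot> fst k2" .
    show "el_res M X (top_el k) (r \<cdot> p2) = top_el k2"
      using el_res_Cmp[OF X kk(5) k(2) p(2)] k(5) xp(2) by simp
    show "el_res M Y (bot_el k) (q \<cdot> a') = bot_el k2"
      using el_res_Cmp[OF Y kk(6) k(3) ab'(1)] k(6) v(2) by simp
  qed fact+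
  ultimately show "\<exists>r. homset squares k1 r \<noteq> {} \<and> homset squares k2 r \<noteq> {}"
    using squares_homset by blast
next
  fix m n assume mn: "m \<in> Arr squares" "n \<in> Arr squares"
    and par: "Dom squares m = Dom squares n \<and> Cod squares m = Cod squares n"
  obtain k k' p q where m: "m = (k, (p, q), k')" "sq_map k k' p q"
    using mn(1) by (auto simp: squares_def)
  obtain p' q' where n: "n = (k, (p', q'), k')" "sq_map k k' p' q'"
    using mn(2) par m(1) by (auto simp: squares_def)
  note pq = sq_mapD[OF m(2)] and pq' = sq_mapD[OF n(2)]
  note k' = sq_obD[OF pq(2)]
  obtain P e x where e: "x \<in> colim_hom M P X" "e \<in> homset M (Dom M (fst k')) P"
    "top_el k' = el_res M X x e" "e \<cdot> p = e \<cdot> p'"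
    using el_equalize[OF X k'(5) pq(3) pq'(3)] pq(6) pq'(6) by metis
  obtain Q d y where d: "y \<in> colim_hom M Q Y" "d \<in> homset M (Cod M (fst k')) Q"
    "bot_el k' = el_res M Y y d" "d \<cdot> q = d \<cdot> q'"
    using el_equalize[OF Y k'(6) pq(4) pq'(4)] pq(7) pq'(7) by metis
  note dw = Cmp_in[OF k'(2) d(2)]
  note fx = ind_act_in[OF f e(1)]
  \<comment> \<open>The tops were equalized by \<open>e\<close> and the bottoms by \<open>d\<close>,
    independently. This pushout reconciles the two enlargements, and its leg \<open>a\<close> is the
    arrow to be factored.\<close>
  obtain R a b where po: "is_pushout M e (d \<cdot> fst k') a b" and ab: "a \<in> homset M P R"
    "b \<in> homset M Q R"
    using pushout_exists[OF colims e(2) dw] by metis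
  have dc: "Cod M e = P" "Cod M (d \<cdot> fst k') = Q" "Cod M a = R" using e(2) dw ab by
    (simp_all add: homset_def)
  have "el_res M Y (ind_act M f x) e = el_res M Y y (d \<cdot> fst k')"
    using k'(7) ind_act_res[OF f e(1,2)] e(3) d(3) el_res_Cmp[OF Y d(1,2) k'(2)] by simp
  then obtain z where z: "z \<in> colim_hom M R Y" "el_res M Y z a = ind_act M f x" "el_res M Y z b = y"
    using el_glue[OF Y po, unfolded dc, OF fx d(1)] by metis
  obtain l r s where l: "l \<in> sq_ob" "r \<in> homset M P (Dom M (fst l))"
    "s \<in> homset M R (Cod M (fst l))"
    "fst l \<cdot> r = s \<cdot> a" "x = el_res M X (top_el l) r" "z = el_res M Y (bot_el l) s"
    using square_factor[OF ab(1) e(1) z(1) z(2)[symmetric]] by metis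
  note ll = sq_obD[OF l(1)]
  have "sq_map k' l (r \<cdot> e) (s \<cdot> (b \<cdot> d))"
    unfolding sq_map_def
  proof (intro conjI)
    show "k' \<in> sq_ob" "l \<in> sq_ob" by fact+
    show "r \<cdot> e \<in> homset M (Dom M (fst k')) (Dom M (fst l))" by (rule Cmp_in[OF e(2) l(2)])
    show "s \<cdot> (b \<cdot> d) \<in> homset M (Cod M (fst k')) (Cod M (fst l))"
      by (rule Cmp_in[OF Cmp_in[OF d(2) ab(2)] l(3)])
    have "fst l \<cdot> (r \<cdot> e) = s \<cdot> (a \<cdot> e)"
      using Cmp_assoc[OF e(2) l(2) ll(2)] Cmp_assoc[OF e(2) ab(1) l(3)] l(4) by simp
    also have "\<dots> = (s \<cdot> (b \<cdot> d)) \<cdot> fst k'"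
      using is_pushoutD(9)[OF po] Cmp_assoc[OF k'(2) d(2) ab(2)]
        Cmp_assoc[OF k'(2) Cmp_in[OF d(2) ab(2)] l(3)]
      by simp
    finally show "fst l \<cdot> (r \<cdot> e) = (s \<cdot> (b \<cdot> d)) \<cdot> fst k'" .
    show "el_res M X (top_el l) (r \<cdot> e) = top_el k'"
      using el_res_Cmp[OF X ll(5) l(2) e(2)] l(5) e(3) by simp
    show "el_res M Y (bot_el l) (s \<cdot> (b \<cdot> d)) = bot_el k'"
      using el_res_Cmp[OF Y ll(6) l(3) Cmp_in[OF d(2) ab(2)]] el_res_Cmp[OF Y z(1) ab(2) d(2)]
        l(6) z(3) d(3) by simp
  qed
  then have "(k', (r \<cdot> e, s \<cdot> (b \<cdot> d)), l) \<in> homset squares k' l" unfolding squares_homset by blast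
  moreover have "(r \<cdot> e) \<cdot> p = (r \<cdot> e) \<cdot> p'"
    using Cmp_assoc[OF pq(3) e(2) l(2)] Cmp_assoc[OF pq'(3) e(2) l(2)] e(4) by simp
  moreover have "(s \<cdot> (b \<cdot> d)) \<cdot> q = (s \<cdot> (b \<cdot> d)) \<cdot> q'"
    using Cmp_assoc[OF pq(4) Cmp_in[OF d(2) ab(2)] l(3)] Cmp_assoc[OF pq'(4) Cmp_in[OF d(2) ab(2)]
      l(3)]
      Cmp_assoc[OF pq(4) d(2) ab(2)] Cmp_assoc[OF pq'(4) d(2) ab(2)] d(4) by simp
  ultimately show "\<exists>w \<in> Arr squares. Dom squares w = Cod squares m \<and> w \<cdot>\<^bsub>squares\<^esub> m =
      w \<cdot>\<^bsub>squares\<^esub> n"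
    unfolding m(1) n(1)
    by (intro bexI[of _ "(k', (r \<cdot> e, s \<cdot> (b \<cdot> d)), l)"])
      (auto simp: squares_Cmp homset_def squares_def)
qed

text \<open>The injectivity needed to recognise \<open>X\<close> as the colimit of the tops. The top
  is enlarged until \<open>h\<close> and \<open>h'\<close> agree, the bottom follows by a pushout,
  and density restores a weak equivalence.\<close>

lemma top_el_equalize:
  assumes k: "k \<in> sq_ob" and h: "h \<in> homset M A (Dom M (fst k))" "h' \<in> homset M A (Dom M (fst k))"
    and eq: "el_res M X (top_el k) h = el_res M X (top_el k) h'"
  obtains l p q where "sq_map k l p q" "p \<cdot> h = p \<cdot> h'"
proof -
  note kk = sq_obD[OF k]
  obtain P e x where e: "x \<in> colim_hom M P X" "e \<in> homset M (Dom M (fst k)) P"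
    "top_el k = el_res M X x e" "e \<cdot> h = e \<cdot> h'"
    using el_equalize[OF X kk(5) h eq] by metis
  note fx = ind_act_in[OF f e(1)]
  obtain R a b where po: "is_pushout M (fst k) e a b" and ab: "a \<in> homset M (Cod M (fst k)) R"
    "b \<in> homset M P R"
    using pushout_exists[OF colims kk(2) e(2)] by metis
  have dc: "Cod M e = P" "Cod M a = R" using e(2) ab by (simp_all add: homset_def)
  have "el_res M Y (bot_el k) (fst k) = el_res M Y (ind_act M f x) e"
    using kk(7) ind_act_res[OF f e(1,2)] e(3) by simp
  then obtain z where z: "z \<in> colim_hom M R Y" "el_res M Y z a = bot_el k" "el_res M Y z b =
      ind_act M f x"
    using el_glue[OF Y po kk(6), unfolded dc, OF fx] by metis
  obtain l r s where l: "l \<in> sq_ob" "r \<in> homset M P (Dom M (fst l))"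
    "s \<in> homset M R (Cod M (fst l))"
    "fst l \<cdot> r = s \<cdot> b" "x = el_res M X (top_el l) r" "z = el_res M Y (bot_el l) s"
    using square_factor[OF ab(2) e(1) z(1) z(3)[symmetric]] by metis
  note ll = sq_obD[OF l(1)]
  have "sq_map k l (r \<cdot> e) (s \<cdot> a)"
    unfolding sq_map_def
  proof (intro conjI)
    show "k \<in> sq_ob" "l \<in> sq_ob" by fact+
    show "r \<cdot> e \<in> homset M (Dom M (fst k)) (Dom M (fst l))" by (rule Cmp_in[OF e(2) l(2)])
    show "s \<cdot> a \<in> homset M (Cod M (fst k)) (Cod M (fst l))" by (rule Cmp_in[OF ab(1) l(3)])
    show "fst l \<cdot> (r \<cdot> e) = (s \<cdot> a) \<cdot> fst k"
      using Cmp_assoc[OF e(2) l(2) ll(2)] Cmp_assoc[OF e(2) ab(2) l(3)] l(4)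
        is_pushoutD(9)[OF po] Cmp_assoc[OF kk(2) ab(1) l(3)] by simp
    show "el_res M X (top_el l) (r \<cdot> e) = top_el k"
      using el_res_Cmp[OF X ll(5) l(2) e(2)] l(5) e(3) by simp
    show "el_res M Y (bot_el l) (s \<cdot> a) = bot_el k"
      using el_res_Cmp[OF Y ll(6) l(3) ab(1)] l(6) z(2) by simp
  qed
  moreover have "(r \<cdot> e) \<cdot> h = (r \<cdot> e) \<cdot> h'"
    using Cmp_assoc[OF h(1) e(2) l(2)] Cmp_assoc[OF h(2) e(2) l(2)] e(4) by simp
  ultimately show thesis by (rule that)
qed

text \<open>Here the top can stay as it is before density is applied: composing the weak equivalence
  with the enlargement \<open>e\<close> of its codomain again gives an arrow with a square to
  \<open>f\<close>.\<close>

lemma bot_el_equalize: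
  assumes k: "k \<in> sq_ob" and h: "h \<in> homset M A (Cod M (fst k))" "h' \<in> homset M A (Cod M (fst k))"
    and eq: "el_res M Y (bot_el k) h = el_res M Y (bot_el k) h'"
  obtains l p q where "sq_map k l p q" "q \<cdot> h = q \<cdot> h'"
proof -
  note kk = sq_obD[OF k]
  obtain Q e y where e: "y \<in> colim_hom M Q Y" "e \<in> homset M (Cod M (fst k)) Q"
    "bot_el k = el_res M Y y e" "e \<cdot> h = e \<cdot> h'"
    using el_equalize[OF Y kk(6) h eq] by metis
  have "ind_act M f (top_el k) = el_res M Y y (e \<cdot> fst k)"
    using kk(7) e(3) el_res_Cmp[OF Y e(1,2) kk(2)] by simp
  then obtain l r s where l: "l \<in> sq_ob" "r \<in> homset M (Dom M (fst k)) (Dom M (fst l))"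
    "s \<in> homset M Q (Cod M (fst l))"
    "fst l \<cdot> r = s \<cdot> (e \<cdot> fst k)" "top_el k = el_res M X (top_el l) r" "y = el_res M Y (bot_el l) s"
    using square_factor[OF Cmp_in[OF kk(2) e(2)] kk(5) e(1)] by metis
  note ll = sq_obD[OF l(1)]
  have "sq_map k l r (s \<cdot> e)"
    unfolding sq_map_def
    using k l Cmp_in[OF e(2) l(3)] Cmp_assoc[OF kk(2) e(2) l(3)] el_res_Cmp[OF Y ll(6) l(3) e(2)]
      e(3) by simp
  moreover have "(s \<cdot> e) \<cdot> h = (s \<cdot> e) \<cdot> h'"
    using Cmp_assoc[OF h(1) e(2) l(3)] Cmp_assoc[OF h(2) e(2) l(3)] e(4) by simp
  ultimately show thesis by (rule that)
qed

text \<open>The levelwise model consists of the domains, codomains and weak equivalences of all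
  squares, over a recoded index category. The elements stored in the squares form the comparison
  maps to \<open>X\<close> and \<open>Y\<close>: density makes every element occur in some square,
  and the equalizing lemmas detect equality at a later square.\<close>

lemma in_Lw_iso:
  assumes inf: "infinite (UNIV :: 'u set)" and e: "inj_on (e :: 'a \<Rightarrow> 'u) (Arr M)"
  shows "f \<in> Lw_iso M W"
proof -
  obtain pr :: "'u \<times> 'u \<Rightarrow> 'u" where pr: "inj pr" using infinite_pairing[OF inf] .
  then have prI: "pr a = pr b \<longleftrightarrow> a = b" for a b by (auto dest: injD)
  have eI: "e a = e b \<longleftrightarrow> a = b" if "a \<in> Arr M" "b \<in> Arr M" for a b
    using e that by (auto dest: inj_onD)
  \<comment> \<open>A square is determined by three arrows and two indices; \<open>e\<close> codes
    the arrows and nested pairs do the rest.\<close>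
  define en where "en k = (case k of (w, (s, \<alpha>), (t, \<beta>)) \<Rightarrow> pr (e w, pr (pr (s, e \<alpha>), pr (t, e \<beta>))))"
    for k :: "('u, 'a) square"
  define ar where "ar m = (case m of (k, (p, q), k') \<Rightarrow> pr (en k, pr (pr (e p, e q), en k')))"
    for m :: "('u, 'a) square \<times> ('a \<times> 'a) \<times> ('u, 'a) square"
  have en: "inj_on en sq_ob"
    using W_Arr unfolding inj_on_def sq_ob_def en_def by
      (auto simp: prI eI subset_iff split: prod.splits)
  have ar: "inj_on ar (Arr squares)"
  proof (rule inj_onI)
    fix m n assume mn: "m \<in> Arr squares" "n \<in> Arr squares" "ar m = ar n"
    obtain k p q k' where m: "m = (k, (p, q), k')" "sq_map k k' p q" using mn(1) by
      (auto simp: squares_def)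
    obtain l r s l' where n: "n = (l, (r, s), l')" "sq_map l l' r s" using mn(2) by
      (auto simp: squares_def)
    have "en k = en l" "e p = e r" "e q = e s" "en k' = en l'"
      using mn(3) by (simp_all add: m(1) n(1) ar_def prI)
    moreover have "p \<in> Arr M" "q \<in> Arr M" "r \<in> Arr M" "s \<in> Arr M"
      using sq_mapD(3,4)[OF m(2)] sq_mapD(3,4)[OF n(2)] by (simp_all add: homset_def)
    ultimately show "m = n"
      using m(1) n(1) eI inj_onD[OF en] sq_mapD(1,2)[OF m(2)] sq_mapD(1,2)[OF n(2)] by simp
  qed
  obtain K :: "('u, 'u) cat" and D where K: "filtered K" and D: "is_functor K squares D"
    and Dsurj: "\<And>k. k \<in> sq_ob \<Longrightarrow> \<exists>k' \<in> Obj K. FOb D k' = k"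
    and Dfull: "\<And>k' k'' m. \<lbrakk>k' \<in> Obj K; k'' \<in> Obj K; m \<in> homset squares (FOb D k') (FOb D k'')\<rbrakk>
      \<Longrightarrow> \<exists>u \<in> homset K k' k''. FAr D u = m"
    using filtered_transport[OF squares_filtered en[folded squares_Obj] ar] unfolding squares_Obj by
      metis
  interpret K: category K using K by (rule filtered_category)
  define FP :: "(('u, 'a) square, ('u, 'a) square \<times> ('a \<times> 'a) \<times> ('u, 'a) square, 'o, 'a) func" where
    "FP = \<lparr>FOb = (\<lambda>k. Dom M (fst k)), FAr = (\<lambda>m. fst (fst (snd m)))\<rparr>"
  define FQ :: "(('u, 'a) square, ('u, 'a) square \<times> ('a \<times> 'a) \<times> ('u, 'a) square, 'o, 'a) func" where
    "FQ = \<lparr>FOb = (\<lambda>k. Cod M (fst k)), FAr = (\<lambda>m. snd (fst (snd m)))\<rparr>"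
  have FP: "is_functor squares M FP"
    unfolding is_functor_def FP_def squares_def using sq_obD(3) sq_mapD(3) by auto
  have FQ: "is_functor squares M FQ"
    unfolding is_functor_def FQ_def squares_def using sq_obD(4) sq_mapD(4) by auto
  define P where "P = comp_func FP D"
  define Q where "Q = comp_func FQ D"
  note PF = is_functor_comp[OF D FP, folded P_def] and QF = is_functor_comp[OF D FQ, folded Q_def]
  have PO: "FOb P k = Dom M (fst (FOb D k))" and QO: "FOb Q k = Cod M (fst (FOb D k))" for k
    by (simp_all add: P_def Q_def FP_def FQ_def comp_func_def)
  have Dob: "FOb D k \<in> sq_ob" if "k \<in> Obj K" for k
    using D that unfolding is_functor_def squares_Obj by blast
  have Dmap: "sq_map (FOb D k) (FOb D k') (FAr P u) (FAr Q u)" if u: "u \<in> homset K k k'" for k k' u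
  proof -
    have "FAr D u \<in> homset squares (FOb D k) (FOb D k')"
      using D u unfolding is_functor_def homset_def by auto
    then show ?thesis
      unfolding squares_homset by (auto simp: P_def Q_def FP_def FQ_def comp_func_def)
  qed
  have KP: "ind_obj M (K, P)" and KQ: "ind_obj M (K, Q)" using K PF QF by
    (simp_all add: ind_obj_def)
  define \<tau> where "\<tau> k = fst (FOb D k)" for k
  have \<tau>: "nat_trans K M P Q \<tau>"
    unfolding nat_trans_def
  proof (intro conjI ballI)
    show "\<tau> k \<in> homset M (FOb P k) (FOb Q k)" if "k \<in> Obj K" for k
      using sq_obD(2)[OF Dob[OF that]] by (simp add: \<tau>_def PO QO)
    show "\<tau> (Cod K u) \<cdot> FAr P u = FAr Q u \<cdot> \<tau> (Dom K u)" if "u \<in> Arr K" for u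
      using sq_mapD(5)[OF Dmap] that unfolding \<tau>_def by (simp add: homset_def)
  qed
  note L = ind_level_arrow[OF K PF QF \<tau>]
  let ?L = "ind_level M K P Q \<tau>"
  have "\<exists>\<xi>. \<xi> \<in> homset (Ind M) (K, P) X \<and> (\<forall>k \<in> Obj K. ind_act M \<xi> (gen (K, P) k) =
      top_el (FOb D k))"
  proof -
    have 1: "top_el (FOb D s) \<in> colim_hom M (FOb P s) X" if "s \<in> Obj K" for s
      using sq_obD(5)[OF Dob[OF that]] by (simp add: PO)
    have 2: "el_res M X (top_el (FOb D t)) (FAr P v) = top_el (FOb D s)" if "v \<in> homset K s t" for s
      t v
      using sq_mapD(6)[OF Dmap[OF that]] .
    show ?thesis
      by (rule ind_arrow_construct[OF KP X, of "\<lambda>k. top_el (FOb D k)", unfolded fst_conv snd_conv,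
        OF 1 2])
        (assumption, assumption, intro exI conjI ballI, assumption, simp)
  qed
  then obtain \<xi> where \<xi>: "\<xi> \<in> homset (Ind M) (K, P) X"
    and \<xi>g: "\<And>k. k \<in> Obj K \<Longrightarrow> ind_act M \<xi> (gen (K, P) k) = top_el (FOb D k)" by blast
  have "\<exists>\<eta>. \<eta> \<in> homset (Ind M) (K, Q) Y \<and> (\<forall>k \<in> Obj K. ind_act M \<eta> (gen (K, Q) k) =
      bot_el (FOb D k))"
  proof -
    have 1: "bot_el (FOb D s) \<in> colim_hom M (FOb Q s) Y" if "s \<in> Obj K" for s
      using sq_obD(6)[OF Dob[OF that]] by (simp add: QO)
    have 2: "el_res M Y (bot_el (FOb D t)) (FAr Q v) = bot_el (FOb D s)" if "v \<in> homset K s t" for s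
      t v
      using sq_mapD(7)[OF Dmap[OF that]] .
    show ?thesis
      by (rule ind_arrow_construct[OF KQ Y, of "\<lambda>k. bot_el (FOb D k)", unfolded fst_conv snd_conv,
        OF 1 2])
        (assumption, assumption, intro exI conjI ballI, assumption, simp)
  qed
  then obtain \<eta> where \<eta>: "\<eta> \<in> homset (Ind M) (K, Q) Y"
    and \<eta>g: "\<And>k. k \<in> Obj K \<Longrightarrow> ind_act M \<eta> (gen (K, Q) k) = bot_el (FOb D k)" by blast
  have genP: "gen (K, P) k \<in> colim_hom M (FOb P k) (K, P)" if "k \<in> Obj K" for k
    using gen_in[OF KP, of k] that by simp
  have genQ: "gen (K, Q) k \<in> colim_hom M (FOb Q k) (K, Q)" if "k \<in> Obj K" for k
    using gen_in[OF KQ, of k] that by simp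
  \<comment> \<open>The recoding is full and reaches every square, so a map of squares out of a
    recoded one comes from an arrow of \<open>K\<close>.\<close>
  have lift: "\<exists>l'. \<exists>u \<in> homset K k l'. FAr P u = r \<and> FAr Q u = s"
    if k: "k \<in> Obj K" and m: "sq_map (FOb D k) l r s" for k l r s
  proof -
    obtain l' where l': "l' \<in> Obj K" "FOb D l' = l" using Dsurj sq_mapD(2)[OF m] by blast
    have "(FOb D k, (r, s), FOb D l') \<in> homset squares (FOb D k) (FOb D l')"
      using m l'(2) unfolding squares_homset by blast
    then obtain u where "u \<in> homset K k l'" "FAr D u = (FOb D k, (r, s), FOb D l')"
      using Dfull[OF k l'(1)] by blast
    then show ?thesis
      by (intro exI[of _ l'] bexI[of _ u]) (simp_all add: P_def Q_def FP_def FQ_def comp_func_def)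
  qed
  have bij\<xi>: "bij_betw (ind_act M \<xi>) (colim_hom M A (K, P)) (colim_hom M A X)" if A: "A \<in> Obj M" for
    A
  proof (rule ind_act_bijI[OF \<xi>], unfold fst_conv snd_conv)
    fix k A h h' assume k: "k \<in> Obj K" and h: "h \<in> homset M A (FOb P k)" "h' \<in> homset M A (FOb P k)"
      and eq: "el_res M X (ind_act M \<xi> (colim_class M (FOb P k) (K, P) k (Idn M (FOb P k)))) h =
        el_res M X (ind_act M \<xi> (colim_class M (FOb P k) (K, P) k (Idn M (FOb P k)))) h'"
    have "el_res M X (top_el (FOb D k)) h = el_res M X (top_el (FOb D k)) h'"
      using eq \<xi>g[OF k] by simp
    then obtain l r s where "sq_map (FOb D k) l r s" "r \<cdot> h = r \<cdot> h'"
      using top_el_equalize[OF Dob[OF k]] h unfolding PO by metis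
    then show "\<exists>l. \<exists>u \<in> homset K k l. FAr P u \<cdot> h = FAr P u \<cdot> h'" using lift[OF k] by metis
  next
    fix x assume x: "x \<in> colim_hom M A X"
    note fx = ind_act_in[OF f x]
    \<comment> \<open>An element \<open>x\<close> over \<open>A\<close> becomes a square by taking
      the identity of \<open>A\<close> on the left and its image under \<open>f\<close> at the
      bottom.\<close>
    obtain k p where k: "k \<in> sq_ob" "p \<in> homset M A (Dom M (fst k))" "x = el_res M X (top_el k) p"
      using square_factor[OF Idn_in[OF A] x fx el_res_Idn[OF Y fx A, symmetric]] by metis
    obtain k' where k': "k' \<in> Obj K" "FOb D k' = k" using Dsurj[OF k(1)] by blast
    show "\<exists>k \<in> Obj K. \<exists>h \<in> homset M A (FOb P k).
        x = el_res M X (ind_act M \<xi> (colim_class M (FOb P k) (K, P) k (Idn M (FOb P k)))) h"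
      using k k' \<xi>g[OF k'(1)] PO by (intro bexI[of _ k'] bexI[of _ p]) simp_all
  qed
  have bij\<eta>: "bij_betw (ind_act M \<eta>) (colim_hom M A (K, Q)) (colim_hom M A Y)" if A: "A \<in> Obj M" for
    A
  proof (rule ind_act_bijI[OF \<eta>], unfold fst_conv snd_conv)
    fix k A h h' assume k: "k \<in> Obj K" and h: "h \<in> homset M A (FOb Q k)" "h' \<in> homset M A (FOb Q k)"
      and eq: "el_res M Y (ind_act M \<eta> (colim_class M (FOb Q k) (K, Q) k (Idn M (FOb Q k)))) h =
        el_res M Y (ind_act M \<eta> (colim_class M (FOb Q k) (K, Q) k (Idn M (FOb Q k)))) h'"
    have "el_res M Y (bot_el (FOb D k)) h = el_res M Y (bot_el (FOb D k)) h'"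
      using eq \<eta>g[OF k] by simp
    then obtain l r s where "sq_map (FOb D k) l r s" "s \<cdot> h = s \<cdot> h'"
      using bot_el_equalize[OF Dob[OF k]] h unfolding QO by metis
    then show "\<exists>l. \<exists>u \<in> homset K k l. FAr Q u \<cdot> h = FAr Q u \<cdot> h'" using lift[OF k] by metis
  next
    fix y assume y: "y \<in> colim_hom M A Y"
    \<comment> \<open>An element of \<open>Y\<close> need not be in the image of \<open>f\<close>.
      The square is completed by the map from the initial object, over which \<open>X\<close> and
      \<open>Y\<close> have exactly one element each.\<close>
    obtain I where I: "is_initial M I" using initial_exists[OF colims] .
    then obtain u where u: "u \<in> homset M I A" using A unfolding is_initial_def by blast
    obtain x where x: "x \<in> colim_hom M I X" using el_nonempty[OF X I] by blast
    have "ind_act M f x = el_res M Y y u"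
      using el_nonempty[OF Y I] ind_act_in[OF f x] el_res_in[OF Y y u] by auto
    then obtain k q where k: "k \<in> sq_ob" "q \<in> homset M A (Cod M (fst k))"
      "y = el_res M Y (bot_el k) q"
      using square_factor[OF u x y] by metis
    obtain k' where k': "k' \<in> Obj K" "FOb D k' = k" using Dsurj[OF k(1)] by blast
    show "\<exists>k \<in> Obj K. \<exists>h \<in> homset M A (FOb Q k).
        y = el_res M Y (ind_act M \<eta> (colim_class M (FOb Q k) (K, Q) k (Idn M (FOb Q k)))) h"
      using k k' \<eta>g[OF k'(1)] QO by (intro bexI[of _ k'] bexI[of _ q]) simp_all
  qed
  obtain \<xi>' where \<xi>': "\<xi>' \<in> homset (Ind M) X (K, P)" "is_iso (Ind M) \<xi>'" "\<xi> \<cdot>\<^bsub>Ind M\<^esub> \<xi>' =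
      Idn (Ind M) X"
    using Ind_isoI[OF \<xi> bij\<xi>] by metis
  obtain \<eta>' where \<eta>': "\<eta>' \<in> homset (Ind M) Y (K, Q)" "is_iso (Ind M) \<eta>'" "\<eta>' \<cdot>\<^bsub>Ind M\<^esub> \<eta> =
      Idn (Ind M) (K, Q)"
    using Ind_isoI[OF \<eta> bij\<eta>] by metis
  have sq: "ind_act M f (ind_act M \<xi> c) = ind_act M \<eta> (ind_act M ?L c)" if c: "c \<in> colim_hom M A (K,
      P)" for A c
  proof -
    obtain k h where k: "k \<in> Obj K" "h \<in> homset M A (FOb P k)"
      "c = el_res M (K, P) (gen (K, P) k) h"
      using colim_hom_gen[OF KP c] unfolding fst_conv snd_conv by metis
    have \<tau>k: "\<tau> k \<in> homset M (FOb P k) (FOb Q k)" using \<tau> k(1) by (simp add: nat_trans_def)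
    have "ind_act M f (ind_act M \<xi> (gen (K, P) k)) = ind_act M \<eta> (ind_act M ?L (gen (K, P) k))"
      unfolding \<xi>g[OF k(1)] L(2)[OF k(1)] ind_act_res[OF \<eta> genQ[OF k(1)] \<tau>k] \<eta>g[OF k(1)]
      using sq_obD(7)[OF Dob[OF k(1)]] by (simp add: \<tau>_def)
    then show ?thesis
      unfolding k(3) ind_act_res[OF \<xi> genP[OF k(1)] k(2)] ind_act_res[OF L(1) genP[OF k(1)] k(2)]
        ind_act_res[OF f ind_act_in[OF \<xi> genP[OF k(1)]] k(2)]
        ind_act_res[OF \<eta> ind_act_in[OF L(1) genP[OF k(1)]] k(2)] by simp
  qed
  have "\<eta>' \<cdot>\<^bsub>Ind M\<^esub> f = ?L \<cdot>\<^bsub>Ind M\<^esub> \<xi>'"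
  proof (rule ind_arrow_ext[OF Ind_Cmp(1)[OF f \<eta>'(1)] Ind_Cmp(1)[OF \<xi>'(1) L(1)]])
    fix s assume s: "s \<in> Obj (fst X)"
    note g = gen_in[OF X s]
    note g' = ind_act_in[OF \<xi>'(1) g]
    have "ind_act M \<eta>' (ind_act M f (gen X s)) =
        ind_act M \<eta>' (ind_act M \<eta> (ind_act M ?L (ind_act M \<xi>' (gen X s))))"
      using sq[OF g'] ind_act_inverse[OF \<xi>'(1) \<xi> \<xi>'(3) g] by simp
    also have "\<dots> = ind_act M ?L (ind_act M \<xi>' (gen X s))"
      by (rule ind_act_inverse[OF \<eta> \<eta>'(1,3) ind_act_in[OF L(1) g']])
    finally show "ind_act M (\<eta>' \<cdot>\<^bsub>Ind M\<^esub> f) (gen X s) = ind_act M (?L \<cdot>\<^bsub>Ind M\<^esub> \<xi>') (gen X s)"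
      using Ind_Cmp(2)[OF f \<eta>'(1) g] Ind_Cmp(2)[OF \<xi>'(1) L(1) g] by simp
  qed
  moreover have "Dom (Ind M) f = X" "Cod (Ind M) f = Y" "Dom (Ind M) ?L = (K, P)" "Cod (Ind M) ?L =
      (K, Q)"
    "f \<in> Arr (Ind M)" "?L \<in> Arr (Ind M)"
    using f L(1) by (simp_all add: homset_def)
  ultimately have "arrows_isomorphic (Ind M) f ?L"
    unfolding arrows_isomorphic_def using \<xi>'(1,2) \<eta>'(1,2) by metis
  moreover have "\<forall>s \<in> Obj K. \<tau> s \<in> W" using sq_obD(1)[OF Dob] by (simp add: \<tau>_def)
  ultimately show ?thesis unfolding Lw_iso_def using K PF QF \<tau> by blast
qed

end

section \<open>Finite simplicial sets\<close>

lemma ord_maps_nth: "\<lbrakk>\<theta> \<in> ord_maps m n; i \<le> m\<rbrakk> \<Longrightarrow> \<theta> ! i \<le> n"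
  using nth_mem[of i \<theta>] unfolding ord_maps_def by (auto simp del: nth_mem)

lemma ord_comp_in:
  assumes "\<theta> \<in> ord_maps m n" "\<phi> \<in> ord_maps k m"
  shows "ord_comp \<theta> \<phi> \<in> ord_maps k n"
proof -
  have \<phi>: "length \<phi> = Suc k" "sorted \<phi>" "set \<phi> \<subseteq> {..m}" and \<theta>: "length \<theta> = Suc m" "sorted \<theta>"
    using assms by (auto simp: ord_maps_def)
  have "sorted (ord_comp \<theta> \<phi>)"
    unfolding ord_comp_def sorted_map
  proof (rule sorted_wrt_mono_rel[OF _ \<phi>(2)])
    fix x y assume "x \<in> set \<phi>" "y \<in> set \<phi>" "x \<le> y"
    then show "\<theta> ! x \<le> \<theta> ! y" using \<theta> \<phi>(3) by (intro sorted_nth_mono) auto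
  qed
  moreover have "set (ord_comp \<theta> \<phi>) \<subseteq> {..n}"
    using ord_maps_nth[OF assms(1)] \<phi>(3) unfolding ord_comp_def by auto
  ultimately show ?thesis using \<phi>(1) by (simp add: ord_maps_def ord_comp_def)
qed

lemma ord_comp_assoc:
  assumes "\<phi> \<in> ord_maps m n" "\<psi> \<in> ord_maps k m"
  shows "ord_comp (ord_comp \<theta> \<phi>) \<psi> = ord_comp \<theta> (ord_comp \<phi> \<psi>)"
  using assms unfolding ord_comp_def ord_maps_def by (auto intro!: nth_map)

lemma ord_comp_id: "\<theta> \<in> ord_maps m n \<Longrightarrow> ord_comp \<theta> [0..<Suc m] = \<theta>"
  unfolding ord_comp_def ord_maps_def using map_nth[of \<theta>] by auto

lemma ord_maps_0: "ord_maps m 0 = {replicate (Suc m) 0}"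
proof -
  have "\<theta> = replicate (Suc m) 0" if "\<theta> \<in> ord_maps m 0" for \<theta>
    using that replicate_length_same[of \<theta> 0] unfolding ord_maps_def by auto
  then show ?thesis by (auto simp: ord_maps_def)
qed

lemma const_ord_map: "c \<le> n \<Longrightarrow> replicate (Suc m) c \<in> ord_maps m n"
  by (auto simp: ord_maps_def)

lemma ord_comp_const: "\<phi> \<in> ord_maps k m \<Longrightarrow> ord_comp (replicate (Suc m) c) \<phi> = replicate (Suc k) c"
proof -
  assume "\<phi> \<in> ord_maps k m"
  then have "length \<phi> = Suc k" "\<forall>i \<in> set \<phi>. i < Suc m" by (auto simp: ord_maps_def)
  then have "map (\<lambda>i. replicate (Suc m) c ! i) \<phi> = map (\<lambda>i. c) \<phi>" by (intro map_cong)
    (auto simp del: replicate_Suc)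
  then show ?thesis using \<open>length \<phi> = Suc k\<close> by (simp add: ord_comp_def map_replicate_const)
qed

lemma finite_ord_maps: "finite (ord_maps m n)"
  by (rule finite_subset[OF _ finite_lists_length_eq[of "{..n}" "Suc m"]]) (auto simp: ord_maps_def)

lemma simplicial_setD:
  assumes "simplicial_set X"
  shows "\<lbrakk>\<theta> \<in> ord_maps m n; x \<in> cells X n\<rbrakk> \<Longrightarrow> act X n \<theta> x \<in> cells X m"
    and "x \<in> cells X n \<Longrightarrow> act X n [0..<Suc n] x = x"
    and "\<lbrakk>\<theta> \<in> ord_maps m n; \<phi> \<in> ord_maps k m; x \<in> cells X n\<rbrakk> \<Longrightarrow>
      act X m \<phi> (act X n \<theta> x) = act X n (ord_comp \<theta> \<phi>) x"
  using assms unfolding simplicial_set_def by blast+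

lemma simplicial_std_simplex: "simplicial_set (std_simplex n)"
  unfolding simplicial_set_def std_simplex_def
  by (auto simp: ord_comp_in ord_comp_id ord_comp_assoc simp del: upt_Suc)

lemma simplicial_sset_prod: "\<lbrakk>simplicial_set X; simplicial_set Y\<rbrakk> \<Longrightarrow> simplicial_set (sset_prod X Y)"
  unfolding simplicial_set_def[of "sset_prod X Y"]
  by (auto simp: sset_prod_def simplicial_setD simp del: upt_Suc)

text \<open>The endomorphism of \<open>[n]\<close> that moves \<open>i + 1\<close> to \<open>i\<close>.  A simplex is fixed by it iff it is
  degenerate along the edge from \<open>i\<close> to \<open>i + 1\<close>.\<close>

definition collapse :: "nat \<Rightarrow> nat \<Rightarrow> nat list" where
  "collapse i n = map (\<lambda>j. if j = Suc i then i else j) [0..<Suc n]"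

definition flat :: "'s sset \<Rightarrow> nat \<Rightarrow> nat \<Rightarrow> 's \<Rightarrow> bool" where
  "flat X n i x \<longleftrightarrow> act X n (collapse i n) x = x"

lemma flat_degenerate:
  assumes X: "simplicial_set X" and x: "x \<in> cells X n" and i: "i < n" and flat: "flat X n i x"
  shows "degenerate X n x"
proof -
  \<comment> \<open>The collapse is split as the degeneracy \<open>\<sigma>\<close> identifying
    \<open>i\<close> and \<open>i + 1\<close>, followed by its section \<open>\<delta>\<close>, the
    face that omits \<open>i + 1\<close>.\<close>
  define \<sigma> where "\<sigma> = map (\<lambda>j. if j \<le> i then j else j - 1) [0..<Suc n]"
  define \<delta> where "\<delta> = map (\<lambda>j. if j \<le> i then j else Suc j) [0..<n]"
  have n: "Suc (n - 1) = n" using i by simp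
  have "sorted \<sigma>"
    unfolding \<sigma>_def sorted_map by (rule sorted_wrt_mono_rel[OF _ sorted_upt]) auto
  moreover have set\<sigma>: "set \<sigma> = {..n - 1}"
  proof -
    have "j \<in> (\<lambda>j. if j \<le> i then j else j - 1) ` {0..<Suc n}" if "j \<le> n - 1" for j
      using that i by (intro image_eqI[of _ _ "if j \<le> i then j else Suc j"]) auto
    then show ?thesis unfolding \<sigma>_def using i by (auto simp del: upt_Suc)
  qed
  ultimately have \<sigma>: "\<sigma> \<in> ord_maps n (n - 1)" unfolding ord_maps_def by (simp add: \<sigma>_def)
  have "sorted \<delta>"
    unfolding \<delta>_def sorted_map by (rule sorted_wrt_mono_rel[OF _ sorted_upt]) auto
  then have \<delta>: "\<delta> \<in> ord_maps (n - 1) n"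
    unfolding ord_maps_def using i by (auto simp: \<delta>_def n)
  have "ord_comp \<delta> \<sigma> = collapse i n"
    unfolding ord_comp_def \<sigma>_def collapse_def map_map
  proof (rule map_cong[OF refl])
    fix j assume "j \<in> set [0..<Suc n]"
    then have "(if j \<le> i then j else j - 1) < n" using i by auto
    then show "((!) \<delta> \<circ> (\<lambda>j. if j \<le> i then j else j - 1)) j = (if j = Suc i then i else j)"
      by (auto simp: \<delta>_def)
  qed
  then have "x = act X (n - 1) \<sigma> (act X n \<delta> x)"
    using simplicial_setD(3)[OF X \<delta> \<sigma> x] flat by (simp add: flat_def)
  then show ?thesis
    unfolding degenerate_def using i \<sigma> set\<sigma> simplicial_setD(1)[OF X \<delta> x]
    by (intro exI[of _ "n - 1"]) auto
qed

text \<open>A nondegenerate simplex has no flat step, so a bound on the non-flat steps bounds its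
  dimension. This bound adds up under products, since a pair is flat at \<open>i\<close> iff both
  components are, whereas the nondegenerate simplices of a product are not pairs of such.\<close>

definition bounded_sset :: "'s sset \<Rightarrow> nat \<Rightarrow> bool" where
  "bounded_sset X N \<longleftrightarrow> simplicial_set X \<and> (\<forall>n. finite (cells X n)) \<and>
    (\<forall>n. \<forall>x \<in> cells X n. card {i. i < n \<and> \<not> flat X n i x} \<le> N)"

lemma bounded_sset_finite:
  assumes "bounded_sset X N"
  shows "finite_sset X"
proof -
  have X: "simplicial_set X" and fin: "\<And>n. finite (cells X n)"
    and card: "\<And>n x. x \<in> cells X n \<Longrightarrow> card {i. i < n \<and> \<not> flat X n i x} \<le> N"
    using assms unfolding bounded_sset_def by auto
  have "{(n, x). x \<in> cells X n \<and> \<not> degenerate X n x} \<subseteq> Sigma {..N} (cells X)"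
  proof
    fix z assume "z \<in> {(n, x). x \<in> cells X n \<and> \<not> degenerate X n x}"
    then obtain n x where z: "z = (n, x)" and x: "x \<in> cells X n" "\<not> degenerate X n x" by blast
    then have "{i. i < n \<and> \<not> flat X n i x} = {..<n}" using flat_degenerate[OF X x(1)] by auto
    then show "z \<in> Sigma {..N} (cells X)" using card[OF x(1)] x(1) z by simp
  qed
  then have "finite {(n, x). x \<in> cells X n \<and> \<not> degenerate X n x}"
    by (rule finite_subset) (intro finite_SigmaI finite_atMost fin)
  then show ?thesis unfolding finite_sset_def using X by simp
qed

lemma bounded_sset_prod:
  assumes "bounded_sset X N" "bounded_sset Y N'"
  shows "bounded_sset (sset_prod X Y) (N + N')"
proof -
  have "card {i. i < n \<and> \<not> flat (sset_prod X Y) n i z} \<le> N + N'" if z: "z \<in> cells (sset_prod X Y) n"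
    for n z
  proof -
    obtain x y where xy: "z = prod_encode (x, y)" "x \<in> cells X n" "y \<in> cells Y n"
      using z by (auto simp: sset_prod_def)
    have "flat (sset_prod X Y) n i z \<longleftrightarrow> flat X n i x \<and> flat Y n i y" for i
      unfolding flat_def xy(1) by (simp add: sset_prod_def)
    then have "{i. i < n \<and> \<not> flat (sset_prod X Y) n i z} =
        {i. i < n \<and> \<not> flat X n i x} \<union> {i. i < n \<and> \<not> flat Y n i y}" by auto
    also have "card \<dots> \<le> card {i. i < n \<and> \<not> flat X n i x} + card {i. i < n \<and> \<not> flat Y n i y}"
      by (rule card_Un_le)
    also have "\<dots> \<le> N + N'"
      using assms xy(2,3) unfolding bounded_sset_def by (intro add_mono) auto
    finally show ?thesis .
  qed
  moreover have "finite (cells (sset_prod X Y) n)" for n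
    using assms unfolding bounded_sset_def by (simp add: sset_prod_def)
  ultimately show ?thesis
    using assms simplicial_sset_prod unfolding bounded_sset_def by blast
qed

text \<open>A step at which \<open>\<theta>\<close> keeps its value is flat, and a monotone sequence
  with values up to \<open>n\<close> can increase at most \<open>n\<close> times: the values after
  the increases are distinct and positive.\<close>

lemma std_simplex_nonflat:
  assumes \<theta>: "\<theta> \<in> ord_maps m n"
  shows "card {i. i < m \<and> \<not> flat (std_simplex n) m i (list_encode \<theta>)} \<le> n"
proof -
  let ?S = "{i. i < m \<and> \<theta> ! i \<noteq> \<theta> ! Suc i}"
  have len: "length \<theta> = Suc m" and srt: "sorted \<theta>" using \<theta> by (auto simp: ord_maps_def)
  have flatI: "flat (std_simplex n) m i (list_encode \<theta>)" if "i < m" "\<theta> ! i = \<theta> ! Suc i" for i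
  proof -
    have "ord_comp \<theta> (collapse i m) = \<theta>"
    proof (rule nth_equalityI)
      show "length (ord_comp \<theta> (collapse i m)) = length \<theta>" using len by
        (simp add: ord_comp_def collapse_def)
      fix j assume "j < length (ord_comp \<theta> (collapse i m))"
      then have "j < Suc m" by (simp add: ord_comp_def collapse_def)
      then show "ord_comp \<theta> (collapse i m) ! j = \<theta> ! j"
        using that by (auto simp: ord_comp_def collapse_def simp del: upt_Suc)
    qed
    then show ?thesis by (simp add: flat_def std_simplex_def)
  qed
  have mono: "\<theta> ! i \<le> \<theta> ! j" if "i \<le> j" "j \<le> m" for i j
    using sorted_nth_mono[OF srt that(1)] that(2) len by simp
  have "inj_on (\<lambda>i. \<theta> ! Suc i) ?S"
  proof (rule linorder_inj_onI')
    fix i j assume ij: "i \<in> ?S" "j \<in> ?S" "i < j"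
    then have "\<theta> ! Suc i \<le> \<theta> ! j" using mono[of "Suc i" j] by auto
    moreover have "\<theta> ! j \<le> \<theta> ! Suc j" using mono[of j "Suc j"] ij(2) by auto
    ultimately show "\<theta> ! Suc i \<noteq> \<theta> ! Suc j" using ij(2) by auto
  qed
  moreover have "(\<lambda>i. \<theta> ! Suc i) ` ?S \<subseteq> {1..n}"
  proof clarify
    fix i assume i: "i < m" "\<theta> ! i \<noteq> \<theta> ! Suc i"
    then have "\<theta> ! i < \<theta> ! Suc i" using mono[of i "Suc i"] by simp
    then show "\<theta> ! Suc i \<in> {1..n}" using ord_maps_nth[OF \<theta>, of "Suc i"] i by simp
  qed
  ultimately have "card ?S \<le> card {1..n}" by (rule card_inj_on_le) simp
  moreover have "{i. i < m \<and> \<not> flat (std_simplex n) m i (list_encode \<theta>)} \<subseteq> ?S" using flatI by auto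
  then have "card {i. i < m \<and> \<not> flat (std_simplex n) m i (list_encode \<theta>)} \<le> card ?S"
    by (rule card_mono[rotated]) simp
  ultimately show ?thesis by simp
qed

lemma bounded_std_simplex: "bounded_sset (std_simplex n) n"
  unfolding bounded_sset_def using simplicial_std_simplex std_simplex_nonflat finite_ord_maps
  by (auto simp: std_simplex_def)

definition boundary_1 :: sf_ob where
  "boundary_1 = \<lparr>cells = (\<lambda>m. {list_encode (replicate (Suc m) 0),
      list_encode (replicate (Suc m) 1)}),
     act = act (std_simplex 1)\<rparr>"

definition empty_sset :: sf_ob where
  "empty_sset = \<lparr>cells = (\<lambda>m. {}), act = (\<lambda>m \<theta> x. x)\<rparr>"

lemma boundary_1_cells_subset: "cells boundary_1 m \<subseteq> cells (std_simplex 1) m"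
  using const_ord_map[of 0 1 m] const_ord_map[of 1 1 m] by
    (auto simp: boundary_1_def std_simplex_def simp del: replicate_Suc)

lemma act_boundary_1_const:
  "\<theta> \<in> ord_maps m n \<Longrightarrow>
    act boundary_1 n \<theta> (list_encode (replicate (Suc n) c)) = list_encode (replicate (Suc m) c)"
  using ord_comp_const[of \<theta> m n c] by (simp add: boundary_1_def std_simplex_def)

lemma simplicial_boundary_1: "simplicial_set boundary_1"
proof -
  have act: "act boundary_1 = act (std_simplex 1)" by (simp add: boundary_1_def)
  have "act boundary_1 n \<theta> x \<in> cells boundary_1 m" if "\<theta> \<in> ord_maps m n" "x \<in> cells boundary_1 n"
    for m n \<theta> x
    using that(2) act_boundary_1_const[OF that(1)] unfolding boundary_1_def
    by (auto simp del: replicate_Suc simp: boundary_1_def)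
  then show ?thesis
    using simplicial_std_simplex[of 1] boundary_1_cells_subset
    unfolding simplicial_set_def act by (meson subsetD)
qed

lemma bounded_boundary_1: "bounded_sset boundary_1 1"
proof -
  have "flat boundary_1 = flat (std_simplex 1)" by (intro ext) (simp add: flat_def boundary_1_def)
  then show ?thesis
    using bounded_std_simplex[of 1] simplicial_boundary_1 boundary_1_cells_subset finite_subset
    unfolding bounded_sset_def by (metis subsetD)
qed

lemma bounded_empty_sset: "bounded_sset empty_sset 0"
  by (simp add: bounded_sset_def empty_sset_def simplicial_set_def)

section \<open>Maps of finite simplicial sets\<close>

lemma SF_simps:
  "Obj SF = {X. finite_sset X}"
  "Arr SF = {(X, f, Y). finite_sset X \<and> finite_sset Y \<and> simplicial_map X Y f}"
  "Dom SF (X, f, Y) = X" "Cod SF (X, f, Y) = Y"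
  "Idn SF X = sf_mk X X (\<lambda>n x. x)"
  "(Y, g, Z) \<cdot>\<^bsub>SF\<^esub> (X, f, Y') = sf_mk X Z (\<lambda>n x. g n (f n x))"
  by (simp_all add: SF_def)

lemma SF_homset: "f \<in> homset SF X Y \<longleftrightarrow>
    (\<exists>f0. f = (X, f0, Y) \<and> finite_sset X \<and> finite_sset Y \<and> simplicial_map X Y f0)"
  by (cases f) (auto simp: homset_def SF_simps)

lemma sf_mk_cong: "(\<And>n x. x \<in> cells X n \<Longrightarrow> f n x = g n x) \<Longrightarrow> sf_mk X Y f = sf_mk X Y g"
  unfolding sf_mk_def by (auto simp: fun_eq_iff restrict_def)

lemma sf_mk_hom:
  assumes "finite_sset X" "finite_sset Y"
    and "\<And>n x. x \<in> cells X n \<Longrightarrow> f n x \<in> cells Y n"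
    and "\<And>m n \<theta> x. \<lbrakk>\<theta> \<in> ord_maps m n; x \<in> cells X n\<rbrakk> \<Longrightarrow> f m (act X n \<theta> x) = act Y n \<theta> (f n x)"
  shows "sf_mk X Y f \<in> homset SF X Y"
proof -
  have "simplicial_set X" using assms(1) by (simp add: finite_sset_def)
  then show ?thesis
    unfolding SF_homset sf_mk_def simplicial_map_def using assms simplicial_setD(1)[of X] by auto
qed

lemma sf_mk_Cmp:
  assumes "\<And>n x. x \<in> cells X n \<Longrightarrow> f n x \<in> cells Y n"
  shows "sf_mk Y Z g \<cdot>\<^bsub>SF\<^esub> sf_mk X Y f = sf_mk X Z (\<lambda>n x. g n (f n x))"
  unfolding sf_mk_def[of Y] sf_mk_def[of X Y] SF_simps by (rule sf_mk_cong) (simp add: assms)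

lemma SF_category: "category SF"
proof
  show "Dom SF f \<in> Obj SF" "Cod SF f \<in> Obj SF" if "f \<in> Arr SF" for f
    using that by (auto simp: SF_simps)
  show "Idn SF A \<in> homset SF A A" if "A \<in> Obj SF" for A
    using that unfolding SF_simps by (intro sf_mk_hom) auto
  fix A B f assume "f \<in> homset SF A B"
  then obtain f0 where f: "f = (A, f0, B)" "finite_sset A" "finite_sset B" "simplicial_map A B f0"
    unfolding SF_homset by blast
  have f0: "f0 n x \<in> cells B n" if "x \<in> cells A n" for n x
    using f(4) that unfolding simplicial_map_def by blast
  have f0r: "restrict (f0 n) (cells A n) = f0 n" for n
    using f(4) unfolding simplicial_map_def by (simp add: extensional_restrict PiE_def)
  have "f = sf_mk A B f0" by (simp add: f(1) sf_mk_def f0r)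
  then show "f \<cdot>\<^bsub>SF\<^esub> Idn SF A = f" "Idn SF B \<cdot>\<^bsub>SF\<^esub> f = f"
    unfolding SF_simps using sf_mk_Cmp[of A "\<lambda>n x. x" A B f0] sf_mk_Cmp[of A f0 B B "\<lambda>n x. x"] f0 by
      simp_all
  fix D g assume "g \<in> homset SF B D"
  then obtain g0 where g: "g = (B, g0, D)" "finite_sset D" "simplicial_map B D g0"
    unfolding SF_homset by blast
  have g0: "g0 n x \<in> cells D n" if "x \<in> cells B n" for n x
    using g(3) that unfolding simplicial_map_def by blast
  show "g \<cdot>\<^bsub>SF\<^esub> f \<in> homset SF A D"
    unfolding f(1) g(1) SF_simps
  proof (rule sf_mk_hom[OF f(2) g(2)])
    show "g0 n (f0 n x) \<in> cells D n" if "x \<in> cells A n" for n x using g0 f0 that by blast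
    show "g0 m (f0 m (act A n \<theta> x)) = act D n \<theta> (g0 n (f0 n x))"
      if "\<theta> \<in> ord_maps m n" "x \<in> cells A n" for m n \<theta> x
      using f(4) g(3) f0[OF that(2)] that unfolding simplicial_map_def by metis
  qed
  fix E h assume "h \<in> homset SF D E"
  then obtain h0 where h: "h = (D, h0, E)" unfolding SF_homset by blast
  show "(h \<cdot>\<^bsub>SF\<^esub> g) \<cdot>\<^bsub>SF\<^esub> f = h \<cdot>\<^bsub>SF\<^esub> (g \<cdot>\<^bsub>SF\<^esub> f)"
    unfolding f(1) g(1) h SF_simps sf_mk_def by (auto simp: fun_eq_iff restrict_def f0)
qed

lemma finite_ssets:
  "finite_sset (std_simplex n)" "finite_sset boundary_1" "finite_sset empty_sset"
  "finite_sset (sset_prod (std_simplex m) (std_simplex n))"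
  using bounded_sset_finite bounded_std_simplex bounded_boundary_1 bounded_empty_sset
    bounded_sset_prod
  by blast+

lemma std_simplex_cells: "cells (std_simplex n) m = list_encode ` ord_maps m n"
  by (simp add: std_simplex_def)

lemma std_simplex_act: "act (std_simplex n) m \<theta> (list_encode \<phi>) = list_encode (ord_comp \<phi> \<theta>)"
  by (simp add: std_simplex_def)

lemma std_simplex_map_hom:
  assumes \<theta>: "\<theta> \<in> ord_maps m n"
  shows "std_simplex_map m n \<theta> \<in> homset SF (std_simplex m) (std_simplex n)"
  unfolding std_simplex_map_def
  by (rule sf_mk_hom) (auto simp: finite_ssets std_simplex_cells std_simplex_act ord_comp_in[OF \<theta>]
    ord_comp_assoc)

lemma SF_terminal:
  assumes "f \<in> homset SF X (std_simplex 0)" "g \<in> homset SF X (std_simplex 0)"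
  shows "f = g"
proof -
  obtain f0 g0 where fg: "f = (X, f0, std_simplex 0)" "simplicial_map X (std_simplex 0) f0"
    "g = (X, g0, std_simplex 0)" "simplicial_map X (std_simplex 0) g0"
    using assms unfolding SF_homset by blast
  have "f0 n = g0 n" for n
  proof (rule extensionalityI)
    show "f0 n \<in> extensional (cells X n)" "g0 n \<in> extensional (cells X n)"
      using fg unfolding simplicial_map_def by (auto simp: PiE_def)
    show "f0 n x = g0 n x" if "x \<in> cells X n" for x
    proof -
      have "f0 n x \<in> cells (std_simplex 0) n" "g0 n x \<in> cells (std_simplex 0) n"
        using fg that unfolding simplicial_map_def by blast+
      then show ?thesis by (simp add: std_simplex_cells ord_maps_0)
    qed
  qed
  then show ?thesis using fg by (simp add: fun_eq_iff)
qed

section \<open>The interval, its boundary and its contraction\<close>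

abbreviation vertex :: "nat \<Rightarrow> sf_arr" where
  "vertex c \<equiv> std_simplex_map 0 1 [c]"

abbreviation to_point :: sf_arr where
  "to_point \<equiv> std_simplex_map 1 0 [0, 0]"

text \<open>The nerve of the poset map \<open>max\<close> on \<open>{0, 1}\<close>. As
  \<open>max 0 y = y\<close> and \<open>max 1 y = 1\<close>, it is a homotopy from the identity of
  the interval to the constant map at the vertex \<open>1\<close>.\<close>

definition simplex_max :: sf_arr where
  "simplex_max = sf_mk (sset_prod (std_simplex 1) (std_simplex 1)) (std_simplex 1)
    (\<lambda>n z. case prod_decode z of (x, y) \<Rightarrow> list_encode (map2 max (list_decode x) (list_decode y)))"

definition boundary_incl :: sf_arr where
  "boundary_incl = sf_mk boundary_1 (std_simplex 1) (\<lambda>n x. x)"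

definition boundary_vertex :: "nat \<Rightarrow> sf_arr" where
  "boundary_vertex c = sf_mk (std_simplex 0) boundary_1 (\<lambda>n x. list_encode (replicate (Suc n) c))"

definition empty_map :: "sf_ob \<Rightarrow> sf_arr" where
  "empty_map X = sf_mk empty_sset X (\<lambda>n x. x)"

lemma vertex_hom: "c \<le> 1 \<Longrightarrow> vertex c \<in> homset SF (std_simplex 0) (std_simplex 1)"
  by (rule std_simplex_map_hom) (simp add: ord_maps_def)

lemma to_point_hom: "to_point \<in> homset SF (std_simplex 1) (std_simplex 0)"
  by (rule std_simplex_map_hom) (simp add: ord_maps_def)

lemma vertex_eq: "vertex c = sf_mk (std_simplex 0) (std_simplex 1) (\<lambda>n x. list_encode
    (replicate (Suc n) c))"
  unfolding std_simplex_map_def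
proof (rule sf_mk_cong)
  fix n x assume "x \<in> cells (std_simplex 0) n"
  then have x: "list_decode x = replicate (Suc n) 0" by (auto simp: std_simplex_cells ord_maps_0)
  show "list_encode (ord_comp [c] (list_decode x)) = list_encode (replicate (Suc n) c)"
    unfolding x by (simp add: ord_comp_def)
qed

lemma map2_max_ord:
  assumes "xs \<in> ord_maps m n" "ys \<in> ord_maps m n"
  shows "map2 max xs ys \<in> ord_maps m n"
proof -
  have len: "length xs = Suc m" "length ys = Suc m" and srt: "sorted xs" "sorted ys"
    using assms by (auto simp: ord_maps_def)
  have "max (xs ! i) (ys ! i) \<le> max (xs ! j) (ys ! j)" if "i \<le> j" "j < Suc m" for i j
    using sorted_nth_mono[OF srt(1) that(1)] sorted_nth_mono[OF srt(2) that(1)] that(2) len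
    by (intro max.mono) auto
  then have "sorted (map2 max xs ys)"
    unfolding sorted_iff_nth_mono using len by simp
  moreover have "set (map2 max xs ys) \<subseteq> {..n}"
    using ord_maps_nth[OF assms(1)] ord_maps_nth[OF assms(2)] len
    by (auto simp: in_set_conv_nth less_Suc_eq_le)
  ultimately show ?thesis using len by (simp add: ord_maps_def)
qed

lemma simplex_max_hom:
  "simplex_max \<in> homset SF (sset_prod (std_simplex 1) (std_simplex 1)) (std_simplex 1)"
  unfolding simplex_max_def
proof (rule sf_mk_hom)
  let ?f = "\<lambda>z. case prod_decode z of (x, y) \<Rightarrow> list_encode (map2 max (list_decode x) (list_decode
      y))"
  show "?f z \<in> cells (std_simplex 1) n" if "z \<in> cells (sset_prod (std_simplex 1) (std_simplex 1)) n"
    for n z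
    using that map2_max_ord by (auto simp: sset_prod_def std_simplex_cells)
  show "?f (act (sset_prod (std_simplex 1) (std_simplex 1)) n \<theta> z) = act (std_simplex 1) n \<theta> (?f z)"
    if \<theta>: "\<theta> \<in> ord_maps m n" and z: "z \<in> cells (sset_prod (std_simplex 1) (std_simplex 1)) n" for m
      n \<theta> z
  proof -
    obtain xs ys where xy: "z = prod_encode (list_encode xs, list_encode ys)" "xs \<in> ord_maps n 1"
      "ys \<in> ord_maps n 1"
      using z by (auto simp: sset_prod_def std_simplex_cells)
    have "map2 max (ord_comp xs \<theta>) (ord_comp ys \<theta>) = ord_comp (map2 max xs ys) \<theta>"
    proof (rule nth_equalityI)
      fix i assume "i < length (map2 max (ord_comp xs \<theta>) (ord_comp ys \<theta>))"
      then have "i < length \<theta>" by (simp add: ord_comp_def)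
      moreover from this have "\<theta> ! i < Suc n" using ord_maps_nth[OF \<theta>, of i] \<theta> by
        (simp add: ord_maps_def)
      ultimately show "map2 max (ord_comp xs \<theta>) (ord_comp ys \<theta>) ! i =
          ord_comp (map2 max xs ys) \<theta> ! i"
        using xy(2,3) by (simp add: ord_comp_def ord_maps_def)
    qed (simp add: ord_comp_def)
    then show ?thesis unfolding xy(1) by (simp add: sset_prod_def std_simplex_act)
  qed
qed (rule finite_ssets)+

lemma Tens_SF: "FAr (Tens SF) (sf_mk X X' f, sf_mk Y Y' g) =
    sf_mk (sset_prod X Y) (sset_prod X' Y')
      (\<lambda>n z. case prod_decode z of (x, y) \<Rightarrow> prod_encode (f n x, g n y))"
  unfolding sf_mk_def[of X] sf_mk_def[of Y] SF_def
  by (simp, rule sf_mk_cong) (auto simp: sset_prod_def)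

lemma FOb_Tens_SF: "FOb (Tens SF) (X, Y) = sset_prod X Y"
  by (simp add: SF_def)

lemma LUn_SF: "LUn SF X = sf_mk (sset_prod (std_simplex 0) X) X (\<lambda>n z. snd (prod_decode z))"
  and RUn_SF: "RUn SF X = sf_mk (sset_prod X (std_simplex 0)) X (\<lambda>n z. fst (prod_decode z))"
  and Unt_SF: "Unt SF = std_simplex 0"
  by (simp_all add: SF_def)

lemma LUn_hom: "LUn SF (std_simplex n) \<in> homset SF (sset_prod (std_simplex 0) (std_simplex n))
    (std_simplex n)"
  unfolding LUn_SF by (intro sf_mk_hom finite_ssets) (auto simp: sset_prod_def)

lemma RUn_hom: "RUn SF (std_simplex n) \<in> homset SF (sset_prod (std_simplex n) (std_simplex 0))
    (std_simplex n)"
  unfolding RUn_SF by (intro sf_mk_hom finite_ssets) (auto simp: sset_prod_def)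

lemma Tens_hom:
  assumes "f \<in> homset SF (std_simplex a) (std_simplex b)"
    "g \<in> homset SF (std_simplex c) (std_simplex d)"
  shows "FAr (Tens SF) (f, g) \<in>
    homset SF (sset_prod (std_simplex a) (std_simplex c))
      (sset_prod (std_simplex b) (std_simplex d))"
proof -
  obtain f0 g0 where f: "f = (std_simplex a, f0, std_simplex b)"
    "simplicial_map (std_simplex a) (std_simplex b) f0"
    and g: "g = (std_simplex c, g0, std_simplex d)" "simplicial_map (std_simplex c) (std_simplex d)
        g0"
    using assms unfolding SF_homset by blast
  have *: "FAr (Tens SF) (f, g) = sf_mk (sset_prod (std_simplex a) (std_simplex c))
      (sset_prod (std_simplex b) (std_simplex d))
      (\<lambda>n z. case prod_decode z of (x, y) \<Rightarrow> prod_encode (f0 n x, g0 n y))"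
    by (simp add: SF_def f(1) g(1))
  have ff: "f0 n x \<in> cells (std_simplex b) n" if "x \<in> cells (std_simplex a) n" for n x
    using f(2) that unfolding simplicial_map_def by blast
  have gg: "g0 n x \<in> cells (std_simplex d) n" if "x \<in> cells (std_simplex c) n" for n x
    using g(2) that unfolding simplicial_map_def by blast
  show ?thesis
    unfolding * using f(2) g(2) ff gg
    by (intro sf_mk_hom finite_ssets) (auto simp: sset_prod_def simplicial_map_def)
qed

lemma sset_prod_simplices:
  assumes "z \<in> cells (sset_prod (std_simplex m) (std_simplex n)) k"
  obtains xs ys where "xs \<in> ord_maps k m" "ys \<in> ord_maps k n" "z = prod_encode (list_encode xs,
      list_encode ys)"
  using assms by (auto simp: sset_prod_def std_simplex_cells)

lemma map2_max_const_left:
  assumes "ys \<in> ord_maps k 1" "c \<le> 1"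
  shows "map2 max (replicate (Suc k) c) ys = (if c = 0 then ys else replicate (Suc k) 1)"
    and "map2 max ys (replicate (Suc k) c) = (if c = 0 then ys else replicate (Suc k) 1)"
proof -
  have "length ys = Suc k" "\<And>i. i < Suc k \<Longrightarrow> ys ! i \<le> 1"
    using assms ord_maps_nth[OF assms(1)] by (auto simp: ord_maps_def)
  then show "map2 max (replicate (Suc k) c) ys = (if c = 0 then ys else replicate (Suc k) 1)"
    "map2 max ys (replicate (Suc k) c) = (if c = 0 then ys else replicate (Suc k) 1)"
    using assms(2) by (auto intro!: nth_equalityI simp: max_absorb1 max_absorb2 le_Suc_eq[of c] simp
      del: replicate_Suc)
qed

lemma vertex_Tens_id:
  "FAr (Tens SF) (vertex c, Idn SF (std_simplex 1)) =
    sf_mk (sset_prod (std_simplex 0) (std_simplex 1)) (sset_prod (std_simplex 1) (std_simplex 1))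
      (\<lambda>n z. prod_encode (list_encode (replicate (Suc n) c), snd (prod_decode z)))"
  "FAr (Tens SF) (Idn SF (std_simplex 1), vertex c) =
    sf_mk (sset_prod (std_simplex 1) (std_simplex 0)) (sset_prod (std_simplex 1) (std_simplex 1))
      (\<lambda>n z. prod_encode (fst (prod_decode z), list_encode (replicate (Suc n) c)))"
  unfolding vertex_eq SF_simps Tens_SF by (simp_all add: case_prod_beta)

lemma const_cells: "c \<le> 1 \<Longrightarrow> list_encode (replicate (Suc n) c) \<in> cells (std_simplex 1) n"
  unfolding std_simplex_cells by (rule imageI[OF const_ord_map])

lemma simplex_max_vertex:
  assumes c: "c \<le> 1"
  shows "simplex_max \<cdot>\<^bsub>SF\<^esub> FAr (Tens SF) (vertex c, Idn SF (std_simplex 1)) =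
    sf_mk (sset_prod (std_simplex 0) (std_simplex 1)) (std_simplex 1)
      (\<lambda>n z. if c = 0 then snd (prod_decode z) else list_encode (replicate (Suc n) 1))" (is ?l)
    and "simplex_max \<cdot>\<^bsub>SF\<^esub> FAr (Tens SF) (Idn SF (std_simplex 1), vertex c) =
    sf_mk (sset_prod (std_simplex 1) (std_simplex 0)) (std_simplex 1)
      (\<lambda>n z. if c = 0 then fst (prod_decode z) else list_encode (replicate (Suc n) 1))" (is ?r)
proof -
  let ?m = "\<lambda>z. case prod_decode z of (x, y) \<Rightarrow> list_encode (map2 max (list_decode x) (list_decode
      y))"
  have L: "prod_encode (list_encode (replicate (Suc n) c), snd (prod_decode z)) \<in>
      cells (sset_prod (std_simplex 1) (std_simplex 1)) n"
      "?m (prod_encode (list_encode (replicate (Suc n) c), snd (prod_decode z))) =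
        (if c = 0 then snd (prod_decode z) else list_encode (replicate (Suc n) 1))"
    if z: "z \<in> cells (sset_prod (std_simplex 0) (std_simplex 1)) n" for n z
  proof -
    obtain xs ys where xy: "ys \<in> ord_maps n 1" "z = prod_encode (list_encode xs, list_encode ys)"
      using sset_prod_simplices[OF z] .
    show "prod_encode (list_encode (replicate (Suc n) c), snd (prod_decode z)) \<in>
        cells (sset_prod (std_simplex 1) (std_simplex 1)) n"
      using const_cells[OF c, of n] xy(1) unfolding xy(2)
      by (simp add: sset_prod_def std_simplex_cells del: replicate_Suc)
    show "?m (prod_encode (list_encode (replicate (Suc n) c), snd (prod_decode z))) =
        (if c = 0 then snd (prod_decode z) else list_encode (replicate (Suc n) 1))"
      unfolding xy(2) using map2_max_const_left(1)[OF xy(1) c] by (simp del: replicate_Suc)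
  qed
  have R: "prod_encode (fst (prod_decode z), list_encode (replicate (Suc n) c)) \<in>
      cells (sset_prod (std_simplex 1) (std_simplex 1)) n"
      "?m (prod_encode (fst (prod_decode z), list_encode (replicate (Suc n) c))) =
        (if c = 0 then fst (prod_decode z) else list_encode (replicate (Suc n) 1))"
    if z: "z \<in> cells (sset_prod (std_simplex 1) (std_simplex 0)) n" for n z
  proof -
    obtain xs ys where xy: "xs \<in> ord_maps n 1" "z = prod_encode (list_encode xs, list_encode ys)"
      using sset_prod_simplices[OF z] .
    show "prod_encode (fst (prod_decode z), list_encode (replicate (Suc n) c)) \<in>
        cells (sset_prod (std_simplex 1) (std_simplex 1)) n"
      using const_cells[OF c, of n] xy(1) unfolding xy(2)
      by (simp add: sset_prod_def std_simplex_cells del: replicate_Suc)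
    show "?m (prod_encode (fst (prod_decode z), list_encode (replicate (Suc n) c))) =
        (if c = 0 then fst (prod_decode z) else list_encode (replicate (Suc n) 1))"
      unfolding xy(2) using map2_max_const_left(2)[OF xy(1) c] by (simp del: replicate_Suc)
  qed
  show ?l
    unfolding simplex_max_def vertex_Tens_id by (subst sf_mk_Cmp, erule L(1), rule sf_mk_cong, erule
      L(2))
  show ?r
    unfolding simplex_max_def vertex_Tens_id by (subst sf_mk_Cmp, erule R(1), rule sf_mk_cong, erule
      R(2))
qed

lemma vertex_point_unit:
  "vertex 1 \<cdot>\<^bsub>SF\<^esub> (to_point \<cdot>\<^bsub>SF\<^esub> LUn SF (std_simplex 1)) =
    sf_mk (sset_prod (std_simplex 0) (std_simplex 1)) (std_simplex 1)
      (\<lambda>n z. list_encode (replicate (Suc n) 1))"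
  "vertex 1 \<cdot>\<^bsub>SF\<^esub> (to_point \<cdot>\<^bsub>SF\<^esub> RUn SF (std_simplex 1)) =
    sf_mk (sset_prod (std_simplex 1) (std_simplex 0)) (std_simplex 1)
      (\<lambda>n z. list_encode (replicate (Suc n) 1))"
proof -
  have *: "vertex 1 \<cdot>\<^bsub>SF\<^esub> g = sf_mk X (std_simplex 1) (\<lambda>n z. list_encode (replicate (Suc n) 1))"
    if g: "g \<in> homset SF X (std_simplex 0)" for g X
  proof -
    obtain g0 where g0: "g = (X, g0, std_simplex 0)" "simplicial_map X (std_simplex 0) g0"
      using g unfolding SF_homset by blast
    then have "g0 n x \<in> cells (std_simplex 0) n" if "x \<in> cells X n" for n x
      using that unfolding simplicial_map_def by blast
    then show ?thesis
      unfolding g0(1) vertex_eq sf_mk_def[of "std_simplex 0"] SF_simps by (intro sf_mk_cong) simp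
  qed
  interpret SF: category SF by (rule SF_category)
  show "vertex 1 \<cdot>\<^bsub>SF\<^esub> (to_point \<cdot>\<^bsub>SF\<^esub> LUn SF (std_simplex 1)) =
    sf_mk (sset_prod (std_simplex 0) (std_simplex 1)) (std_simplex 1)
      (\<lambda>n z. list_encode (replicate (Suc n) 1))"
    by (rule *[OF SF.Cmp_in[OF LUn_hom to_point_hom]])
  show "vertex 1 \<cdot>\<^bsub>SF\<^esub> (to_point \<cdot>\<^bsub>SF\<^esub> RUn SF (std_simplex 1)) =
    sf_mk (sset_prod (std_simplex 1) (std_simplex 0)) (std_simplex 1)
      (\<lambda>n z. list_encode (replicate (Suc n) 1))"
    by (rule *[OF SF.Cmp_in[OF RUn_hom to_point_hom]])
qed

text \<open>Three edges of the square. Read as a homotopy in the first factor, they say that the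
  contraction starts at the identity, ends at the constant map and leaves the vertex
  \<open>1\<close> fixed at all times. The unit maps appear because an edge is a product with the
  point.\<close>

lemma simplex_max_vertices:
  "simplex_max \<cdot>\<^bsub>SF\<^esub> FAr (Tens SF) (vertex 0, Idn SF (std_simplex 1)) = LUn SF (std_simplex 1)"
  "simplex_max \<cdot>\<^bsub>SF\<^esub> FAr (Tens SF) (vertex 1, Idn SF (std_simplex 1)) =
    vertex 1 \<cdot>\<^bsub>SF\<^esub> (to_point \<cdot>\<^bsub>SF\<^esub> LUn SF (std_simplex 1))"
  "simplex_max \<cdot>\<^bsub>SF\<^esub> FAr (Tens SF) (Idn SF (std_simplex 1), vertex 1) =
    vertex 1 \<cdot>\<^bsub>SF\<^esub> (to_point \<cdot>\<^bsub>SF\<^esub> RUn SF (std_simplex 1))"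
  unfolding vertex_point_unit simplex_max_vertex(1)[OF le0] simplex_max_vertex[OF order_refl]
  by (simp_all add: LUn_SF)

lemma empty_map_hom: "finite_sset X \<Longrightarrow> empty_map X \<in> homset SF empty_sset X"
  unfolding empty_map_def by (rule sf_mk_hom) (auto simp: finite_ssets, auto simp: empty_sset_def)

lemma empty_sset_initial: "is_initial SF empty_sset"
  unfolding is_initial_def
proof (intro conjI ballI)
  show "empty_sset \<in> Obj SF" by (simp add: SF_simps finite_ssets)
  fix X assume "X \<in> Obj SF"
  then have X: "finite_sset X" by (simp add: SF_simps)
  have "f = empty_map X" if "f \<in> homset SF empty_sset X" for f
    using that unfolding SF_homset
    by (auto simp: empty_map_def sf_mk_def simplicial_map_def empty_sset_def fun_eq_iff restrict_def
      PiE_def extensional_def)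
  then show "\<exists>!f. f \<in> homset SF empty_sset X" using empty_map_hom[OF X] by blast
qed

lemma boundary_incl_hom: "boundary_incl \<in> homset SF boundary_1 (std_simplex 1)"
  unfolding boundary_incl_def
  by (rule sf_mk_hom) (use boundary_1_cells_subset in \<open>auto simp: finite_ssets, auto simp:
    boundary_1_def\<close>)

lemma boundary_incl_Cof: "boundary_incl \<in> SF_Cof"
  using boundary_incl_hom unfolding SF_homset SF_Cof_def SF_simps sset_cofibration_def
  by (auto simp: boundary_incl_def sf_mk_def inj_on_def)

lemma boundary_vertex_hom: "c \<le> 1 \<Longrightarrow> boundary_vertex c \<in> homset SF (std_simplex 0) boundary_1"
  unfolding boundary_vertex_def
proof (rule sf_mk_hom)
  assume c: "c \<le> 1"
  show "list_encode (replicate (Suc n) c) \<in> cells boundary_1 n" for n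
    using c by (auto simp: boundary_1_def le_Suc_eq)
  show "list_encode (replicate (Suc m) c) = act boundary_1 n \<theta> (list_encode (replicate (Suc n) c))"
    if "\<theta> \<in> ord_maps m n" for m n \<theta> using act_boundary_1_const[OF that] by simp
qed (rule finite_ssets)+

lemma boundary_incl_vertex: "c \<le> 1 \<Longrightarrow> boundary_incl \<cdot>\<^bsub>SF\<^esub> boundary_vertex c = vertex c"
  unfolding boundary_incl_def boundary_vertex_def vertex_eq
  by (subst sf_mk_Cmp) (auto simp: boundary_1_def le_Suc_eq)

text \<open>The boundary of the interval is two points glued along the empty set. In this form the
  tensor, which preserves finite colimits, turns it into a coproduct of two copies of an
  object.\<close>

lemma boundary_pushout:
  "is_pushout SF (empty_map (std_simplex 0)) (empty_map (std_simplex 0)) (boundary_vertex 0)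
      (boundary_vertex 1)"
proof -
  interpret SF: category SF by (rule SF_category)
  let ?pt = "\<lambda>n. list_encode (replicate (Suc n) (0::nat))"
  have pt: "cells (std_simplex 0) n = {?pt n}" for n by (simp add: std_simplex_cells ord_maps_0)
  have bd: "cells boundary_1 n = {?pt n, list_encode (replicate (Suc n) 1)}" for n by
    (simp add: boundary_1_def)
  have ne: "list_encode (replicate (Suc n) 1) \<noteq> ?pt n" for n by (simp add: list_encode_eq)
  note e = empty_map_hom[OF finite_ssets(1)[of 0]]
  show ?thesis
  proof (rule SF.is_pushoutI[OF e e boundary_vertex_hom boundary_vertex_hom])
    show "boundary_vertex 0 \<cdot>\<^bsub>SF\<^esub> empty_map (std_simplex 0) = boundary_vertex 1 \<cdot>\<^bsub>SF\<^esub> empty_map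
        (std_simplex 0)"
      using empty_sset_initial SF.Cmp_in[OF e boundary_vertex_hom[of 0]]
        SF.Cmp_in[OF e boundary_vertex_hom[of 1]]
        SF.homset_Obj[OF boundary_vertex_hom[of 0]] unfolding is_initial_def by force
    show "\<exists>h \<in> homset SF boundary_1 E. h \<cdot>\<^bsub>SF\<^esub> boundary_vertex 0 = p' \<and> h \<cdot>\<^bsub>SF\<^esub> boundary_vertex 1 =
        q'"
      if p': "p' \<in> homset SF (std_simplex 0) E" and q': "q' \<in> homset SF (std_simplex 0) E" for E p'
        q'
    proof -
      obtain p q where p: "p' = (std_simplex 0, p, E)" "simplicial_map (std_simplex 0) E p"
        and q: "q' = (std_simplex 0, q, E)" "simplicial_map (std_simplex 0) E q" and E:
          "finite_sset E"
        using p' q' unfolding SF_homset by blast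
      have pE: "p n (?pt n) \<in> cells E n" "q n (?pt n) \<in> cells E n" for n
        using p(2) q(2) pt[of n] unfolding simplicial_map_def by blast+
      have act_pt: "act (std_simplex 0) n \<theta> (?pt n) = ?pt m" if "\<theta> \<in> ord_maps m n" for m n \<theta>
        unfolding std_simplex_act using ord_comp_const[OF that] by simp
      have nat: "p m (?pt m) = act E n \<theta> (p n (?pt n))" "q m (?pt m) = act E n \<theta> (q n (?pt n))"
        if "\<theta> \<in> ord_maps m n" for m n \<theta>
        using p(2) q(2) that pt[of n] act_pt[OF that] unfolding simplicial_map_def by
          (metis singletonI)+
      let ?h = "sf_mk boundary_1 E (\<lambda>n x. if x = ?pt n then p n (?pt n) else q n (?pt n))"
      have h: "?h \<in> homset SF boundary_1 E"
      proof (rule sf_mk_hom[OF finite_ssets(2) E])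
        show "(if x = ?pt n then p n (?pt n) else q n (?pt n)) \<in> cells E n" for n x using pE by simp
        show "(if act boundary_1 n \<theta> x = ?pt m then p m (?pt m) else q m (?pt m)) =
            act E n \<theta> (if x = ?pt n then p n (?pt n) else q n (?pt n))"
          if "\<theta> \<in> ord_maps m n" "x \<in> cells boundary_1 n" for m n \<theta> x
          using that(2) act_boundary_1_const[OF that(1), of 0]
            act_boundary_1_const[OF that(1), of 1]
            nat[OF that(1)] ne[of m] ne[of n] unfolding bd by auto
      qed
      have ext: "f = sf_mk (std_simplex 0) E g"
        if "f = (std_simplex 0, f0, E)" "simplicial_map (std_simplex 0) E f0" "\<And>n. f0 n (?pt n) =
            g n (?pt n)"
        for f f0 g
      proof -
        have "f0 n = restrict (g n) (cells (std_simplex 0) n)" for n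
        proof (rule extensionalityI[of _ "cells (std_simplex 0) n"])
          show "f0 n \<in> extensional (cells (std_simplex 0) n)"
            using that(2) unfolding simplicial_map_def by (auto simp: PiE_def)
        qed (use that(3) pt[of n] in auto)
        then show ?thesis unfolding that(1) sf_mk_def by (simp add: fun_eq_iff)
      qed
      have "?h \<cdot>\<^bsub>SF\<^esub> boundary_vertex 0 = p'" "?h \<cdot>\<^bsub>SF\<^esub> boundary_vertex 1 = q'"
        unfolding boundary_vertex_def
        by (subst sf_mk_Cmp, simp add: bd, rule ext[OF p, symmetric], simp)
          (subst sf_mk_Cmp, simp add: bd, rule ext[OF q, symmetric], use ne in simp)
      then show ?thesis using h by blast
    qed
    show "h = h'"
      if h: "h \<in> homset SF boundary_1 E" and h': "h' \<in> homset SF boundary_1 E"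
        and 0: "h \<cdot>\<^bsub>SF\<^esub> boundary_vertex 0 = h' \<cdot>\<^bsub>SF\<^esub> boundary_vertex 0"
        and 1: "h \<cdot>\<^bsub>SF\<^esub> boundary_vertex 1 = h' \<cdot>\<^bsub>SF\<^esub> boundary_vertex 1" for E h h'
    proof -
      obtain g g' where g: "h = (boundary_1, g, E)" "simplicial_map boundary_1 E g"
        and g': "h' = (boundary_1, g', E)" "simplicial_map boundary_1 E g'"
        using h h' unfolding SF_homset by blast
      have "g n (list_encode (replicate (Suc n) c)) = g' n (list_encode (replicate (Suc n) c))"
        if "h \<cdot>\<^bsub>SF\<^esub> boundary_vertex c = h' \<cdot>\<^bsub>SF\<^esub> boundary_vertex c" for n c
      proof -
        \<comment> \<open>Both composites are functions on the single \<open>n\<close>-simplex of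
          the point; evaluated there they give the values of \<open>g\<close> and \<open>g'\<close>
          at a constant simplex of the boundary.\<close>
        have "(\<lambda>n. restrict (\<lambda>x. g n (restrict (\<lambda>x. list_encode (replicate (Suc n) c))
            (cells (std_simplex 0) n) x)) (cells (std_simplex 0) n)) =
          (\<lambda>n. restrict (\<lambda>x. g' n (restrict (\<lambda>x. list_encode (replicate (Suc n) c))
            (cells (std_simplex 0) n) x)) (cells (std_simplex 0) n))"
          using that unfolding g(1) g'(1) boundary_vertex_def
            sf_mk_def[of "std_simplex 0" boundary_1] SF_simps
          by (simp add: sf_mk_def)
        from fun_cong[OF fun_cong[OF this, of n], of "?pt n"] show ?thesis using pt[of n] by simp
      qed
      from this[OF 0] this[OF 1] have "g n = g' n" for n
        by (intro extensionalityI[of _ "cells boundary_1 n"])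
          (use g(2) g'(2) in \<open>auto simp: simplicial_map_def PiE_def bd\<close>)
      then show ?thesis using g(1) g'(1) by (simp add: fun_eq_iff)
    qed
  qed simp_all
qed

section \<open>Cylinders\<close>

context simplicial_weak_cofibration_category
begin

abbreviation \<Delta>0 :: sf_ob where "\<Delta>0 \<equiv> std_simplex 0"
abbreviation \<Delta>1 :: sf_ob where "\<Delta>1 \<equiv> std_simplex 1"

lemma T_Obj: "\<lbrakk>finite_sset X; A \<in> Obj M\<rbrakk> \<Longrightarrow> FOb T (X, A) \<in> Obj M"
  using T_functor unfolding is_functor_def prod_cat_def by (simp add: SF_simps)

lemma T_hom:
  assumes "f \<in> homset SF X X'" "h \<in> homset M A A'"
  shows "FAr T (f, h) \<in> homset M (FOb T (X, A)) (FOb T (X', A'))"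
  using T_functor assms unfolding is_functor_def prod_cat_def homset_def by auto

lemma T_Idn: "\<lbrakk>finite_sset X; A \<in> Obj M\<rbrakk> \<Longrightarrow> FAr T (Idn SF X, Idn M A) = Idn M (FOb T (X, A))"
  using T_functor unfolding is_functor_def prod_cat_def by (simp add: SF_simps(1))

lemma T_Cmp:
  assumes "f \<in> homset SF X X'" "f' \<in> homset SF X' X''" "h \<in> homset M A A'" "h' \<in> homset M A' A''"
  shows "FAr T (f', h') \<cdot> FAr T (f, h) = FAr T (f' \<cdot>\<^bsub>SF\<^esub> f, h' \<cdot> h)"
  using T_functor assms unfolding is_functor_def prod_cat_def homset_def by auto

lemma SF_Idn_hom: "finite_sset X \<Longrightarrow> Idn SF X \<in> homset SF X X"
  using category.Idn_in[OF SF_category] by (simp add: SF_simps(1))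

lemma T_Cmp_left:
  assumes "f \<in> homset SF X X'" "f' \<in> homset SF X' X''" "A \<in> Obj M"
  shows "FAr T (f', Idn M A) \<cdot> FAr T (f, Idn M A) = FAr T (f' \<cdot>\<^bsub>SF\<^esub> f, Idn M A)"
  using T_Cmp[OF assms(1,2) Idn_in[OF assms(3)] Idn_in[OF assms(3)]] Cmp_Idn[OF Idn_in[OF assms(3)]]
    by simp

lemma T_Cmp_right:
  assumes "finite_sset X" "h \<in> homset M A A'" "h' \<in> homset M A' A''"
  shows "FAr T (Idn SF X, h') \<cdot> FAr T (Idn SF X, h) = FAr T (Idn SF X, h' \<cdot> h)"
  using T_Cmp[OF SF_Idn_hom[OF assms(1)] SF_Idn_hom[OF assms(1)] assms(2,3)]
    category.Cmp_Idn[OF SF_category SF_Idn_hom[OF assms(1)]] by simp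

lemma T_swap:
  assumes f: "f \<in> homset SF X X'" and h: "h \<in> homset M A A'"
  shows "FAr T (f, Idn M A') \<cdot> FAr T (Idn SF X, h) = FAr T (Idn SF X', h) \<cdot> FAr T (f, Idn M A)"
proof -
  interpret SF: category SF by (rule SF_category)
  have X: "Idn SF X \<in> homset SF X X" "Idn SF X' \<in> homset SF X' X'"
    using SF.homset_Obj[OF f] SF.Idn_in by auto
  have A: "Idn M A \<in> homset M A A" "Idn M A' \<in> homset M A' A'" using homset_Obj[OF h] Idn_in by auto
  show ?thesis
    unfolding T_Cmp[OF X(1) f h A(2)] T_Cmp[OF f X(2) A(1) h] SF.Cmp_Idn[OF f] SF.Idn_Cmp[OF f]
      Cmp_Idn[OF h] Idn_Cmp[OF h] ..
qed

definition l_inv :: "'o \<Rightarrow> 'a" where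
  "l_inv A = (SOME g. g \<in> homset M A (FOb T (\<Delta>0, A)) \<and>
    g \<cdot> l A = Idn M (FOb T (\<Delta>0, A)) \<and> l A \<cdot> g = Idn M A)"

definition a_inv :: "sf_ob \<Rightarrow> sf_ob \<Rightarrow> 'o \<Rightarrow> 'a" where
  "a_inv X Y A = (SOME g. g \<in> homset M (FOb T (X, FOb T (Y, A))) (FOb T (sset_prod X Y, A)) \<and>
    g \<cdot> a X Y A = Idn M (FOb T (sset_prod X Y, A)) \<and> a X Y A \<cdot> g = Idn M (FOb T (X, FOb T (Y, A))))"

lemma l_hom: "A \<in> Obj M \<Longrightarrow> l A \<in> homset M (FOb T (\<Delta>0, A)) A"
  using l_arr by (simp add: Unt_SF)

lemma l_inv:
  assumes "A \<in> Obj M"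
  shows "l_inv A \<in> homset M A (FOb T (\<Delta>0, A))" "l_inv A \<cdot> l A = Idn M (FOb T (\<Delta>0, A))"
    "l A \<cdot> l_inv A = Idn M A"
proof -
  have "\<exists>g. g \<in> homset M A (FOb T (\<Delta>0, A)) \<and> g \<cdot> l A = Idn M (FOb T (\<Delta>0, A)) \<and> l A \<cdot> g = Idn M A"
    by (rule is_iso_inverse[OF l_iso[OF assms] l_hom[OF assms]]) blast
  from someI_ex[OF this, folded l_inv_def]
  show "l_inv A \<in> homset M A (FOb T (\<Delta>0, A))" "l_inv A \<cdot> l A = Idn M (FOb T (\<Delta>0, A))"
    "l A \<cdot> l_inv A = Idn M A" by auto
qed

lemma a_hom: "\<lbrakk>finite_sset X; finite_sset Y; A \<in> Obj M\<rbrakk> \<Longrightarrow>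
    a X Y A \<in> homset M (FOb T (sset_prod X Y, A)) (FOb T (X, FOb T (Y, A)))"
  using a_arr[of X Y A] by (simp add: SF_simps(1) FOb_Tens_SF)

lemma a_inv:
  assumes "finite_sset X" "finite_sset Y" "A \<in> Obj M"
  shows "a_inv X Y A \<in> homset M (FOb T (X, FOb T (Y, A))) (FOb T (sset_prod X Y, A))"
    "a_inv X Y A \<cdot> a X Y A = Idn M (FOb T (sset_prod X Y, A))"
    "a X Y A \<cdot> a_inv X Y A = Idn M (FOb T (X, FOb T (Y, A)))"
proof -
  have "is_iso M (a X Y A)" using a_iso[of X Y A] assms by (simp add: SF_simps(1))
  then have "\<exists>g. g \<in> homset M (FOb T (X, FOb T (Y, A))) (FOb T (sset_prod X Y, A)) \<and>
    g \<cdot> a X Y A = Idn M (FOb T (sset_prod X Y, A)) \<and> a X Y A \<cdot> g = Idn M (FOb T (X, FOb T (Y, A)))"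
    by (rule is_iso_inverse[OF _ a_hom[OF assms]]) blast
  from someI_ex[OF this, folded a_inv_def]
  show "a_inv X Y A \<in> homset M (FOb T (X, FOb T (Y, A))) (FOb T (sset_prod X Y, A))"
    "a_inv X Y A \<cdot> a X Y A = Idn M (FOb T (sset_prod X Y, A))"
    "a X Y A \<cdot> a_inv X Y A = Idn M (FOb T (X, FOb T (Y, A)))" by auto
qed

lemma iso_cancel_right:
  assumes "x \<in> homset M B D" "y \<in> homset M B D" "e \<in> homset M A B" "r \<in> homset M B A" "e \<cdot> r =
      Idn M B"
    and eq: "x \<cdot> e = y \<cdot> e"
  shows "x = y"
proof -
  have "x = (x \<cdot> e) \<cdot> r" unfolding Cmp_assoc[OF assms(4,3,1)] assms(5) Cmp_Idn[OF assms(1)] ..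
  also have "\<dots> = y" unfolding eq Cmp_assoc[OF assms(4,3,2)] assms(5) Cmp_Idn[OF assms(2)] ..
  finally show ?thesis .
qed

section \<open>The cylinder functor and the contraction of a cylinder\<close>

definition Cyl :: "'o \<Rightarrow> 'o" where "Cyl A = FOb T (\<Delta>1, A)"
definition cyl_map :: "'a \<Rightarrow> 'a" where "cyl_map f = FAr T (Idn SF \<Delta>1, f)"
definition cyl_in :: "nat \<Rightarrow> 'o \<Rightarrow> 'a" where "cyl_in c A = FAr T (vertex c, Idn M A) \<cdot> l_inv A"
definition cyl_pr :: "'o \<Rightarrow> 'a" where "cyl_pr A = l A \<cdot> FAr T (to_point, Idn M A)"
text \<open>The contraction of the interval tensored with \<open>A\<close>. The outer cylinder is
  the time of the homotopy, the inner one the cylinder that is contracted.\<close>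

definition cyl_max :: "'o \<Rightarrow> 'a" where "cyl_max A = FAr T (simplex_max, Idn M A) \<cdot> a_inv \<Delta>1 \<Delta>1 A"

lemmas fin_std = finite_ssets(1)

lemma Cyl_Obj: "A \<in> Obj M \<Longrightarrow> Cyl A \<in> Obj M"
  unfolding Cyl_def by (rule T_Obj[OF fin_std])

lemma cyl_map_hom: "f \<in> homset M A B \<Longrightarrow> cyl_map f \<in> homset M (Cyl A) (Cyl B)"
  unfolding cyl_map_def Cyl_def by (rule T_hom[OF SF_Idn_hom[OF fin_std]])

lemma cyl_map_Cmp: "\<lbrakk>f \<in> homset M A B; g \<in> homset M B D\<rbrakk> \<Longrightarrow> cyl_map (g \<cdot> f) = cyl_map g \<cdot> cyl_map f"
  unfolding cyl_map_def by (rule T_Cmp_right[OF fin_std, symmetric])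

lemma cyl_in_hom: "\<lbrakk>A \<in> Obj M; c \<le> 1\<rbrakk> \<Longrightarrow> cyl_in c A \<in> homset M A (Cyl A)"
  unfolding cyl_in_def Cyl_def by (rule Cmp_in[OF l_inv(1) T_hom[OF vertex_hom Idn_in]])

lemma cyl_pr_hom: "A \<in> Obj M \<Longrightarrow> cyl_pr A \<in> homset M (Cyl A) A"
  unfolding cyl_pr_def Cyl_def by (rule Cmp_in[OF T_hom[OF to_point_hom Idn_in] l_hom])

lemma cyl_max_hom: "A \<in> Obj M \<Longrightarrow> cyl_max A \<in> homset M (Cyl (Cyl A)) (Cyl A)"
  unfolding cyl_max_def Cyl_def
  by (rule Cmp_in[OF a_inv(1)[OF fin_std fin_std] T_hom[OF simplex_max_hom Idn_in]])

lemma l_inv_natural: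
  assumes h: "h \<in> homset M A B"
  shows "l_inv B \<cdot> h = FAr T (Idn SF \<Delta>0, h) \<cdot> l_inv A"
proof -
  have O: "A \<in> Obj M" "B \<in> Obj M" using homset_Obj[OF h] by auto
  note lA = l_hom[OF O(1)] l_inv[OF O(1)] and lB = l_hom[OF O(2)] l_inv[OF O(2)]
  have Th: "FAr T (Idn SF \<Delta>0, h) \<in> homset M (FOb T (\<Delta>0, A)) (FOb T (\<Delta>0, B))"
    by (rule T_hom[OF SF_Idn_hom[OF fin_std] h])
  have "l B \<cdot> FAr T (Idn SF \<Delta>0, h) = h \<cdot> l A" using l_natural[OF h] by (simp add: Unt_SF)
  then have "(l_inv B \<cdot> h) \<cdot> l A = FAr T (Idn SF \<Delta>0, h)"
    using Cmp_assoc[OF lA(1) h lB(2)] Cmp_assoc[OF Th lB(1) lB(2)] lB(3) Idn_Cmp[OF Th] by simp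
  also have "\<dots> = (FAr T (Idn SF \<Delta>0, h) \<cdot> l_inv A) \<cdot> l A"
    using Cmp_assoc[OF lA(1) lA(2) Th] lA(3) Cmp_Idn[OF Th] by simp
  finally show ?thesis
    by (rule iso_cancel_right[OF Cmp_in[OF h lB(2)] Cmp_in[OF lA(2) Th] lA(1,2,4)])
qed

lemma cyl_in_natural:
  assumes f: "f \<in> homset M A B" and c: "c \<le> 1"
  shows "cyl_map f \<cdot> cyl_in c A = cyl_in c B \<cdot> f"
proof -
  have O: "A \<in> Obj M" "B \<in> Obj M" using homset_Obj[OF f] by auto
  note v = vertex_hom[OF c]
  note vA = T_hom[OF v Idn_in[OF O(1)]] and vB = T_hom[OF v Idn_in[OF O(2)]]
  note i0 = T_hom[OF SF_Idn_hom[OF fin_std[of 0]] f] and i1 = T_hom[OF SF_Idn_hom[OF fin_std[of 1]]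
    f]
  have "cyl_map f \<cdot> cyl_in c A = (FAr T (Idn SF \<Delta>1, f) \<cdot> FAr T (vertex c, Idn M A)) \<cdot> l_inv A"
    unfolding cyl_map_def cyl_in_def by (rule Cmp_assoc[OF l_inv(1)[OF O(1)] vA i1, symmetric])
  also have "\<dots> = FAr T (vertex c, Idn M B) \<cdot> (FAr T (Idn SF \<Delta>0, f) \<cdot> l_inv A)"
    unfolding T_swap[OF v f, symmetric] by (rule Cmp_assoc[OF l_inv(1)[OF O(1)] i0 vB])
  also have "\<dots> = cyl_in c B \<cdot> f"
    unfolding l_inv_natural[OF f, symmetric] cyl_in_def
    by (rule Cmp_assoc[OF f l_inv(1)[OF O(2)] vB, symmetric])
  finally show ?thesis .
qed

lemma cyl_pr_natural:
  assumes f: "f \<in> homset M A B"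
  shows "cyl_pr B \<cdot> cyl_map f = f \<cdot> cyl_pr A"
proof -
  have O: "A \<in> Obj M" "B \<in> Obj M" using homset_Obj[OF f] by auto
  note v = to_point_hom
  note vA = T_hom[OF v Idn_in[OF O(1)]] and vB = T_hom[OF v Idn_in[OF O(2)]]
  note i0 = T_hom[OF SF_Idn_hom[OF fin_std[of 0]] f] and i1 = T_hom[OF SF_Idn_hom[OF fin_std[of 1]]
    f]
  have "cyl_pr B \<cdot> cyl_map f = l B \<cdot> (FAr T (to_point, Idn M B) \<cdot> FAr T (Idn SF \<Delta>1, f))"
    unfolding cyl_map_def cyl_pr_def by (rule Cmp_assoc[OF i1 vB l_hom[OF O(2)]])
  also have "\<dots> = (l B \<cdot> FAr T (Idn SF \<Delta>0, f)) \<cdot> FAr T (to_point, Idn M A)"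
    unfolding T_swap[OF v f] by (rule Cmp_assoc[OF vA i0 l_hom[OF O(2)], symmetric])
  also have "\<dots> = f \<cdot> cyl_pr A"
    unfolding l_natural[OF f, unfolded Unt_SF] cyl_pr_def by
      (rule Cmp_assoc[OF vA l_hom[OF O(1)] f])
  finally show ?thesis .
qed

lemma cyl_in_pr:
  assumes A: "A \<in> Obj M" and c: "c \<le> 1"
  shows "cyl_in c A \<cdot> cyl_pr A = FAr T (vertex c, Idn M A) \<cdot> FAr T (to_point, Idn M A)"
proof -
  note v = T_hom[OF vertex_hom[OF c] Idn_in[OF A]] and p = T_hom[OF to_point_hom Idn_in[OF A]]
  have "cyl_in c A \<cdot> cyl_pr A = FAr T (vertex c, Idn M A) \<cdot> (l_inv A \<cdot> (l A \<cdot> FAr T (to_point,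
      Idn M A)))"
    unfolding cyl_in_def cyl_pr_def by (rule Cmp_assoc[OF Cmp_in[OF p l_hom[OF A]] l_inv(1)[OF A]
      v])
  also have "l_inv A \<cdot> (l A \<cdot> FAr T (to_point, Idn M A)) = FAr T (to_point, Idn M A)"
    using Cmp_assoc[OF p l_hom[OF A] l_inv(1)[OF A]] l_inv(2)[OF A] Idn_Cmp[OF p] by simp
  finally show ?thesis .
qed

lemma cyl_pr_in:
  assumes A: "A \<in> Obj M" and c: "c \<le> 1"
  shows "cyl_pr A \<cdot> cyl_in c A = Idn M A"
proof -
  note v = T_hom[OF vertex_hom[OF c] Idn_in[OF A]] and p = T_hom[OF to_point_hom Idn_in[OF A]]
  have "to_point \<cdot>\<^bsub>SF\<^esub> vertex c = Idn SF \<Delta>0"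
    by (rule SF_terminal[OF category.Cmp_in[OF SF_category vertex_hom[OF c] to_point_hom]
      SF_Idn_hom[OF fin_std]])
  then have pv: "FAr T (to_point, Idn M A) \<cdot> FAr T (vertex c, Idn M A) = Idn M (FOb T (\<Delta>0, A))"
    using T_Cmp_left[OF vertex_hom[OF c] to_point_hom A] T_Idn[OF fin_std A] by simp
  have "cyl_pr A \<cdot> cyl_in c A = l A \<cdot> (FAr T (to_point, Idn M A) \<cdot> (FAr T (vertex c, Idn M A) \<cdot>
      l_inv A))"
    unfolding cyl_in_def cyl_pr_def by (rule Cmp_assoc[OF Cmp_in[OF l_inv(1)[OF A] v] p
      l_hom[OF A]])
  also have "\<dots> = Idn M A"
    using Cmp_assoc[OF l_inv(1)[OF A] v p] pv Idn_Cmp[OF l_inv(1)[OF A]] l_inv(3)[OF A] by simp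
  finally show ?thesis .
qed

lemma T_LUn:
  assumes A: "A \<in> Obj M"
  shows "FAr T (LUn SF \<Delta>1, Idn M A) = l (Cyl A) \<cdot> a \<Delta>0 \<Delta>1 A"
  using unit_left[of \<Delta>1 A] A by (simp add: Unt_SF SF_simps(1) fin_std Cyl_def)

lemma T_RUn:
  assumes A: "A \<in> Obj M"
  shows "FAr T (RUn SF \<Delta>1, Idn M A) = cyl_map (l A) \<cdot> a \<Delta>1 \<Delta>0 A"
  using unit_right[of \<Delta>1 A] A by (simp add: Unt_SF SF_simps(1) fin_std cyl_map_def)

text \<open>Precomposition with the left unit removes all structure maps: by unit coherence it
  cancels the inverse of \<open>l\<close> and leaves an associator, whose naturality moves the
  vertex into the first factor of a product in \<open>SF\<close>. What remains is a computation with
  \<open>max\<close>.\<close>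

lemma cyl_max_in_LUn:
  assumes A: "A \<in> Obj M" and c: "c \<le> 1"
  shows "(cyl_max A \<cdot> cyl_in c (Cyl A)) \<cdot> FAr T (LUn SF \<Delta>1, Idn M A) =
    FAr T (simplex_max \<cdot>\<^bsub>SF\<^esub> FAr (Tens SF) (vertex c, Idn SF \<Delta>1), Idn M A)"
proof -
  note v = vertex_hom[OF c] and i = SF_Idn_hom[OF fin_std[of 1]] and IA = Idn_in[OF A]
  note CO = Cyl_Obj[OF A]
  have vI: "FAr T (vertex c, Idn M (Cyl A)) \<in> homset M (FOb T (\<Delta>0, Cyl A)) (Cyl (Cyl A))"
    unfolding Cyl_def[of "Cyl A"] by (rule T_hom[OF v Idn_in[OF CO]])
  have a0: "a \<Delta>0 \<Delta>1 A \<in> homset M (FOb T (sset_prod \<Delta>0 \<Delta>1, A)) (FOb T (\<Delta>0, Cyl A))"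
    unfolding Cyl_def by (rule a_hom[OF fin_std fin_std A])
  have a1: "a \<Delta>1 \<Delta>1 A \<in> homset M (FOb T (sset_prod \<Delta>1 \<Delta>1, A)) (Cyl (Cyl A))"
    "a_inv \<Delta>1 \<Delta>1 A \<in> homset M (Cyl (Cyl A)) (FOb T (sset_prod \<Delta>1 \<Delta>1, A))"
    unfolding Cyl_def by (rule a_hom[OF fin_std fin_std A], rule a_inv(1)[OF fin_std fin_std A])
  note vt = T_hom[OF Tens_hom[OF v i] IA]
  note mx = T_hom[OF simplex_max_hom IA]
  have nat: "FAr T (vertex c, Idn M (Cyl A)) \<cdot> a \<Delta>0 \<Delta>1 A =
      a \<Delta>1 \<Delta>1 A \<cdot> FAr T (FAr (Tens SF) (vertex c, Idn SF \<Delta>1), Idn M A)"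
    using a_natural[OF v i IA] T_Idn[OF fin_std[of 1] A] by (simp add: Cyl_def)
  have "cyl_in c (Cyl A) \<cdot> FAr T (LUn SF \<Delta>1, Idn M A) =
      FAr T (vertex c, Idn M (Cyl A)) \<cdot> (l_inv (Cyl A) \<cdot> (l (Cyl A) \<cdot> a \<Delta>0 \<Delta>1 A))"
    unfolding cyl_in_def T_LUn[OF A] by (rule Cmp_assoc[OF Cmp_in[OF a0 l_hom[OF CO]]
      l_inv(1)[OF CO] vI])
  also have "\<dots> = a \<Delta>1 \<Delta>1 A \<cdot> FAr T (FAr (Tens SF) (vertex c, Idn SF \<Delta>1), Idn M A)"
    using Cmp_assoc[OF a0 l_hom[OF CO] l_inv(1)[OF CO]] l_inv(2)[OF CO] Idn_Cmp[OF a0] nat by simp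
  finally have 1: "cyl_in c (Cyl A) \<cdot> FAr T (LUn SF \<Delta>1, Idn M A) =
      a \<Delta>1 \<Delta>1 A \<cdot> FAr T (FAr (Tens SF) (vertex c, Idn SF \<Delta>1), Idn M A)" .
  have L: "FAr T (LUn SF \<Delta>1, Idn M A) \<in> homset M (FOb T (sset_prod \<Delta>0 \<Delta>1, A)) (Cyl A)"
    unfolding Cyl_def by (rule T_hom[OF LUn_hom IA])
  have "(cyl_max A \<cdot> cyl_in c (Cyl A)) \<cdot> FAr T (LUn SF \<Delta>1, Idn M A) =
      cyl_max A \<cdot> (a \<Delta>1 \<Delta>1 A \<cdot> FAr T (FAr (Tens SF) (vertex c, Idn SF \<Delta>1), Idn M A))"
    unfolding 1[symmetric] by (rule Cmp_assoc[OF L cyl_in_hom[OF CO c] cyl_max_hom[OF A]])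
  also have "\<dots> = FAr T (simplex_max, Idn M A) \<cdot>
      (a_inv \<Delta>1 \<Delta>1 A \<cdot> (a \<Delta>1 \<Delta>1 A \<cdot> FAr T (FAr (Tens SF) (vertex c, Idn SF \<Delta>1), Idn M A)))"
    unfolding cyl_max_def by (rule Cmp_assoc[OF Cmp_in[OF vt a1(1)] a1(2) mx])
  also have "\<dots> = FAr T (simplex_max, Idn M A) \<cdot> FAr T (FAr (Tens SF) (vertex c, Idn SF \<Delta>1),
      Idn M A)"
    using Cmp_assoc[OF vt a1] a_inv(2)[OF fin_std fin_std A] Idn_Cmp[OF vt] by simp
  also have "\<dots> = FAr T (simplex_max \<cdot>\<^bsub>SF\<^esub> FAr (Tens SF) (vertex c, Idn SF \<Delta>1), Idn M A)"
    by (rule T_Cmp_left[OF Tens_hom[OF v i] simplex_max_hom A])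
  finally show ?thesis .
qed

text \<open>By unit coherence the left unit tensored with \<open>A\<close> is a composite of
  isomorphisms, so maps out of the cylinder can be compared after composing with it.\<close>

lemma LUn_cancel:
  assumes A: "A \<in> Obj M" and xy: "x \<in> homset M (Cyl A) D" "y \<in> homset M (Cyl A) D"
    and eq: "x \<cdot> FAr T (LUn SF \<Delta>1, Idn M A) = y \<cdot> FAr T (LUn SF \<Delta>1, Idn M A)"
  shows "x = y"
proof -
  note CO = Cyl_Obj[OF A]
  have a0: "a \<Delta>0 \<Delta>1 A \<in> homset M (FOb T (sset_prod \<Delta>0 \<Delta>1, A)) (FOb T (\<Delta>0, Cyl A))"
    "a_inv \<Delta>0 \<Delta>1 A \<in> homset M (FOb T (\<Delta>0, Cyl A)) (FOb T (sset_prod \<Delta>0 \<Delta>1, A))"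
    "a \<Delta>0 \<Delta>1 A \<cdot> a_inv \<Delta>0 \<Delta>1 A = Idn M (FOb T (\<Delta>0, Cyl A))"
    unfolding Cyl_def by (rule a_hom[OF fin_std fin_std A], rule a_inv(1)[OF fin_std fin_std A],
      rule a_inv(3)[OF fin_std fin_std A])
  note l = l_hom[OF CO] l_inv[OF CO]
  have "(l (Cyl A) \<cdot> a \<Delta>0 \<Delta>1 A) \<cdot> (a_inv \<Delta>0 \<Delta>1 A \<cdot> l_inv (Cyl A)) = Idn M (Cyl A)"
    using Cmp_assoc[OF Cmp_in[OF l(2) a0(2)] a0(1) l(1)] Cmp_assoc[OF l(2) a0(2,1)] a0(3)
      Idn_Cmp[OF l(2)] l(4)
    by simp
  then show ?thesis
    using iso_cancel_right[OF xy Cmp_in[OF a0(1) l(1)] Cmp_in[OF l(2) a0(2)]] eq unfolding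
      T_LUn[OF A] by blast
qed

lemma cyl_max_in_0:
  assumes A: "A \<in> Obj M"
  shows "cyl_max A \<cdot> cyl_in 0 (Cyl A) = Idn M (Cyl A)"
proof (rule LUn_cancel[OF A])
  note CO = Cyl_Obj[OF A]
  show "cyl_max A \<cdot> cyl_in 0 (Cyl A) \<in> homset M (Cyl A) (Cyl A)"
    by (rule Cmp_in[OF cyl_in_hom[OF CO] cyl_max_hom[OF A]]) simp
  show "Idn M (Cyl A) \<in> homset M (Cyl A) (Cyl A)" by (rule Idn_in[OF CO])
  have L: "FAr T (LUn SF \<Delta>1, Idn M A) \<in> homset M (FOb T (sset_prod \<Delta>0 \<Delta>1, A)) (Cyl A)"
    unfolding Cyl_def by (rule T_hom[OF LUn_hom Idn_in[OF A]])
  show "(cyl_max A \<cdot> cyl_in 0 (Cyl A)) \<cdot> FAr T (LUn SF \<Delta>1, Idn M A) =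
      Idn M (Cyl A) \<cdot> FAr T (LUn SF \<Delta>1, Idn M A)"
    unfolding cyl_max_in_LUn[OF A le0] simplex_max_vertices(1) Idn_Cmp[OF L] ..
qed

lemma T_const:
  assumes A: "A \<in> Obj M" and g: "g \<in> homset SF X \<Delta>1"
  shows "FAr T (vertex 1 \<cdot>\<^bsub>SF\<^esub> (to_point \<cdot>\<^bsub>SF\<^esub> g), Idn M A) = (cyl_in 1 A \<cdot> cyl_pr A) \<cdot> FAr T (g,
      Idn M A)"
proof -
  interpret SF: category SF by (rule SF_category)
  note v = vertex_hom[OF order_refl]
  note IA = Idn_in[OF A]
  have "FAr T (vertex 1 \<cdot>\<^bsub>SF\<^esub> (to_point \<cdot>\<^bsub>SF\<^esub> g), Idn M A) =
      FAr T (vertex 1, Idn M A) \<cdot> FAr T (to_point \<cdot>\<^bsub>SF\<^esub> g, Idn M A)"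
    by (rule T_Cmp_left[OF SF.Cmp_in[OF g to_point_hom] v A, symmetric])
  also have "\<dots> = FAr T (vertex 1, Idn M A) \<cdot> (FAr T (to_point, Idn M A) \<cdot> FAr T (g, Idn M A))"
    unfolding T_Cmp_left[OF g to_point_hom A] ..
  also have "\<dots> = (cyl_in 1 A \<cdot> cyl_pr A) \<cdot> FAr T (g, Idn M A)"
    unfolding cyl_in_pr[OF A order_refl]
    by (rule Cmp_assoc[OF T_hom[OF g IA] T_hom[OF to_point_hom IA] T_hom[OF v IA], symmetric])
  finally show ?thesis .
qed

lemma cyl_max_in_1:
  assumes A: "A \<in> Obj M"
  shows "cyl_max A \<cdot> cyl_in 1 (Cyl A) = cyl_in 1 A \<cdot> cyl_pr A"
proof (rule LUn_cancel[OF A])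
  note CO = Cyl_Obj[OF A]
  show "cyl_max A \<cdot> cyl_in 1 (Cyl A) \<in> homset M (Cyl A) (Cyl A)"
    by (rule Cmp_in[OF cyl_in_hom[OF CO order_refl] cyl_max_hom[OF A]])
  show "cyl_in 1 A \<cdot> cyl_pr A \<in> homset M (Cyl A) (Cyl A)"
    by (rule Cmp_in[OF cyl_pr_hom[OF A] cyl_in_hom[OF A order_refl]])
  show "(cyl_max A \<cdot> cyl_in 1 (Cyl A)) \<cdot> FAr T (LUn SF \<Delta>1, Idn M A) =
      (cyl_in 1 A \<cdot> cyl_pr A) \<cdot> FAr T (LUn SF \<Delta>1, Idn M A)"
    unfolding cyl_max_in_LUn[OF A order_refl] simplex_max_vertices(2) by
      (rule T_const[OF A LUn_hom])
qed

text \<open>The end \<open>1\<close> is the one glued to another object in a mapping cylinder, so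
  the homotopy must be stationary there in order to descend. The vertex now sits in the second
  factor, hence the right unit takes over the role of the left one.\<close>

lemma cyl_max_cyl_in_1:
  assumes A: "A \<in> Obj M"
  shows "cyl_max A \<cdot> cyl_map (cyl_in 1 A) = cyl_in 1 A \<cdot> cyl_pr A"
proof -
  note v = vertex_hom[OF order_refl] and i = SF_Idn_hom[OF fin_std[of 1]] and IA = Idn_in[OF A]
  note CO = Cyl_Obj[OF A] and lA = l_hom[OF A] l_inv[OF A]
  have a0: "a \<Delta>1 \<Delta>0 A \<in> homset M (FOb T (sset_prod \<Delta>1 \<Delta>0, A)) (Cyl (FOb T (\<Delta>0, A)))"
    "a_inv \<Delta>1 \<Delta>0 A \<in> homset M (Cyl (FOb T (\<Delta>0, A))) (FOb T (sset_prod \<Delta>1 \<Delta>0, A))"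
    "a \<Delta>1 \<Delta>0 A \<cdot> a_inv \<Delta>1 \<Delta>0 A = Idn M (Cyl (FOb T (\<Delta>0, A)))"
    unfolding Cyl_def by (rule a_hom[OF fin_std fin_std A], rule a_inv(1)[OF fin_std fin_std A],
      rule a_inv(3)[OF fin_std fin_std A])
  have a1: "a \<Delta>1 \<Delta>1 A \<in> homset M (FOb T (sset_prod \<Delta>1 \<Delta>1, A)) (Cyl (Cyl A))"
    "a_inv \<Delta>1 \<Delta>1 A \<in> homset M (Cyl (Cyl A)) (FOb T (sset_prod \<Delta>1 \<Delta>1, A))"
    unfolding Cyl_def by (rule a_hom[OF fin_std fin_std A], rule a_inv(1)[OF fin_std fin_std A])
  have vA: "FAr T (vertex 1, Idn M A) \<in> homset M (FOb T (\<Delta>0, A)) (Cyl A)"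
    unfolding Cyl_def by (rule T_hom[OF v IA])
  note vt = T_hom[OF Tens_hom[OF i v] IA]
  note mx = T_hom[OF simplex_max_hom IA]
  note cl = cyl_map_hom[OF lA(1)] cyl_map_hom[OF lA(2)]
  have R: "FAr T (RUn SF \<Delta>1, Idn M A) \<in> homset M (FOb T (sset_prod \<Delta>1 \<Delta>0, A)) (Cyl A)"
    unfolding Cyl_def by (rule T_hom[OF RUn_hom IA])
  have nat: "cyl_map (FAr T (vertex 1, Idn M A)) \<cdot> a \<Delta>1 \<Delta>0 A =
      a \<Delta>1 \<Delta>1 A \<cdot> FAr T (FAr (Tens SF) (Idn SF \<Delta>1, vertex 1), Idn M A)"
    using a_natural[OF i v IA] by (simp add: cyl_map_def)
  have "cyl_map (cyl_in 1 A) \<cdot> FAr T (RUn SF \<Delta>1, Idn M A) = (cyl_map (cyl_in 1 A) \<cdot> cyl_map (l A)) \<cdot>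
      a \<Delta>1 \<Delta>0 A"
    unfolding T_RUn[OF A] by (rule Cmp_assoc[OF a0(1) cl(1) cyl_map_hom[OF cyl_in_hom[OF A
      order_refl]], symmetric])
  also have "cyl_map (cyl_in 1 A) \<cdot> cyl_map (l A) = cyl_map (cyl_in 1 A \<cdot> l A)"
    by (rule cyl_map_Cmp[OF lA(1) cyl_in_hom[OF A order_refl], symmetric])
  also have "cyl_in 1 A \<cdot> l A = FAr T (vertex 1, Idn M A)"
    unfolding cyl_in_def using Cmp_assoc[OF lA(1,2) vA] lA(3) Cmp_Idn[OF vA] by simp
  also note nat
  finally have 1: "cyl_map (cyl_in 1 A) \<cdot> FAr T (RUn SF \<Delta>1, Idn M A) =
      a \<Delta>1 \<Delta>1 A \<cdot> FAr T (FAr (Tens SF) (Idn SF \<Delta>1, vertex 1), Idn M A)" .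
  have "(cyl_max A \<cdot> cyl_map (cyl_in 1 A)) \<cdot> FAr T (RUn SF \<Delta>1, Idn M A) =
      cyl_max A \<cdot> (a \<Delta>1 \<Delta>1 A \<cdot> FAr T (FAr (Tens SF) (Idn SF \<Delta>1, vertex 1), Idn M A))"
    unfolding 1[symmetric]
    by (rule Cmp_assoc[OF R cyl_map_hom[OF cyl_in_hom[OF A order_refl]] cyl_max_hom[OF A]])
  also have "\<dots> = FAr T (simplex_max, Idn M A) \<cdot>
      (a_inv \<Delta>1 \<Delta>1 A \<cdot> (a \<Delta>1 \<Delta>1 A \<cdot> FAr T (FAr (Tens SF) (Idn SF \<Delta>1, vertex 1), Idn M A)))"
    unfolding cyl_max_def by (rule Cmp_assoc[OF Cmp_in[OF vt a1(1)] a1(2) mx])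
  also have "\<dots> = FAr T (simplex_max, Idn M A) \<cdot> FAr T (FAr (Tens SF) (Idn SF \<Delta>1, vertex 1),
      Idn M A)"
    using Cmp_assoc[OF vt a1] a_inv(2)[OF fin_std fin_std A] Idn_Cmp[OF vt] by simp
  also have "\<dots> = FAr T (vertex 1 \<cdot>\<^bsub>SF\<^esub> (to_point \<cdot>\<^bsub>SF\<^esub> RUn SF \<Delta>1), Idn M A)"
    unfolding T_Cmp_left[OF Tens_hom[OF i v] simplex_max_hom A] simplex_max_vertices(3) ..
  also have "\<dots> = (cyl_in 1 A \<cdot> cyl_pr A) \<cdot> FAr T (RUn SF \<Delta>1, Idn M A)"
    by (rule T_const[OF A RUn_hom])
  finally have eq: "(cyl_max A \<cdot> cyl_map (cyl_in 1 A)) \<cdot> FAr T (RUn SF \<Delta>1, Idn M A) =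
      (cyl_in 1 A \<cdot> cyl_pr A) \<cdot> FAr T (RUn SF \<Delta>1, Idn M A)" .
  have "cyl_map (l A) \<cdot> cyl_map (l_inv A) = Idn M (Cyl A)"
    using cyl_map_Cmp[OF lA(2,1)] lA(4) T_Idn[OF fin_std[of 1] A] by (simp add: cyl_map_def Cyl_def)
  then have inv: "FAr T (RUn SF \<Delta>1, Idn M A) \<cdot> (a_inv \<Delta>1 \<Delta>0 A \<cdot> cyl_map (l_inv A)) = Idn M (Cyl A)"
    unfolding T_RUn[OF A]
    using Cmp_assoc[OF Cmp_in[OF cl(2) a0(2)] a0(1) cl(1)] Cmp_assoc[OF cl(2) a0(2,1)] a0(3)
      Idn_Cmp[OF cl(2)]
    by simp
  show ?thesis
    by (rule iso_cancel_right[OF Cmp_in[OF cyl_map_hom[OF cyl_in_hom[OF A order_refl]]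
      cyl_max_hom[OF A]]
        Cmp_in[OF cyl_pr_hom[OF A] cyl_in_hom[OF A order_refl]] R Cmp_in[OF cl(2) a0(2)] inv eq])
qed

text \<open>The contraction lies over \<open>A\<close>. Up to unit and associativity isomorphisms
  both sides are induced by maps from the square to the point, and these are equal because the point
  is terminal in \<open>SF\<close>.\<close>

lemma cyl_pr_max:
  assumes A: "A \<in> Obj M"
  shows "cyl_pr A \<cdot> cyl_max A = cyl_pr A \<cdot> cyl_pr (Cyl A)"
proof -
  interpret SF: category SF by (rule SF_category)
  note i = SF_Idn_hom[OF fin_std[of 1]] and IA = Idn_in[OF A] and pt = to_point_hom
  note CO = Cyl_Obj[OF A]
  have a1: "a \<Delta>1 \<Delta>1 A \<in> homset M (FOb T (sset_prod \<Delta>1 \<Delta>1, A)) (Cyl (Cyl A))"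
    "a_inv \<Delta>1 \<Delta>1 A \<in> homset M (Cyl (Cyl A)) (FOb T (sset_prod \<Delta>1 \<Delta>1, A))"
    "a \<Delta>1 \<Delta>1 A \<cdot> a_inv \<Delta>1 \<Delta>1 A = Idn M (Cyl (Cyl A))"
    unfolding Cyl_def by (rule a_hom[OF fin_std fin_std A], rule a_inv(1)[OF fin_std fin_std A],
      rule a_inv(3)[OF fin_std fin_std A])
  have a0: "a \<Delta>0 \<Delta>1 A \<in> homset M (FOb T (sset_prod \<Delta>0 \<Delta>1, A)) (FOb T (\<Delta>0, Cyl A))"
    unfolding Cyl_def by (rule a_hom[OF fin_std fin_std A])
  have pA: "FAr T (to_point, Idn M A) \<in> homset M (Cyl A) (FOb T (\<Delta>0, A))"
    unfolding Cyl_def by (rule T_hom[OF pt IA])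
  have pC: "FAr T (to_point, Idn M (Cyl A)) \<in> homset M (Cyl (Cyl A)) (FOb T (\<Delta>0, Cyl A))"
    unfolding Cyl_def[of "Cyl A"] by (rule T_hom[OF pt Idn_in[OF CO]])
  have mx: "FAr T (simplex_max, Idn M A) \<in> homset M (FOb T (sset_prod \<Delta>1 \<Delta>1, A)) (Cyl A)"
    unfolding Cyl_def by (rule T_hom[OF simplex_max_hom IA])
  have L: "FAr T (LUn SF \<Delta>1, Idn M A) \<in> homset M (FOb T (sset_prod \<Delta>0 \<Delta>1, A)) (Cyl A)"
    unfolding Cyl_def by (rule T_hom[OF LUn_hom IA])
  note vt = T_hom[OF Tens_hom[OF pt i] IA]
  have nat: "FAr T (to_point, Idn M (Cyl A)) \<cdot> a \<Delta>1 \<Delta>1 A =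
      a \<Delta>0 \<Delta>1 A \<cdot> FAr T (FAr (Tens SF) (to_point, Idn SF \<Delta>1), Idn M A)"
    using a_natural[OF pt i IA] T_Idn[OF fin_std[of 1] A] by (simp add: Cyl_def)
  have "cyl_max A \<cdot> a \<Delta>1 \<Delta>1 A = FAr T (simplex_max, Idn M A)"
    unfolding cyl_max_def using Cmp_assoc[OF a1(1,2) mx] a_inv(2)[OF fin_std fin_std A]
      Cmp_Idn[OF mx] by simp
  then have 1: "(cyl_pr A \<cdot> cyl_max A) \<cdot> a \<Delta>1 \<Delta>1 A = l A \<cdot> (FAr T (to_point, Idn M A) \<cdot>
      FAr T (simplex_max, Idn M A))"
    using Cmp_assoc[OF a1(1) cyl_max_hom[OF A] cyl_pr_hom[OF A]] Cmp_assoc[OF mx pA l_hom[OF A]]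
    by (simp add: cyl_pr_def)
  have "cyl_pr (Cyl A) \<cdot> a \<Delta>1 \<Delta>1 A = l (Cyl A) \<cdot> (FAr T (to_point, Idn M (Cyl A)) \<cdot> a \<Delta>1 \<Delta>1 A)"
    unfolding cyl_pr_def by (rule Cmp_assoc[OF a1(1) pC l_hom[OF CO]])
  also have "\<dots> = FAr T (LUn SF \<Delta>1, Idn M A) \<cdot> FAr T (FAr (Tens SF) (to_point, Idn SF \<Delta>1), Idn M A)"
    unfolding nat T_LUn[OF A] by (rule Cmp_assoc[OF vt a0 l_hom[OF CO], symmetric])
  finally have "(cyl_pr A \<cdot> cyl_pr (Cyl A)) \<cdot> a \<Delta>1 \<Delta>1 A =
      l A \<cdot> (FAr T (to_point, Idn M A) \<cdot> (FAr T (LUn SF \<Delta>1, Idn M A) \<cdot> FAr T (FAr (Tens SF)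
        (to_point, Idn SF \<Delta>1), Idn M A)))"
    using Cmp_assoc[OF a1(1) cyl_pr_hom[OF CO] cyl_pr_hom[OF A]]
      Cmp_assoc[OF Cmp_in[OF vt L] pA l_hom[OF A]]
    by (simp add: cyl_pr_def)
  also have "FAr T (to_point, Idn M A) \<cdot> (FAr T (LUn SF \<Delta>1, Idn M A) \<cdot>
      FAr T (FAr (Tens SF) (to_point, Idn SF \<Delta>1), Idn M A))
      = FAr T (to_point \<cdot>\<^bsub>SF\<^esub> (LUn SF \<Delta>1 \<cdot>\<^bsub>SF\<^esub> FAr (Tens SF) (to_point, Idn SF \<Delta>1)), Idn M A)"
    unfolding T_Cmp_left[OF Tens_hom[OF pt i] LUn_hom A]
    by (rule T_Cmp_left[OF SF.Cmp_in[OF Tens_hom[OF pt i] LUn_hom] pt A])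
  also have "to_point \<cdot>\<^bsub>SF\<^esub> (LUn SF \<Delta>1 \<cdot>\<^bsub>SF\<^esub> FAr (Tens SF) (to_point, Idn SF \<Delta>1)) =
      to_point \<cdot>\<^bsub>SF\<^esub> simplex_max"
    by (rule SF_terminal[OF SF.Cmp_in[OF SF.Cmp_in[OF Tens_hom[OF pt i] LUn_hom] pt] SF.Cmp_in[OF
      simplex_max_hom pt]])
  also have "FAr T (to_point \<cdot>\<^bsub>SF\<^esub> simplex_max, Idn M A) = FAr T (to_point, Idn M A) \<cdot>
      FAr T (simplex_max, Idn M A)"
    by (rule T_Cmp_left[OF simplex_max_hom pt A, symmetric])
  finally have "(cyl_pr A \<cdot> cyl_max A) \<cdot> a \<Delta>1 \<Delta>1 A = (cyl_pr A \<cdot> cyl_pr (Cyl A)) \<cdot> a \<Delta>1 \<Delta>1 A"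
    unfolding 1 ..
  then show ?thesis
    by (rule iso_cancel_right[OF Cmp_in[OF cyl_max_hom[OF A] cyl_pr_hom[OF A]]
        Cmp_in[OF cyl_pr_hom[OF CO] cyl_pr_hom[OF A]] a1])
qed

text \<open>With this, homotopies on a pushout, and equations between them, can be glued from the
  two pieces.\<close>

lemma cyl_map_pushout:
  assumes "is_pushout M f g p q"
  shows "is_pushout M (cyl_map f) (cyl_map g) (cyl_map p) (cyl_map q)"
proof -
  let ?F = "\<lparr>FOb = (\<lambda>A. FOb T (\<Delta>1, A)), FAr = (\<lambda>h. FAr T (Idn SF \<Delta>1, h))\<rparr>"
  have M: "category M" by (rule category_axioms)
  have "is_functor M M ?F"
    unfolding is_functor_def
  proof (intro conjI ballI impI)
    show "FOb ?F A \<in> Obj M" "FAr ?F (Idn M A) = Idn M (FOb ?F A)" if "A \<in> Obj M" for A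
      using T_Obj[OF fin_std that] T_Idn[OF fin_std that] by simp_all
    show "FAr ?F h \<in> homset M (FOb ?F (Dom M h)) (FOb ?F (Cod M h))" if "h \<in> Arr M" for h
      using cyl_map_hom[of h "Dom M h" "Cod M h"] that by (simp add: homset_def cyl_map_def Cyl_def)
    show "FAr ?F (g \<cdot> h) = FAr ?F g \<cdot> FAr ?F h" if "h \<in> Arr M" "g \<in> Arr M" "Dom M g = Cod M h" for h
      g
      using cyl_map_Cmp[of h "Dom M h" "Cod M h" g "Cod M g"] that by
        (simp add: homset_def cyl_map_def)
  qed
  from preserves_pushout[OF M M this T_colim_right assms] show ?thesis
    by (simp add: cyl_map_def SF_simps(1) fin_std)
qed

end

text \<open>Since \<open>\<theta>\<close> has a right inverse, composing both maps with it does not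
  change which pairs form a cocone. It serves to strip the unit isomorphism off the end of a
  cylinder.\<close>

lemma (in category) pushout_precomp:
  assumes P: "is_pushout C f g p q" and \<theta>: "\<theta> \<in> homset C A (Dom C f)" and \<rho>:
    "\<rho> \<in> homset C (Dom C f) A"
    and \<theta>\<rho>: "\<theta> \<cdot> \<rho> = Idn C (Dom C f)"
  shows "is_pushout C (f \<cdot> \<theta>) (g \<cdot> \<theta>) p q"
proof -
  note D = is_pushoutD[OF P]
  have f: "f \<in> homset C (Dom C f) (Cod C f)" and g: "g \<in> homset C (Dom C f) (Cod C g)"
    and p: "p \<in> homset C (Cod C f) (Cod C p)" and q: "q \<in> homset C (Cod C g) (Cod C p)"
    using D by (simp_all add: homset_def)
  show ?thesis
  proof (rule is_pushoutI[OF Cmp_in[OF \<theta> f] Cmp_in[OF \<theta> g] p q])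
    show "p \<cdot> (f \<cdot> \<theta>) = q \<cdot> (g \<cdot> \<theta>)"
      using Cmp_assoc[OF \<theta> f p] Cmp_assoc[OF \<theta> g q] D(9) by simp
    show "\<exists>h \<in> homset C (Cod C p) E. h \<cdot> p = p' \<and> h \<cdot> q = q'"
      if p': "p' \<in> homset C (Cod C f) E" and q': "q' \<in> homset C (Cod C g) E"
        and eq: "p' \<cdot> (f \<cdot> \<theta>) = q' \<cdot> (g \<cdot> \<theta>)" for E p' q'
    proof -
      note pf = Cmp_in[OF f p'] and qg = Cmp_in[OF g q']
      have "p' \<cdot> f = ((p' \<cdot> f) \<cdot> \<theta>) \<cdot> \<rho>" unfolding Cmp_assoc[OF \<rho> \<theta> pf] \<theta>\<rho> Cmp_Idn[OF pf] ..
      also have "(p' \<cdot> f) \<cdot> \<theta> = (q' \<cdot> g) \<cdot> \<theta>" using eq Cmp_assoc[OF \<theta> f p'] Cmp_assoc[OF \<theta> g q'] by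
        simp
      also have "((q' \<cdot> g) \<cdot> \<theta>) \<cdot> \<rho> = q' \<cdot> g" unfolding Cmp_assoc[OF \<rho> \<theta> qg] \<theta>\<rho> Cmp_Idn[OF qg] ..
      finally show ?thesis using pushout_induced[OF P p' q'] by metis
    qed
    show "h = h'" if "h \<in> homset C (Cod C p) E" "h' \<in> homset C (Cod C p) E" "h \<cdot> p = h' \<cdot> p"
      "h \<cdot> q = h' \<cdot> q"
      for E h h'
      by (rule pushout_eqI[OF P that])
  qed
qed

lemma is_initial_eqI:
  assumes "is_initial C I" "category C" "f \<in> homset C I B" "g \<in> homset C I B"
  shows "f = g"
  using assms category.homset_Obj[OF assms(2,3)] unfolding is_initial_def by blast

section \<open>Cobase change of weak equivalences along cofibrations\<close>

context weak_cofibration_category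
begin

lemma Cof_cobaseI: "\<lbrakk>f \<in> Cof; is_pushout M f g p q\<rbrakk> \<Longrightarrow> q \<in> Cof"
  using Cof_cobase unfolding closed_under_cobase_change_def by blast

lemma Cof_cobaseI': "\<lbrakk>g \<in> Cof; is_pushout M f g p q\<rbrakk> \<Longrightarrow> p \<in> Cof"
  using Cof_cobaseI is_pushout_sym by blast

lemma acyclic_cobaseI: "\<lbrakk>f \<in> Cof; f \<in> W; is_pushout M f g p q\<rbrakk> \<Longrightarrow> q \<in> W"
  using acyclic_Cof_cobase unfolding closed_under_cobase_change_def by blast

lemma acyclic_cobaseI': "\<lbrakk>g \<in> Cof; g \<in> W; is_pushout M f g p q\<rbrakk> \<Longrightarrow> p \<in> W"
  using acyclic_cobaseI is_pushout_sym by blast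

lemma Cof_Arr: "f \<in> Cof \<Longrightarrow> f \<in> Arr M"
  and W_Arr: "f \<in> W \<Longrightarrow> f \<in> Arr M"
  using Cof_sub W_sub unfolding subcategory_with_isos_def by blast+

lemma Cof_iso: "is_iso M f \<Longrightarrow> f \<in> Cof"
  and W_iso: "is_iso M f \<Longrightarrow> f \<in> W"
  using Cof_sub W_sub unfolding subcategory_with_isos_def by blast+

lemma Idn_iso: "A \<in> Obj M \<Longrightarrow> is_iso M (Idn M A)"
  by (rule is_isoI[OF Idn_in Idn_in]) (auto intro: Cmp_Idn Idn_in)

lemma Cof_Cmp: "\<lbrakk>f \<in> Cof; g \<in> Cof; f \<in> homset M A B; g \<in> homset M B D\<rbrakk> \<Longrightarrow> g \<cdot> f \<in> Cof"
  using Cof_sub unfolding subcategory_with_isos_def homset_def by auto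

lemma W_Cmp: "\<lbrakk>f \<in> W; g \<in> W; f \<in> homset M A B; g \<in> homset M B D\<rbrakk> \<Longrightarrow> g \<cdot> f \<in> W"
  using W_sub unfolding subcategory_with_isos_def homset_def by auto

lemma W_cancel_left: "\<lbrakk>g \<in> W; g \<cdot> f \<in> W; f \<in> homset M A B; g \<in> homset M B D\<rbrakk> \<Longrightarrow> f \<in> W"
  using W_two_of_three unfolding two_out_of_three_def homset_def by auto

lemma W_cancel_right: "\<lbrakk>f \<in> W; g \<cdot> f \<in> W; f \<in> homset M A B; g \<in> homset M B D\<rbrakk> \<Longrightarrow> g \<in> W"
  using W_two_of_three unfolding two_out_of_three_def homset_def by auto

lemma W_section: "\<lbrakk>g \<cdot> f = Idn M A; g \<in> W; f \<in> homset M A B; g \<in> homset M B A\<rbrakk> \<Longrightarrow> f \<in> W"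
  using W_cancel_left[of g f A B A] W_iso[OF Idn_iso] homset_Obj[of f A B] by simp

lemma W_retraction: "\<lbrakk>g \<cdot> f = Idn M A; f \<in> W; f \<in> homset M A B; g \<in> homset M B A\<rbrakk> \<Longrightarrow> g \<in> W"
  using W_cancel_right[of f g A B A] W_iso[OF Idn_iso] homset_Obj[of f A B] by simp

lemma factorE:
  assumes "f \<in> homset M A B"
  obtains E i w where "i \<in> Cof" "w \<in> W" "i \<in> homset M A E" "w \<in> homset M E B" "w \<cdot> i = f"
proof -
  obtain i w where iw: "i \<in> Cof" "w \<in> W" "Dom M w = Cod M i" "f = w \<cdot> i"
    using factorization[of f] assms by (auto simp: homset_def)
  have "i \<in> Arr M" "w \<in> Arr M" using iw Cof_Arr W_Arr by auto
  then have "i \<in> homset M A (Cod M i)" "w \<in> homset M (Cod M i) B"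
    using assms iw(3,4) by (auto simp: homset_def)
  then show thesis using that iw by blast
qed

text \<open>Applied to fold maps, this is the factorization of K. Brown's lemma.\<close>

lemma pushout_factor:
  assumes po: "is_pushout M f g p q" and f: "f \<in> Cof" and g: "g \<in> Cof"
    and u: "u \<in> homset M (Cod M f) E" and v: "v \<in> homset M (Cod M g) E" and eq: "u \<cdot> f = v \<cdot> g"
  obtains D i j w where "i \<in> Cof" "j \<in> Cof" "w \<in> W" "i \<in> homset M (Cod M f) D"
    "j \<in> homset M (Cod M g) D"
    "w \<in> homset M D E" "w \<cdot> i = u" "w \<cdot> j = v" "i \<cdot> f = j \<cdot> g"
proof -
  note D = is_pushoutD[OF po]
  have p: "p \<in> homset M (Cod M f) (Cod M p)" and q: "q \<in> homset M (Cod M g) (Cod M p)"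
    and f': "f \<in> homset M (Dom M f) (Cod M f)" and g': "g \<in> homset M (Dom M f) (Cod M g)"
    using D by (simp_all add: homset_def)
  obtain h where h: "h \<in> homset M (Cod M p) E" "h \<cdot> p = u" "h \<cdot> q = v"
    by (rule pushout_induced[OF po u v eq])
  obtain D k w where k: "k \<in> Cof" "w \<in> W" "k \<in> homset M (Cod M p) D" "w \<in> homset M D E" "w \<cdot> k = h"
    by (rule factorE[OF h(1)])
  show thesis
  proof (rule that[of "k \<cdot> p" "k \<cdot> q" w D])
    show "k \<cdot> p \<in> Cof" by (rule Cof_Cmp[OF Cof_cobaseI'[OF g po] k(1) p k(3)])
    show "k \<cdot> q \<in> Cof" by (rule Cof_Cmp[OF Cof_cobaseI[OF f po] k(1) q k(3)])
    show "k \<cdot> p \<in> homset M (Cod M f) D" "k \<cdot> q \<in> homset M (Cod M g) D"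
      by (rule Cmp_in[OF p k(3)], rule Cmp_in[OF q k(3)])
    show "w \<cdot> (k \<cdot> p) = u" "w \<cdot> (k \<cdot> q) = v"
      using Cmp_assoc[OF p k(3,4)] Cmp_assoc[OF q k(3,4)] k(5) h(2,3) by simp_all
    show "(k \<cdot> p) \<cdot> f = (k \<cdot> q) \<cdot> g"
      using Cmp_assoc[OF f' p k(3)] Cmp_assoc[OF g' q k(3)] D(9) by simp
  qed fact+
qed

text \<open>The claim is evident for a cofibration \<open>x\<close> obtained from a map out of
  \<open>D\<close> by cobase change along \<open>s\<close>: pushing out along \<open>r\<close> after
  \<open>s\<close> is pushing out along an identity. The given \<open>f\<close> is linked to such an
  \<open>x\<close> by a weak equivalence under \<open>A\<close>, and the link is made of acyclic
  cofibrations so that it survives the cobase change along \<open>r\<close>.\<close>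

lemma cobase_change_retraction:
  assumes s: "s \<in> Cof" "s \<in> W" "s \<in> homset M D A" and r: "r \<in> homset M A D" "r \<cdot> s = Idn M D"
    and f: "f \<in> Cof" "f \<in> homset M A B" and po: "is_pushout M f r p q"
  shows "p \<in> W"
proof -
  note O = homset_Obj[OF f(2)] homset_Obj[OF r(1)]
  have po_hom: "p \<in> homset M B (Cod M p)" "q \<in> homset M D (Cod M p)"
    using is_pushoutD[OF po] f(2) r(1) by (simp_all add: homset_def)
  note fs = Cmp_in[OF s(3) f(2)]
  \<comment> \<open>The substitute \<open>x\<close> for \<open>f\<close>: restrict \<open>f\<close>
    to \<open>D\<close> along \<open>s\<close> and push it back out to \<open>A\<close>.\<close>
  obtain R x y where R: "is_pushout M s (f \<cdot> s) x y" and x: "x \<in> homset M A R" and y: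
    "y \<in> homset M B R"
    by (rule pushout_exists[OF fin_colims s(3) fs])
  have yW: "y \<in> W" by (rule acyclic_cobaseI[OF s(1,2) R])
  have xC: "x \<in> Cof" by (rule Cof_cobaseI'[OF Cof_Cmp[OF s(1) f(1) s(3) f(2)] R])
  \<comment> \<open>Pasted with the previous pushout, this is the cobase change of
    \<open>r \<cdot> s\<close>, an identity. Hence \<open>v \<cdot> y\<close> is a weak equivalence,
    and so is \<open>v\<close>.\<close>
  obtain R' z v where Q: "is_pushout M r x z v" and z: "z \<in> homset M D R'" and v:
    "v \<in> homset M R R'"
    by (rule pushout_exists[OF fin_colims r(1) x])
  have "is_pushout M (r \<cdot> s) (f \<cdot> s) z (v \<cdot> y)" by (rule pushout_paste[OF R Q])
  then have "v \<cdot> y \<in> W"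
    using acyclic_cobaseI[OF Cof_iso[OF Idn_iso] W_iso[OF Idn_iso]] O r(2) by metis
  then have vW: "v \<in> W" by (rule W_cancel_right[OF yW _ y v])
  have IB: "Idn M B \<in> homset M B B" using Idn_in O by blast
  have cods: "Cod M s = A" "Cod M (f \<cdot> s) = B" "Cod M x = R"
    using s(3) fs x by (simp_all add: homset_def)
  have "f \<cdot> s = Idn M B \<cdot> (f \<cdot> s)" using Idn_Cmp[OF fs] by simp
  then obtain m where m: "m \<in> homset M R B" "m \<cdot> x = f" "m \<cdot> y = Idn M B"
    by (rule pushout_induced[OF R, unfolded cods, OF f(2) IB])
  have mW: "m \<in> W" by (rule W_retraction[OF m(3) yW y m(1)])
  \<comment> \<open>The weak equivalence \<open>m\<close> from \<open>x\<close> to \<open>f\<close>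
    is not known to be a cofibration. Factoring \<open>m\<close> and the identity jointly under
    \<open>A\<close> replaces it by acyclic cofibrations \<open>\<alpha>\<close> and
    \<open>\<beta>\<close> into one object, whose cobase changes are under control.\<close>
  obtain S b1 b2 where S: "is_pushout M x f b1 b2"
    using pushout_exists[OF fin_colims x f(2)] by metis
  have cod: "Cod M x = R" "Cod M f = B" using x f(2) by (simp_all add: homset_def)
  have "m \<cdot> x = Idn M B \<cdot> f" using m(2) Idn_Cmp[OF f(2)] by simp
  then obtain E \<alpha> \<beta> w where \<alpha>: "\<alpha> \<in> Cof" "\<alpha> \<in> homset M R E" and \<beta>: "\<beta> \<in> Cof" "\<beta> \<in> homset M B E"
    and w: "w \<in> W" "w \<in> homset M E B" "w \<cdot> \<alpha> = m" "w \<cdot> \<beta> = Idn M B" and ab: "\<alpha> \<cdot> x = \<beta> \<cdot> f"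
    using pushout_factor[OF S xC f(1), unfolded cod, OF m(1) IB] by metis
  have \<alpha>W: "\<alpha> \<in> W" using W_cancel_left[OF w(1) _ \<alpha>(2) w(2)] w(3) mW by simp
  have \<beta>W: "\<beta> \<in> W" by (rule W_section[OF w(4,1) \<beta>(2) w(2)])
  obtain E' \<alpha>1 \<alpha>' where po2: "is_pushout M \<alpha> v \<alpha>1 \<alpha>'" and \<alpha>1: "\<alpha>1 \<in> homset M E E'" and \<alpha>':
    "\<alpha>' \<in> homset M R' E'"
    by (rule pushout_exists[OF fin_colims \<alpha>(2) v])
  have \<alpha>'W: "\<alpha>' \<in> W" by (rule acyclic_cobaseI[OF \<alpha>(1) \<alpha>W po2])
  have "\<alpha>1 \<cdot> \<alpha> \<in> W" using is_pushoutD(9)[OF po2] W_Cmp[OF vW \<alpha>'W v \<alpha>'] by simp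
  then have \<alpha>1W: "\<alpha>1 \<in> W" by (rule W_cancel_right[OF \<alpha>W _ \<alpha>(2) \<alpha>1])
  \<comment> \<open>Because \<open>\<alpha> \<cdot> x = \<beta> \<cdot> f\<close>, this cobase
    change along \<open>r\<close> can be reached through \<open>x\<close> or through
    \<open>f\<close>. The second way presents \<open>t\<close> as a cobase change of
    \<open>\<beta>\<close>.\<close>
  have big: "is_pushout M (\<beta> \<cdot> f) r \<alpha>1 (\<alpha>' \<cdot> z)"
    using pushout_paste[OF is_pushout_sym[OF Q] po2] ab by simp
  have "(\<alpha>1 \<cdot> \<beta>) \<cdot> f = (\<alpha>' \<cdot> z) \<cdot> r"
    using is_pushoutD(9)[OF big] Cmp_assoc[OF f(2) \<beta>(2) \<alpha>1] by simp
  moreover have "\<alpha>1 \<cdot> \<beta> \<in> homset M (Cod M f) E'" "\<alpha>' \<cdot> z \<in> homset M (Cod M r) E'"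
    using Cmp_in[OF \<beta>(2) \<alpha>1] Cmp_in[OF z \<alpha>'] f(2) r(1) by (simp_all add: homset_def)
  ultimately obtain t where t: "t \<in> homset M (Cod M p) E'" "t \<cdot> p = \<alpha>1 \<cdot> \<beta>" "t \<cdot> q = \<alpha>' \<cdot> z"
    using pushout_induced[OF po] by metis
  have "is_pushout M \<beta> p \<alpha>1 t"
  proof (rule pushout_cancel[OF po])
    show "is_pushout M (\<beta> \<cdot> f) r \<alpha>1 (t \<cdot> q)" using big t(3) by simp
    show "\<beta> \<in> homset M (Cod M f) (Dom M \<alpha>1)" "t \<in> homset M (Cod M p) (Cod M \<alpha>1)" "\<alpha>1 \<cdot> \<beta> = t \<cdot> p"
      using \<beta>(2) \<alpha>1 t cod by (simp_all add: homset_def)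
  qed
  then have "t \<in> W" by (rule acyclic_cobaseI[OF \<beta>(1) \<beta>W])
  moreover have "t \<cdot> p \<in> W" unfolding t(2) by (rule W_Cmp[OF \<beta>W \<alpha>1W \<beta>(2) \<alpha>1])
  ultimately show ?thesis using W_cancel_left po_hom(1) t(1) by blast
qed

text \<open>Reedy's argument: a weak equivalence between cofibrant objects is an acyclic cofibration
  followed by a retraction of an acyclic cofibration.\<close>

lemma left_properI:
  assumes cofibrant: "\<And>A. A \<in> Obj M \<Longrightarrow> cofibrant M Cof A"
  shows "left_proper M Cof W"
  unfolding left_proper_def
proof (intro allI impI)
  fix f g p q assume f: "f \<in> Cof" and g: "g \<in> W" and po: "is_pushout M f g p q"
  note D = is_pushoutD[OF po]
  define A B D where "A = Dom M f" and "B = Cod M f" and "D = Cod M g"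
  have f': "f \<in> homset M A B" and g': "g \<in> homset M A D" and p: "p \<in> homset M B (Cod M p)"
    and q: "q \<in> homset M D (Cod M p)"
    using D by (simp_all add: homset_def A_def B_def D_def)
  have O: "A \<in> Obj M" "B \<in> Obj M" "D \<in> Obj M" using homset_Obj f' g' by blast+
  obtain I where I: "is_initial M I" using initial_exists[OF fin_colims] .
  obtain iA iD where i: "iA \<in> homset M I A" "iD \<in> homset M I D"
    using I O unfolding is_initial_def by metis
  have iC: "iA \<in> Cof" "iD \<in> Cof" using cofibrant[of A] cofibrant[of D] O i I unfolding cofibrant_def
    by blast+
  \<comment> \<open>A coproduct of \<open>A\<close> and \<open>D\<close>, glued along the initial
    object. Factoring \<open>g\<close> and the identity of \<open>D\<close> out of it makes
    \<open>g\<close> the composite \<open>w \<cdot> j\<close> and provides a section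
    \<open>s\<close> of \<open>w\<close>.\<close>
  obtain S a d where S: "is_pushout M iA iD a d"
    using pushout_exists[OF fin_colims i] by metis
  have cod: "Cod M iA = A" "Cod M iD = D" using i by (simp_all add: homset_def)
  have "g \<cdot> iA = Idn M D \<cdot> iD"
    by (rule is_initial_eqI[OF I category_axioms Cmp_in[OF i(1) g'] Cmp_in[OF i(2)
      Idn_in[OF O(3)]]])
  then obtain E j s w where j: "j \<in> Cof" "j \<in> homset M A E" and s: "s \<in> Cof" "s \<in> homset M D E"
    and w: "w \<in> W" "w \<in> homset M E D" "w \<cdot> j = g" "w \<cdot> s = Idn M D"
    using pushout_factor[OF S iC, unfolded cod, OF g' Idn_in[OF O(3)]] by metis
  have jW: "j \<in> W" using W_cancel_left[OF w(1) _ j(2) w(2)] w(3) g by simp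
  have sW: "s \<in> W" by (rule W_section[OF w(4,1) s(2) w(2)])
  obtain B1 p1 q1 where po1: "is_pushout M f j p1 q1" and p1: "p1 \<in> homset M B B1" and q1:
    "q1 \<in> homset M E B1"
    by (rule pushout_exists[OF fin_colims f' j(2)])
  have "p \<cdot> f = (q \<cdot> w) \<cdot> j" using D(9) w(3) Cmp_assoc[OF j(2) w(2) q] by simp
  moreover have "p \<in> homset M (Cod M f) (Cod M p)" "q \<cdot> w \<in> homset M (Cod M j) (Cod M p)"
    using p Cmp_in[OF w(2) q] j(2) by (simp_all add: homset_def B_def)
  ultimately obtain p2 where p2: "p2 \<in> homset M (Cod M p1) (Cod M p)" "p2 \<cdot> p1 = p" "p2 \<cdot> q1 =
      q \<cdot> w"
    using pushout_induced[OF po1] by metis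
  have p2': "p2 \<in> homset M B1 (Cod M p)" using p2(1) p1 by (simp add: homset_def)
  \<comment> \<open>The cobase change of \<open>g\<close> is computed in two stages:
    \<open>p1\<close> is that of the acyclic cofibration \<open>j\<close>, and \<open>p2\<close>
    that of the retraction \<open>w\<close>.\<close>
  have "is_pushout M w q1 q p2"
  proof (rule pushout_cancel[OF is_pushout_sym[OF po1]])
    show "is_pushout M (w \<cdot> j) f q (p2 \<cdot> p1)" using is_pushout_sym[OF po] w(3) p2(2) by simp
    show "w \<in> homset M (Cod M j) (Dom M q)" "p2 \<in> homset M (Cod M q1) (Cod M q)" "q \<cdot> w = p2 \<cdot> q1"
      using w(2) j(2) q q1 p2 p1 by (simp_all add: homset_def)
  qed
  then have "p2 \<in> W"
    using cobase_change_retraction[OF s(1) sW s(2) w(2,4) Cof_cobaseI[OF f po1] q1 is_pushout_sym]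
      by blast
  then show "p \<in> W"
    using W_Cmp[OF acyclic_cobaseI'[OF j(1) jW po1] _ p1 p2'] p2(2) by simp
qed

end

section \<open>Fibrewise deformation retractions and mapping cylinders\<close>

context simplicial_weak_cofibration_category
begin

definition fibrewise_retraction :: "'a \<Rightarrow> 'o \<Rightarrow> 'o \<Rightarrow> bool" where
  "fibrewise_retraction \<pi> E B \<longleftrightarrow> \<pi> \<in> homset M E B \<and>
    (\<exists>s \<in> homset M B E. \<exists>H \<in> homset M (Cyl E) E. \<pi> \<cdot> s = Idn M B \<and>
      H \<cdot> cyl_in 0 E = Idn M E \<and> H \<cdot> cyl_in 1 E = s \<cdot> \<pi> \<and> \<pi> \<cdot> H = \<pi> \<cdot> cyl_pr E)"

lemma fibrewise_retraction_homotopy_equivalence: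
  assumes "fibrewise_retraction \<pi> E B"
  shows "simplicial_homotopy_equivalence M T l \<pi>"
proof -
  obtain s H where \<pi>: "\<pi> \<in> homset M E B" and s: "s \<in> homset M B E" and H: "H \<in> homset M (Cyl E) E"
    and eq: "\<pi> \<cdot> s = Idn M B" "H \<cdot> cyl_in 0 E = Idn M E" "H \<cdot> cyl_in 1 E = s \<cdot> \<pi>"
    using assms unfolding fibrewise_retraction_def by blast
  have O: "E \<in> Obj M" "B \<in> Obj M" using homset_Obj[OF \<pi>] by auto
  note lE = l_hom[OF O(1)] l_inv[OF O(1)]
  have v: "FAr T (vertex c, Idn M E) = cyl_in c E \<cdot> l E" if c: "c \<le> 1" for c
  proof -
    have vE: "FAr T (vertex c, Idn M E) \<in> homset M (FOb T (\<Delta>0, E)) (Cyl E)"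
      unfolding Cyl_def by (rule T_hom[OF vertex_hom[OF c] Idn_in[OF O(1)]])
    show ?thesis
      unfolding cyl_in_def Cmp_assoc[OF lE(1,2) vE] lE(3) Cmp_Idn[OF vE] ..
  qed
  let ?X = "Map_space M T E E"
  have "H \<in> cells ?X 1" using H by (simp add: Map_space_def Cyl_def)
  moreover have "act ?X 1 [0] H = Idn M E \<cdot> l E"
    using v[of 0] Cmp_assoc[OF lE(1) cyl_in_hom[OF O(1), of 0] H] eq(2) by (simp add: Map_space_def)
  moreover have "act ?X 1 [1] H = (s \<cdot> \<pi>) \<cdot> l E"
    using v[of 1] Cmp_assoc[OF lE(1) cyl_in_hom[OF O(1), of 1] H] eq(3) by (simp add: Map_space_def)
  ultimately have "\<exists>e \<in> cells ?X 1. Idn M E \<cdot> l E = act ?X 1 [0] e \<and> (s \<cdot> \<pi>) \<cdot> l E = act ?X 1 [1] e"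
    by metis
  then have "same_component ?X (Idn M E \<cdot> l E) ((s \<cdot> \<pi>) \<cdot> l E)"
    unfolding same_component_def by (rule r_into_equivclp)
  \<comment> \<open>As an edge of the mapping space, \<open>H\<close> starts at the identity, while
    the definition lists the composite first.\<close>
  then have "same_component ?X ((s \<cdot> \<pi>) \<cdot> l E) (Idn M E \<cdot> l E)"
    unfolding same_component_def by (rule equivclp_sym)
  moreover have "same_component (Map_space M T B B) ((\<pi> \<cdot> s) \<cdot> l B) (Idn M B \<cdot> l B)"
    unfolding same_component_def eq(1) by simp
  moreover have "\<pi> \<in> Arr M" "Dom M \<pi> = E" "Cod M \<pi> = B" using \<pi> by (simp_all add: homset_def)
  ultimately show ?thesis
    using s unfolding simplicial_homotopy_equivalence_def by metis
qed

text \<open>The universal property is taken as a premise so that any pullback qualifies. The section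
  is induced by the identity and \<open>s \<cdot> g\<close>, the homotopy by the constant homotopy
  on \<open>D\<close> and \<open>H\<close> on \<open>E\<close>; the second pair is compatible
  exactly because \<open>\<pi> \<cdot> H\<close> is constant.\<close>

lemma fibrewise_retraction_base_change:
  assumes fib: "fibrewise_retraction \<pi> E B" and g: "g \<in> homset M D B"
    and p: "p \<in> homset M P D" and q: "q \<in> homset M P E" and sq: "g \<cdot> p = \<pi> \<cdot> q"
    and ex: "\<And>Z p' q'. \<lbrakk>p' \<in> homset M Z D; q' \<in> homset M Z E; g \<cdot> p' = \<pi> \<cdot> q'\<rbrakk>
      \<Longrightarrow> \<exists>h \<in> homset M Z P. p \<cdot> h = p' \<and> q \<cdot> h = q'"
    and un: "\<And>Z h h'. \<lbrakk>h \<in> homset M Z P; h' \<in> homset M Z P; p \<cdot> h = p \<cdot> h'; q \<cdot> h = q \<cdot> h'\<rbrakk> \<Longrightarrow> h =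
        h'"
  shows "fibrewise_retraction p P D"
proof -
  obtain s H where \<pi>: "\<pi> \<in> homset M E B" and s: "s \<in> homset M B E" and H: "H \<in> homset M (Cyl E) E"
    and eq: "\<pi> \<cdot> s = Idn M B" "H \<cdot> cyl_in 0 E = Idn M E" "H \<cdot> cyl_in 1 E = s \<cdot> \<pi>" "\<pi> \<cdot> H =
        \<pi> \<cdot> cyl_pr E"
    using fib unfolding fibrewise_retraction_def by blast
  have O: "E \<in> Obj M" "B \<in> Obj M" "D \<in> Obj M" "P \<in> Obj M"
    using homset_Obj \<pi> p by blast+
  note sg = Cmp_in[OF g s]
  have "\<pi> \<cdot> (s \<cdot> g) = g" using Cmp_assoc[OF g s \<pi>] eq(1) Idn_Cmp[OF g] by simp
  then have "g \<cdot> Idn M D = \<pi> \<cdot> (s \<cdot> g)" using Cmp_Idn[OF g] by simp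
  then obtain t where t: "t \<in> homset M D P" "p \<cdot> t = Idn M D" "q \<cdot> t = s \<cdot> g"
    using ex[OF Idn_in[OF O(3)] sg] by blast
  note cq = cyl_map_hom[OF q] and prP = cyl_pr_hom[OF O(4)] and prE = cyl_pr_hom[OF O(1)]
  note pp = Cmp_in[OF prP p] and Hq = Cmp_in[OF cq H]
  have "\<pi> \<cdot> (H \<cdot> cyl_map q) = (\<pi> \<cdot> cyl_pr E) \<cdot> cyl_map q"
    using Cmp_assoc[OF cq H \<pi>] eq(4) by simp
  also have "\<dots> = \<pi> \<cdot> (q \<cdot> cyl_pr P)"
    using Cmp_assoc[OF cq prE \<pi>] cyl_pr_natural[OF q] by simp
  also have "\<dots> = g \<cdot> (p \<cdot> cyl_pr P)"
    using Cmp_assoc[OF prP q \<pi>] Cmp_assoc[OF prP p g] sq by simp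
  finally obtain K where K: "K \<in> homset M (Cyl P) P" "p \<cdot> K = p \<cdot> cyl_pr P" "q \<cdot> K = H \<cdot> cyl_map q"
    using ex[OF pp Hq] by metis
  have in_hom: "cyl_in c P \<in> homset M P (Cyl P)" "cyl_in c E \<in> homset M E (Cyl E)" if "c \<le> 1" for c
    using cyl_in_hom O that by auto
  have pK: "p \<cdot> (K \<cdot> cyl_in c P) = p" if c: "c \<le> 1" for c
    using Cmp_assoc[OF in_hom(1)[OF c] K(1) p] K(2) Cmp_assoc[OF in_hom(1)[OF c] prP p]
      cyl_pr_in[OF O(4) c] Cmp_Idn[OF p] by simp
  have qK: "q \<cdot> (K \<cdot> cyl_in c P) = (H \<cdot> cyl_in c E) \<cdot> q" if c: "c \<le> 1" for c
    using Cmp_assoc[OF in_hom(1)[OF c] K(1) q] K(3) Cmp_assoc[OF in_hom(1)[OF c] cq H]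
      cyl_in_natural[OF q c] Cmp_assoc[OF q in_hom(2)[OF c] H] by simp
  have "K \<cdot> cyl_in 0 P = Idn M P"
  proof (rule un[OF Cmp_in[OF in_hom(1)[OF le0] K(1)] Idn_in[OF O(4)]])
    show "p \<cdot> (K \<cdot> cyl_in 0 P) = p \<cdot> Idn M P" unfolding pK[OF le0] Cmp_Idn[OF p] ..
    show "q \<cdot> (K \<cdot> cyl_in 0 P) = q \<cdot> Idn M P" unfolding qK[OF le0] eq(2) Cmp_Idn[OF q] Idn_Cmp[OF q]
      ..
  qed
  moreover have "K \<cdot> cyl_in 1 P = t \<cdot> p"
  proof (rule un[OF Cmp_in[OF in_hom(1)[OF order_refl] K(1)] Cmp_in[OF p t(1)]])
    show "p \<cdot> (K \<cdot> cyl_in 1 P) = p \<cdot> (t \<cdot> p)"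
      using pK[OF order_refl] Cmp_assoc[OF p t(1) p] t(2) Idn_Cmp[OF p] by simp
    have "q \<cdot> (K \<cdot> cyl_in 1 P) = (s \<cdot> \<pi>) \<cdot> q" unfolding qK[OF order_refl] eq(3) ..
    also have "\<dots> = q \<cdot> (t \<cdot> p)"
      using Cmp_assoc[OF q \<pi> s] sq Cmp_assoc[OF p g s] Cmp_assoc[OF p t(1) q] t(3) by simp
    finally show "q \<cdot> (K \<cdot> cyl_in 1 P) = q \<cdot> (t \<cdot> p)" .
  qed
  ultimately show ?thesis
    unfolding fibrewise_retraction_def using p t(1,2) K(1,2) by blast
qed

lemma T_initial:
  assumes X: "finite_sset X" and I: "is_initial M I"
  shows "is_initial M (FOb T (X, I))"
  using preserves_initial[OF T_colim_right I, of X] X by (simp add: SF_simps(1))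

lemma T_empty_initial:
  assumes A: "A \<in> Obj M"
  shows "is_initial M (FOb T (empty_sset, A))"
  using preserves_initial[OF T_colim_left[OF A] empty_sset_initial] by simp

lemma T_boundary_pushout:
  assumes A: "A \<in> Obj M"
  shows "is_pushout M (FAr T (empty_map \<Delta>0, Idn M A)) (FAr T (empty_map \<Delta>0, Idn M A))
    (FAr T (boundary_vertex 0, Idn M A)) (FAr T (boundary_vertex 1, Idn M A))"
proof -
  let ?F = "\<lparr>FOb = (\<lambda>X. FOb T (X, A)), FAr = (\<lambda>f. FAr T (f, Idn M A))\<rparr>"
  have M: "category M" by (rule category_axioms)
  have "is_functor SF M ?F"
    unfolding is_functor_def
  proof (intro conjI ballI impI)
    show "FOb ?F X \<in> Obj M" "FAr ?F (Idn SF X) = Idn M (FOb ?F X)" if "X \<in> Obj SF" for X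
      using T_Obj[of X A] T_Idn[of X A] A that by (simp_all add: SF_simps(1))
    show "FAr ?F h \<in> homset M (FOb ?F (Dom SF h)) (FOb ?F (Cod SF h))" if "h \<in> Arr SF" for h
      using T_hom[of h "Dom SF h" "Cod SF h", OF _ Idn_in[OF A]] that by (simp add: homset_def)
    show "FAr ?F (g \<cdot>\<^bsub>SF\<^esub> h) = FAr ?F g \<cdot> FAr ?F h" if "h \<in> Arr SF" "g \<in> Arr SF" "Dom SF g =
        Cod SF h" for h g
      using T_Cmp_left[of h "Dom SF h" "Cod SF h" g "Cod SF g", OF _ _ A] that by
        (simp add: homset_def)
  qed
  from preserves_pushout[OF SF_category M this T_colim_left[OF A] boundary_pushout] show ?thesis by
    simp
qed

text \<open>The pushout-product of the boundary inclusion with the map from the initial object to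
  \<open>A\<close>. Tensors with an initial object are initial, so its corner is the boundary
  tensored with \<open>A\<close>.\<close>

lemma T_boundary_incl_Cof:
  assumes A: "cofibrant M Cof A"
  shows "FAr T (boundary_incl, Idn M A) \<in> Cof"
proof -
  have AO: "A \<in> Obj M" using A by (simp add: cofibrant_def)
  obtain I where I: "is_initial M I" using initial_exists[OF fin_colims] .
  then have IO: "I \<in> Obj M" by (simp add: is_initial_def)
  obtain i where i: "i \<in> homset M I A" using I AO unfolding is_initial_def by blast
  then have iC: "i \<in> Cof" using A I unfolding cofibrant_def by blast
  note fin = finite_ssets(2) fin_std[of 1]
  note bI = T_hom[OF SF_Idn_hom[OF fin(1)] i] and b1 = T_hom[OF SF_Idn_hom[OF fin(2)] i]
  note jI = T_hom[OF boundary_incl_hom Idn_in[OF IO]] and jA =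
    T_hom[OF boundary_incl_hom Idn_in[OF AO]]
  note iniB = T_initial[OF fin(1) I] and ini1 = T_initial[OF fin(2) I]
  obtain q where q: "q \<in> homset M (FOb T (\<Delta>1, I)) (FOb T (boundary_1, A))"
    using ini1 T_Obj[OF fin(1) AO] unfolding is_initial_def by blast
  have bA: "FOb T (boundary_1, A) \<in> Obj M" by (rule T_Obj[OF fin(1) AO])
  have po: "is_pushout M (FAr T (Idn SF boundary_1, i)) (FAr T (boundary_incl, Idn M I))
      (Idn M (FOb T (boundary_1, A))) q"
    by (rule initial_pushout[OF iniB bI ini1 jI q])
  have h: "FAr T (boundary_incl, Idn M A) \<in> homset M (Cod M (Idn M (FOb T (boundary_1, A))))
      (FOb T (\<Delta>1, A))"
    using jA bA by simp
  have "FAr T (boundary_incl, Idn M A) \<cdot> q = FAr T (Idn SF \<Delta>1, i)"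
    by (rule is_initial_eqI[OF ini1 category_axioms Cmp_in[OF q jA] b1])
  then show ?thesis
    using pushout_product[OF boundary_incl_Cof boundary_incl_hom iC i po h Cmp_Idn[OF jA]] by blast
qed

text \<open>The object \<open>E\<close> is the cylinder of \<open>A\<close> with its end
  \<open>1\<close> glued to \<open>B\<close> along \<open>f\<close>. It is needed in two
  presentations: gluing along both ends at once exhibits the cofibration \<open>i\<close>, while
  gluing along the end \<open>1\<close> alone is suited to inducing \<open>\<pi>\<close> and
  \<open>H\<close>.\<close>

lemma mapping_cylinder:
  assumes f: "f \<in> homset M A B" and A: "cofibrant M Cof A" and B: "cofibrant M Cof B"
  obtains E i \<pi> where "i \<in> Cof" "i \<in> homset M A E" "fibrewise_retraction \<pi> E B" "\<pi> \<cdot> i = f"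
proof -
  have O: "A \<in> Obj M" "B \<in> Obj M" using homset_Obj[OF f] by auto
  have CO: "Cyl A \<in> Obj M" by (rule Cyl_Obj[OF O(1)])
  note IA = Idn_in[OF O(1)]
  define bdA where "bdA = FOb T (boundary_1, A)"
  define k where "k c = FAr T (boundary_vertex c, Idn M A)" for c
  define j where "j = FAr T (boundary_incl, Idn M A)"
  define e where "e = FAr T (empty_map \<Delta>0, Idn M A)"
  have k: "k c \<in> homset M (FOb T (\<Delta>0, A)) bdA" if "c \<le> 1" for c
    unfolding k_def bdA_def by (rule T_hom[OF boundary_vertex_hom[OF that] IA])
  have j: "j \<in> homset M bdA (Cyl A)" unfolding j_def bdA_def Cyl_def by
    (rule T_hom[OF boundary_incl_hom IA])
  have e: "e \<in> homset M (FOb T (empty_sset, A)) (FOb T (\<Delta>0, A))"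
    unfolding e_def by (rule T_hom[OF empty_map_hom[OF fin_std] IA])
  note lA = l_hom[OF O(1)] l_inv[OF O(1)]
  note k0 = k[OF le0] and k1 = k[OF order_refl]
  have jk: "j \<cdot> (k c \<cdot> l_inv A) = cyl_in c A" if c: "c \<le> 1" for c
  proof -
    have "j \<cdot> (k c \<cdot> l_inv A) = (j \<cdot> k c) \<cdot> l_inv A" by
      (rule Cmp_assoc[OF lA(2) k[OF c] j, symmetric])
    also have "j \<cdot> k c = FAr T (vertex c, Idn M A)"
      unfolding j_def k_def T_Cmp_left[OF boundary_vertex_hom[OF c] boundary_incl_hom O(1)]
        boundary_incl_vertex[OF c] ..
    finally show ?thesis unfolding cyl_in_def .
  qed
  have PO1: "is_pushout M e e (k 0) (k 1)" unfolding e_def k_def by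
    (rule T_boundary_pushout[OF O(1)])
  note fl = Cmp_in[OF lA(1) f]
  \<comment> \<open>The two copies of \<open>A\<close> over the boundary, with the copy at
    \<open>1\<close> replaced by \<open>B\<close>; in effect a coproduct of \<open>A\<close> and
    \<open>B\<close>.\<close>
  obtain N m n where PO2: "is_pushout M (k 1) (f \<cdot> l A) m n" and m: "m \<in> homset M bdA N" and n:
    "n \<in> homset M B N"
    by (rule pushout_exists[OF fin_colims k1 fl])
  \<comment> \<open>The empty simplicial set tensored with \<open>A\<close> is initial, so
    \<open>(f \<cdot> l A) \<cdot> e\<close> is a cofibration by cofibrancy of \<open>B\<close>. Its
    cobase change includes the remaining copy of \<open>A\<close>.\<close>
  have "is_pushout M ((f \<cdot> l A) \<cdot> e) e n (m \<cdot> k 0)"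
    by (rule pushout_paste[OF is_pushout_sym[OF PO1] is_pushout_sym[OF PO2]])
  moreover have "(f \<cdot> l A) \<cdot> e \<in> Cof"
    using B T_empty_initial[OF O(1)] Cmp_in[OF e fl] unfolding cofibrant_def by blast
  ultimately have mk_Cof: "m \<cdot> k 0 \<in> Cof" using Cof_cobaseI by blast
  note mk = Cmp_in[OF k0 m]
  have "is_iso M (l_inv A)" by (rule is_isoI[OF lA(2,1,4,3)])
  then have i0_Cof: "(m \<cdot> k 0) \<cdot> l_inv A \<in> Cof" using Cof_Cmp[OF Cof_iso mk_Cof lA(2) mk] by blast
  obtain E p c where PO3: "is_pushout M j m p c" and p: "p \<in> homset M (Cyl A) E" and c:
    "c \<in> homset M N E"
    by (rule pushout_exists[OF fin_colims j m])
  have c_Cof: "c \<in> Cof" by (rule Cof_cobaseI[OF T_boundary_incl_Cof[OF A, folded j_def] PO3])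
  define s where "s = c \<cdot> n"
  have s: "s \<in> homset M B E" unfolding s_def by (rule Cmp_in[OF n c])
  have EO: "E \<in> Obj M" using homset_Obj[OF s] by simp
  \<comment> \<open>Pasting passes to the second presentation of \<open>E\<close>, as a pushout of
    the end \<open>1\<close> along \<open>f\<close>.\<close>
  have "is_pushout M (j \<cdot> k 1) (f \<cdot> l A) p s" unfolding s_def by (rule pushout_paste[OF PO2 PO3])
  moreover have "Dom M (j \<cdot> k 1) = FOb T (\<Delta>0, A)" using Cmp_in[OF k1 j] by (simp add: homset_def)
  ultimately have "is_pushout M ((j \<cdot> k 1) \<cdot> l_inv A) ((f \<cdot> l A) \<cdot> l_inv A) p s"
    using pushout_precomp[of "j \<cdot> k 1" "f \<cdot> l A" p s "l_inv A" A "l A"] lA by simp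
  moreover have "(j \<cdot> k 1) \<cdot> l_inv A = cyl_in 1 A"
    using Cmp_assoc[OF lA(2) k1 j] jk[OF order_refl] by simp
  moreover have "(f \<cdot> l A) \<cdot> l_inv A = f"
    using Cmp_assoc[OF lA(2,1) f] lA(4) Cmp_Idn[OF f] by simp
  ultimately have PO: "is_pushout M (cyl_in 1 A) f p s" by simp
  note PO_I = cyl_map_pushout[OF PO]
  note i1 = cyl_in_hom[OF O(1) order_refl] and prA = cyl_pr_hom[OF O(1)] and prB =
    cyl_pr_hom[OF O(2)]
  note mxA = cyl_max_hom[OF O(1)]
  note psq = is_pushoutD(9)[OF PO]
  have cod: "Cod M (cyl_in 1 A) = Cyl A" "Cod M f = B" "Cod M p = E"
    "Cod M (cyl_map (cyl_in 1 A)) = Cyl (Cyl A)" "Cod M (cyl_map f) = Cyl B" "Cod M (cyl_map p) =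
        Cyl E"
    using i1 f p cyl_map_hom[OF i1] cyl_map_hom[OF f] cyl_map_hom[OF p] by
      (simp_all add: homset_def)
  have "(f \<cdot> cyl_pr A) \<cdot> cyl_in 1 A = Idn M B \<cdot> f"
    using Cmp_assoc[OF i1 prA f] cyl_pr_in[OF O(1) order_refl] Cmp_Idn[OF f] Idn_Cmp[OF f] by simp
  then obtain \<pi> where \<pi>: "\<pi> \<in> homset M E B" "\<pi> \<cdot> p = f \<cdot> cyl_pr A" "\<pi> \<cdot> s = Idn M B"
    by (rule pushout_induced[OF PO, unfolded cod, OF Cmp_in[OF prA f] Idn_in[OF O(2)]])
  \<comment> \<open>The homotopy is the contraction on the cylinder of \<open>A\<close> and constant
    on \<open>B\<close>. The two agree on the glued end because the contraction is stationary
    there.\<close>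
  have "(p \<cdot> cyl_max A) \<cdot> cyl_map (cyl_in 1 A) = (s \<cdot> cyl_pr B) \<cdot> cyl_map f"
  proof -
    have "(p \<cdot> cyl_max A) \<cdot> cyl_map (cyl_in 1 A) = p \<cdot> (cyl_in 1 A \<cdot> cyl_pr A)"
      unfolding Cmp_assoc[OF cyl_map_hom[OF i1] mxA p] cyl_max_cyl_in_1[OF O(1)] ..
    also have "\<dots> = s \<cdot> (f \<cdot> cyl_pr A)"
      using Cmp_assoc[OF prA i1 p] Cmp_assoc[OF prA f s] psq by simp
    also have "\<dots> = (s \<cdot> cyl_pr B) \<cdot> cyl_map f"
      using Cmp_assoc[OF cyl_map_hom[OF f] prB s] cyl_pr_natural[OF f] by simp
    finally show ?thesis .
  qed
  then obtain H where H: "H \<in> homset M (Cyl E) E" "H \<cdot> cyl_map p = p \<cdot> cyl_max A" "H \<cdot> cyl_map s =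
      s \<cdot> cyl_pr B"
    by (rule pushout_induced[OF PO_I, unfolded cod, OF Cmp_in[OF mxA p] Cmp_in[OF prB s]])
  note cp = cyl_map_hom[OF p] and cs = cyl_map_hom[OF s]
  note prE = cyl_pr_hom[OF EO] and prC = cyl_pr_hom[OF CO]
  have Hin_s: "(H \<cdot> cyl_in c E) \<cdot> s = s" if c: "c \<le> 1" for c
  proof -
    note iB = cyl_in_hom[OF O(2) c] and iE = cyl_in_hom[OF EO c]
    have "(H \<cdot> cyl_in c E) \<cdot> s = (H \<cdot> cyl_map s) \<cdot> cyl_in c B"
      using Cmp_assoc[OF s iE H(1)] Cmp_assoc[OF iB cs H(1)] cyl_in_natural[OF s c] by simp
    also have "\<dots> = s"
      unfolding H(3) Cmp_assoc[OF iB prB s] cyl_pr_in[OF O(2) c] Cmp_Idn[OF s] ..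
    finally show ?thesis .
  qed
  have Hin_p: "(H \<cdot> cyl_in c E) \<cdot> p = p \<cdot> (cyl_max A \<cdot> cyl_in c (Cyl A))" if c: "c \<le> 1" for c
  proof -
    note iC = cyl_in_hom[OF CO c] and iE = cyl_in_hom[OF EO c]
    have "(H \<cdot> cyl_in c E) \<cdot> p = (H \<cdot> cyl_map p) \<cdot> cyl_in c (Cyl A)"
      using Cmp_assoc[OF p iE H(1)] Cmp_assoc[OF iC cp H(1)] cyl_in_natural[OF p c] by simp
    also have "\<dots> = p \<cdot> (cyl_max A \<cdot> cyl_in c (Cyl A))"
      unfolding H(2) by (rule Cmp_assoc[OF iC mxA p])
    finally show ?thesis .
  qed
  have "H \<cdot> cyl_in 0 E = Idn M E"
  proof (rule pushout_eqI[OF PO, unfolded cod, OF Cmp_in[OF cyl_in_hom[OF EO le0] H(1)]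
    Idn_in[OF EO]])
    show "(H \<cdot> cyl_in 0 E) \<cdot> p = Idn M E \<cdot> p"
      unfolding Hin_p[OF le0] cyl_max_in_0[OF O(1)] Cmp_Idn[OF p] Idn_Cmp[OF p] ..
    show "(H \<cdot> cyl_in 0 E) \<cdot> s = Idn M E \<cdot> s" unfolding Hin_s[OF le0] Idn_Cmp[OF s] ..
  qed
  moreover have "H \<cdot> cyl_in 1 E = s \<cdot> \<pi>"
  proof (rule pushout_eqI[OF PO, unfolded cod, OF Cmp_in[OF cyl_in_hom[OF EO order_refl] H(1)]
    Cmp_in[OF \<pi>(1) s]])
    have "p \<cdot> (cyl_in 1 A \<cdot> cyl_pr A) = s \<cdot> (f \<cdot> cyl_pr A)"
      using Cmp_assoc[OF prA i1 p] Cmp_assoc[OF prA f s] psq by simp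
    then show "(H \<cdot> cyl_in 1 E) \<cdot> p = (s \<cdot> \<pi>) \<cdot> p"
      unfolding Hin_p[OF order_refl] cyl_max_in_1[OF O(1)] Cmp_assoc[OF p \<pi>(1) s] \<pi>(2) .
    show "(H \<cdot> cyl_in 1 E) \<cdot> s = (s \<cdot> \<pi>) \<cdot> s"
      unfolding Hin_s[OF order_refl] Cmp_assoc[OF s \<pi>(1) s] \<pi>(3) Cmp_Idn[OF s] ..
  qed
  moreover have "\<pi> \<cdot> H = \<pi> \<cdot> cyl_pr E"
  proof (rule pushout_eqI[OF PO_I, unfolded cod, OF Cmp_in[OF H(1) \<pi>(1)] Cmp_in[OF prE \<pi>(1)]])
    have "(\<pi> \<cdot> H) \<cdot> cyl_map p = (\<pi> \<cdot> p) \<cdot> cyl_max A"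
      using Cmp_assoc[OF cp H(1) \<pi>(1)] H(2) Cmp_assoc[OF mxA p \<pi>(1)] by simp
    also have "\<dots> = f \<cdot> (cyl_pr A \<cdot> cyl_pr (Cyl A))"
      unfolding \<pi>(2) Cmp_assoc[OF mxA prA f] cyl_pr_max[OF O(1)] ..
    also have "\<dots> = (\<pi> \<cdot> cyl_pr E) \<cdot> cyl_map p"
      using Cmp_assoc[OF cp prE \<pi>(1)] cyl_pr_natural[OF p] Cmp_assoc[OF prC p \<pi>(1)] \<pi>(2)
        Cmp_assoc[OF prC prA f] by simp
    finally show "(\<pi> \<cdot> H) \<cdot> cyl_map p = (\<pi> \<cdot> cyl_pr E) \<cdot> cyl_map p" .
    show "(\<pi> \<cdot> H) \<cdot> cyl_map s = (\<pi> \<cdot> cyl_pr E) \<cdot> cyl_map s"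
      using Cmp_assoc[OF cs H(1) \<pi>(1)] H(3) Cmp_assoc[OF cs prE \<pi>(1)] cyl_pr_natural[OF s] by simp
  qed
  ultimately have fib: "fibrewise_retraction \<pi> E B"
    unfolding fibrewise_retraction_def using \<pi>(1,3) s H(1) by blast
  note mkl = Cmp_in[OF lA(2) mk]
  \<comment> \<open>The cofibration is the free end \<open>0\<close> of the cylinder, on which
    \<open>\<pi>\<close> restricts to \<open>f\<close>.\<close>
  have i: "c \<cdot> ((m \<cdot> k 0) \<cdot> l_inv A) = p \<cdot> cyl_in 0 A"
  proof -
    have "c \<cdot> ((m \<cdot> k 0) \<cdot> l_inv A) = (c \<cdot> m) \<cdot> (k 0 \<cdot> l_inv A)"
      unfolding Cmp_assoc[OF lA(2) k0 m] by (rule Cmp_assoc[OF Cmp_in[OF lA(2) k0] m c, symmetric])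
    also have "\<dots> = p \<cdot> cyl_in 0 A"
      unfolding is_pushoutD(9)[OF PO3, symmetric] Cmp_assoc[OF Cmp_in[OF lA(2) k0] j p] jk[OF le0]
        ..
    finally show ?thesis .
  qed
  show thesis
  proof (rule that[OF Cof_Cmp[OF i0_Cof c_Cof mkl c] Cmp_in[OF mkl c] fib])
    note i0 = cyl_in_hom[OF O(1) le0]
    show "\<pi> \<cdot> (c \<cdot> ((m \<cdot> k 0) \<cdot> l_inv A)) = f"
      unfolding i using Cmp_assoc[OF i0 p \<pi>(1)] \<pi>(2) Cmp_assoc[OF i0 prA f] cyl_pr_in[OF O(1) le0]
        Cmp_Idn[OF f]
      by simp
  qed
qed

end

section \<open>Mapping cylinders when homotopy equivalences are weak equivalences\<close>

context special_weak_cofibration_category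
begin

lemma fibrewise_retraction_W: "fibrewise_retraction \<pi> E B \<Longrightarrow> \<pi> \<in> W"
  by (rule homotopy_equivalence_W[OF fibrewise_retraction_homotopy_equivalence])

lemma fibrewise_retraction_pullback:
  assumes "fibrewise_retraction \<pi> E B" "g \<in> homset M D B"
  obtains P p q where "p \<in> homset M P D" "q \<in> homset M P E" "g \<cdot> p = \<pi> \<cdot> q" "p \<in> W"
    "\<And>Z p' q'. \<lbrakk>p' \<in> homset M Z D; q' \<in> homset M Z E; g \<cdot> p' = \<pi> \<cdot> q'\<rbrakk>
      \<Longrightarrow> \<exists>h \<in> homset M Z P. p \<cdot> h = p' \<and> q \<cdot> h = q'"
    "\<And>Z h h'. \<lbrakk>h \<in> homset M Z P; h' \<in> homset M Z P; p \<cdot> h = p \<cdot> h'; q \<cdot> h = q \<cdot> h'\<rbrakk> \<Longrightarrow> h = h'"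
proof -
  have \<pi>: "\<pi> \<in> homset M E B" using assms(1) by (simp add: fibrewise_retraction_def)
  obtain P p q where P: "p \<in> homset M P D" "q \<in> homset M P E" "g \<cdot> p = \<pi> \<cdot> q"
    "\<And>Z p' q'. \<lbrakk>p' \<in> homset M Z D; q' \<in> homset M Z E; g \<cdot> p' = \<pi> \<cdot> q'\<rbrakk>
      \<Longrightarrow> \<exists>h \<in> homset M Z P. p \<cdot> h = p' \<and> q \<cdot> h = q'"
    "\<And>Z h h'. \<lbrakk>h \<in> homset M Z P; h' \<in> homset M Z P; p \<cdot> h = p \<cdot> h'; q \<cdot> h = q \<cdot> h'\<rbrakk> \<Longrightarrow> h = h'"
    by (rule pullback_exists[OF fin_lims assms(2) \<pi>]) blast
  have "p \<in> W"
    by (rule fibrewise_retraction_W[OF fibrewise_retraction_base_change[OF assms P]])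
  then show thesis by (rule that[OF P(1-3) _ P(4,5)])
qed

lemma mapping_cylinderE:
  assumes "f \<in> homset M A B"
  obtains E i \<pi> where "i \<in> Cof" "i \<in> homset M A E" "\<pi> \<in> homset M E B" "fibrewise_retraction \<pi> E B"
    "\<pi> \<in> W" "\<pi> \<cdot> i = f"
proof -
  have "cofibrant M Cof A" "cofibrant M Cof B" using homset_Obj[OF assms] all_cofibrant by auto
  from mapping_cylinder[OF assms this] show thesis
    using that fibrewise_retraction_W unfolding fibrewise_retraction_def by metis
qed

end

section \<open>Two out of three\<close>

sublocale weak_cofibration_category \<subseteq> base_category M ..

context special_weak_cofibration_category
begin

lemma left_proper: "left_proper M Cof W"
  by (rule left_properI[OF all_cofibrant])

lemma W_cobase:
  assumes "f \<in> Cof" "g \<in> W" "is_pushout M f g p q"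
  shows "p \<in> W"
  using left_proper assms unfolding left_proper_def by blast

text \<open>Density of \<open>g\<close> gives \<open>w2 : R \<rightarrow> S\<close>, and density of
  \<open>f\<close>, applied to the map \<open>A \<rightarrow> R\<close>, then gives
  \<open>w1 : P1 \<rightarrow> Q1\<close> with a map \<open>q : R \<rightarrow> Q1\<close>. These do
  not compose, as \<open>q\<close> leads away from the source of \<open>w2\<close>. Over the mapping
  cylinder of \<open>q\<close> they do: \<open>w1\<close> is pulled back along the projection and
  \<open>w2\<close> pushed out along the cofibration.\<close>

lemma W_dense_Cmp:
  assumes f: "f \<in> homset (Ind M) X Y" and g: "g \<in> homset (Ind M) Y Z"
    and fd: "W_dense M W X Y f" and gd: "W_dense M W Y Z g"
  shows "W_dense M W X Z (g \<cdot>\<^bsub>Ind M\<^esub> f)"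
proof (rule W_denseI)
  fix A C u x z
  assume u: "u \<in> homset M A C" and x: "x \<in> colim_hom M A X" and z: "z \<in> colim_hom M C Z"
    and xz: "ind_act M (g \<cdot>\<^bsub>Ind M\<^esub> f) x = el_res M Z z u"
  note X = Ind_homsetD(1)[OF f] and Y = Ind_homsetD(2)[OF f] and Z = Ind_homsetD(2)[OF g]
  note fx = ind_act_in[OF f x]
  have "ind_act M g (ind_act M f x) = el_res M Z z u" using xz Ind_Cmp(2)[OF f g x] by simp
  then obtain R S w2 r c y' z' where w2: "w2 \<in> W" "w2 \<in> homset M R S" and r: "r \<in> homset M A R"
    and c: "c \<in> homset M C S" and w2r: "w2 \<cdot> r = c \<cdot> u" and y': "y' \<in> colim_hom M R Y"
    and z': "z' \<in> colim_hom M S Z" and yz': "ind_act M g y' = el_res M Z z' w2"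
    and y'r: "ind_act M f x = el_res M Y y' r" and z'c: "z = el_res M Z z' c"
    by (rule W_denseE[OF gd u fx z])
  obtain P1 Q1 w1 p q x1 y1 where w1: "w1 \<in> W" "w1 \<in> homset M P1 Q1" and p: "p \<in> homset M A P1"
    and q: "q \<in> homset M R Q1" and w1p: "w1 \<cdot> p = q \<cdot> r" and x1: "x1 \<in> colim_hom M P1 X"
    and y1: "y1 \<in> colim_hom M Q1 Y" and xy1: "ind_act M f x1 = el_res M Y y1 w1"
    and x1p: "x = el_res M X x1 p" and y1q: "y' = el_res M Y y1 q"
    by (rule W_denseE[OF fd r x y' y'r])
  obtain V i \<pi> where i: "i \<in> Cof" "i \<in> homset M R V" and \<pi>: "\<pi> \<in> homset M V Q1"
    "fibrewise_retraction \<pi> V Q1" "\<pi> \<in> W"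
    and \<pi>i: "\<pi> \<cdot> i = q"
    by (rule mapping_cylinderE[OF q])
  obtain P0 p0 v where p0: "p0 \<in> homset M P0 P1" and v: "v \<in> homset M P0 V" and w1p0: "w1 \<cdot> p0 =
      \<pi> \<cdot> v"
    and p0W: "p0 \<in> W" and univ: "\<And>Z p' q'. \<lbrakk>p' \<in> homset M Z P1; q' \<in> homset M Z V; w1 \<cdot> p' = \<pi> \<cdot> q'\<rbrakk>
      \<Longrightarrow> \<exists>h \<in> homset M Z P0. p0 \<cdot> h = p' \<and> v \<cdot> h = q'"
    by (rule fibrewise_retraction_pullback[OF \<pi>(2) w1(2)]) blast
  \<comment> \<open>Nothing is known about base changes of \<open>w1\<close> itself. The other
    projection \<open>p0\<close> is a base change of \<open>\<pi>\<close>, hence a weak equivalence,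
    and two out of three yields \<open>v\<close>.\<close>
  have "\<pi> \<cdot> v \<in> W" unfolding w1p0[symmetric] by (rule W_Cmp[OF p0W w1(1) p0 w1(2)])
  then have vW: "v \<in> W" by (rule W_cancel_left[OF \<pi>(3) _ v \<pi>(1)])
  obtain Q0 b d where po: "is_pushout M i w2 b d" and b: "b \<in> homset M V Q0" and d:
    "d \<in> homset M S Q0"
    by (rule pushout_exists[OF fin_colims i(2) w2(2)])
  have bW: "b \<in> W" by (rule W_cobase[OF i(1) w2(1) po])
  have "w1 \<cdot> p = \<pi> \<cdot> (i \<cdot> r)" using w1p \<pi>i Cmp_assoc[OF r i(2) \<pi>(1)] by simp
  then obtain h where h: "h \<in> homset M A P0" "p0 \<cdot> h = p" "v \<cdot> h = i \<cdot> r"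
    using univ[OF p Cmp_in[OF r i(2)]] by blast
  define y2 where "y2 = el_res M Y y1 \<pi>"
  have y2: "y2 \<in> colim_hom M V Y" unfolding y2_def by (rule el_res_in[OF Y y1 \<pi>(1)])
  note gy2 = ind_act_in[OF g y2]
  have cod: "Cod M i = V" "Cod M w2 = S" "Cod M b = Q0" using i(2) w2(2) b by
    (simp_all add: homset_def)
  have "el_res M Z (ind_act M g y2) i = el_res M Z z' w2"
    using ind_act_res[OF g y2 i(2)] el_res_Cmp[OF Y y1 \<pi>(1) i(2)] \<pi>i y1q yz' unfolding y2_def by
      simp
  then obtain z0 where z0: "z0 \<in> colim_hom M Q0 Z" "el_res M Z z0 b = ind_act M g y2"
    "el_res M Z z0 d = z'"
    by (rule el_glue[OF Z po, unfolded cod, OF gy2 z'])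
  define x0 where "x0 = el_res M X x1 p0"
  have x0: "x0 \<in> colim_hom M P0 X" unfolding x0_def by (rule el_res_in[OF X x1 p0])
  have sq: "(b \<cdot> v) \<cdot> h = (d \<cdot> c) \<cdot> u"
  proof -
    have "(b \<cdot> v) \<cdot> h = (b \<cdot> i) \<cdot> r"
      using Cmp_assoc[OF h(1) v b] h(3) Cmp_assoc[OF r i(2) b] by simp
    also have "\<dots> = (d \<cdot> w2) \<cdot> r" using is_pushoutD(9)[OF po] by simp
    also have "\<dots> = (d \<cdot> c) \<cdot> u"
      using Cmp_assoc[OF r w2(2) d] w2r Cmp_assoc[OF u c d] by simp
    finally show ?thesis .
  qed
  have "ind_act M (g \<cdot>\<^bsub>Ind M\<^esub> f) x0 = ind_act M g (el_res M Y (el_res M Y y1 w1) p0)"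
    using Ind_Cmp(2)[OF f g x0] ind_act_res[OF f x1 p0] xy1 unfolding x0_def by simp
  also have "\<dots> = ind_act M g (el_res M Y y2 v)"
    using el_res_Cmp[OF Y y1 w1(2) p0] el_res_Cmp[OF Y y1 \<pi>(1) v] w1p0 unfolding y2_def by simp
  also have "\<dots> = el_res M Z z0 (b \<cdot> v)"
    using ind_act_res[OF g y2 v] z0(2) el_res_Cmp[OF Z z0(1) b v] by simp
  finally have act: "ind_act M (g \<cdot>\<^bsub>Ind M\<^esub> f) x0 = el_res M Z z0 (b \<cdot> v)" .
  have "x = el_res M X x0 h" using el_res_Cmp[OF X x1 p0 h(1)] h(2) x1p unfolding x0_def by simp
  moreover have "z = el_res M Z z0 (d \<cdot> c)" using el_res_Cmp[OF Z z0(1) d c] z0(3) z'c by simp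
  ultimately show "W_factors M W X Z (g \<cdot>\<^bsub>Ind M\<^esub> f) A C u x z"
    unfolding W_factors_def
    using W_Cmp[OF vW bW v b] Cmp_in[OF v b] h(1) Cmp_in[OF c d] sq x0 z0(1) act by blast
qed

text \<open>Density of \<open>g \<cdot> f\<close> gives \<open>w1 : A1 \<rightarrow> B1\<close>, but
  \<open>B1\<close> carries an element of \<open>Z\<close> where one of \<open>Y\<close> is wanted.
  Density of \<open>g\<close> then offers an element of \<open>Y\<close> on \<open>C2\<close>,
  related to \<open>B1\<close> only by a map \<open>B1 \<rightarrow> D2\<close> and a weak
  equivalence \<open>w2 : C2 \<rightarrow> D2\<close> in the wrong direction. The object
  \<open>B1\<close> is replaced by a weakly equivalent one that does map to
  \<open>C2\<close>.\<close>

lemma W_dense_cancel_left: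
  assumes f: "f \<in> homset (Ind M) X Y" and g: "g \<in> homset (Ind M) Y Z"
    and gd: "W_dense M W Y Z g" and gfd: "W_dense M W X Z (g \<cdot>\<^bsub>Ind M\<^esub> f)"
  shows "W_dense M W X Y f"
proof (rule W_denseI)
  fix A C u x y
  assume u: "u \<in> homset M A C" and x: "x \<in> colim_hom M A X" and y: "y \<in> colim_hom M C Y"
    and xy: "ind_act M f x = el_res M Y y u"
  note X = Ind_homsetD(1)[OF f] and Y = Ind_homsetD(2)[OF f] and Z = Ind_homsetD(2)[OF g]
  note gy = ind_act_in[OF g y]
  have "ind_act M (g \<cdot>\<^bsub>Ind M\<^esub> f) x = el_res M Z (ind_act M g y) u"
    using Ind_Cmp(2)[OF f g x] xy ind_act_res[OF g y u] by simp
  then obtain A1 B1 w1 p q x1 z1 where w1: "w1 \<in> W" "w1 \<in> homset M A1 B1" and p: "p \<in> homset M A A1"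
    and q: "q \<in> homset M C B1" and w1p: "w1 \<cdot> p = q \<cdot> u" and x1: "x1 \<in> colim_hom M A1 X"
    and z1: "z1 \<in> colim_hom M B1 Z" and xz1: "ind_act M (g \<cdot>\<^bsub>Ind M\<^esub> f) x1 = el_res M Z z1 w1"
    and x1p: "x = el_res M X x1 p" and z1q: "ind_act M g y = el_res M Z z1 q"
    by (rule W_denseE[OF gfd u x gy])
  note fx1 = ind_act_in[OF f x1]
  \<comment> \<open>The object \<open>S\<close> collects what is already known in \<open>Y\<close>:
    the image of \<open>x1\<close> and \<open>y\<close> glue to one element over it. The induced
    \<open>t : S \<rightarrow> B1\<close> is the arrow to which density of \<open>g\<close> is
    applied.\<close>
  obtain S a c where po: "is_pushout M p u a c" and a: "a \<in> homset M A1 S" and c: "c \<in> homset M C S"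
    by (rule pushout_exists[OF fin_colims p u])
  have cod: "Cod M p = A1" "Cod M u = C" "Cod M a = S" using p u a by (simp_all add: homset_def)
  have "el_res M Y (ind_act M f x1) p = el_res M Y y u"
    using ind_act_res[OF f x1 p] x1p xy by simp
  then obtain y1 where y1: "y1 \<in> colim_hom M S Y" "el_res M Y y1 a = ind_act M f x1"
    "el_res M Y y1 c = y"
    by (rule el_glue[OF Y po, unfolded cod, OF fx1 y])
  obtain t where t: "t \<in> homset M S B1" "t \<cdot> a = w1" "t \<cdot> c = q"
    by (rule pushout_induced[OF po, unfolded cod, OF w1(2) q w1p])
  have "ind_act M g y1 = el_res M Z z1 t"
  proof (rule el_pushout_eqI[OF Z po, unfolded cod, OF ind_act_in[OF g y1(1)] el_res_in[OF Z z1
    t(1)]])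
    show "el_res M Z (ind_act M g y1) a = el_res M Z (el_res M Z z1 t) a"
      using ind_act_res[OF g y1(1) a] y1(2) Ind_Cmp(2)[OF f g x1] xz1 el_res_Cmp[OF Z z1 t(1) a]
        t(2) by simp
    show "el_res M Z (ind_act M g y1) c = el_res M Z (el_res M Z z1 t) c"
      using ind_act_res[OF g y1(1) c] y1(3) z1q el_res_Cmp[OF Z z1 t(1) c] t(3) by simp
  qed
  then obtain C2 D2 w2 s d y2 z2 where w2: "w2 \<in> W" "w2 \<in> homset M C2 D2" and s: "s \<in> homset M S C2"
    and d: "d \<in> homset M B1 D2" and w2s: "w2 \<cdot> s = d \<cdot> t" and y2: "y2 \<in> colim_hom M C2 Y"
    and "z2 \<in> colim_hom M D2 Z" "ind_act M g y2 = el_res M Z z2 w2"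
    and y2s: "y1 = el_res M Y y2 s" and "z1 = el_res M Z z2 d"
    by (rule W_denseE[OF gd t(1) y1(1) z1])
  \<comment> \<open>The weak equivalence \<open>w2\<close> is inverted in two parts: its acyclic
    cofibration has a retraction \<open>\<rho>\<close> by fibrancy of \<open>C2\<close>, and its
    projection is dealt with by pulling it back along \<open>d\<close>.\<close>
  obtain E i \<pi> where i: "i \<in> Cof" "i \<in> homset M C2 E" and \<pi>: "\<pi> \<in> homset M E D2"
    "fibrewise_retraction \<pi> E D2" "\<pi> \<in> W"
    and \<pi>i: "\<pi> \<cdot> i = w2"
    by (rule mapping_cylinderE[OF w2(2)])
  have C2: "C2 \<in> Obj M" using homset_Obj[OF i(2)] by simp
  have iW: "i \<in> W" using W_cancel_left[OF \<pi>(3) _ i(2) \<pi>(1)] \<pi>i w2(1) by simp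
  have "Dom M i = C2" "Cod M i = E" using i(2) by (simp_all add: homset_def)
  then obtain \<rho> where \<rho>: "\<rho> \<in> homset M E C2" "\<rho> \<cdot> i = Idn M C2"
    using all_fibrant[OF C2] i(1) iW Idn_in[OF C2] unfolding fibrant_def by (metis IntI)
  obtain Q0 p0 v where p0: "p0 \<in> homset M Q0 B1" and v: "v \<in> homset M Q0 E" and dp0: "d \<cdot> p0 =
      \<pi> \<cdot> v"
    and p0W: "p0 \<in> W" and univ: "\<And>Z p' q'. \<lbrakk>p' \<in> homset M Z B1; q' \<in> homset M Z E; d \<cdot> p' = \<pi> \<cdot> q'\<rbrakk>
      \<Longrightarrow> \<exists>h \<in> homset M Z Q0. p0 \<cdot> h = p' \<and> v \<cdot> h = q'"
    and uniq: "\<And>Z h h'. \<lbrakk>h \<in> homset M Z Q0; h' \<in> homset M Z Q0; p0 \<cdot> h = p0 \<cdot> h'; v \<cdot> h = v \<cdot> h'\<rbrakk> \<Longrightarrow>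
        h = h'"
    by (rule fibrewise_retraction_pullback[OF \<pi>(2) d]) blast
  have lift: "\<exists>h \<in> homset M B Q0. p0 \<cdot> h = t \<cdot> k \<and> v \<cdot> h = i \<cdot> (s \<cdot> k)" if k: "k \<in> homset M B S" for
    B k
  proof -
    note sk = Cmp_in[OF k s]
    have "d \<cdot> (t \<cdot> k) = \<pi> \<cdot> (i \<cdot> (s \<cdot> k))"
      using Cmp_assoc[OF k t(1) d] w2s Cmp_assoc[OF k s w2(2)] \<pi>i Cmp_assoc[OF sk i(2) \<pi>(1)] by simp
    then show ?thesis by (rule univ[OF Cmp_in[OF k t(1)] Cmp_in[OF sk i(2)]])
  qed
  obtain w0 where w0: "w0 \<in> homset M A1 Q0" "p0 \<cdot> w0 = w1" "v \<cdot> w0 = i \<cdot> (s \<cdot> a)"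
    using lift[OF a] t(2) by auto
  obtain q0 where q0: "q0 \<in> homset M C Q0" "p0 \<cdot> q0 = q" "v \<cdot> q0 = i \<cdot> (s \<cdot> c)"
    using lift[OF c] t(3) by auto
  have w0W: "w0 \<in> W" using W_cancel_left[OF p0W _ w0(1) p0] w0(2) w1(1) by simp
  have sq: "w0 \<cdot> p = q0 \<cdot> u"
  proof (rule uniq[OF Cmp_in[OF p w0(1)] Cmp_in[OF u q0(1)]])
    show "p0 \<cdot> (w0 \<cdot> p) = p0 \<cdot> (q0 \<cdot> u)"
      using Cmp_assoc[OF p w0(1) p0] Cmp_assoc[OF u q0(1) p0] w0(2) q0(2) w1p by simp
    have "v \<cdot> (w0 \<cdot> p) = i \<cdot> (s \<cdot> (a \<cdot> p))"
      using Cmp_assoc[OF p w0(1) v] w0(3) Cmp_assoc[OF p Cmp_in[OF a s] i(2)] Cmp_assoc[OF p a s] by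
        simp
    also have "\<dots> = v \<cdot> (q0 \<cdot> u)"
      using Cmp_assoc[OF u q0(1) v] q0(3) Cmp_assoc[OF u Cmp_in[OF c s] i(2)] Cmp_assoc[OF u c s]
        is_pushoutD(9)[OF po] by simp
    finally show "v \<cdot> (w0 \<cdot> p) = v \<cdot> (q0 \<cdot> u)" .
  qed
  note \<rho>v = Cmp_in[OF v \<rho>(1)]
  \<comment> \<open>The element of \<open>Y\<close> travels from \<open>C2\<close> to the pullback
    through \<open>\<rho> \<cdot> v\<close>. It restricts to the old one on maps lifted from
    \<open>S\<close>, because \<open>v\<close> sends these into the image of \<open>i\<close>, where
    \<open>\<rho>\<close> cancels.\<close>
  define y0 where "y0 = el_res M Y y2 (\<rho> \<cdot> v)"
  have y0: "y0 \<in> colim_hom M Q0 Y" unfolding y0_def by (rule el_res_in[OF Y y2 \<rho>v])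
  have res: "el_res M Y y0 h = el_res M Y y1 k"
    if h: "h \<in> homset M B Q0" "v \<cdot> h = i \<cdot> (s \<cdot> k)" and k: "k \<in> homset M B S" for B h k
  proof -
    note sk = Cmp_in[OF k s]
    have "(\<rho> \<cdot> v) \<cdot> h = s \<cdot> k"
      using Cmp_assoc[OF h(1) v \<rho>(1)] h(2) Cmp_assoc[OF sk i(2) \<rho>(1)] \<rho>(2) Idn_Cmp[OF sk] by simp
    then show ?thesis
      unfolding y0_def el_res_Cmp[OF Y y2 \<rho>v h(1)] y2s el_res_Cmp[OF Y y2 s k] by simp
  qed
  have "ind_act M f x1 = el_res M Y y0 w0" using res[OF w0(1,3) a] y1(2) by simp
  moreover have "y = el_res M Y y0 q0" using res[OF q0(1,3) c] y1(3) by simp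
  ultimately show "W_factors M W X Y f A C u x y"
    unfolding W_factors_def
    using w0W w0(1) p q0(1) sq x1 y0 x1p by blast
qed

text \<open>Both given densities start from an element of \<open>X\<close>, and none need lie over
  \<open>y\<close>. The initial object supplies one, and the first density turns it into a weak
  equivalence \<open>w1 : A1 \<rightarrow> B1\<close> whose target receives \<open>B\<close>. Left
  properness suffices for the rest; no pullback occurs.\<close>

lemma W_dense_cancel_right:
  assumes f: "f \<in> homset (Ind M) X Y" and g: "g \<in> homset (Ind M) Y Z"
    and fd: "W_dense M W X Y f" and gfd: "W_dense M W X Z (g \<cdot>\<^bsub>Ind M\<^esub> f)"
  shows "W_dense M W Y Z g"
proof (rule W_denseI)
  fix B C u y z
  assume u: "u \<in> homset M B C" and y: "y \<in> colim_hom M B Y" and z: "z \<in> colim_hom M C Z"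
    and yz: "ind_act M g y = el_res M Z z u"
  note X = Ind_homsetD(1)[OF f] and Y = Ind_homsetD(2)[OF f] and Z = Ind_homsetD(2)[OF g]
  obtain I where I: "is_initial M I" using initial_exists[OF fin_colims] .
  obtain b0 where b0: "b0 \<in> homset M I B" using I homset_Obj[OF u] unfolding is_initial_def by blast
  obtain x where x: "x \<in> colim_hom M I X" using el_nonempty[OF X I] by blast
  have "ind_act M f x = el_res M Y y b0"
    using el_nonempty[OF Y I] ind_act_in[OF f x] el_res_in[OF Y y b0] by auto
  then obtain A1 B1 w1 p1 q1 x1 y1 where w1: "w1 \<in> W" "w1 \<in> homset M A1 B1" and "p1 \<in> homset M I A1"
    and q1: "q1 \<in> homset M B B1" and "w1 \<cdot> p1 = q1 \<cdot> b0" and x1: "x1 \<in> colim_hom M A1 X"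
    and y1: "y1 \<in> colim_hom M B1 Y" and xy1: "ind_act M f x1 = el_res M Y y1 w1"
    and "x = el_res M X x1 p1" and y1q: "y = el_res M Y y1 q1"
    by (rule W_denseE[OF fd b0 x y])
  note gy1 = ind_act_in[OF g y1]
  \<comment> \<open>Moves the arrow \<open>u\<close> along \<open>B \<rightarrow> B1\<close>. Its
    cobase change \<open>m\<close> starts at \<open>B1\<close>, so \<open>m \<cdot> w1\<close>
    starts at an object with an element of \<open>X\<close> and can be tested against
    \<open>g \<cdot> f\<close>.\<close>
  obtain C1 m c where po: "is_pushout M q1 u m c" and m: "m \<in> homset M B1 C1" and c:
    "c \<in> homset M C C1"
    by (rule pushout_exists[OF fin_colims q1 u])
  have cod: "Cod M q1 = B1" "Cod M u = C" "Cod M m = C1" using q1 u m by (simp_all add: homset_def)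
  have "el_res M Z (ind_act M g y1) q1 = el_res M Z z u"
    using ind_act_res[OF g y1 q1] y1q yz by simp
  then obtain z1 where z1: "z1 \<in> colim_hom M C1 Z" "el_res M Z z1 m = ind_act M g y1"
    "el_res M Z z1 c = z"
    by (rule el_glue[OF Z po, unfolded cod, OF gy1 z])
  note mw1 = Cmp_in[OF w1(2) m]
  have "ind_act M (g \<cdot>\<^bsub>Ind M\<^esub> f) x1 = el_res M Z z1 (m \<cdot> w1)"
    using Ind_Cmp(2)[OF f g x1] xy1 ind_act_res[OF g y1 w1(2)] z1(2) el_res_Cmp[OF Z z1(1) m w1(2)]
      by simp
  then obtain A2 C2 w2 p2 q2 x2 z2 where w2: "w2 \<in> W" "w2 \<in> homset M A2 C2" and p2:
    "p2 \<in> homset M A1 A2"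
    and q2: "q2 \<in> homset M C1 C2" and w2p: "w2 \<cdot> p2 = q2 \<cdot> (m \<cdot> w1)" and x2: "x2 \<in> colim_hom M A2 X"
    and z2: "z2 \<in> colim_hom M C2 Z" and xz2: "ind_act M (g \<cdot>\<^bsub>Ind M\<^esub> f) x2 = el_res M Z z2 w2"
    and x2p: "x1 = el_res M X x2 p2" and z2q: "z1 = el_res M Z z2 q2"
    by (rule W_denseE[OF gfd mw1 x1 z1(1)])
  \<comment> \<open>Since \<open>p2\<close> need not be a cofibration, only its cofibration part is
    used to push out \<open>w1\<close>. The weak equivalence part is composed with
    \<open>w2\<close>, and two out of three applies to \<open>w0\<close>.\<close>
  obtain E i e where i: "i \<in> Cof" "i \<in> homset M A1 E" and e: "e \<in> W" "e \<in> homset M E A2" and ei: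
    "e \<cdot> i = p2"
    using factorE[OF p2] by metis
  obtain B2 b d where po2: "is_pushout M i w1 b d" and b: "b \<in> homset M E B2" and d:
    "d \<in> homset M B1 B2"
    by (rule pushout_exists[OF fin_colims i(2) w1(2)])
  have bW: "b \<in> W" by (rule W_cobase[OF i(1) w1(1) po2])
  have cod2: "Cod M i = E" "Cod M w1 = B1" "Cod M b = B2" using i(2) w1(2) b by
    (simp_all add: homset_def)
  have "(w2 \<cdot> e) \<cdot> i = (q2 \<cdot> m) \<cdot> w1"
    using Cmp_assoc[OF i(2) e(2) w2(2)] ei w2p Cmp_assoc[OF w1(2) m q2] by simp
  then obtain w0 where w0: "w0 \<in> homset M B2 C2" "w0 \<cdot> b = w2 \<cdot> e" "w0 \<cdot> d = q2 \<cdot> m"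
    by (rule pushout_induced[OF po2, unfolded cod2, OF Cmp_in[OF e(2) w2(2)] Cmp_in[OF m q2]])
  have "w0 \<cdot> b \<in> W" unfolding w0(2) by (rule W_Cmp[OF e(1) w2(1) e(2) w2(2)])
  then have w0W: "w0 \<in> W" by (rule W_cancel_right[OF bW _ b w0(1)])
  note fx2 = ind_act_in[OF f x2]
  note y2 = el_res_in[OF Y fx2 e(2)]
  have "el_res M Y (el_res M Y (ind_act M f x2) e) i = el_res M Y y1 w1"
    using el_res_Cmp[OF Y fx2 e(2) i(2)] ei ind_act_res[OF f x2 p2] x2p xy1 by simp
  then obtain y0 where y0: "y0 \<in> colim_hom M B2 Y" "el_res M Y y0 b = el_res M Y (ind_act M f x2) e"
    "el_res M Y y0 d = y1"
    by (rule el_glue[OF Y po2, unfolded cod2, OF y2 y1])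
  have act: "ind_act M g y0 = el_res M Z z2 w0"
  proof (rule el_pushout_eqI[OF Z po2, unfolded cod2, OF ind_act_in[OF g y0(1)] el_res_in[OF Z z2
    w0(1)]])
    show "el_res M Z (ind_act M g y0) b = el_res M Z (el_res M Z z2 w0) b"
      using ind_act_res[OF g y0(1) b] y0(2) ind_act_res[OF g fx2 e(2)] Ind_Cmp(2)[OF f g x2] xz2
        el_res_Cmp[OF Z z2 w2(2) e(2)] el_res_Cmp[OF Z z2 w0(1) b] w0(2) by simp
    show "el_res M Z (ind_act M g y0) d = el_res M Z (el_res M Z z2 w0) d"
      using ind_act_res[OF g y0(1) d] y0(3) z1(2) z2q el_res_Cmp[OF Z z2 q2 m]
        el_res_Cmp[OF Z z2 w0(1) d] w0(3) by simp
  qed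
  have sq: "w0 \<cdot> (d \<cdot> q1) = (q2 \<cdot> c) \<cdot> u"
    using Cmp_assoc[OF q1 d w0(1)] w0(3) Cmp_assoc[OF q1 m q2] is_pushoutD(9)[OF po]
      Cmp_assoc[OF u c q2] by simp
  have "y = el_res M Y y0 (d \<cdot> q1)" using el_res_Cmp[OF Y y0(1) d q1] y0(3) y1q by simp
  moreover have "z = el_res M Z z2 (q2 \<cdot> c)" using el_res_Cmp[OF Z z2 q2 c] z2q z1(3) by simp
  ultimately show "W_factors M W Y Z g B C u y z"
    unfolding W_factors_def
    using w0W w0(1) Cmp_in[OF q1 d] Cmp_in[OF c q2] sq y0(1) z2 act by blast
qed

text \<open>Smallness of \<open>M\<close> enters here, as a coding of its arrows in
  \<open>'u\<close>.\<close>

lemma Lw_iso_iff_W_dense: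
  fixes f :: "('u, 'o, 'a) ind_arr"
  assumes "infinite (UNIV :: 'u set)" and f: "f \<in> homset (Ind M) X Y"
  shows "f \<in> Lw_iso M W \<longleftrightarrow> W_dense M W X Y f"
proof
  assume "f \<in> Lw_iso M W"
  then show "W_dense M W X Y f" by (rule Lw_iso_W_dense[OF f])
next
  assume "W_dense M W X Y f"
  then interpret W_dense_arrow M W X Y f
    using f W_Arr fin_colims by unfold_locales auto
  obtain e :: "'a \<Rightarrow> 'u" where "inj_on e (Arr M)" using small unfolding small_category_def by blast
  then show "f \<in> Lw_iso M W" by (rule in_Lw_iso[OF assms(1)])
qed

lemma ind_admissible:
  assumes inf: "infinite (UNIV :: 'u set)"
  shows "ind_admissible TYPE('u) M W"
  unfolding ind_admissible_def two_out_of_three_def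
proof (intro ballI impI)
  fix f g :: "('u, 'o, 'a) ind_arr"
  assume "f \<in> Arr (Ind M)" "g \<in> Arr (Ind M)" and gf: "Dom (Ind M) g = Cod (Ind M) f"
  then have f: "f \<in> homset (Ind M) (Dom (Ind M) f) (Cod (Ind M) f)"
    and g: "g \<in> homset (Ind M) (Cod (Ind M) f) (Cod (Ind M) g)"
    by (simp_all add: homset_def)
  note iff = Lw_iso_iff_W_dense[OF inf f] Lw_iso_iff_W_dense[OF inf g]
    Lw_iso_iff_W_dense[OF inf Ind_Cmp(1)[OF f g]]
  show "(f \<in> Lw_iso M W \<and> g \<in> Lw_iso M W \<longrightarrow> g \<cdot>\<^bsub>Ind M\<^esub> f \<in> Lw_iso M W) \<and>
    (f \<in> Lw_iso M W \<and> g \<cdot>\<^bsub>Ind M\<^esub> f \<in> Lw_iso M W \<longrightarrow> g \<in> Lw_iso M W) \<and>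
    (g \<in> Lw_iso M W \<and> g \<cdot>\<^bsub>Ind M\<^esub> f \<in> Lw_iso M W \<longrightarrow> f \<in> Lw_iso M W)"
    unfolding iff using W_dense_Cmp[OF f g] W_dense_cancel_right[OF f g] W_dense_cancel_left[OF f g]
      by blast
qed

end

theorem theorem4p12:
  fixes M :: "('o, 'a) cat" and Cof W :: "'a set"
    and T :: "(sf_ob \<times> 'o, sf_arr \<times> 'a, 'o, 'a) func"
    and a :: "sf_ob \<Rightarrow> sf_ob \<Rightarrow> 'o \<Rightarrow> 'a"
    and l :: "'o \<Rightarrow> 'a"
  assumes "infinite (UNIV :: 'u set)"
    and "special_weak_cofibration_category TYPE('u) M Cof W T a l"
  shows "left_proper M Cof W \<and> ind_admissible TYPE('u) M W"
proof -
  interpret special_weak_cofibration_category "TYPE('u)" M Cof W T a l by fact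
  show ?thesis using left_proper ind_admissible[OF assms(1)] by blast
qed

end
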